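(* Let $\mathbb{K}$ be a field with $\operatorname{char}\mathbb{K}\neq 2$, let $V$ be a $\mathbb{K}$-vector space with basis $v_1,\dots,v_n$, let $G\subset GL(V)$ be a finite group with $\operatorname{char}\mathbb{K}\nmid|G|$, and let $\mathbf{q}=\{q_{ij}\}$ be a set of nonzero elements of $\mathbb{K}$. The truncated quantum Drinfeld Hecke algebras $\hat{\mathscr{H}}_{\mathbf{q},\kappa,t}$ over $\mathbb{K}[t]$ are the deformations of $\Lambda_{\mathbf{q}}(V)\rtimes G$ over $\mathbb{K}[t]$ with $\deg\mu_i=-2i$ and $\mu_i(v_j,v_j)=0$ for all $j\in\{1,\dots,n\}$ and all $i>0$.
   Context: For a finite group $G$ acting on a $\mathbb{K}$-algebra $A$, the skew group algebra $A\rtimes G$ is $A\otimes\mathbb{K}G$ as a vector space with multiplication $(ag)(bh)=a({}^gb)gh$ for $a,b\in A$ and $g,h\in G$, where ${}^gb$ denotes the action of $g$ on $b$. The quantum exterior algebra is $\Lambda_{\mathbf{q}}(V)=\mathbb{K}\langle v_1,\dots,v_n\mid v_jv_i=q_{ij}v_iv_j\text{ and }v_i^2=0\text{ for }i\ne j\in\{1,\dots,n\}\rangle$; in $\Lambda_{\mathbf{q}}(V)\rtimes G$ the group $G$ acts on $\Lambda_{\mathbf{q}}(V)$ by the action induced from $V$. For an indeterminate $t$ and a bilinear function $\kappa:V\times V\to\mathbb{K}G$, the associative algebra $\hat{\mathscr{H}}_{\mathbf{q},\kappa,t}$ is the quotient of $T(V)\rtimes G[t]$ ($T(V)$ the tensor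 algebra of $V$) by the ideal generated by the elements $v_jv_i-q_{ij}v_iv_j-\kappa(v_i,v_j)t$ and $v_i^2$. It is called a truncated quantum Drinfeld Hecke algebra over $\mathbb{K}[t]$ if it has a Poincaré-Birkhoff-Witt (PBW) basis over $\mathbb{K}[t]$, i.e. if the elements $v_1^{\alpha_1}\cdots v_n^{\alpha_n}g$ with $\alpha_i\in\{0,1\}$ and $g\in G$ form a $\mathbb{K}[t]$-basis. A deformation of a $\mathbb{K}$-algebra $A$ over $\mathbb{K}[t]$ is an associative $\mathbb{K}[t]$-algebra (with underlying $\mathbb{K}[t]$-module $A[t]$) with a deformed multiplication determined by bilinear maps $\mu_i:A\otimes A\to A$, where for all $a,b\in A$ one has $a*b=ab+\mu_1(a\otimes b)t+\mu_2(a\otimes b)t^2+\cdots+\mu_k(a\otimes b)t^k$ (a finite sum) and $ab$ is the product in $A$. Here $\mu_i(a,b)$ means $\mu_i(a\otimes b)$. The degree of $\mu_i$ is taken with respect to the grading of $\Lambda_{\mathbf{q}}(V)\rtimes G$ in which each $v_i$ has degree $1$ and each element of $G$ has degree $0$: $\deg\mu_i=-2i$ means that $\mu_i$ lowers total degree by $2i$.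
   Formalization: The nonzero elements q_ij are additionally assumed to satisfy q_ji = q_ij^{-1} for i ≠ j; otherwise no truncated quantum Drinfeld Hecke algebra has a PBW basis, while the trivial deformation still satisfies all the conditions, so the claim fails. *)

theory Defs
  imports
    "HOL-Algebra.QuotRing"
    "HOL-Algebra.UnivPoly"
    "HOL-Computational_Algebra.Polynomial"
    "HOL-Library.FuncSet"
begin

text \<open>
  Scalars are type-class based: the ground field is a type \<open>'k :: field\<close> and \<open>K[t]\<close> is
  \<open>'k poly\<close>. An (associative, not necessarily commutative) algebra over \<open>'s\<close> is a record
  \<open>('s, 'a) module\<close> of HOL-Algebra; of that theory only the record type is used, since
  its locale \<open>algebra\<close> is restricted to commutative algebras.
\<close>

section \<open>General constructions on algebras\<close>

definition list_prod :: "('a, 'm) monoid_scheme \<Rightarrow> 'a list \<Rightarrow> 'a" where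
  "list_prod M xs = foldr (\<lambda>x y. x \<otimes>\<^bsub>M\<^esub> y) xs \<one>\<^bsub>M\<^esub>"

definition quot_algebra :: "('s, 'a) module \<Rightarrow> 'a set \<Rightarrow> ('s, 'a set) module" where
  "quot_algebra A I =
    \<lparr>carrier = carrier (A Quot I), monoid.mult = monoid.mult (A Quot I), one = one (A Quot I),
     zero = zero (A Quot I), add = add (A Quot I),
     module.smult = (\<lambda>c X. \<Union>x\<in>X. I +>\<^bsub>A\<^esub> (c \<odot>\<^bsub>A\<^esub> x))\<rparr>"

text \<open>
  The skew group algebra of a finite group \<open>H\<close> acting on \<open>A\<close> through \<open>act\<close>. The function
  \<open>f\<close> stands for the sum of the elements \<open>(f g) g\<close>, so the product below is
  the bilinear extension of \<open>(a g) (b h) = a (act g b) (g h)\<close>.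
\<close>
definition skew_algebra ::
    "('k, 'a) module \<Rightarrow> 'g monoid \<Rightarrow> ('g \<Rightarrow> 'a \<Rightarrow> 'a) \<Rightarrow> ('k, 'g \<Rightarrow> 'a) module" where
  "skew_algebra A H act =
    \<lparr>carrier = {f. (\<forall>g\<in>carrier H. f g \<in> carrier A) \<and> (\<forall>g. g \<notin> carrier H \<longrightarrow> f g = \<zero>\<^bsub>A\<^esub>)},
     monoid.mult = (\<lambda>f h x. if x \<in> carrier H
                     then \<Oplus>\<^bsub>A\<^esub>g\<in>carrier H. f g \<otimes>\<^bsub>A\<^esub> act g (h (inv\<^bsub>H\<^esub> g \<otimes>\<^bsub>H\<^esub> x))
                     else \<zero>\<^bsub>A\<^esub>),
     one = (\<lambda>x. if x = \<one>\<^bsub>H\<^esub> then \<one>\<^bsub>A\<^esub> else \<zero>\<^bsub>A\<^esub>),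
     zero = (\<lambda>x. \<zero>\<^bsub>A\<^esub>),
     add = (\<lambda>f h x. f x \<oplus>\<^bsub>A\<^esub> h x),
     module.smult = (\<lambda>c f x. c \<odot>\<^bsub>A\<^esub> f x)\<rparr>"

definition skew_elem :: "('k, 'a) module \<Rightarrow> 'a \<Rightarrow> 'g \<Rightarrow> 'g \<Rightarrow> 'a" where
  "skew_elem A a g = (\<lambda>x. if x = g then a else \<zero>\<^bsub>A\<^esub>)"

text \<open>\<open>A[t]\<close> with central \<open>t\<close>, as an algebra over \<open>K[t]\<close>.\<close>
definition poly_algebra :: "('k::field, 'a) module \<Rightarrow> ('k poly, nat \<Rightarrow> 'a) module" where
  "poly_algebra A =
    \<lparr>carrier = carrier (UP A), monoid.mult = monoid.mult (UP A), one = one (UP A),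
     zero = zero (UP A), add = add (UP A),
     module.smult = (\<lambda>p f m. \<Oplus>\<^bsub>A\<^esub>i\<in>{..m}. Polynomial.coeff p i \<odot>\<^bsub>A\<^esub> f (m - i))\<rparr>"

abbreviation tmonom :: "('k, 'a) module \<Rightarrow> 'a \<Rightarrow> nat \<Rightarrow> nat \<Rightarrow> 'a" where
  "tmonom A a m \<equiv> up_ring.monom (UP A) a m"

definition is_basis :: "('s::zero, 'a) module \<Rightarrow> 'i set \<Rightarrow> ('i \<Rightarrow> 'a) \<Rightarrow> bool" where
  "is_basis M I b \<longleftrightarrow> b ` I \<subseteq> carrier M \<and>
    (\<forall>x\<in>carrier M. \<exists>!c. finite {i. c i \<noteq> 0} \<and> {i. c i \<noteq> 0} \<subseteq> I \<and>
       x = (\<Oplus>\<^bsub>M\<^esub>i\<in>{i. c i \<noteq> 0}. c i \<odot>\<^bsub>M\<^esub> b i))"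

definition alg_iso :: "('s, 'a) module \<Rightarrow> ('s, 'b) module \<Rightarrow> ('a \<Rightarrow> 'b) set" where
  "alg_iso A B = {\<phi> \<in> ring_iso A B. \<forall>c. \<forall>x\<in>carrier A. \<phi> (c \<odot>\<^bsub>A\<^esub> x) = c \<odot>\<^bsub>B\<^esub> \<phi> x}"

section \<open>Deformations over \<open>K[t]\<close>\<close>

definition bilinear_op :: "('k, 'a) module \<Rightarrow> ('a \<Rightarrow> 'a \<Rightarrow> 'a) \<Rightarrow> bool" where
  "bilinear_op A \<beta> \<longleftrightarrow>
    (\<forall>a\<in>carrier A. \<forall>b\<in>carrier A. \<beta> a b \<in> carrier A \<and>
       (\<forall>c\<in>carrier A. \<beta> (a \<oplus>\<^bsub>A\<^esub> c) b = \<beta> a b \<oplus>\<^bsub>A\<^esub> \<beta> c b \<and>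
                     \<beta> a (b \<oplus>\<^bsub>A\<^esub> c) = \<beta> a b \<oplus>\<^bsub>A\<^esub> \<beta> a c) \<and>
       (\<forall>r. \<beta> (r \<odot>\<^bsub>A\<^esub> a) b = r \<odot>\<^bsub>A\<^esub> \<beta> a b \<and> \<beta> a (r \<odot>\<^bsub>A\<^esub> b) = r \<odot>\<^bsub>A\<^esub> \<beta> a b))"

text \<open>The \<open>K[t]\<close>-bilinear extension to \<open>A[t]\<close> of \<open>a * b = \<Sum>i. \<mu> i a b t^i\<close>.\<close>
definition star ::
    "('k, 'a) module \<Rightarrow> (nat \<Rightarrow> 'a \<Rightarrow> 'a \<Rightarrow> 'a) \<Rightarrow> (nat \<Rightarrow> 'a) \<Rightarrow> (nat \<Rightarrow> 'a) \<Rightarrow> nat \<Rightarrow> 'a" where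
  "star A \<mu> f g =
    (\<lambda>m. \<Oplus>\<^bsub>A\<^esub>i\<in>{..m}. \<Oplus>\<^bsub>A\<^esub>j\<in>{..m - i}. \<mu> i (f j) (g (m - i - j)))"

definition deform_algebra ::
    "('k::field, 'a) module \<Rightarrow> (nat \<Rightarrow> 'a \<Rightarrow> 'a \<Rightarrow> 'a) \<Rightarrow> ('k poly, nat \<Rightarrow> 'a) module" where
  "deform_algebra A \<mu> = (poly_algebra A)\<lparr>monoid.mult := star A \<mu>\<rparr>"

definition is_deformation ::
    "('k::field, 'a) module \<Rightarrow> (nat \<Rightarrow> 'a \<Rightarrow> 'a \<Rightarrow> 'a) \<Rightarrow> bool" where
  "is_deformation A \<mu> \<longleftrightarrow>
    (\<forall>i. bilinear_op A (\<mu> i)) \<and>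
    (\<forall>a\<in>carrier A. \<forall>b\<in>carrier A. \<mu> 0 a b = a \<otimes>\<^bsub>A\<^esub> b \<and> finite {i. \<mu> i a b \<noteq> \<zero>\<^bsub>A\<^esub>}) \<and>
    (let B = deform_algebra A \<mu> in
       \<forall>f\<in>carrier B. \<forall>g\<in>carrier B. \<forall>h\<in>carrier B.
         (f \<otimes>\<^bsub>B\<^esub> g) \<otimes>\<^bsub>B\<^esub> h = f \<otimes>\<^bsub>B\<^esub> (g \<otimes>\<^bsub>B\<^esub> h))"

section \<open>The tensor algebra, the quantum exterior algebra and the group action\<close>

text \<open>
  Throughout, \<open>V\<close> is the type \<open>'v\<close> with scalar multiplication \<open>scale\<close>, and
  \<open>v 1, \<dots>, v n\<close> is a basis of it. The tensor algebra \<open>T(V)\<close> is written in its basis of words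
  in the \<open>v i\<close>, the word \<open>[i1, \<dots>, ik]\<close> standing for the tensor product of
  \<open>v i1, \<dots>, v ik\<close>; this is the free algebra on \<open>v 1, \<dots>, v n\<close>.
\<close>
definition tensor_algebra :: "nat \<Rightarrow> ('k::field, nat list \<Rightarrow> 'k) module" where
  "tensor_algebra n =
    \<lparr>carrier = {f. finite {w. f w \<noteq> 0} \<and> (\<forall>w. f w \<noteq> 0 \<longrightarrow> set w \<subseteq> {1..n})},
     monoid.mult = (\<lambda>f h w. \<Sum>i\<le>length w. f (take i w) * h (drop i w)),
     one = (\<lambda>w. if w = [] then 1 else 0),
     zero = (\<lambda>w. 0),
     add = (\<lambda>f h w. f w + h w),
     module.smult = (\<lambda>c f w. c * f w)\<rparr>"

definition letter :: "nat \<Rightarrow> nat list \<Rightarrow> 'k::field" where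
  "letter i = (\<lambda>w. if w = [i] then 1 else 0)"

definition tensor_vector ::
    "('k::field \<Rightarrow> 'v::ab_group_add \<Rightarrow> 'v) \<Rightarrow> (nat \<Rightarrow> 'v) \<Rightarrow> nat \<Rightarrow> 'v \<Rightarrow> nat list \<Rightarrow> 'k" where
  "tensor_vector scale v n x =
    (\<Oplus>\<^bsub>tensor_algebra n\<^esub>i\<in>{1..n}.
       module.representation scale (v ` {1..n}) x (v i) \<odot>\<^bsub>tensor_algebra n\<^esub> letter i)"

text \<open>The linear map sending the tensor of \<open>v i1, \<dots>, v ik\<close> to that of \<open>g (v i1), \<dots>, g (v ik)\<close>.\<close>
definition tensor_action ::
    "('k::field \<Rightarrow> 'v::ab_group_add \<Rightarrow> 'v) \<Rightarrow> (nat \<Rightarrow> 'v) \<Rightarrow> nat \<Rightarrow> ('v \<Rightarrow> 'v) \<Rightarrow>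
     (nat list \<Rightarrow> 'k) \<Rightarrow> nat list \<Rightarrow> 'k" where
  "tensor_action scale v n g f =
    (\<Oplus>\<^bsub>tensor_algebra n\<^esub>w\<in>{w. f w \<noteq> 0}.
       f w \<odot>\<^bsub>tensor_algebra n\<^esub>
         list_prod (tensor_algebra n) (map (\<lambda>i. tensor_vector scale v n (g (v i))) w))"

definition qext_ideal :: "nat \<Rightarrow> (nat \<Rightarrow> nat \<Rightarrow> 'k::field) \<Rightarrow> (nat list \<Rightarrow> 'k) set" where
  "qext_ideal n q =
    (let T = tensor_algebra n in
     Idl\<^bsub>T\<^esub> ({letter j \<otimes>\<^bsub>T\<^esub> letter i \<ominus>\<^bsub>T\<^esub> q i j \<odot>\<^bsub>T\<^esub> (letter i \<otimes>\<^bsub>T\<^esub> letter j) | i j.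
                i \<in> {1..n} \<and> j \<in> {1..n} \<and> i \<noteq> j} \<union>
             {letter i \<otimes>\<^bsub>T\<^esub> letter i | i. i \<in> {1..n}}))"

definition qext_algebra ::
    "nat \<Rightarrow> (nat \<Rightarrow> nat \<Rightarrow> 'k::field) \<Rightarrow> ('k, (nat list \<Rightarrow> 'k) set) module" where
  "qext_algebra n q = quot_algebra (tensor_algebra n) (qext_ideal n q)"

text \<open>The induced action; it is well defined when each \<open>g\<close> preserves \<open>qext_ideal n q\<close>.\<close>
definition qext_action ::
    "('k::field \<Rightarrow> 'v::ab_group_add \<Rightarrow> 'v) \<Rightarrow> (nat \<Rightarrow> 'v) \<Rightarrow> nat \<Rightarrow> (nat \<Rightarrow> nat \<Rightarrow> 'k) \<Rightarrow>
     ('v \<Rightarrow> 'v) \<Rightarrow> (nat list \<Rightarrow> 'k) set \<Rightarrow> (nat list \<Rightarrow> 'k) set" where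
  "qext_action scale v n q g X =
    (\<Union>x\<in>X. qext_ideal n q +>\<^bsub>tensor_algebra n\<^esub> tensor_action scale v n g x)"

definition comp_monoid :: "('v \<Rightarrow> 'v) set \<Rightarrow> ('v \<Rightarrow> 'v) monoid" where
  "comp_monoid G = \<lparr>carrier = G, monoid.mult = (\<circ>), one = id\<rparr>"

definition GL :: "('k::field \<Rightarrow> 'v::ab_group_add \<Rightarrow> 'v) \<Rightarrow> ('v \<Rightarrow> 'v) monoid" where
  "GL scale = comp_monoid {g. Vector_Spaces.linear scale scale g \<and> bij g}"

definition tensor_skew ::
    "('k::field \<Rightarrow> 'v::ab_group_add \<Rightarrow> 'v) \<Rightarrow> (nat \<Rightarrow> 'v) \<Rightarrow> nat \<Rightarrow> ('v \<Rightarrow> 'v) set \<Rightarrow>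
     ('k, ('v \<Rightarrow> 'v) \<Rightarrow> nat list \<Rightarrow> 'k) module" where
  "tensor_skew scale v n G =
    skew_algebra (tensor_algebra n) (comp_monoid G) (tensor_action scale v n)"

definition qext_skew ::
    "('k::field \<Rightarrow> 'v::ab_group_add \<Rightarrow> 'v) \<Rightarrow> (nat \<Rightarrow> 'v) \<Rightarrow> nat \<Rightarrow> ('v \<Rightarrow> 'v) set \<Rightarrow>
     (nat \<Rightarrow> nat \<Rightarrow> 'k) \<Rightarrow> ('k, ('v \<Rightarrow> 'v) \<Rightarrow> (nat list \<Rightarrow> 'k) set) module" where
  "qext_skew scale v n G q =
    skew_algebra (qext_algebra n q) (comp_monoid G) (qext_action scale v n q)"

text \<open>The elements \<open>v i\<close> and \<open>g\<close> of \<open>T(V) \<rtimes> G\<close> and of the skew group algebra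
  of the quantum exterior algebra.\<close>
definition tensor_v :: "nat \<Rightarrow> nat \<Rightarrow> ('v \<Rightarrow> 'v) \<Rightarrow> nat list \<Rightarrow> 'k::field" where
  "tensor_v n i = skew_elem (tensor_algebra n) (letter i) id"

definition tensor_g :: "nat \<Rightarrow> ('v \<Rightarrow> 'v) \<Rightarrow> ('v \<Rightarrow> 'v) \<Rightarrow> nat list \<Rightarrow> 'k::field" where
  "tensor_g n g = skew_elem (tensor_algebra n) \<one>\<^bsub>tensor_algebra n\<^esub> g"

definition qext_v ::
    "nat \<Rightarrow> (nat \<Rightarrow> nat \<Rightarrow> 'k::field) \<Rightarrow> nat \<Rightarrow> ('v \<Rightarrow> 'v) \<Rightarrow> (nat list \<Rightarrow> 'k) set" where
  "qext_v n q i =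
    skew_elem (qext_algebra n q) (qext_ideal n q +>\<^bsub>tensor_algebra n\<^esub> letter i) id"

definition qext_g ::
    "nat \<Rightarrow> (nat \<Rightarrow> nat \<Rightarrow> 'k::field) \<Rightarrow> ('v \<Rightarrow> 'v) \<Rightarrow> ('v \<Rightarrow> 'v) \<Rightarrow> (nat list \<Rightarrow> 'k) set" where
  "qext_g n q g = skew_elem (qext_algebra n q) \<one>\<^bsub>qext_algebra n q\<^esub> g"

text \<open>The homogeneous components, for \<open>v i\<close> of degree 1 and \<open>g\<close> of degree 0. The
  component of a negative degree is zero.\<close>
definition qext_skew_degree ::
    "('k::field \<Rightarrow> 'v::ab_group_add \<Rightarrow> 'v) \<Rightarrow> (nat \<Rightarrow> 'v) \<Rightarrow> nat \<Rightarrow> ('v \<Rightarrow> 'v) set \<Rightarrow>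
     (nat \<Rightarrow> nat \<Rightarrow> 'k) \<Rightarrow> int \<Rightarrow> (('v \<Rightarrow> 'v) \<Rightarrow> (nat list \<Rightarrow> 'k) set) set" where
  "qext_skew_degree scale v n G q d =
    {f \<in> carrier (qext_skew scale v n G q). \<forall>g\<in>G. \<exists>x\<in>carrier (tensor_algebra n).
       (\<forall>w. x w \<noteq> 0 \<longrightarrow> int (length w) = d) \<and> f g = qext_ideal n q +>\<^bsub>tensor_algebra n\<^esub> x}"

definition has_degree :: "(int \<Rightarrow> 'a set) \<Rightarrow> ('a \<Rightarrow> 'a \<Rightarrow> 'a) \<Rightarrow> int \<Rightarrow> bool" where
  "has_degree A \<beta> e \<longleftrightarrow> (\<forall>p q. \<forall>a\<in>A p. \<forall>b\<in>A q. \<beta> a b \<in> A (p + q + e))"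

section \<open>Truncated quantum Drinfeld Hecke algebras\<close>

text \<open>\<open>KG\<close> consists of the functions from \<open>G\<close> to the field, extended by zero outside \<open>G\<close>.\<close>
definition bilinear_to_group_algebra ::
    "('k::field \<Rightarrow> 'v::ab_group_add \<Rightarrow> 'v) \<Rightarrow> ('v \<Rightarrow> 'v) set \<Rightarrow>
     ('v \<Rightarrow> 'v \<Rightarrow> ('v \<Rightarrow> 'v) \<Rightarrow> 'k) \<Rightarrow> bool" where
  "bilinear_to_group_algebra scale G \<kappa> \<longleftrightarrow>
    (\<forall>x y g. g \<notin> G \<longrightarrow> \<kappa> x y g = 0) \<and>
    (\<forall>g. (\<forall>y. Vector_Spaces.linear scale (*) (\<lambda>x. \<kappa> x y g)) \<and>
         (\<forall>x. Vector_Spaces.linear scale (*) (\<lambda>y. \<kappa> x y g)))"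

definition group_algebra_embed ::
    "nat \<Rightarrow> (('v \<Rightarrow> 'v) \<Rightarrow> 'k::field) \<Rightarrow> ('v \<Rightarrow> 'v) \<Rightarrow> nat list \<Rightarrow> 'k" where
  "group_algebra_embed n a = (\<lambda>g. a g \<odot>\<^bsub>tensor_algebra n\<^esub> \<one>\<^bsub>tensor_algebra n\<^esub>)"

text \<open>The first family of generators runs over all \<open>i, j\<close>, including \<open>i = j\<close>.\<close>
definition qdh_ideal ::
    "('k::field \<Rightarrow> 'v::ab_group_add \<Rightarrow> 'v) \<Rightarrow> (nat \<Rightarrow> 'v) \<Rightarrow> nat \<Rightarrow> ('v \<Rightarrow> 'v) set \<Rightarrow>
     (nat \<Rightarrow> nat \<Rightarrow> 'k) \<Rightarrow> ('v \<Rightarrow> 'v \<Rightarrow> ('v \<Rightarrow> 'v) \<Rightarrow> 'k) \<Rightarrow>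
     (nat \<Rightarrow> ('v \<Rightarrow> 'v) \<Rightarrow> nat list \<Rightarrow> 'k) set" where
  "qdh_ideal scale v n G q \<kappa> =
    (let S = tensor_skew scale v n G; P = poly_algebra S; x = tensor_v n in
     Idl\<^bsub>P\<^esub> ({tmonom S (x j \<otimes>\<^bsub>S\<^esub> x i \<ominus>\<^bsub>S\<^esub> q i j \<odot>\<^bsub>S\<^esub> (x i \<otimes>\<^bsub>S\<^esub> x j)) 0
                \<ominus>\<^bsub>P\<^esub> tmonom S (group_algebra_embed n (\<kappa> (v i) (v j))) 1 | i j.
                i \<in> {1..n} \<and> j \<in> {1..n}} \<union>
             {tmonom S (x i \<otimes>\<^bsub>S\<^esub> x i) 0 | i. i \<in> {1..n}}))"

definition qdh_algebra ::
    "('k::field \<Rightarrow> 'v::ab_group_add \<Rightarrow> 'v) \<Rightarrow> (nat \<Rightarrow> 'v) \<Rightarrow> nat \<Rightarrow> ('v \<Rightarrow> 'v) set \<Rightarrow>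
     (nat \<Rightarrow> nat \<Rightarrow> 'k) \<Rightarrow> ('v \<Rightarrow> 'v \<Rightarrow> ('v \<Rightarrow> 'v) \<Rightarrow> 'k) \<Rightarrow>
     ('k poly, (nat \<Rightarrow> ('v \<Rightarrow> 'v) \<Rightarrow> nat list \<Rightarrow> 'k) set) module" where
  "qdh_algebra scale v n G q \<kappa> =
    quot_algebra (poly_algebra (tensor_skew scale v n G)) (qdh_ideal scale v n G q \<kappa>)"

text \<open>The images of \<open>v i\<close> and \<open>g\<close> in the quotient.\<close>
definition qdh_v ::
    "('k::field \<Rightarrow> 'v::ab_group_add \<Rightarrow> 'v) \<Rightarrow> (nat \<Rightarrow> 'v) \<Rightarrow> nat \<Rightarrow> ('v \<Rightarrow> 'v) set \<Rightarrow>
     (nat \<Rightarrow> nat \<Rightarrow> 'k) \<Rightarrow> ('v \<Rightarrow> 'v \<Rightarrow> ('v \<Rightarrow> 'v) \<Rightarrow> 'k) \<Rightarrow> nat \<Rightarrow>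
     (nat \<Rightarrow> ('v \<Rightarrow> 'v) \<Rightarrow> nat list \<Rightarrow> 'k) set" where
  "qdh_v scale v n G q \<kappa> i =
    (let S = tensor_skew scale v n G in
     qdh_ideal scale v n G q \<kappa> +>\<^bsub>poly_algebra S\<^esub> tmonom S (tensor_v n i) 0)"

definition qdh_g ::
    "('k::field \<Rightarrow> 'v::ab_group_add \<Rightarrow> 'v) \<Rightarrow> (nat \<Rightarrow> 'v) \<Rightarrow> nat \<Rightarrow> ('v \<Rightarrow> 'v) set \<Rightarrow>
     (nat \<Rightarrow> nat \<Rightarrow> 'k) \<Rightarrow> ('v \<Rightarrow> 'v \<Rightarrow> ('v \<Rightarrow> 'v) \<Rightarrow> 'k) \<Rightarrow> ('v \<Rightarrow> 'v) \<Rightarrow>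
     (nat \<Rightarrow> ('v \<Rightarrow> 'v) \<Rightarrow> nat list \<Rightarrow> 'k) set" where
  "qdh_g scale v n G q \<kappa> g =
    (let S = tensor_skew scale v n G in
     qdh_ideal scale v n G q \<kappa> +>\<^bsub>poly_algebra S\<^esub> tmonom S (tensor_g n g) 0)"

definition is_truncated_qdh ::
    "('k::field \<Rightarrow> 'v::ab_group_add \<Rightarrow> 'v) \<Rightarrow> (nat \<Rightarrow> 'v) \<Rightarrow> nat \<Rightarrow> ('v \<Rightarrow> 'v) set \<Rightarrow>
     (nat \<Rightarrow> nat \<Rightarrow> 'k) \<Rightarrow> ('v \<Rightarrow> 'v \<Rightarrow> ('v \<Rightarrow> 'v) \<Rightarrow> 'k) \<Rightarrow> bool" where
  "is_truncated_qdh scale v n G q \<kappa> \<longleftrightarrow>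
    (let H = qdh_algebra scale v n G q \<kappa> in
     is_basis H (({1..n} \<rightarrow>\<^sub>E {0, 1}) \<times> G)
       (\<lambda>(\<alpha>, g). list_prod H (map (\<lambda>i. qdh_v scale v n G q \<kappa> i [^]\<^bsub>H\<^esub> (\<alpha> i :: nat)) [1..<Suc n])
                 \<otimes>\<^bsub>H\<^esub> qdh_g scale v n G q \<kappa> g))"

text \<open>
  The isomorphisms of \<open>K[t]\<close>-algebras from the algebra of \<open>\<kappa>\<close> onto the deformation given by \<open>\<mu>\<close>
  under which the generators \<open>v i\<close> and \<open>g\<close> of the two algebras correspond.
\<close>
definition qdh_deformation_iso ::
    "('k::field \<Rightarrow> 'v::ab_group_add \<Rightarrow> 'v) \<Rightarrow> (nat \<Rightarrow> 'v) \<Rightarrow> nat \<Rightarrow> ('v \<Rightarrow> 'v) set \<Rightarrow>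
     (nat \<Rightarrow> nat \<Rightarrow> 'k) \<Rightarrow> ('v \<Rightarrow> 'v \<Rightarrow> ('v \<Rightarrow> 'v) \<Rightarrow> 'k) \<Rightarrow>
     (nat \<Rightarrow> (('v \<Rightarrow> 'v) \<Rightarrow> (nat list \<Rightarrow> 'k) set) \<Rightarrow> (('v \<Rightarrow> 'v) \<Rightarrow> (nat list \<Rightarrow> 'k) set) \<Rightarrow>
        ('v \<Rightarrow> 'v) \<Rightarrow> (nat list \<Rightarrow> 'k) set) \<Rightarrow>
     ((nat \<Rightarrow> ('v \<Rightarrow> 'v) \<Rightarrow> nat list \<Rightarrow> 'k) set \<Rightarrow> nat \<Rightarrow> ('v \<Rightarrow> 'v) \<Rightarrow> (nat list \<Rightarrow> 'k) set) set"
  where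
  "qdh_deformation_iso scale v n G q \<kappa> \<mu> =
    (let A = qext_skew scale v n G q in
     {\<phi> \<in> alg_iso (qdh_algebra scale v n G q \<kappa>) (deform_algebra A \<mu>).
        (\<forall>i\<in>{1..n}. \<phi> (qdh_v scale v n G q \<kappa> i) = tmonom A (qext_v n q i) 0) \<and>
        (\<forall>g\<in>G. \<phi> (qdh_g scale v n G q \<kappa> g) = tmonom A (qext_g n q g) 0)})"

text \<open>The deformations with \<open>deg (\<mu> i) = -2i\<close> and \<open>\<mu> i (v j) (v j) = 0\<close> for \<open>i > 0\<close>.\<close>
definition is_graded_truncated_deformation ::
    "('k::field \<Rightarrow> 'v::ab_group_add \<Rightarrow> 'v) \<Rightarrow> (nat \<Rightarrow> 'v) \<Rightarrow> nat \<Rightarrow> ('v \<Rightarrow> 'v) set \<Rightarrow>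
     (nat \<Rightarrow> nat \<Rightarrow> 'k) \<Rightarrow>
     (nat \<Rightarrow> (('v \<Rightarrow> 'v) \<Rightarrow> (nat list \<Rightarrow> 'k) set) \<Rightarrow> (('v \<Rightarrow> 'v) \<Rightarrow> (nat list \<Rightarrow> 'k) set) \<Rightarrow>
        ('v \<Rightarrow> 'v) \<Rightarrow> (nat list \<Rightarrow> 'k) set) \<Rightarrow> bool" where
  "is_graded_truncated_deformation scale v n G q \<mu> \<longleftrightarrow>
    (let A = qext_skew scale v n G q in
     is_deformation A \<mu> \<and>
     (\<forall>i>0. has_degree (qext_skew_degree scale v n G q) (\<mu> i) (- 2 * int i)) \<and>
     (\<forall>i>0. \<forall>j\<in>{1..n}. \<mu> i (qext_v n q j) (qext_v n q j) = \<zero>\<^bsub>A\<^esub>))"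

end

theory Submission
  imports Defs
begin

text \<open>
  Write \<open>A\<close> for the skew group algebra of the quantum exterior algebra; its PBW monomials form a
  basis over \<open>K\<close>, hence a basis of \<open>A[t]\<close> over \<open>K[t]\<close>. If the PBW monomials of the algebra of
  \<open>\<kappa>\<close> form a basis, matching the two bases transports its product to \<open>A[t]\<close>. The defining
  ideal is homogeneous for \<open>t\<close> of degree 2, so the coefficient of \<open>t^i\<close> in the transported product
  has degree \<open>-2i\<close>, and setting \<open>t = 0\<close> recovers \<open>A\<close>.

  Conversely, let \<open>*\<close> be a graded deformation. For degree reasons products of total degree at
  most 1 are undeformed and \<open>v j * v i\<close> involves only \<open>\<mu> 0\<close> and \<open>\<mu> 1\<close>, where \<open>\<mu> 1 (v j) (v i)\<close>
  lies in \<open>KG\<close>. With \<open>\<kappa> (v i) (v j) = \<mu> 1 (v j) (v i) - q i j \<mu> 1 (v i) (v j)\<close> the defining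
  relations hold in the deformation, which gives a homomorphism from the algebra of \<open>\<kappa>\<close>. The PBW
  monomials span this algebra, and their images are unitriangular in the basis of \<open>A[t]\<close>; so they are
  a basis and the homomorphism is bijective.
\<close>

section \<open>Algebras over a commutative ring\<close>

text \<open>The basis of the quantum exterior algebra, which the overview presupposes, comes without
  rewriting theory: every PBW monomial has an explicit coefficient functional \<open>nf\<close> on
  T(V), a sum over the rearrangements of its letters weighted by their inversions, and these
  functionals vanish on the relations. The weights respect the relation for (i, j) and the one for
  (j, i) at the same time because q_ji is the inverse of q_ij.

  Group elements act by arbitrary matrices, so moving g past a letter produces a sum over all
  letters, and a product of monomials is not a monomial. Only the length of words survives;
  spanning, homogeneity and triangularity are all arguments by length. The locale
  \<open>xalg\<close> isolates what they use, because the same computation is needed in T(V) x G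
  [t], in its quotient, in A[t] and in the deformed algebra.

  A deformation is only required to be associative, so that the unit of A is also its unit has to be
  derived.\<close>

locale kalg = ring A for A :: "('s::comm_ring_1, 'a) module" (structure) +
  assumes smult_closed [simp]: "x \<in> carrier A \<Longrightarrow> c \<odot> x \<in> carrier A"
    and smult_add_right: "x \<in> carrier A \<Longrightarrow> y \<in> carrier A \<Longrightarrow> c \<odot> (x \<oplus> y) = c \<odot> x \<oplus> c \<odot> y"
    and smult_add_left: "x \<in> carrier A \<Longrightarrow> (c + d) \<odot> x = c \<odot> x \<oplus> d \<odot> x"
    and smult_assoc: "x \<in> carrier A \<Longrightarrow> (c * d) \<odot> x = c \<odot> (d \<odot> x)"
    and smult_one [simp]: "x \<in> carrier A \<Longrightarrow> 1 \<odot> x = x"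
    and smult_mult_left: "x \<in> carrier A \<Longrightarrow> y \<in> carrier A \<Longrightarrow> (c \<odot> x) \<otimes> y = c \<odot> (x \<otimes> y)"
    and smult_mult_right: "x \<in> carrier A \<Longrightarrow> y \<in> carrier A \<Longrightarrow> x \<otimes> (c \<odot> y) = c \<odot> (x \<otimes> y)"
begin

lemma smult_zero_left [simp]: "x \<in> carrier A \<Longrightarrow> 0 \<odot> x = \<zero>"
  using smult_add_left[of x 0 0] by (metis add_0 add.l_cancel_one' smult_closed)

lemma smult_zero_right [simp]: "c \<odot> \<zero> = \<zero>"
  using smult_add_right[of \<zero> \<zero> c] by (metis add.l_cancel_one' l_zero smult_closed zero_closed)

lemma smult_minus_left: "x \<in> carrier A \<Longrightarrow> (- c) \<odot> x = \<ominus> (c \<odot> x)"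
  by (metis ab_left_minus minus_equality smult_add_left smult_closed smult_zero_left)

lemma minus_eq_smult: "x \<in> carrier A \<Longrightarrow> \<ominus> x = (- 1) \<odot> x"
  by (simp add: smult_minus_left)

lemma diff_eq_smult: "x \<in> carrier A \<Longrightarrow> y \<in> carrier A \<Longrightarrow> x \<ominus> y = x \<oplus> (- 1) \<odot> y"
  by (simp add: a_minus_def minus_eq_smult)

lemma smult_diff_right:
  "x \<in> carrier A \<Longrightarrow> y \<in> carrier A \<Longrightarrow> c \<odot> (x \<ominus> y) = c \<odot> x \<ominus> c \<odot> y"
  by (simp add: diff_eq_smult smult_add_right smult_assoc[symmetric] mult.commute)

lemma finsum_smult:
  "f \<in> X \<rightarrow> carrier A \<Longrightarrow> c \<odot> finsum A f X = finsum A (\<lambda>i. c \<odot> f i) X"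
proof (induction X rule: infinite_finite_induct)
  case (insert x F)
  then have "f \<in> F \<rightarrow> carrier A" "f x \<in> carrier A" by auto
  with insert show ?case by (simp add: smult_add_right Pi_def)
qed auto

lemma sum_smult:
  "x \<in> carrier A \<Longrightarrow> sum f X \<odot> x = finsum A (\<lambda>i. f i \<odot> x) X"
  by (induction X rule: infinite_finite_induct) (auto simp: smult_add_left)

lemma finsum_cong_all: "(\<And>i. i \<in> X \<Longrightarrow> f i = g i) \<Longrightarrow> (\<And>i. i \<in> X \<Longrightarrow> g i \<in> carrier A) \<Longrightarrow> finsum A f X = finsum A g X"
  by (rule finsum_cong') auto

lemma finsum_in: "(\<And>i. i \<in> X \<Longrightarrow> f i \<in> carrier A) \<Longrightarrow> finsum A f X \<in> carrier A"
  by (rule finsum_closed) auto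

lemma finsum_delta:
  assumes "finite X" "a \<in> X" "f a \<in> carrier A"
  shows "(\<Oplus>i\<in>X. if i = a then f i else \<zero>) = f a"
proof -
  have "(\<Oplus>i\<in>X. if i = a then f i else \<zero>) = (\<Oplus>i\<in>X. if a = i then f a else \<zero>)"
    using assms by (intro finsum_cong') auto
  with add.finprod_singleton[of a X "\<lambda>_. f a"] assms show ?thesis by auto
qed

lemma finsum_single:
  assumes "finite X" "a \<in> X" "\<And>i. i \<in> X \<Longrightarrow> f i \<in> carrier A" "\<And>i. i \<in> X \<Longrightarrow> i \<noteq> a \<Longrightarrow> f i = \<zero>"
  shows "finsum A f X = f a"
proof -
  have "finsum A f X = (\<Oplus>i\<in>X. if i = a then f i else \<zero>)"
    using assms by (intro finsum_cong') auto
  with finsum_delta[of X a f] assms show ?thesis by simp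
qed

lemma finsum_mono_neutral:
  assumes "finite Y" "X \<subseteq> Y" "\<And>i. i \<in> Y - X \<Longrightarrow> f i = \<zero>" "\<And>i. i \<in> X \<Longrightarrow> f i \<in> carrier A"
  shows "finsum A f X = finsum A f Y"
proof (rule add.finprod_mono_neutral_cong_left)
  show "f \<in> Y \<rightarrow> carrier A" using assms(3,4) by (metis DiffI Pi_I zero_closed)
qed (use assms in auto)

lemma list_prod_closed [simp]: "set xs \<subseteq> carrier A \<Longrightarrow> list_prod A xs \<in> carrier A"
  by (induction xs) (auto simp: list_prod_def)

lemma list_prod_Nil [simp]: "list_prod A [] = \<one>"
  by (simp add: list_prod_def)

lemma list_prod_Cons [simp]: "list_prod A (x # xs) = x \<otimes> list_prod A xs"
  by (simp add: list_prod_def)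

lemma list_prod_append:
  "set xs \<subseteq> carrier A \<Longrightarrow> set ys \<subseteq> carrier A \<Longrightarrow> list_prod A (xs @ ys) = list_prod A xs \<otimes> list_prod A ys"
  by (induction xs) (auto simp: m_assoc)

end

section \<open>Linear and additive maps between algebras\<close>

definition linear_on :: "('s, 'a) module \<Rightarrow> ('s, 'b) module \<Rightarrow> ('a \<Rightarrow> 'b) \<Rightarrow> bool" where
  "linear_on A B h \<longleftrightarrow> h \<in> carrier A \<rightarrow> carrier B \<and>
    (\<forall>x\<in>carrier A. \<forall>y\<in>carrier A. h (x \<oplus>\<^bsub>A\<^esub> y) = h x \<oplus>\<^bsub>B\<^esub> h y) \<and>
    (\<forall>c. \<forall>x\<in>carrier A. h (c \<odot>\<^bsub>A\<^esub> x) = c \<odot>\<^bsub>B\<^esub> h x)"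

lemma linear_onI:
  assumes "\<And>x. x \<in> carrier A \<Longrightarrow> h x \<in> carrier B"
    and "\<And>x y. x \<in> carrier A \<Longrightarrow> y \<in> carrier A \<Longrightarrow> h (x \<oplus>\<^bsub>A\<^esub> y) = h x \<oplus>\<^bsub>B\<^esub> h y"
    and "\<And>c x. x \<in> carrier A \<Longrightarrow> h (c \<odot>\<^bsub>A\<^esub> x) = c \<odot>\<^bsub>B\<^esub> h x"
  shows "linear_on A B h"
  using assms by (auto simp: linear_on_def)

lemma linear_onD:
  assumes "linear_on A B h"
  shows "x \<in> carrier A \<Longrightarrow> h x \<in> carrier B"
    and "x \<in> carrier A \<Longrightarrow> y \<in> carrier A \<Longrightarrow> h (x \<oplus>\<^bsub>A\<^esub> y) = h x \<oplus>\<^bsub>B\<^esub> h y"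
    and "x \<in> carrier A \<Longrightarrow> h (c \<odot>\<^bsub>A\<^esub> x) = c \<odot>\<^bsub>B\<^esub> h x"
  using assms by (auto simp: linear_on_def)

lemma additive_zero:
  assumes "abelian_group A" "abelian_group B"
    and "h \<in> carrier A \<rightarrow> carrier B"
    and "\<And>x y. x \<in> carrier A \<Longrightarrow> y \<in> carrier A \<Longrightarrow> h (x \<oplus>\<^bsub>A\<^esub> y) = h x \<oplus>\<^bsub>B\<^esub> h y"
  shows "h \<zero>\<^bsub>A\<^esub> = \<zero>\<^bsub>B\<^esub>"
proof -
  interpret A: abelian_group A by fact
  interpret B: abelian_group B by fact
  show ?thesis
    using assms(3) assms(4)[of "\<zero>\<^bsub>A\<^esub>" "\<zero>\<^bsub>A\<^esub>"] by (metis A.l_zero A.zero_closed B.add.l_cancel_one' PiE)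
qed

text \<open>Additivity is separated from linearity because some maps below are not linear over a
  common scalar ring: a coefficient of t^m and the evaluation at t = 0 change the scalars, and a
  homogeneous component does not commute with t.\<close>

lemma additive_finsum:
  assumes "abelian_group A" "abelian_group B"
    and "h \<in> carrier A \<rightarrow> carrier B"
    and "\<And>x y. x \<in> carrier A \<Longrightarrow> y \<in> carrier A \<Longrightarrow> h (x \<oplus>\<^bsub>A\<^esub> y) = h x \<oplus>\<^bsub>B\<^esub> h y"
    and "\<And>i. i \<in> X \<Longrightarrow> f i \<in> carrier A"
  shows "h (finsum A f X) = finsum B (\<lambda>i. h (f i)) X"
proof -
  interpret A: abelian_group A by fact
  interpret B: abelian_group B by fact
  show ?thesis using assms(5)
  proof (induction X rule: infinite_finite_induct)
    case (insert x F)
    then have f: "f \<in> F \<rightarrow> carrier A" "f x \<in> carrier A" by auto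
    moreover have "(\<lambda>i. h (f i)) \<in> F \<rightarrow> carrier B" "h (f x) \<in> carrier B" using f assms(3) by auto
    ultimately show ?case using insert assms(4) by simp
  qed (use additive_zero[OF assms(1-4)] in auto)
qed

lemma linear_on_zero:
  "kalg A \<Longrightarrow> kalg B \<Longrightarrow> linear_on A B h \<Longrightarrow> h \<zero>\<^bsub>A\<^esub> = \<zero>\<^bsub>B\<^esub>"
  by (rule additive_zero) (auto simp: linear_on_def kalg_def ring_def)

lemma linear_on_finsum:
  "kalg A \<Longrightarrow> kalg B \<Longrightarrow> linear_on A B h \<Longrightarrow> (\<And>i. i \<in> X \<Longrightarrow> f i \<in> carrier A) \<Longrightarrow>
    h (finsum A f X) = finsum B (\<lambda>i. h (f i)) X"
  by (rule additive_finsum) (auto simp: linear_on_def kalg_def ring_def)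

lemma linear_on_diff:
  assumes "kalg A" "kalg B" "linear_on A B h" "x \<in> carrier A" "y \<in> carrier A"
  shows "h (x \<ominus>\<^bsub>A\<^esub> y) = h x \<ominus>\<^bsub>B\<^esub> h y"
proof -
  interpret A: kalg A by fact
  interpret B: kalg B by fact
  show ?thesis using linear_onD[OF assms(3)] assms(4,5)
    by (simp add: A.diff_eq_smult B.diff_eq_smult)
qed

section \<open>Quotients\<close>

lemma quot_algebra_simps [simp]:
  "carrier (quot_algebra A I) = a_rcosets\<^bsub>A\<^esub> I"
  "monoid.mult (quot_algebra A I) = rcoset_mult A I"
  "one (quot_algebra A I) = I +>\<^bsub>A\<^esub> \<one>\<^bsub>A\<^esub>"
  "zero (quot_algebra A I) = I"
  "add (quot_algebra A I) = set_add A"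
  by (simp_all add: quot_algebra_def FactRing_def)

text \<open>An ideal absorbs scalars because c x is the product of c 1 with x.\<close>

lemma (in kalg) ideal_smult:
  assumes "ideal I A" "x \<in> I" shows "c \<odot> x \<in> I"
proof -
  interpret ideal I A by fact
  show ?thesis using assms(2) Icarr I_l_closed[of x "c \<odot> \<one>"] by (simp add: smult_mult_left)
qed

lemma (in kalg) coset_eq_iff:
  assumes "ideal I A" "x \<in> carrier A" "y \<in> carrier A"
  shows "I +> x = I +> y \<longleftrightarrow> x \<ominus> y \<in> I"
  using quotient_eq_iff_same_a_r_cos[OF assms(1,2,3)] by auto

text \<open>The union over representatives in \<open>quot_algebra\<close> collapses to a single
  coset: two representatives differ by an element of the ideal, and multiplying this difference by c
  stays inside it.\<close>

lemma (in kalg) quot_smult: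
  assumes "ideal I A" "x \<in> carrier A"
  shows "c \<odot>\<^bsub>quot_algebra A I\<^esub> (I +> x) = I +> (c \<odot> x)"
proof -
  interpret ideal I A by fact
  have "I +> (c \<odot> y) = I +> (c \<odot> x)" if "y \<in> I +> x" for y
  proof -
    have y: "y \<in> carrier A" using that a_r_coset_subset_G[of I x] assms a_subset by auto
    have "I +> x = I +> y"
      using a_repr_independence[OF that assms(2)] a_subgroup by simp
    then have "x \<ominus> y \<in> I" using coset_eq_iff[OF assms y] by simp
    then have "c \<odot> x \<ominus> c \<odot> y \<in> I"
      using ideal_smult[OF assms(1)] smult_diff_right[OF assms(2) y] by metis
    then show ?thesis using coset_eq_iff[OF assms(1), of "c \<odot> x" "c \<odot> y"] y assms(2) by simp
  qed
  moreover have "x \<in> I +> x" using assms a_rcos_self by simp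
  ultimately have "(\<Union>y\<in>I +> x. I +> (c \<odot> y)) = I +> (c \<odot> x)"
    by (intro UN_constant_eq[of x]) blast+
  then show ?thesis by (simp only: quot_algebra_def module.simps)
qed

lemma quot_carrierE:
  assumes "X \<in> a_rcosets\<^bsub>A\<^esub> I"
  obtains x where "x \<in> carrier A" "X = I +>\<^bsub>A\<^esub> x"
  using assms unfolding A_RCOSETS_def' a_r_coset_def' by blast

lemma quot_carrierI: "x \<in> carrier A \<Longrightarrow> I +>\<^bsub>A\<^esub> x \<in> a_rcosets\<^bsub>A\<^esub> I"
  unfolding A_RCOSETS_def' a_r_coset_def' by blast

text \<open>Quotients and polynomials are known to be rings as other records; this carries the
  axioms over to the records that also hold the scalar multiplication.\<close>

lemma ring_cong:
  assumes "ring R" "carrier S = carrier R" "monoid.mult S = monoid.mult R" "one S = one R"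
    "zero S = zero R" "add S = add R"
  shows "ring S"
proof -
  interpret R: ring R by fact
  show ?thesis
  proof (intro ringI abelian_groupI monoidI)
    fix x assume "x \<in> carrier S"
    then show "\<exists>y\<in>carrier S. y \<oplus>\<^bsub>S\<^esub> x = \<zero>\<^bsub>S\<^esub>"
      using assms(2-) by (metis R.a_inv_closed R.l_neg)
  qed (use assms(2-) in \<open>auto simp: R.ring_simprules\<close>)
qed

lemma (in kalg) kalg_quot_algebra:
  assumes "ideal I A"
  shows "kalg (quot_algebra A I)"
proof -
  interpret I: ideal I A by fact
  let ?Q = "quot_algebra A I"
  have Q: "ring ?Q" by (rule ring_cong[OF I.quotient_is_ring]) (auto simp: FactRing_def)
  show ?thesis
  proof (rule kalg.intro[OF Q], unfold_locales)
  qed (auto elim!: quot_carrierE simp: quot_smult[OF assms] I.a_rcos_sum I.rcoset_mult_add quot_carrierI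
     smult_add_right smult_add_left smult_assoc smult_mult_left smult_mult_right)
qed

lemma (in kalg) linear_on_coset:
  assumes "ideal I A"
  shows "linear_on A (quot_algebra A I) ((+>) I)"
proof -
  interpret I: ideal I A by fact
  show ?thesis
    by (rule linear_onI) (simp_all add: quot_smult[OF assms] quot_carrierI I.a_rcos_sum)
qed

section \<open>Skew group algebras\<close>

locale skew = kalg A + H: group H for A :: "('k::comm_ring_1, 'a) module" (structure) and H :: "'g monoid" +
  fixes act :: "'g \<Rightarrow> 'a \<Rightarrow> 'a"
  assumes finite_H: "finite (carrier H)"
    and act_linear: "g \<in> carrier H \<Longrightarrow> linear_on A A (act g)"
    and act_mult: "g \<in> carrier H \<Longrightarrow> x \<in> carrier A \<Longrightarrow> y \<in> carrier A \<Longrightarrow> act g (x \<otimes> y) = act g x \<otimes> act g y"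
    and act_one: "g \<in> carrier H \<Longrightarrow> act g \<one> = \<one>"
    and act_id: "x \<in> carrier A \<Longrightarrow> act \<one>\<^bsub>H\<^esub> x = x"
    and act_act: "g \<in> carrier H \<Longrightarrow> h \<in> carrier H \<Longrightarrow> x \<in> carrier A \<Longrightarrow> act (g \<otimes>\<^bsub>H\<^esub> h) x = act g (act h x)"
begin

abbreviation "S \<equiv> skew_algebra A H act"
abbreviation "se \<equiv> skew_elem A"

lemma skew_simps:
  "carrier S = {f. (\<forall>g\<in>carrier H. f g \<in> carrier A) \<and> (\<forall>g. g \<notin> carrier H \<longrightarrow> f g = \<zero>)}"
  "monoid.mult S = (\<lambda>f h x. if x \<in> carrier H
                     then \<Oplus>g\<in>carrier H. f g \<otimes> act g (h (inv\<^bsub>H\<^esub> g \<otimes>\<^bsub>H\<^esub> x))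
                     else \<zero>)"
  "one S = se \<one> \<one>\<^bsub>H\<^esub>"
  "zero S = (\<lambda>x. \<zero>)"
  "add S = (\<lambda>f h x. f x \<oplus> h x)"
  "module.smult S = (\<lambda>c f x. c \<odot> f x)"
  by (simp_all add: skew_algebra_def skew_elem_def fun_eq_iff)

lemma act_closed [simp]: "g \<in> carrier H \<Longrightarrow> x \<in> carrier A \<Longrightarrow> act g x \<in> carrier A"
  using linear_onD(1)[OF act_linear] .

lemma act_zero [simp]: "g \<in> carrier H \<Longrightarrow> act g \<zero> = \<zero>"
  using linear_on_zero[OF _ _ act_linear] kalg_axioms by blast

lemma skew_comp_closed: "f \<in> carrier S \<Longrightarrow> f x \<in> carrier A"
  by (cases "x \<in> carrier H") (auto simp: skew_simps)

lemma skew_zero_off: "f \<in> carrier S \<Longrightarrow> g \<notin> carrier H \<Longrightarrow> f g = \<zero>"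
  by (simp add: skew_simps(1))

lemma skew_carrierI:
  "(\<And>g. f g \<in> carrier A) \<Longrightarrow> (\<And>g. g \<notin> carrier H \<Longrightarrow> f g = \<zero>) \<Longrightarrow> f \<in> carrier S"
  by (simp add: skew_simps(1))

lemma skew_add_group: "abelian_group S"
proof (rule abelian_groupI)
  fix x assume x: "x \<in> carrier S"
  note xc = skew_comp_closed[OF x] skew_zero_off[OF x]
  have 1: "(\<lambda>g. \<ominus> x g) \<in> carrier S"
    by (rule skew_carrierI) (simp_all add: xc)
  show "\<exists>y\<in>carrier S. y \<oplus>\<^bsub>S\<^esub> x = \<zero>\<^bsub>S\<^esub>"
    by (rule bexI[OF _ 1]) (simp add: skew_simps(4,5) l_neg xc)
next
  fix x y z assume xyz: "x \<in> carrier S" "y \<in> carrier S" "z \<in> carrier S"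
  note c = xyz[THEN skew_comp_closed] xyz[THEN skew_zero_off]
  show "(x \<oplus>\<^bsub>S\<^esub> y) \<oplus>\<^bsub>S\<^esub> z = x \<oplus>\<^bsub>S\<^esub> (y \<oplus>\<^bsub>S\<^esub> z)"
    unfolding skew_simps(5) by (rule ext) (simp add: c a_assoc)
  show "x \<oplus>\<^bsub>S\<^esub> y = y \<oplus>\<^bsub>S\<^esub> x"
    unfolding skew_simps(5) by (rule ext) (simp add: c a_comm)
  show "\<zero>\<^bsub>S\<^esub> \<oplus>\<^bsub>S\<^esub> x = x"
    unfolding skew_simps(4,5) by (rule ext) (simp add: c)
  show "x \<oplus>\<^bsub>S\<^esub> y \<in> carrier S"
    unfolding skew_simps(5) by (rule skew_carrierI) (simp_all add: c)
qed (simp add: skew_simps(1,4))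

lemma se_closed [simp]: "a \<in> carrier A \<Longrightarrow> g \<in> carrier H \<Longrightarrow> se a g \<in> carrier S"
  by (auto simp: skew_simps skew_elem_def)

lemma se_mult:
  assumes "a \<in> carrier A" "b \<in> carrier A" "g \<in> carrier H" "h \<in> carrier H"
  shows "se a g \<otimes>\<^bsub>S\<^esub> se b h = se (a \<otimes> act g b) (g \<otimes>\<^bsub>H\<^esub> h)"
proof
  fix x
  show "(se a g \<otimes>\<^bsub>S\<^esub> se b h) x = se (a \<otimes> act g b) (g \<otimes>\<^bsub>H\<^esub> h) x"
  proof (cases "x \<in> carrier H")
    case True
    have "(\<Oplus>g'\<in>carrier H. se a g g' \<otimes> act g' (se b h (inv\<^bsub>H\<^esub> g' \<otimes>\<^bsub>H\<^esub> x)))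
      = se a g g \<otimes> act g (se b h (inv\<^bsub>H\<^esub> g \<otimes>\<^bsub>H\<^esub> x))"
      by (rule finsum_single) (use assms True finite_H in \<open>auto simp: skew_elem_def\<close>)
    moreover have "inv\<^bsub>H\<^esub> g \<otimes>\<^bsub>H\<^esub> x = h \<longleftrightarrow> x = g \<otimes>\<^bsub>H\<^esub> h"
      using assms True by (metis H.inv_closed H.inv_solve_left')
    ultimately show ?thesis using assms True by (auto simp: skew_simps skew_elem_def)
  qed (use assms in \<open>auto simp: skew_simps skew_elem_def\<close>)
qed

text \<open>An element of the skew group algebra is the finite sum of its values placed at single
  group elements. Additive statements therefore reduce to the elements \<open>se a g\<close>, whose
  product is a closed formula instead of a convolution sum.\<close>

lemma skew_induct [consumes 1, case_names zero elem add]: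
  assumes "f \<in> carrier S" "P (\<lambda>_. \<zero>)"
    and "\<And>a g. a \<in> carrier A \<Longrightarrow> g \<in> carrier H \<Longrightarrow> P (se a g)"
    and "\<And>f h. f \<in> carrier S \<Longrightarrow> h \<in> carrier S \<Longrightarrow> P f \<Longrightarrow> P h \<Longrightarrow> P (f \<oplus>\<^bsub>S\<^esub> h)"
  shows "P f"
proof -
  note c = skew_comp_closed[OF assms(1)] skew_zero_off[OF assms(1)]
  \<comment> \<open>The restriction of \<open>f\<close> to a set of group elements, enlarged by one
    element at a time until it is all of \<open>f\<close>.\<close>
  let ?r = "\<lambda>X g. if g \<in> X then f g else \<zero>"
  have "P (?r X)" if "finite X" "X \<subseteq> carrier H" for X
    using that
  proof (induction X rule: finite_induct)
    case (insert x F)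
    have eq: "?r (insert x F) = se (f x) x \<oplus>\<^bsub>S\<^esub> ?r F"
      unfolding skew_simps(5) skew_elem_def using insert.hyps(2) by (intro ext) (simp add: c)
    have H: "x \<in> carrier H" "F \<subseteq> carrier H" using insert.prems by simp_all
    have r: "?r F \<in> carrier S"
      using H(2) by (intro skew_carrierI) (auto simp: c)
    show ?case
      unfolding eq by (rule assms(4)[OF se_closed[OF c(1) H(1)] r assms(3)[OF c(1) H(1)] insert.IH[OF H(2)]])
  qed (use assms(2) in simp)
  from this[OF finite_H] have "P (?r (carrier H))" by simp
  moreover have "?r (carrier H) = f"
    by (rule ext) (simp add: c)
  ultimately show ?thesis by simp
qed

lemma skew_mult_closed:
  assumes "f \<in> carrier S" "h \<in> carrier S"
  shows "f \<otimes>\<^bsub>S\<^esub> h \<in> carrier S"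
proof (rule skew_carrierI)
  note c = assms[THEN skew_comp_closed]
  show "(f \<otimes>\<^bsub>S\<^esub> h) x \<in> carrier A" for x
    unfolding skew_simps(2) by (auto intro!: finsum_in simp: c)
qed (simp add: skew_simps(2))

lemma skew_l_distr:
  assumes "f \<in> carrier S" "h \<in> carrier S" "k \<in> carrier S"
  shows "(f \<oplus>\<^bsub>S\<^esub> h) \<otimes>\<^bsub>S\<^esub> k = f \<otimes>\<^bsub>S\<^esub> k \<oplus>\<^bsub>S\<^esub> h \<otimes>\<^bsub>S\<^esub> k"
proof
  fix x
  note c = assms[THEN skew_comp_closed]
  have "(\<Oplus>g\<in>carrier H. (f g \<oplus> h g) \<otimes> act g (k (inv\<^bsub>H\<^esub> g \<otimes>\<^bsub>H\<^esub> x))) =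
    (\<Oplus>g\<in>carrier H. f g \<otimes> act g (k (inv\<^bsub>H\<^esub> g \<otimes>\<^bsub>H\<^esub> x)) \<oplus> h g \<otimes> act g (k (inv\<^bsub>H\<^esub> g \<otimes>\<^bsub>H\<^esub> x)))"
    by (rule finsum_cong_all) (simp_all add: c l_distr)
  also have "\<dots> = (\<Oplus>g\<in>carrier H. f g \<otimes> act g (k (inv\<^bsub>H\<^esub> g \<otimes>\<^bsub>H\<^esub> x))) \<oplus>
      (\<Oplus>g\<in>carrier H. h g \<otimes> act g (k (inv\<^bsub>H\<^esub> g \<otimes>\<^bsub>H\<^esub> x)))"
    by (rule finsum_addf) (simp_all add: c Pi_def)
  finally show "((f \<oplus>\<^bsub>S\<^esub> h) \<otimes>\<^bsub>S\<^esub> k) x = (f \<otimes>\<^bsub>S\<^esub> k \<oplus>\<^bsub>S\<^esub> h \<otimes>\<^bsub>S\<^esub> k) x"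
    unfolding skew_simps(2,5) by (cases "x \<in> carrier H") simp_all
qed

lemma skew_r_distr:
  assumes "f \<in> carrier S" "h \<in> carrier S" "k \<in> carrier S"
  shows "k \<otimes>\<^bsub>S\<^esub> (f \<oplus>\<^bsub>S\<^esub> h) = k \<otimes>\<^bsub>S\<^esub> f \<oplus>\<^bsub>S\<^esub> k \<otimes>\<^bsub>S\<^esub> h"
proof
  fix x
  note c = assms[THEN skew_comp_closed]
  have "(\<Oplus>g\<in>carrier H. k g \<otimes> act g (f (inv\<^bsub>H\<^esub> g \<otimes>\<^bsub>H\<^esub> x) \<oplus> h (inv\<^bsub>H\<^esub> g \<otimes>\<^bsub>H\<^esub> x))) =
    (\<Oplus>g\<in>carrier H. k g \<otimes> act g (f (inv\<^bsub>H\<^esub> g \<otimes>\<^bsub>H\<^esub> x)) \<oplus> k g \<otimes> act g (h (inv\<^bsub>H\<^esub> g \<otimes>\<^bsub>H\<^esub> x)))"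
    by (rule finsum_cong_all) (simp_all add: c linear_onD(2)[OF act_linear] r_distr)
  also have "\<dots> = (\<Oplus>g\<in>carrier H. k g \<otimes> act g (f (inv\<^bsub>H\<^esub> g \<otimes>\<^bsub>H\<^esub> x))) \<oplus>
      (\<Oplus>g\<in>carrier H. k g \<otimes> act g (h (inv\<^bsub>H\<^esub> g \<otimes>\<^bsub>H\<^esub> x)))"
    by (rule finsum_addf) (simp_all add: c Pi_def)
  finally show "(k \<otimes>\<^bsub>S\<^esub> (f \<oplus>\<^bsub>S\<^esub> h)) x = (k \<otimes>\<^bsub>S\<^esub> f \<oplus>\<^bsub>S\<^esub> k \<otimes>\<^bsub>S\<^esub> h) x"
    unfolding skew_simps(2,5) by (cases "x \<in> carrier H") simp_all
qed

lemma skew_zero_mult: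
  assumes "f \<in> carrier S"
  shows "(\<lambda>_. \<zero>) \<otimes>\<^bsub>S\<^esub> f = (\<lambda>_. \<zero>)" "f \<otimes>\<^bsub>S\<^esub> (\<lambda>_. \<zero>) = (\<lambda>_. \<zero>)"
proof -
  note c = skew_comp_closed[OF assms]
  show "(\<lambda>_. \<zero>) \<otimes>\<^bsub>S\<^esub> f = (\<lambda>_. \<zero>)"
    unfolding skew_simps(2) by (rule ext) (auto simp: c intro!: add.finprod_one_eqI)
  show "f \<otimes>\<^bsub>S\<^esub> (\<lambda>_. \<zero>) = (\<lambda>_. \<zero>)"
    unfolding skew_simps(2) by (rule ext) (auto simp: c intro!: add.finprod_one_eqI)
qed

text \<open>Both sides are additive in each factor, so three nested inductions, on \<open>k\<close>,
  then \<open>h\<close>, then \<open>f\<close>, leave only products of three elements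
  \<open>se a g\<close>.\<close>

lemma skew_assoc:
  assumes "f \<in> carrier S" "h \<in> carrier S" "k \<in> carrier S"
  shows "(f \<otimes>\<^bsub>S\<^esub> h) \<otimes>\<^bsub>S\<^esub> k = f \<otimes>\<^bsub>S\<^esub> (h \<otimes>\<^bsub>S\<^esub> k)"
proof -
  have z: "(\<lambda>_. \<zero>) \<in> carrier S" by (simp add: skew_simps)
  note [simp] = skew_mult_closed skew_zero_mult z
  have 1: "(se a g \<otimes>\<^bsub>S\<^esub> se b g') \<otimes>\<^bsub>S\<^esub> k = se a g \<otimes>\<^bsub>S\<^esub> (se b g' \<otimes>\<^bsub>S\<^esub> k)"
    if "a \<in> carrier A" "g \<in> carrier H" "b \<in> carrier A" "g' \<in> carrier H" for a g b g'
    using assms(3)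
  proof (induction k rule: skew_induct)
    case (elem c g'')
    \<comment> \<open>With x, y for the actions of g on b and of g g' on c, both sides are a x y
      placed at g g' g''; this uses that each group element acts multiplicatively and that the
      action respects products in the group.\<close>
    with that show ?case by (simp add: se_mult act_mult m_assoc act_act H.m_assoc)
  qed (use that in \<open>auto simp: skew_r_distr\<close>)
  have 2: "(se a g \<otimes>\<^bsub>S\<^esub> h) \<otimes>\<^bsub>S\<^esub> k = se a g \<otimes>\<^bsub>S\<^esub> (h \<otimes>\<^bsub>S\<^esub> k)"
    if "a \<in> carrier A" "g \<in> carrier H" for a g
    using assms(2)
  proof (induction h rule: skew_induct)
    case (elem b g')
    with that 1 show ?case by blast
  qed (use that assms(3) in \<open>auto simp: skew_r_distr skew_l_distr\<close>)
  show ?thesis using assms(1)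
  proof (induction f rule: skew_induct)
    case (elem a g)
    with 2 show ?case by blast
  qed (use assms(2,3) in \<open>auto simp: skew_l_distr\<close>)
qed

lemma skew_one:
  assumes "f \<in> carrier S"
  shows "\<one>\<^bsub>S\<^esub> \<otimes>\<^bsub>S\<^esub> f = f" "f \<otimes>\<^bsub>S\<^esub> \<one>\<^bsub>S\<^esub> = f"
proof -
  have o: "\<one>\<^bsub>S\<^esub> \<in> carrier S" by (simp add: skew_simps(3))
  show "\<one>\<^bsub>S\<^esub> \<otimes>\<^bsub>S\<^esub> f = f" using assms
  proof (induction f rule: skew_induct)
    case (elem a g)
    then show ?case by (simp add: skew_simps(3) se_mult act_id)
  qed (use o in \<open>auto simp: skew_r_distr skew_zero_mult\<close>)
  show "f \<otimes>\<^bsub>S\<^esub> \<one>\<^bsub>S\<^esub> = f" using assms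
  proof (induction f rule: skew_induct)
    case (elem a g)
    then show ?case by (simp add: skew_simps(3) se_mult act_one)
  qed (use o in \<open>auto simp: skew_l_distr skew_zero_mult\<close>)
qed

lemma skew_one_closed: "\<one>\<^bsub>S\<^esub> \<in> carrier S"
  by (simp add: skew_simps(3))

lemma ring_skew: "ring S"
  by (intro ringI monoidI skew_add_group)
    (simp_all only: skew_mult_closed skew_one_closed skew_assoc skew_one skew_l_distr skew_r_distr)

lemma kalg_skew: "kalg S"
proof (rule kalg.intro[OF ring_skew], unfold_locales)
  fix c d x y assume xy: "x \<in> carrier S" "y \<in> carrier S"
  note c = xy[THEN skew_comp_closed] xy[THEN skew_zero_off]
  show "(c \<odot>\<^bsub>S\<^esub> x) \<otimes>\<^bsub>S\<^esub> y = c \<odot>\<^bsub>S\<^esub> (x \<otimes>\<^bsub>S\<^esub> y)"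
    unfolding skew_simps(2,6)
    by (rule ext) (simp add: c Pi_def finsum_smult smult_mult_left cong: finsum_cong)
  show "x \<otimes>\<^bsub>S\<^esub> (c \<odot>\<^bsub>S\<^esub> y) = c \<odot>\<^bsub>S\<^esub> (x \<otimes>\<^bsub>S\<^esub> y)"
    unfolding skew_simps(2,6)
    by (rule ext) (simp add: c Pi_def finsum_smult smult_mult_right linear_onD(3)[OF act_linear] cong: finsum_cong)
  show "c \<odot>\<^bsub>S\<^esub> (x \<oplus>\<^bsub>S\<^esub> y) = c \<odot>\<^bsub>S\<^esub> x \<oplus>\<^bsub>S\<^esub> c \<odot>\<^bsub>S\<^esub> y"
    unfolding skew_simps(5,6) by (rule ext) (simp add: c smult_add_right)
next
  fix c d x assume x: "x \<in> carrier S"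
  note c = skew_comp_closed[OF x] skew_zero_off[OF x]
  show "c \<odot>\<^bsub>S\<^esub> x \<in> carrier S"
    unfolding skew_simps(6) by (rule skew_carrierI) (simp_all add: c)
  show "(c + d) \<odot>\<^bsub>S\<^esub> x = c \<odot>\<^bsub>S\<^esub> x \<oplus>\<^bsub>S\<^esub> d \<odot>\<^bsub>S\<^esub> x"
    unfolding skew_simps(5,6) by (rule ext) (simp add: c smult_add_left)
  show "(c * d) \<odot>\<^bsub>S\<^esub> x = c \<odot>\<^bsub>S\<^esub> (d \<odot>\<^bsub>S\<^esub> x)"
    unfolding skew_simps(6) by (rule ext) (simp add: c smult_assoc)
  show "1 \<odot>\<^bsub>S\<^esub> x = x"
    unfolding skew_simps(6) by (rule ext) (simp add: c)
qed

lemma skew_finsum: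
  assumes "\<And>i. i \<in> X \<Longrightarrow> f i \<in> carrier S"
  shows "finsum S f X g = (\<Oplus>i\<in>X. f i g)"
proof -
  have "(\<lambda>f. f g) \<in> carrier S \<rightarrow> carrier A"
    using skew_comp_closed by blast
  from additive_finsum[OF skew_add_group is_abelian_group this _ assms]
  show ?thesis by (simp add: skew_simps(5))
qed

lemma linear_on_se:
  assumes "g \<in> carrier H" shows "linear_on A S (\<lambda>a. se a g)"
proof (rule linear_onI)
  show "se (x \<oplus> y) g = se x g \<oplus>\<^bsub>S\<^esub> se y g" if "x \<in> carrier A" "y \<in> carrier A" for x y
    unfolding skew_simps(5) skew_elem_def by (rule ext) (simp add: that)
  show "se (c \<odot> x) g = c \<odot>\<^bsub>S\<^esub> se x g" if "x \<in> carrier A" for c x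
    unfolding skew_simps(6) skew_elem_def by (rule ext) (simp add: that)
qed (rule se_closed[OF _ assms])

end

section \<open>Finite bases\<close>

locale fbasis = kalg M for M :: "('s::comm_ring_1, 'a) module" (structure) +
  fixes I :: "'i set" and b :: "'i \<Rightarrow> 'a"
  assumes finite_I: "finite I" and basis: "is_basis M I b"
begin

lemma b_closed [simp]: "i \<in> I \<Longrightarrow> b i \<in> carrier M"
  using basis by (auto simp: is_basis_def)

lemma supp_sum:
  assumes "{i. c i \<noteq> 0} \<subseteq> I"
  shows "(\<Oplus>i\<in>{i. c i \<noteq> 0}. c i \<odot> b i) = (\<Oplus>i\<in>I. c i \<odot> b i)"
  using assms finite_I by (intro finsum_mono_neutral) auto

text \<open>For a finite index set the sum over the support, which changes with the coefficients,
  can be replaced by the sum over all of \<open>I\<close>, which is linear in them. The support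
  condition still pins the coefficients outside \<open>I\<close> to zero.\<close>

lemma ex1_coords:
  assumes "x \<in> carrier M"
  shows "\<exists>!c. {i. c i \<noteq> 0} \<subseteq> I \<and> x = (\<Oplus>i\<in>I. c i \<odot> b i)"
proof -
  have "(finite {i. c i \<noteq> 0} \<and> {i. c i \<noteq> 0} \<subseteq> I \<and> x = (\<Oplus>i\<in>{i. c i \<noteq> 0}. c i \<odot> b i)) \<longleftrightarrow>
    ({i. c i \<noteq> 0} \<subseteq> I \<and> x = (\<Oplus>i\<in>I. c i \<odot> b i))" for c
    using supp_sum[of c] finite_subset[OF _ finite_I] by auto
  moreover have "\<exists>!c. finite {i. c i \<noteq> 0} \<and> {i. c i \<noteq> 0} \<subseteq> I \<and> x = (\<Oplus>i\<in>{i. c i \<noteq> 0}. c i \<odot> b i)"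
    using assms basis unfolding is_basis_def by blast
  ultimately show ?thesis by (simp only:)
qed

definition crd :: "'a \<Rightarrow> 'i \<Rightarrow> 's" where
  "crd x = (THE c. {i. c i \<noteq> 0} \<subseteq> I \<and> x = (\<Oplus>i\<in>I. c i \<odot> b i))"

lemma crd_expand: "x \<in> carrier M \<Longrightarrow> (\<Oplus>i\<in>I. crd x i \<odot> b i) = x"
  and crd_outside: "x \<in> carrier M \<Longrightarrow> i \<notin> I \<Longrightarrow> crd x i = 0"
  using theI'[OF ex1_coords[of x], folded crd_def] by auto

lemma lc_closed [simp]: "(\<Oplus>i\<in>I. c i \<odot> b i) \<in> carrier M"
  by (intro finsum_in) simp

lemma crd_lc:
  assumes "i \<in> I"
  shows "crd (\<Oplus>i\<in>I. c i \<odot> b i) i = c i"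
proof -
  let ?c = "\<lambda>i. if i \<in> I then c i else 0"
  have "(\<Oplus>i\<in>I. c i \<odot> b i) = (\<Oplus>i\<in>I. ?c i \<odot> b i)"
    by (rule finsum_cong_all) simp_all
  then have "{i. ?c i \<noteq> 0} \<subseteq> I \<and> (\<Oplus>i\<in>I. c i \<odot> b i) = (\<Oplus>i\<in>I. ?c i \<odot> b i)" by auto
  then have "crd (\<Oplus>i\<in>I. c i \<odot> b i) = ?c"
    unfolding crd_def by (rule the1_equality[OF ex1_coords[OF lc_closed]])
  then show ?thesis using assms by simp
qed

lemma crd_eqI:
  "x \<in> carrier M \<Longrightarrow> y \<in> carrier M \<Longrightarrow> (\<And>i. i \<in> I \<Longrightarrow> crd x i = crd y i) \<Longrightarrow> x = y"
  by (metis (no_types, lifting) crd_expand crd_outside ext)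

lemma crd_add:
  assumes "x \<in> carrier M" "y \<in> carrier M"
  shows "crd (x \<oplus> y) i = crd x i + crd y i"
proof (cases "i \<in> I")
  case True
  have "(\<Oplus>i\<in>I. (crd x i + crd y i) \<odot> b i) = (\<Oplus>i\<in>I. crd x i \<odot> b i \<oplus> crd y i \<odot> b i)"
    by (rule finsum_cong_all) (simp_all add: smult_add_left)
  also have "\<dots> = (\<Oplus>i\<in>I. crd x i \<odot> b i) \<oplus> (\<Oplus>i\<in>I. crd y i \<odot> b i)"
    by (rule finsum_addf) auto
  also have "\<dots> = x \<oplus> y" by (simp add: crd_expand assms)
  finally show ?thesis using crd_lc[OF True, of "\<lambda>i. crd x i + crd y i"] by simp
qed (simp add: crd_outside assms)

lemma crd_smult:
  assumes "x \<in> carrier M"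
  shows "crd (c \<odot> x) i = c * crd x i"
proof (cases "i \<in> I")
  case True
  have "(\<Oplus>i\<in>I. (c * crd x i) \<odot> b i) = (\<Oplus>i\<in>I. c \<odot> (crd x i \<odot> b i))"
    by (rule finsum_cong_all) (simp_all add: smult_assoc)
  also have "\<dots> = c \<odot> (\<Oplus>i\<in>I. crd x i \<odot> b i)"
    by (rule finsum_smult[symmetric]) auto
  also have "\<dots> = c \<odot> x" by (simp add: crd_expand assms)
  finally show ?thesis using crd_lc[OF True, of "\<lambda>i. c * crd x i"] by simp
qed (simp add: crd_outside assms)

lemma crd_zero [simp]: "crd \<zero> i = 0"
  using crd_smult[of \<zero> 0 i] by simp

lemma crd_basis:
  assumes "j \<in> I" shows "crd (b j) i = (if i = j then 1 else 0)"
proof (cases "i \<in> I")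
  case True
  have "(\<Oplus>i\<in>I. (if i = j then 1 else 0) \<odot> b i) = 1 \<odot> b j"
    using finsum_single[of I j "\<lambda>i. (if i = j then 1 else 0) \<odot> b i"] finite_I assms by simp
  then show ?thesis using crd_lc[OF True, of "\<lambda>i. if i = j then 1 else 0"] assms by simp
qed (use assms in \<open>auto simp: crd_outside\<close>)

lemma crd_finsum:
  "(\<And>i. i \<in> X \<Longrightarrow> f i \<in> carrier M) \<Longrightarrow> crd (finsum M f X) j = (\<Sum>i\<in>X. crd (f i) j)"
proof (induction X rule: infinite_finite_induct)
  case (insert x F)
  then have "f \<in> F \<rightarrow> carrier M" "f x \<in> carrier M" by auto
  with insert show ?case by (simp add: crd_add)
qed auto

end

text \<open>The usual criterion by spanning and independence. Existence cuts the coefficients off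
  outside \<open>I\<close>, and uniqueness is independence applied to a difference of two
  coefficient families.\<close>

lemma is_basisI:
  assumes "kalg M" "finite I" and b: "\<And>i. i \<in> I \<Longrightarrow> b i \<in> carrier M"
    and span: "\<And>x. x \<in> carrier M \<Longrightarrow> \<exists>c. x = (\<Oplus>\<^bsub>M\<^esub>i\<in>I. c i \<odot>\<^bsub>M\<^esub> b i)"
    and indep: "\<And>c i. (\<Oplus>\<^bsub>M\<^esub>i\<in>I. c i \<odot>\<^bsub>M\<^esub> b i) = \<zero>\<^bsub>M\<^esub> \<Longrightarrow> i \<in> I \<Longrightarrow> c i = 0"
  shows "is_basis M I b"
proof -
  interpret kalg M by fact
  let ?l = "\<lambda>c. \<Oplus>\<^bsub>M\<^esub>i\<in>I. c i \<odot>\<^bsub>M\<^esub> b i"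
  have supp: "(\<Oplus>\<^bsub>M\<^esub>i\<in>{i. c i \<noteq> 0}. c i \<odot>\<^bsub>M\<^esub> b i) = ?l c" if "{i. c i \<noteq> 0} \<subseteq> I" for c
    using that b \<open>finite I\<close> by (intro finsum_mono_neutral) auto
  have lc: "?l c \<in> carrier M" for c by (intro finsum_in) (simp add: b)
  have "\<exists>!c. finite {i. c i \<noteq> 0} \<and> {i. c i \<noteq> 0} \<subseteq> I \<and> x = (\<Oplus>\<^bsub>M\<^esub>i\<in>{i. c i \<noteq> 0}. c i \<odot>\<^bsub>M\<^esub> b i)"
    if x: "x \<in> carrier M" for x
  proof -
    obtain c where c: "x = ?l c" using span[OF x] by blast
    let ?c = "\<lambda>i. if i \<in> I then c i else 0"
    have s: "{i. ?c i \<noteq> 0} \<subseteq> I" by auto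
    have "?l ?c = x" unfolding c by (rule finsum_cong_all) (auto simp: b)
    then have ex1: "finite {i. ?c i \<noteq> 0} \<and> {i. ?c i \<noteq> 0} \<subseteq> I \<and> x = (\<Oplus>\<^bsub>M\<^esub>i\<in>{i. ?c i \<noteq> 0}. ?c i \<odot>\<^bsub>M\<^esub> b i)"
      using supp[OF s] finite_subset[OF s \<open>finite I\<close>] s by metis
    have uniq: "d = e"
      if d: "finite {i. d i \<noteq> 0} \<and> {i. d i \<noteq> 0} \<subseteq> I \<and> x = (\<Oplus>\<^bsub>M\<^esub>i\<in>{i. d i \<noteq> 0}. d i \<odot>\<^bsub>M\<^esub> b i)"
        and e: "finite {i. e i \<noteq> 0} \<and> {i. e i \<noteq> 0} \<subseteq> I \<and> x = (\<Oplus>\<^bsub>M\<^esub>i\<in>{i. e i \<noteq> 0}. e i \<odot>\<^bsub>M\<^esub> b i)" for d e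
    proof
      fix i
      have de: "?l d = x" "?l e = x" using d e supp by simp_all
      \<comment> \<open>Two expansions of \<open>x\<close> have a difference whose combination is
        zero; the difference is written with the scalar -1, for which distributivity over scalars is
        available.\<close>
      have "?l (\<lambda>i. d i + - 1 * e i) = (\<Oplus>\<^bsub>M\<^esub>i\<in>I. d i \<odot>\<^bsub>M\<^esub> b i \<oplus>\<^bsub>M\<^esub> (- 1) \<odot>\<^bsub>M\<^esub> (e i \<odot>\<^bsub>M\<^esub> b i))"
        by (rule finsum_cong_all) (simp_all only: smult_add_left smult_assoc b a_closed smult_closed)
      also have "\<dots> = ?l d \<oplus>\<^bsub>M\<^esub> (\<Oplus>\<^bsub>M\<^esub>i\<in>I. (- 1) \<odot>\<^bsub>M\<^esub> (e i \<odot>\<^bsub>M\<^esub> b i))"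
        by (rule finsum_addf) (auto simp: b)
      also have "(\<Oplus>\<^bsub>M\<^esub>i\<in>I. (- 1) \<odot>\<^bsub>M\<^esub> (e i \<odot>\<^bsub>M\<^esub> b i)) = (- 1) \<odot>\<^bsub>M\<^esub> ?l e"
        by (rule finsum_smult[symmetric]) (auto simp: b)
      also have "?l d \<oplus>\<^bsub>M\<^esub> \<dots> = \<zero>\<^bsub>M\<^esub>"
        unfolding de using x by (simp add: minus_eq_smult[symmetric] r_neg)
      finally have "i \<in> I \<Longrightarrow> d i + - 1 * e i = 0" by (rule indep)
      moreover have "d i = 0 \<and> e i = 0" if "i \<notin> I" using that d e by blast
      ultimately show "d i = e i" by (cases "i \<in> I") auto
    qed
    show ?thesis by (rule ex1I[of _ ?c], rule ex1, rule uniq[OF _ ex1])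
  qed
  then show ?thesis using b by (auto simp: is_basis_def)
qed

section \<open>Matching two equally indexed bases\<close>

locale basis_change = M: fbasis M I b + N: fbasis N I d
  for M :: "('s::comm_ring_1, 'a) module" and I :: "'i set" and b
    and N :: "('s, 'b) module" and d
begin

definition change :: "'a \<Rightarrow> 'b" where
  "change x = (\<Oplus>\<^bsub>N\<^esub>i\<in>I. M.crd x i \<odot>\<^bsub>N\<^esub> d i)"

lemma crd_change: "x \<in> carrier M \<Longrightarrow> N.crd (change x) i = M.crd x i"
  by (cases "i \<in> I") (simp_all add: change_def N.crd_lc M.crd_outside N.crd_outside)

lemma change_closed [simp]: "change x \<in> carrier N"
  by (simp add: change_def)

lemma change_eqI:
  "x \<in> carrier M \<Longrightarrow> y \<in> carrier N \<Longrightarrow> (\<And>i. i \<in> I \<Longrightarrow> M.crd x i = N.crd y i) \<Longrightarrow> change x = y"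
  by (rule N.crd_eqI) (simp_all add: crd_change)

lemma change_basis: "i \<in> I \<Longrightarrow> change (b i) = d i"
  by (rule change_eqI) (simp_all add: M.crd_basis N.crd_basis)

lemma linear_on_change: "linear_on M N change"
  by (rule linear_onI) (auto intro!: change_eqI simp: M.crd_add M.crd_smult N.crd_add N.crd_smult crd_change)

lemma bij_change: "bij_betw change (carrier M) (carrier N)"
proof (rule bij_betwI')
  fix x y assume "x \<in> carrier M" "y \<in> carrier M"
  then show "change x = change y \<longleftrightarrow> x = y" by (metis M.crd_eqI crd_change)
next
  fix y assume y: "y \<in> carrier N"
  have "change (\<Oplus>\<^bsub>M\<^esub>i\<in>I. N.crd y i \<odot>\<^bsub>M\<^esub> b i) = y"
    by (rule change_eqI) (simp_all add: y M.crd_lc)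
  then show "\<exists>x\<in>carrier M. y = change x" by (metis M.lc_closed)
qed simp

end

section \<open>Polynomials with coefficients in an algebra\<close>

locale kpoly = kalg A for A :: "('k::field, 'a) module" (structure)
begin

abbreviation "PA \<equiv> poly_algebra A"

sublocale U: UP_ring A "UP A"
  by unfold_locales simp

lemma PA_simps:
  "carrier PA = up A" "\<one>\<^bsub>PA\<^esub> = (\<lambda>i. if i = 0 then \<one> else \<zero>)" "\<zero>\<^bsub>PA\<^esub> = (\<lambda>i. \<zero>)"
  by (simp_all add: poly_algebra_def UP_def)

lemma PA_add: "f \<in> carrier PA \<Longrightarrow> g \<in> carrier PA \<Longrightarrow> f \<oplus>\<^bsub>PA\<^esub> g = (\<lambda>i. f i \<oplus> g i)"
  by (simp add: poly_algebra_def UP_def)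

lemma PA_mult: "f \<in> carrier PA \<Longrightarrow> g \<in> carrier PA \<Longrightarrow> f \<otimes>\<^bsub>PA\<^esub> g = (\<lambda>n. \<Oplus>i\<in>{..n}. f i \<otimes> g (n - i))"
  by (simp add: poly_algebra_def UP_def)

lemma PA_smult: "p \<odot>\<^bsub>PA\<^esub> f = (\<lambda>m. \<Oplus>i\<in>{..m}. Polynomial.coeff p i \<odot> f (m - i))"
  by (simp add: poly_algebra_def)

lemma PA_closed: "f \<in> carrier PA \<Longrightarrow> f m \<in> carrier A"
  by (auto simp: PA_simps)

lemma PA_bound: "f \<in> carrier PA \<Longrightarrow> \<exists>n. \<forall>m>n. f m = \<zero>"
  unfolding PA_simps up_def by (blast dest: bound.bound)

lemma PA_carrierI: "(\<And>m. f m \<in> carrier A) \<Longrightarrow> (\<And>m. m > n \<Longrightarrow> f m = \<zero>) \<Longrightarrow> f \<in> carrier PA"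
  unfolding PA_simps by (rule mem_upI) (blast intro: bound.intro)+

lemma tmonom_eq: "a \<in> carrier A \<Longrightarrow> tmonom A a m = (\<lambda>i. if i = m then a else \<zero>)"
  by (simp add: UP_def)

lemma tmonom_closed [simp]: "a \<in> carrier A \<Longrightarrow> tmonom A a m \<in> carrier PA"
  by (rule PA_carrierI[of _ m]) (simp_all add: tmonom_eq)

lemma ring_PA: "ring PA"
  by (rule ring_cong[OF U.UP_ring]) (simp_all add: poly_algebra_def)

text \<open>The image of K[t] in A[t]. Scalar multiplication by p is multiplication by this central
  element, so the module axioms of A[t] become ring axioms.\<close>

definition scal :: "'k poly \<Rightarrow> nat \<Rightarrow> 'a" where
  "scal p = (\<lambda>i. Polynomial.coeff p i \<odot> \<one>)"

lemma scal_closed: "scal p \<in> carrier PA"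
  by (rule PA_carrierI[of _ "degree p"]) (simp_all add: scal_def coeff_eq_0)

lemma scal_mult_left: 
  assumes f: "f \<in> carrier PA" shows "scal p \<otimes>\<^bsub>PA\<^esub> f = p \<odot>\<^bsub>PA\<^esub> f"
  unfolding PA_mult[OF scal_closed f] PA_smult
  by (rule ext, rule finsum_cong_all) (simp_all add: scal_def smult_mult_left PA_closed[OF f])

lemma scal_mult_right:
  assumes f: "f \<in> carrier PA" shows "f \<otimes>\<^bsub>PA\<^esub> scal p = p \<odot>\<^bsub>PA\<^esub> f"
proof
  fix m :: nat
  \<comment> \<open>Reversing the summation index by i to m - i turns the convolution with the
    scalar on the right into the one with the scalar on the left.\<close>
  have "i \<in> (\<lambda>i. m - i) ` {..m}" if "i \<le> m" for i
    using that by (intro image_eqI[of _ _ "m - i"]) auto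
  then have img: "(\<lambda>i. m - i) ` {..m} = {..m}" by auto
  have "(f \<otimes>\<^bsub>PA\<^esub> scal p) m = (\<Oplus>i\<in>{..m}. Polynomial.coeff p (m - i) \<odot> f i)"
    unfolding PA_mult[OF f scal_closed]
    by (rule finsum_cong_all) (simp_all add: scal_def smult_mult_right PA_closed[OF f])
  also have "\<dots> = (\<Oplus>i\<in>(\<lambda>i. m - i) ` {..m}. Polynomial.coeff p i \<odot> f (m - i))"
    by (subst finsum_reindex)
      (auto simp: inj_on_def PA_closed[OF f] intro!: finsum_cong_all)
  finally show "(f \<otimes>\<^bsub>PA\<^esub> scal p) m = (p \<odot>\<^bsub>PA\<^esub> f) m"
    unfolding PA_smult img .
qed

lemma scal_add: "scal (p + r) = scal p \<oplus>\<^bsub>PA\<^esub> scal r"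
  unfolding PA_add[OF scal_closed scal_closed] by (simp add: scal_def smult_add_left)

lemma scal_mult: "scal (p * r) = scal p \<otimes>\<^bsub>PA\<^esub> scal r"
  unfolding PA_mult[OF scal_closed scal_closed]
proof
  fix m
  show "scal (p * r) m = (\<Oplus>i\<in>{..m}. scal p i \<otimes> scal r (m - i))"
    unfolding scal_def coeff_mult sum_smult[OF one_closed]
    by (rule finsum_cong_all) (simp_all add: smult_mult_left smult_assoc)
qed

lemma scal_one: "scal 1 = \<one>\<^bsub>PA\<^esub>"
  unfolding PA_simps scal_def by (rule ext) simp

lemma kalg_PA: "kalg PA"
proof -
  interpret P: ring PA by (rule ring_PA)
  show ?thesis
  proof unfold_locales
    fix x y c d assume xy: "x \<in> carrier PA" "y \<in> carrier PA"
    note [simp] = xy scal_closed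
    note s = scal_mult_left[symmetric]
    show "c \<odot>\<^bsub>PA\<^esub> x \<in> carrier PA" by (simp add: s)
    show "c \<odot>\<^bsub>PA\<^esub> (x \<oplus>\<^bsub>PA\<^esub> y) = c \<odot>\<^bsub>PA\<^esub> x \<oplus>\<^bsub>PA\<^esub> c \<odot>\<^bsub>PA\<^esub> y" by (simp add: s P.r_distr)
    show "(c + d) \<odot>\<^bsub>PA\<^esub> x = c \<odot>\<^bsub>PA\<^esub> x \<oplus>\<^bsub>PA\<^esub> d \<odot>\<^bsub>PA\<^esub> x" by (simp add: s scal_add P.l_distr)
    show "(c * d) \<odot>\<^bsub>PA\<^esub> x = c \<odot>\<^bsub>PA\<^esub> (d \<odot>\<^bsub>PA\<^esub> x)" by (simp add: s scal_mult P.m_assoc)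
    show "1 \<odot>\<^bsub>PA\<^esub> x = x" by (simp add: s scal_one)
    show "c \<odot>\<^bsub>PA\<^esub> x \<otimes>\<^bsub>PA\<^esub> y = c \<odot>\<^bsub>PA\<^esub> (x \<otimes>\<^bsub>PA\<^esub> y)" by (simp add: s P.m_assoc)
    have "x \<otimes>\<^bsub>PA\<^esub> (scal c \<otimes>\<^bsub>PA\<^esub> y) = (x \<otimes>\<^bsub>PA\<^esub> scal c) \<otimes>\<^bsub>PA\<^esub> y" by (simp add: P.m_assoc)
    also have "\<dots> = scal c \<otimes>\<^bsub>PA\<^esub> x \<otimes>\<^bsub>PA\<^esub> y" by (simp add: scal_mult_right scal_mult_left)
    finally show "x \<otimes>\<^bsub>PA\<^esub> (c \<odot>\<^bsub>PA\<^esub> y) = c \<odot>\<^bsub>PA\<^esub> (x \<otimes>\<^bsub>PA\<^esub> y)" by (simp add: s P.m_assoc)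
  qed
qed

sublocale P: kalg PA by (rule kalg_PA)

lemma PA_finsum:
  assumes "\<And>i. i \<in> X \<Longrightarrow> f i \<in> carrier PA"
  shows "finsum PA f X m = (\<Oplus>i\<in>X. f i m)"
proof -
  have "(\<lambda>f. f m) \<in> carrier PA \<rightarrow> carrier A" using PA_closed by blast
  from additive_finsum[OF P.is_abelian_group is_abelian_group this _ assms]
  show ?thesis by (simp add: PA_add)
qed

lemma const_smult: 
  assumes "f \<in> carrier PA" shows "([:c:] \<odot>\<^bsub>PA\<^esub> f) m = c \<odot> f m"
proof -
  have "([:c:] \<odot>\<^bsub>PA\<^esub> f) m = Polynomial.coeff [:c:] 0 \<odot> f (m - 0)"
    unfolding PA_smult
    by (rule finsum_single) (auto simp: PA_closed[OF assms] coeff_pCons split: nat.splits)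
  then show ?thesis by simp
qed

lemma smult_tmonom:
  assumes "a \<in> carrier A" shows "(p \<odot>\<^bsub>PA\<^esub> tmonom A a j) m = (if j \<le> m then Polynomial.coeff p (m - j) \<odot> a else \<zero>)"
proof (cases "j \<le> m")
  case True
  have "(p \<odot>\<^bsub>PA\<^esub> tmonom A a j) m = Polynomial.coeff p (m - j) \<odot> tmonom A a j (m - (m - j))"
    unfolding PA_smult
    by (rule finsum_single) (use True in \<open>auto simp: assms tmonom_eq\<close>)
  then show ?thesis using True assms by (simp add: tmonom_eq)
next
  case False
  then show ?thesis
    unfolding PA_smult using assms by (auto intro!: add.finprod_one_eqI simp: tmonom_eq)
qed

lemma tmonom_linear: "tmonom A (a \<oplus> b) m = tmonom A a m \<oplus>\<^bsub>PA\<^esub> tmonom A b m"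
    "tmonom A (c \<odot> a) m = [:c:] \<odot>\<^bsub>PA\<^esub> tmonom A a m"
  if "a \<in> carrier A" "b \<in> carrier A"
proof -
  show "tmonom A (a \<oplus> b) m = tmonom A a m \<oplus>\<^bsub>PA\<^esub> tmonom A b m"
    unfolding PA_add[OF that[THEN tmonom_closed]] by (rule ext) (simp add: that tmonom_eq)
  show "tmonom A (c \<odot> a) m = [:c:] \<odot>\<^bsub>PA\<^esub> tmonom A a m"
    by (rule ext, subst const_smult[OF tmonom_closed[OF that(1)]]) (simp add: that tmonom_eq)
qed

lemma smult_monom_tmonom: "a \<in> carrier A \<Longrightarrow> Polynomial.monom c l \<odot>\<^bsub>PA\<^esub> tmonom A a j = tmonom A (c \<odot> a) (j + l)"
  by (rule ext, subst smult_tmonom) (auto simp: tmonom_eq)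

text \<open>Polynomials are finite sums of monomials, so additive statements over A[t] reduce to the
  elements a t^m.\<close>

lemma PA_induct [consumes 1, case_names zero monom add]:
  assumes f: "f \<in> carrier PA" and "P \<zero>\<^bsub>PA\<^esub>"
    and monom: "\<And>a m. a \<in> carrier A \<Longrightarrow> P (tmonom A a m)"
    and add: "\<And>f h. f \<in> carrier PA \<Longrightarrow> h \<in> carrier PA \<Longrightarrow> P f \<Longrightarrow> P h \<Longrightarrow> P (f \<oplus>\<^bsub>PA\<^esub> h)"
  shows "P f"
proof -
  \<comment> \<open>Truncation below degree \<open>n\<close>. The bound is strict so that
    \<open>n = 0\<close> gives the zero polynomial; truncating at \<open>Suc n\<close> gives back an
    \<open>f\<close> that vanishes beyond \<open>n\<close>.\<close>
  let ?r = "\<lambda>n m. if m < n then f m else \<zero>"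
  have r: "?r n \<in> carrier PA" for n
    by (rule PA_carrierI[of _ n]) (simp_all add: PA_closed[OF f])
  have "P (?r n)" for n
  proof (induction n)
    case (Suc n)
    have "?r (Suc n) = tmonom A (f n) n \<oplus>\<^bsub>PA\<^esub> ?r n"
      unfolding PA_add[OF tmonom_closed[OF PA_closed[OF f]] r]
      unfolding tmonom_eq[OF PA_closed[OF f]]
      by (rule ext) (auto simp: PA_closed[OF f] less_Suc_eq)
    then show ?case by (simp only: add[OF tmonom_closed[OF PA_closed[OF f]] r monom[OF PA_closed[OF f]] Suc])
  qed (use assms(2) in \<open>simp add: PA_simps\<close>)
  note r_all = this
  obtain n where n: "\<forall>m>n. f m = \<zero>" using PA_bound[OF f] by blast
  have "?r (Suc n) = f" by (rule ext) (use n in simp)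
  with r_all[of "Suc n"] show ?thesis by (simp only:)
qed

lemma is_basis_PA:
  assumes I: "finite I" and "is_basis A I b"
  shows "is_basis PA I (\<lambda>i. tmonom A (b i) 0)"
proof -
  interpret B: fbasis A I b by unfold_locales (fact assms)+
  have lc: "(\<Oplus>\<^bsub>PA\<^esub>i\<in>I. c i \<odot>\<^bsub>PA\<^esub> tmonom A (b i) 0) m = (\<Oplus>i\<in>I. Polynomial.coeff (c i) m \<odot> b i)" for c m
    by (subst PA_finsum) (auto intro!: finsum_cong_all simp: smult_tmonom)
  show ?thesis
  proof (rule is_basisI[OF kalg_PA I])
    fix f assume f: "f \<in> carrier PA"
    obtain n where n: "\<forall>m>n. f m = \<zero>" using PA_bound[OF f] by blast
    \<comment> \<open>The coordinate polynomial at \<open>i\<close> collects the \<open>i\<close>-th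
      coordinates of all coefficients of \<open>f\<close>; the sum may stop at \<open>n\<close>
      because later coefficients are zero.\<close>
    let ?c = "\<lambda>i. \<Sum>m\<le>n. Polynomial.monom (B.crd (f m) i) m"
    have "Polynomial.coeff (?c i) m = B.crd (f m) i" for i m
      using n by (simp add: coeff_sum sum.delta' not_le)
    then have "(\<Oplus>\<^bsub>PA\<^esub>i\<in>I. ?c i \<odot>\<^bsub>PA\<^esub> tmonom A (b i) 0) = f"
      by (intro ext) (simp add: lc B.crd_expand PA_closed[OF f])
    from this[symmetric] show "\<exists>c. f = (\<Oplus>\<^bsub>PA\<^esub>i\<in>I. c i \<odot>\<^bsub>PA\<^esub> tmonom A (b i) 0)" by (rule exI[of _ ?c])
  next
    fix c i assume c: "(\<Oplus>\<^bsub>PA\<^esub>i\<in>I. c i \<odot>\<^bsub>PA\<^esub> tmonom A (b i) 0) = \<zero>\<^bsub>PA\<^esub>" and i: "i \<in> I"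
    have "Polynomial.coeff (c i) m = 0" for m
      using fun_cong[OF c, of m] B.crd_lc[OF i, of "\<lambda>i. Polynomial.coeff (c i) m"] by (simp add: lc PA_simps)
    then show "c i = 0" by (simp add: poly_eq_iff)
  qed simp
qed

end

section \<open>Deformed products\<close>

text \<open>Bilinearity and finiteness without associativity: for a given deformation this is the
  ground on which the algebra is built, and for the transported product it is where associativity is
  yet to be shown.\<close>

locale kbil = kpoly A for A :: "('k::field, 'a) module" (structure) +
  fixes \<mu> :: "nat \<Rightarrow> 'a \<Rightarrow> 'a \<Rightarrow> 'a"
  assumes bil: "bilinear_op A (\<mu> i)"
    and fin: "a \<in> carrier A \<Longrightarrow> b \<in> carrier A \<Longrightarrow> finite {i. \<mu> i a b \<noteq> \<zero>}"
begin

abbreviation "st \<equiv> star A \<mu>"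

lemma mu_closed [simp]: "a \<in> carrier A \<Longrightarrow> b \<in> carrier A \<Longrightarrow> \<mu> i a b \<in> carrier A"
  and mu_add_left: "a \<in> carrier A \<Longrightarrow> a' \<in> carrier A \<Longrightarrow> b \<in> carrier A \<Longrightarrow> \<mu> i (a \<oplus> a') b = \<mu> i a b \<oplus> \<mu> i a' b"
  and mu_add_right: "a \<in> carrier A \<Longrightarrow> b \<in> carrier A \<Longrightarrow> b' \<in> carrier A \<Longrightarrow> \<mu> i a (b \<oplus> b') = \<mu> i a b \<oplus> \<mu> i a b'"
  and mu_smult_left: "a \<in> carrier A \<Longrightarrow> b \<in> carrier A \<Longrightarrow> \<mu> i (c \<odot> a) b = c \<odot> \<mu> i a b"
  and mu_smult_right: "a \<in> carrier A \<Longrightarrow> b \<in> carrier A \<Longrightarrow> \<mu> i a (c \<odot> b) = c \<odot> \<mu> i a b"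
  using bil[of i] unfolding bilinear_op_def by simp_all

lemma mu_zero [simp]: "a \<in> carrier A \<Longrightarrow> \<mu> i a \<zero> = \<zero>" "a \<in> carrier A \<Longrightarrow> \<mu> i \<zero> a = \<zero>"
  using mu_smult_left[of \<zero> a i 0] mu_smult_right[of a \<zero> i 0] by simp_all

text \<open>Stated for a single coefficient, because \<open>PA_add\<close> needs its arguments in
  the carrier and the closure of \<open>st\<close> is only deduced from this lemma.\<close>

lemma st_add_left:
  assumes "f \<in> carrier PA" "f' \<in> carrier PA" "g \<in> carrier PA"
  shows "st (f \<oplus>\<^bsub>PA\<^esub> f') g m = st f g m \<oplus> st f' g m"
proof -
  note c = assms[THEN PA_closed]
  have "st (f \<oplus>\<^bsub>PA\<^esub> f') g m = (\<Oplus>i\<in>{..m}. (\<Oplus>j\<in>{..m-i}. \<mu> i (f j) (g (m - i - j))) \<oplus> (\<Oplus>j\<in>{..m-i}. \<mu> i (f' j) (g (m - i - j))))"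
    unfolding star_def PA_add[OF assms(1,2)]
  proof (rule finsum_cong_all)
    fix i
    have "(\<Oplus>j\<in>{..m-i}. \<mu> i (f j \<oplus> f' j) (g (m - i - j))) = (\<Oplus>j\<in>{..m-i}. \<mu> i (f j) (g (m - i - j)) \<oplus> \<mu> i (f' j) (g (m - i - j)))"
      by (rule finsum_cong_all) (simp_all add: c mu_add_left)
    also have "\<dots> = (\<Oplus>j\<in>{..m-i}. \<mu> i (f j) (g (m - i - j))) \<oplus> (\<Oplus>j\<in>{..m-i}. \<mu> i (f' j) (g (m - i - j)))"
      by (rule finsum_addf) (simp_all add: c Pi_def)
    finally show "(\<Oplus>j\<in>{..m-i}. \<mu> i (f j \<oplus> f' j) (g (m - i - j))) = (\<Oplus>j\<in>{..m-i}. \<mu> i (f j) (g (m - i - j))) \<oplus> (\<Oplus>j\<in>{..m-i}. \<mu> i (f' j) (g (m - i - j)))" .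
  qed (simp add: c finsum_in)
  also have "\<dots> = st f g m \<oplus> st f' g m"
    unfolding star_def by (rule finsum_addf) (simp_all add: c Pi_def finsum_in)
  finally show ?thesis .
qed

lemma st_add_right:
  assumes "f \<in> carrier PA" "f' \<in> carrier PA" "g \<in> carrier PA"
  shows "st g (f \<oplus>\<^bsub>PA\<^esub> f') m = st g f m \<oplus> st g f' m"
proof -
  note c = assms[THEN PA_closed]
  have "st g (f \<oplus>\<^bsub>PA\<^esub> f') m = (\<Oplus>i\<in>{..m}. (\<Oplus>j\<in>{..m-i}. \<mu> i (g j) (f (m - i - j))) \<oplus> (\<Oplus>j\<in>{..m-i}. \<mu> i (g j) (f' (m - i - j))))"
    unfolding star_def PA_add[OF assms(1,2)]
  proof (rule finsum_cong_all)
    fix i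
    have "(\<Oplus>j\<in>{..m-i}. \<mu> i (g j) (f (m - i - j) \<oplus> f' (m - i - j))) = (\<Oplus>j\<in>{..m-i}. \<mu> i (g j) (f (m - i - j)) \<oplus> \<mu> i (g j) (f' (m - i - j)))"
      by (rule finsum_cong_all) (simp_all add: c mu_add_right)
    also have "\<dots> = (\<Oplus>j\<in>{..m-i}. \<mu> i (g j) (f (m - i - j))) \<oplus> (\<Oplus>j\<in>{..m-i}. \<mu> i (g j) (f' (m - i - j)))"
      by (rule finsum_addf) (simp_all add: c Pi_def)
    finally show "(\<Oplus>j\<in>{..m-i}. \<mu> i (g j) (f (m - i - j) \<oplus> f' (m - i - j))) = (\<Oplus>j\<in>{..m-i}. \<mu> i (g j) (f (m - i - j))) \<oplus> (\<Oplus>j\<in>{..m-i}. \<mu> i (g j) (f' (m - i - j)))" .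
  qed (simp add: c finsum_in)
  also have "\<dots> = st g f m \<oplus> st g f' m"
    unfolding star_def by (rule finsum_addf) (simp_all add: c Pi_def finsum_in)
  finally show ?thesis .
qed

text \<open>Since t is central, the product of a t^j and b t^k is the sum over i of
  \<open>\<mu> i a b\<close> times t^(i+j+k); the coefficient at t^m selects i = m - j - k.\<close>

lemma st_tmonom:
  assumes a: "a \<in> carrier A" and b: "b \<in> carrier A"
  shows "st (tmonom A a j) (tmonom A b k) = (\<lambda>m. if j + k \<le> m then \<mu> (m - j - k) a b else \<zero>)"
proof
  fix m
  note [simp] = tmonom_eq[OF a] tmonom_eq[OF b]
  have t: "\<mu> i (tmonom A a j j') (tmonom A b k k') = (if j' = j \<and> k' = k then \<mu> i a b else \<zero>)" for i j' k'
    using a b by auto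
  show "st (tmonom A a j) (tmonom A b k) m = (if j + k \<le> m then \<mu> (m - j - k) a b else \<zero>)"
  proof (cases "j + k \<le> m")
    case True
    have "st (tmonom A a j) (tmonom A b k) m =
      (\<Oplus>j'\<in>{..m - (m - j - k)}. \<mu> (m - j - k) (tmonom A a j j') (tmonom A b k (m - (m - j - k) - j')))"
      unfolding star_def t
    proof (rule finsum_single)
      fix i assume "i \<in> {..m}" "i \<noteq> m - j - k"
      then show "(\<Oplus>j'\<in>{..m - i}. if j' = j \<and> m - i - j' = k then \<mu> i a b else \<zero>) = \<zero>"
        by (intro add.finprod_one_eqI) auto
    qed (use a b in \<open>auto intro!: finsum_in\<close>)
    also have "\<dots> = \<mu> (m - j - k) (tmonom A a j j) (tmonom A b k (m - (m - j - k) - j))"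
      unfolding t by (rule finsum_single) (use True a b in auto)
    finally show ?thesis using True by simp
  next
    case False
    then show ?thesis
      unfolding star_def t using a b by (auto intro!: add.finprod_one_eqI)
  qed
qed

lemma st_tmonom_closed:
  assumes a: "a \<in> carrier A" and b: "b \<in> carrier A"
  shows "st (tmonom A a j) (tmonom A b k) \<in> carrier PA"
proof -
  obtain n where "\<forall>i\<in>{i. \<mu> i a b \<noteq> \<zero>}. i \<le> n" using fin[OF a b] finite_nat_set_iff_bounded_le by blast
  then have n: "\<mu> i a b = \<zero>" if "i > n" for i using that by fastforce
  show ?thesis
    unfolding st_tmonom[OF a b] by (rule PA_carrierI[of _ "n + j + k"]) (use a b in \<open>auto simp: n\<close>)
qed

lemma st_zero: "f \<in> carrier PA \<Longrightarrow> st \<zero>\<^bsub>PA\<^esub> f = \<zero>\<^bsub>PA\<^esub>" "f \<in> carrier PA \<Longrightarrow> st f \<zero>\<^bsub>PA\<^esub> = \<zero>\<^bsub>PA\<^esub>"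
  unfolding star_def PA_simps(3) by (auto intro!: ext add.finprod_one_eqI simp: PA_closed)

text \<open>Finiteness of the family \<open>\<mu> i a b\<close> is assumed for each pair a, b only
  and without a uniform bound. It bounds the degree of a product of monomials, and additivity in
  both factors extends this to all polynomials.\<close>

lemma st_closed [simp]:
  assumes f: "f \<in> carrier PA" and g: "g \<in> carrier PA"
  shows "st f g \<in> carrier PA"
  using f
proof (induction f rule: PA_induct)
  case (monom a j)
  show ?case using g
  proof (induction g rule: PA_induct)
    case (add f h)
    have "st (tmonom A a j) (f \<oplus>\<^bsub>PA\<^esub> h) = st (tmonom A a j) f \<oplus>\<^bsub>PA\<^esub> st (tmonom A a j) h"
      unfolding PA_add[OF add(3,4)] using monom add by (intro ext st_add_right) auto
    then show ?case using add by simp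
  qed (use monom in \<open>simp_all add: st_tmonom_closed st_zero\<close>)
next
  case (add f h)
  have "st (f \<oplus>\<^bsub>PA\<^esub> h) g = st f g \<oplus>\<^bsub>PA\<^esub> st h g"
    unfolding PA_add[OF add(3,4)] using add g by (intro ext st_add_left) auto
  then show ?case using add by simp
qed (use g in \<open>simp add: st_zero\<close>)

lemma st_l_distr:
  "f \<in> carrier PA \<Longrightarrow> f' \<in> carrier PA \<Longrightarrow> g \<in> carrier PA \<Longrightarrow> st (f \<oplus>\<^bsub>PA\<^esub> f') g = st f g \<oplus>\<^bsub>PA\<^esub> st f' g"
  by (subst PA_add[of "st f g"]) (auto intro!: ext st_add_left)

lemma st_r_distr:
  "f \<in> carrier PA \<Longrightarrow> f' \<in> carrier PA \<Longrightarrow> g \<in> carrier PA \<Longrightarrow> st g (f \<oplus>\<^bsub>PA\<^esub> f') = st g f \<oplus>\<^bsub>PA\<^esub> st g f'"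
  by (subst PA_add[of "st g f"]) (auto intro!: ext st_add_right)

lemma smult_monom_shift:
  assumes f: "f \<in> carrier PA"
  shows "(Polynomial.monom c l \<odot>\<^bsub>PA\<^esub> f) m = (if l \<le> m then c \<odot> f (m - l) else \<zero>)"
proof (cases "l \<le> m")
  case True
  have "(Polynomial.monom c l \<odot>\<^bsub>PA\<^esub> f) m = Polynomial.coeff (Polynomial.monom c l) l \<odot> f (m - l)"
    unfolding PA_smult by (rule finsum_single) (use True in \<open>auto simp: PA_closed[OF f]\<close>)
  then show ?thesis using True by simp
next
  case False
  then show ?thesis unfolding PA_smult by (auto intro!: add.finprod_one_eqI simp: PA_closed[OF f])
qed

text \<open>Reduces K[t]-linearity of the deformed product to scalars c t^l, which merely shift
  coefficients.\<close>

lemma poly_monom_induct: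
  fixes p :: "'k poly"
  assumes "\<And>c l. Q (Polynomial.monom c l)" "\<And>p r. Q p \<Longrightarrow> Q r \<Longrightarrow> Q (p + r)"
  shows "Q p"
proof -
  have "Q (\<Sum>i\<le>n. Polynomial.monom (Polynomial.coeff p i) i)" for n
    by (induction n) (auto intro: assms)
  from this[of "degree p"] show ?thesis by (simp add: poly_as_sum_of_monoms)
qed

lemma st_smult_monom:
  assumes f: "f \<in> carrier PA" and g: "g \<in> carrier PA"
  shows "st (Polynomial.monom c l \<odot>\<^bsub>PA\<^esub> f) g = Polynomial.monom c l \<odot>\<^bsub>PA\<^esub> st f g"
    and "st f (Polynomial.monom c l \<odot>\<^bsub>PA\<^esub> g) = Polynomial.monom c l \<odot>\<^bsub>PA\<^esub> st f g"
proof -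
  let ?p = "Polynomial.monom c l"
  have 1: "st (?p \<odot>\<^bsub>PA\<^esub> tmonom A a j) (tmonom A b k) = ?p \<odot>\<^bsub>PA\<^esub> st (tmonom A a j) (tmonom A b k)"
    "st (tmonom A a j) (?p \<odot>\<^bsub>PA\<^esub> tmonom A b k) = ?p \<odot>\<^bsub>PA\<^esub> st (tmonom A a j) (tmonom A b k)"
    if a: "a \<in> carrier A" and b: "b \<in> carrier A" for a b j k
    using a b
    by (auto simp: fun_eq_iff smult_monom_tmonom smult_monom_shift st_tmonom_closed)
      (auto simp: st_tmonom mu_smult_left mu_smult_right algebra_simps)
  have 2: "st (?p \<odot>\<^bsub>PA\<^esub> tmonom A a j) g = ?p \<odot>\<^bsub>PA\<^esub> st (tmonom A a j) g \<and>
    st (tmonom A a j) (?p \<odot>\<^bsub>PA\<^esub> g) = ?p \<odot>\<^bsub>PA\<^esub> st (tmonom A a j) g" if a: "a \<in> carrier A" for a j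
    using g by (induction g rule: PA_induct) (use a 1 in \<open>simp_all add: st_zero st_r_distr P.smult_add_right\<close>)
  have 3: "st (?p \<odot>\<^bsub>PA\<^esub> f) g = ?p \<odot>\<^bsub>PA\<^esub> st f g \<and> st f (?p \<odot>\<^bsub>PA\<^esub> g) = ?p \<odot>\<^bsub>PA\<^esub> st f g"
    using f by (induction f rule: PA_induct) (use g 2 in \<open>simp_all add: st_zero st_l_distr P.smult_add_right\<close>)
  show "st (?p \<odot>\<^bsub>PA\<^esub> f) g = ?p \<odot>\<^bsub>PA\<^esub> st f g" "st f (?p \<odot>\<^bsub>PA\<^esub> g) = ?p \<odot>\<^bsub>PA\<^esub> st f g"
    using 3 by simp_all
qed

lemma st_smult:
  assumes f: "f \<in> carrier PA" and g: "g \<in> carrier PA"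
  shows "st (p \<odot>\<^bsub>PA\<^esub> f) g = p \<odot>\<^bsub>PA\<^esub> st f g" "st f (p \<odot>\<^bsub>PA\<^esub> g) = p \<odot>\<^bsub>PA\<^esub> st f g"
  by (induction p rule: poly_monom_induct; simp add: f g st_smult_monom P.smult_add_left st_l_distr st_r_distr)+

abbreviation "B \<equiv> deform_algebra A \<mu>"

lemma B_simps:
  "carrier B = carrier PA" "\<zero>\<^bsub>B\<^esub> = \<zero>\<^bsub>PA\<^esub>" "\<one>\<^bsub>B\<^esub> = \<one>\<^bsub>PA\<^esub>" "add B = add PA" "module.smult B = module.smult PA"
  "monoid.mult B = st"
  by (simp_all add: deform_algebra_def)

text \<open>The unit laws are premises because \<open>is_deformation\<close> demands only
  associativity; for a graded deformation they are derived from the degrees.\<close>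

lemma kalg_B:
  assumes "\<And>f g h. f \<in> carrier PA \<Longrightarrow> g \<in> carrier PA \<Longrightarrow> h \<in> carrier PA \<Longrightarrow> st (st f g) h = st f (st g h)"
    and "\<And>f. f \<in> carrier PA \<Longrightarrow> st \<one>\<^bsub>PA\<^esub> f = f" "\<And>f. f \<in> carrier PA \<Longrightarrow> st f \<one>\<^bsub>PA\<^esub> = f"
  shows "kalg B"
proof -
  have "abelian_group B"
  proof (rule abelian_groupI)
    fix x assume "x \<in> carrier B"
    then show "\<exists>y\<in>carrier B. y \<oplus>\<^bsub>B\<^esub> x = \<zero>\<^bsub>B\<^esub>"
      unfolding B_simps using P.a_inv_closed P.l_neg by blast
  qed (simp_all add: B_simps P.a_ac)
  then have "ring B"
    by (intro ringI monoidI) (simp_all add: B_simps assms st_l_distr st_r_distr)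
  then show ?thesis
    by (intro kalg.intro kalg_axioms.intro)
      (simp_all add: B_simps st_smult P.smult_add_left P.smult_add_right P.smult_assoc)
qed

lemma B_is_basis: "is_basis PA I b \<longleftrightarrow> is_basis B I b"
  by (simp add: is_basis_def B_simps finsum_def)

end

section \<open>Sorting words\<close>

lemma sorted_not_distinct_adjacent:
  "sorted w \<Longrightarrow> \<not> distinct w \<Longrightarrow> \<exists>a i b. w = a @ i # i # b"
proof (induction w)
  case (Cons x w)
  show ?case
  proof (cases "distinct w")
    case True
    then have "x \<in> set w" using Cons by auto
    then obtain y w' where w: "w = y # w'" by (cases w) auto
    then have "x = y" using Cons.prems(1) \<open>x \<in> set w\<close> by auto
    then have "x # w = [] @ y # y # w'" using w by simp
    then show ?thesis by blast
  next
    case False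
    then obtain a i b where "w = a @ i # i # b" using Cons by auto
    then have "x # w = (x # a) @ i # i # b" by simp
    then show ?thesis by blast
  qed
qed simp

text \<open>The shape of every straightening argument: a word is reached from its sorted
  rearrangement by undoing swaps of neighbours, and a sorted word is either strictly increasing,
  hence a PBW monomial, or has two equal neighbours.\<close>

lemma sort_induct [consumes 1, case_names sorted adjacent swap]:
  fixes w :: "'a::linorder list"
  assumes "set w \<subseteq> X"
    and sorted: "\<And>w. set w \<subseteq> X \<Longrightarrow> sorted w \<Longrightarrow> distinct w \<Longrightarrow> P w"
    and dup: "\<And>a i b. set (a @ i # i # b) \<subseteq> X \<Longrightarrow> P (a @ i # i # b)"
    and swap: "\<And>a i j b. set (a @ i # j # b) \<subseteq> X \<Longrightarrow> i < j \<Longrightarrow> P (a @ i # j # b) \<Longrightarrow> P (a @ j # i # b)"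
  shows "P w"
proof -
  \<comment> \<open>Undoes one insertion: the letter \<open>j\<close> travels from its sorted place
    back to the front, past the smaller letters one at a time. The prefix \<open>a\<close> is
    arbitrary because it grows along the way.\<close>
  have insort: "P (a @ insort j w) \<Longrightarrow> set (a @ j # w) \<subseteq> X \<Longrightarrow> P (a @ j # w)" for a j w
  proof (induction w arbitrary: a)
    case (Cons i w)
    show ?case
    proof (cases "j \<le> i")
      case False
      then have "P ((a @ [i]) @ j # w)" using Cons.prems by (intro Cons.IH) auto
      then show ?thesis using swap[of a i j w] False Cons.prems by auto
    qed (use Cons.prems in simp)
  qed simp
  have "set (a @ w) \<subseteq> X \<Longrightarrow> P (a @ sort w) \<Longrightarrow> P (a @ w)" for a
  proof (induction w arbitrary: a)
    case (Cons j w)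
    have "P (a @ j # sort w)" using Cons.prems by (intro insort) auto
    then show ?case using Cons.IH[of "a @ [j]"] Cons.prems by simp
  qed simp
  from this[of "[]"] have "P (sort w) \<Longrightarrow> P w" using assms(1) by simp
  moreover have "P (sort w)"
  proof (cases "distinct (sort w)")
    case True
    then show ?thesis using assms(1) by (intro sorted) auto
  next
    case False
    then obtain a i b where "sort w = a @ i # i # b" using sorted_not_distinct_adjacent sorted_sort by blast
    moreover have "set (sort w) \<subseteq> X" using assms(1) by simp
    ultimately show ?thesis using dup by metis
  qed
  ultimately show ?thesis by blast
qed

definition wd :: "nat \<Rightarrow> (nat \<Rightarrow> nat) \<Rightarrow> nat list" where
  "wd n \<alpha> = filter (\<lambda>i. \<alpha> i = 1) [1..<Suc n]"

text \<open>The exponent vector of a set of letters. It is restricted to \<open>{1..n}\<close>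
  because PBW exponents are extensional functions, and only then does a square-free word determine
  its exponent vector.\<close>

definition idx :: "nat \<Rightarrow> nat set \<Rightarrow> nat \<Rightarrow> nat" where
  "idx n X = (\<lambda>i\<in>{1..n}. if i \<in> X then 1 else 0)"

definition expo :: "nat \<Rightarrow> (nat \<Rightarrow> nat) set" where
  "expo n = {1..n} \<rightarrow>\<^sub>E {0, 1}"

lemma finite_expo [simp]: "finite (expo n)"
  unfolding expo_def by (rule finite_PiE) auto

lemma wd_sorted: "sorted (wd n \<alpha>)" "distinct (wd n \<alpha>)" "set (wd n \<alpha>) \<subseteq> {1..n}"
  by (auto simp: wd_def sorted_wrt_filter simp del: upt_Suc)

lemma idx_expo: "idx n X \<in> expo n"
  by (auto simp: idx_def expo_def)

lemma set_wd_idx: "X \<subseteq> {1..n} \<Longrightarrow> set (wd n (idx n X)) = X"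
  by (auto simp: wd_def idx_def)

lemma wd_idx: "set w \<subseteq> {1..n} \<Longrightarrow> sorted w \<Longrightarrow> distinct w \<Longrightarrow> wd n (idx n (set w)) = w"
  by (rule sorted_distinct_set_unique) (simp_all add: wd_sorted set_wd_idx)

lemma wd_inj: "\<alpha> \<in> expo n \<Longrightarrow> \<beta> \<in> expo n \<Longrightarrow> wd n \<alpha> = wd n \<beta> \<Longrightarrow> \<alpha> = \<beta>"
  unfolding expo_def
proof (rule PiE_ext)
  fix i assume *: "\<alpha> \<in> {1..n} \<rightarrow>\<^sub>E {0, 1}" "\<beta> \<in> {1..n} \<rightarrow>\<^sub>E {0, 1}" "wd n \<alpha> = wd n \<beta>" "i \<in> {1..n}"
  then have "i \<in> set (wd n \<alpha>) \<longleftrightarrow> i \<in> set (wd n \<beta>)" by simp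
  then have "\<alpha> i = 1 \<longleftrightarrow> \<beta> i = 1" using *(4) by (auto simp: wd_def)
  moreover have "\<alpha> i \<in> {0, 1}" "\<beta> i \<in> {0, 1}" using * PiE_mem by metis+
  ultimately show "\<alpha> i = \<beta> i" by auto
qed auto

section \<open>The tensor algebra\<close>

lemma tensor_simps:
  "carrier (tensor_algebra n) = {f. finite {w. f w \<noteq> 0} \<and> (\<forall>w. f w \<noteq> 0 \<longrightarrow> set w \<subseteq> {1..n})}"
  "\<one>\<^bsub>tensor_algebra n\<^esub> = (\<lambda>w. if w = [] then 1 else 0)"
  "\<zero>\<^bsub>tensor_algebra n\<^esub> = (\<lambda>w. 0)"
  "f \<oplus>\<^bsub>tensor_algebra n\<^esub> h = (\<lambda>w. f w + h w)"
  "c \<odot>\<^bsub>tensor_algebra n\<^esub> f = (\<lambda>w. c * f w)"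
  "f \<otimes>\<^bsub>tensor_algebra n\<^esub> h = (\<lambda>w. \<Sum>i\<le>length w. f (take i w) * h (drop i w))"
  by (simp_all add: tensor_algebra_def)

lemma tensor_mult_nonzero:
  assumes "(f \<otimes>\<^bsub>tensor_algebra n\<^esub> h) w \<noteq> 0"
  obtains u u' where "w = u @ u'" "f u \<noteq> 0" "h u' \<noteq> 0"
proof -
  obtain i where "f (take i w) * h (drop i w) \<noteq> 0"
    using assms unfolding tensor_simps by (metis (mono_tags, lifting) sum.neutral)
  then show ?thesis by (intro that[of "take i w" "drop i w"]) auto
qed

lemma tensor_mult_closed:
  assumes "f \<in> carrier (tensor_algebra n)" "h \<in> carrier (tensor_algebra n)"
  shows "f \<otimes>\<^bsub>tensor_algebra n\<^esub> h \<in> carrier (tensor_algebra n)"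
proof -
  let ?m = "f \<otimes>\<^bsub>tensor_algebra n\<^esub> h"
  have "{w. ?m w \<noteq> 0} \<subseteq> (\<lambda>(u, u'). u @ u') ` ({w. f w \<noteq> 0} \<times> {w. h w \<noteq> 0})"
    by (auto elim!: tensor_mult_nonzero)
  then have "finite {w. ?m w \<noteq> 0}"
    using assms by (elim finite_subset) (simp add: tensor_simps(1))
  moreover have "set w \<subseteq> {1..n}" if "?m w \<noteq> 0" for w
    using that assms by (elim tensor_mult_nonzero) (auto simp: tensor_simps(1) simp del: atLeastAtMost_iff)
  ultimately show ?thesis by (simp only: tensor_simps(1)) blast
qed

text \<open>Pairs j \<le> i are reindexed by j and the difference i - j.\<close>

lemma sum_triangle:
  fixes F :: "nat \<Rightarrow> nat \<Rightarrow> 'a::comm_monoid_add"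
  shows "(\<Sum>i\<le>N. \<Sum>j\<le>i. F j i) = (\<Sum>j\<le>N. \<Sum>i\<le>N - j. F j (j + i))"
proof -
  have "(\<Sum>i\<le>N. \<Sum>j\<le>i. F j i) = (\<Sum>(i, j)\<in>(SIGMA i:{..N}. {..i}). F j i)"
    by (rule sum.Sigma) auto
  also have "\<dots> = (\<Sum>(j, i)\<in>(SIGMA j:{..N}. {..N - j}). F j (j + i))"
    by (rule sum.reindex_bij_witness[of _ "\<lambda>(j, i). (j + i, j)" "\<lambda>(i, j). (j, i - j)"]) auto
  also have "\<dots> = (\<Sum>j\<le>N. \<Sum>i\<le>N - j. F j (j + i))"
    by (rule sum.Sigma[symmetric]) auto
  finally show ?thesis .
qed

text \<open>Both sides sum over the ways of cutting \<open>w\<close> into three pieces; one side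
  chooses the later cut first, the other the earlier cut.\<close>

lemma tensor_assoc:
  "(f \<otimes>\<^bsub>tensor_algebra n\<^esub> h) \<otimes>\<^bsub>tensor_algebra n\<^esub> k = f \<otimes>\<^bsub>tensor_algebra n\<^esub> (h \<otimes>\<^bsub>tensor_algebra n\<^esub> k)"
proof
  fix w
  have "((f \<otimes>\<^bsub>tensor_algebra n\<^esub> h) \<otimes>\<^bsub>tensor_algebra n\<^esub> k) w =
    (\<Sum>i\<le>length w. \<Sum>j\<le>i. f (take j w) * h (drop j (take i w)) * k (drop i w))"
    unfolding tensor_simps
    by (intro sum.cong refl) (simp add: sum_distrib_right min_def)
  also have "\<dots> = (\<Sum>j\<le>length w. \<Sum>i\<le>length w - j. f (take j w) * h (drop j (take (j + i) w)) * k (drop (j + i) w))"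
    by (rule sum_triangle)
  also have "\<dots> = (f \<otimes>\<^bsub>tensor_algebra n\<^esub> (h \<otimes>\<^bsub>tensor_algebra n\<^esub> k)) w"
    unfolding tensor_simps
    by (intro sum.cong refl) (simp add: sum_distrib_left mult.assoc drop_take add.commute)
  finally show "((f \<otimes>\<^bsub>tensor_algebra n\<^esub> h) \<otimes>\<^bsub>tensor_algebra n\<^esub> k) w = (f \<otimes>\<^bsub>tensor_algebra n\<^esub> (h \<otimes>\<^bsub>tensor_algebra n\<^esub> k)) w" .
qed

lemma tensor_one_mult:
  "\<one>\<^bsub>tensor_algebra n\<^esub> \<otimes>\<^bsub>tensor_algebra n\<^esub> f = f" "f \<otimes>\<^bsub>tensor_algebra n\<^esub> \<one>\<^bsub>tensor_algebra n\<^esub> = f"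
proof -
  have "(\<Sum>i\<le>length w. (if take i w = [] then 1 else 0) * f (drop i w)) = (\<Sum>i\<le>length w. if i = 0 then f w else 0)" for w
    by (intro sum.cong refl) auto
  then show "\<one>\<^bsub>tensor_algebra n\<^esub> \<otimes>\<^bsub>tensor_algebra n\<^esub> f = f"
    unfolding tensor_simps by (intro ext) simp
  have "(\<Sum>i\<le>length w. f (take i w) * (if drop i w = [] then 1 else 0)) = (\<Sum>i\<le>length w. if i = length w then f w else 0)" for w
    by (intro sum.cong refl) auto
  then show "f \<otimes>\<^bsub>tensor_algebra n\<^esub> \<one>\<^bsub>tensor_algebra n\<^esub> = f"
    unfolding tensor_simps by (intro ext) simp
qed

lemma tensor_add_closed:
  assumes "f \<in> carrier (tensor_algebra n)" "h \<in> carrier (tensor_algebra n)"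
  shows "f \<oplus>\<^bsub>tensor_algebra n\<^esub> h \<in> carrier (tensor_algebra n)"
proof -
  have "{w. f w + h w \<noteq> 0} \<subseteq> {w. f w \<noteq> 0} \<union> {w. h w \<noteq> 0}" by auto
  then have "finite {w. f w + h w \<noteq> 0}" using assms by (elim finite_subset) (simp add: tensor_simps(1))
  moreover have "set w \<subseteq> {1..n}" if "f w + h w \<noteq> 0" for w
    using that assms by (cases "f w = 0") (simp_all add: tensor_simps(1))
  ultimately show ?thesis by (simp add: tensor_simps(1,4))
qed

lemma tensor_smult_closed:
  "f \<in> carrier (tensor_algebra n) \<Longrightarrow> c \<odot>\<^bsub>tensor_algebra n\<^esub> f \<in> carrier (tensor_algebra n)"
  by (simp add: tensor_simps(1,5))

lemma kalg_tensor: "kalg (tensor_algebra n :: ('k::field, nat list \<Rightarrow> 'k) module)"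
proof -
  let ?T = "tensor_algebra n :: ('k, nat list \<Rightarrow> 'k) module"
  have "abelian_group ?T"
  proof (rule abelian_groupI)
    fix x assume x: "x \<in> carrier ?T"
    then show "\<exists>y\<in>carrier ?T. y \<oplus>\<^bsub>?T\<^esub> x = \<zero>\<^bsub>?T\<^esub>"
      by (intro bexI[of _ "(- 1) \<odot>\<^bsub>?T\<^esub> x"] tensor_smult_closed) (auto simp: tensor_simps)
  qed (simp_all only: tensor_add_closed, simp_all add: tensor_simps add_ac)
  moreover have "Group.monoid ?T"
    by (rule monoidI) (simp_all only: tensor_mult_closed tensor_assoc tensor_one_mult, simp add: tensor_simps)
  ultimately have "ring ?T"
    by (intro ringI) (simp_all add: tensor_simps sum.distrib distrib_left distrib_right)
  then show ?thesis
    by (intro kalg.intro kalg_axioms.intro)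
      (simp_all only: tensor_smult_closed, simp_all add: tensor_simps algebra_simps sum_distrib_left)
qed

section \<open>Words as a basis of the tensor algebra\<close>

definition word :: "nat list \<Rightarrow> nat list \<Rightarrow> 'k::field" where
  "word w = (\<lambda>u. if u = w then 1 else 0)"

lemma letter_word: "letter i = word [i]"
  by (simp add: letter_def word_def)

lemma word_closed: "set w \<subseteq> {1..n} \<Longrightarrow> word w \<in> carrier (tensor_algebra n)"
  by (simp add: word_def tensor_simps)

lemma word_mult: "word u \<otimes>\<^bsub>tensor_algebra n\<^esub> word w = (word (u @ w) :: nat list \<Rightarrow> 'k::field)"
proof
  fix z
  show "(word u \<otimes>\<^bsub>tensor_algebra n\<^esub> word w) z = (word (u @ w) z :: 'k)"
  proof (cases "z = u @ w")
    case True
    have "(\<Sum>i\<le>length z. word u (take i z) * word w (drop i z)) = (\<Sum>i\<le>length z. if i = length u then 1 else 0 :: 'k)"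
    proof (rule sum.cong)
      fix i assume "i \<in> {..length z}"
      then have "take i z = u \<and> drop i z = w \<longleftrightarrow> i = length u"
        unfolding True by (metis append_eq_conv_conj atMost_iff length_take min.absorb2)
      then show "word u (take i z) * word w (drop i z) = (if i = length u then 1 else 0 :: 'k)"
        by (auto simp: word_def)
    qed simp
    then show ?thesis using True by (simp add: tensor_simps word_def)
  next
    case False
    have "(\<Sum>i\<le>length z. word u (take i z) * word w (drop i z)) = (0 :: 'k)"
    proof (intro sum.neutral ballI)
      fix i
      show "word u (take i z) * word w (drop i z) = (0 :: 'k)"
        using False by (cases "take i z = u") (auto simp: word_def)
    qed
    then show ?thesis using False by (simp add: tensor_simps word_def)
  qed
qed

lemma word_Nil: "word [] = \<one>\<^bsub>tensor_algebra n\<^esub>"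
  by (simp add: word_def tensor_simps)

lemma tensor_finsum:
  "(\<And>i. i \<in> X \<Longrightarrow> f i \<in> carrier (tensor_algebra n)) \<Longrightarrow>
    finsum (tensor_algebra n) f X w = (\<Sum>i\<in>X. f i w)"
proof (induction X rule: infinite_finite_induct)
  case (insert x F)
  interpret T: kalg "tensor_algebra n" by (rule kalg_tensor)
  show ?case using insert by (subst T.finsum_insert) (auto simp: tensor_simps(4))
next
  case (infinite X)
  interpret T: kalg "tensor_algebra n" by (rule kalg_tensor)
  show ?case using infinite by (simp add: tensor_simps)
next
  case empty
  interpret T: kalg "tensor_algebra n" by (rule kalg_tensor)
  show ?case by (simp add: tensor_simps)
qed

text \<open>A tensor has finite support, so it is the finite sum of its words with their
  coefficients.\<close>

lemma tensor_induct [consumes 1, case_names zero word smult add]: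
  assumes f: "f \<in> carrier (tensor_algebra n)" and zero: "P \<zero>\<^bsub>tensor_algebra n\<^esub>"
    and word: "\<And>w. set w \<subseteq> {1..n} \<Longrightarrow> P (word w)"
    and smult: "\<And>c f. f \<in> carrier (tensor_algebra n) \<Longrightarrow> P f \<Longrightarrow> P (c \<odot>\<^bsub>tensor_algebra n\<^esub> f)"
    and add: "\<And>f h. f \<in> carrier (tensor_algebra n) \<Longrightarrow> h \<in> carrier (tensor_algebra n) \<Longrightarrow> P f \<Longrightarrow> P h \<Longrightarrow>
      P (f \<oplus>\<^bsub>tensor_algebra n\<^esub> h)"
  shows "P f"
proof -
  interpret T: kalg "tensor_algebra n" by (rule kalg_tensor)
  let ?t = "\<lambda>w. f w \<odot>\<^bsub>tensor_algebra n\<^esub> word w"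
  have "finsum (tensor_algebra n) ?t X \<in> carrier (tensor_algebra n) \<and> P (finsum (tensor_algebra n) ?t X)"
    if "finite X" "\<forall>w\<in>X. set w \<subseteq> {1..n}" for X
    using that
  proof (induction X rule: finite_induct)
    case (insert x F)
    then have "?t \<in> F \<rightarrow> carrier (tensor_algebra n)" "?t x \<in> carrier (tensor_algebra n)"
      by (auto intro!: word_closed T.smult_closed simp del: atLeastAtMost_iff One_nat_def)
    moreover have "P (?t x)" using insert.prems by (intro smult word word_closed) auto
    ultimately show ?case using insert by (simp add: add)
  qed (use zero in auto)
  moreover have "finsum (tensor_algebra n) ?t {w. f w \<noteq> 0} = f"
  proof
    fix w
    have c: "?t u \<in> carrier (tensor_algebra n)" if "u \<in> {u. f u \<noteq> 0}" for u
      using that f by (intro T.smult_closed word_closed) (simp add: tensor_simps(1))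
    have "finsum (tensor_algebra n) ?t {w. f w \<noteq> 0} w = (\<Sum>u\<in>{u. f u \<noteq> 0}. ?t u w)"
      by (rule tensor_finsum) (rule c)
    also have "\<dots> = (\<Sum>u\<in>{u. f u \<noteq> 0}. if u = w then f w else 0)"
      by (rule sum.cong) (auto simp: tensor_simps(5) word_def)
    also have "\<dots> = f w" using f by (simp add: tensor_simps)
    finally show "finsum (tensor_algebra n) ?t {w. f w \<noteq> 0} w = f w" .
  qed
  ultimately show ?thesis using f by (metis (mono_tags, lifting) mem_Collect_eq tensor_simps(1))
qed

text \<open>The homomorphism given by the universal property of the free algebra, sending
  \<open>letter i\<close> to \<open>y i\<close>. The action of a linear map on T(V) is the case
  where the target is T(V) itself.\<close>

definition tensor_eval :: "('k::field, 'b) module \<Rightarrow> (nat \<Rightarrow> 'b) \<Rightarrow> (nat list \<Rightarrow> 'k) \<Rightarrow> 'b" where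
  "tensor_eval B y f = (\<Oplus>\<^bsub>B\<^esub>w\<in>{w. f w \<noteq> 0}. f w \<odot>\<^bsub>B\<^esub> list_prod B (map y w))"

locale teval = kalg B for B :: "('k::field, 'b) module" (structure) +
  fixes n :: nat and y :: "nat \<Rightarrow> 'b"
  assumes y_closed: "i \<in> {1..n} \<Longrightarrow> y i \<in> carrier B"
begin

abbreviation T :: "('k, nat list \<Rightarrow> 'k) module" where "T \<equiv> tensor_algebra n"
abbreviation "ev \<equiv> tensor_eval B y"

lemma y_word [simp]: "set w \<subseteq> {1..n} \<Longrightarrow> list_prod B (map y w) \<in> carrier B"
  using y_closed by (intro list_prod_closed) auto

text \<open>Supports change under addition; evaluating over a common finite set of words makes
  additivity a termwise statement.\<close>

lemma ev_superset:
  assumes "f \<in> carrier T" "finite W" "{w. f w \<noteq> 0} \<subseteq> W" "\<And>w. w \<in> W \<Longrightarrow> set w \<subseteq> {1..n}"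
  shows "ev f = (\<Oplus>w\<in>W. f w \<odot> list_prod B (map y w))"
  unfolding tensor_eval_def using assms by (intro finsum_mono_neutral) auto

lemma linear_on_ev: "linear_on T B ev"
proof (rule linear_onI)
  fix f h assume f: "f \<in> carrier T" and h: "h \<in> carrier T"
  show "ev f \<in> carrier B"
    unfolding tensor_eval_def using f by (intro finsum_in) (auto simp: tensor_simps(1))
  let ?W = "{w. f w \<noteq> 0} \<union> {w. h w \<noteq> 0}"
  have W: "finite ?W" "\<And>w. w \<in> ?W \<Longrightarrow> set w \<subseteq> {1..n}"
    using f h unfolding tensor_simps(1) by blast+
  have "ev (f \<oplus>\<^bsub>T\<^esub> h) = (\<Oplus>w\<in>?W. (f w + h w) \<odot> list_prod B (map y w))"
  proof -
    have "{w. (f \<oplus>\<^bsub>T\<^esub> h) w \<noteq> 0} \<subseteq> ?W" by (auto simp: tensor_simps(4))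
    from ev_superset[OF tensor_add_closed[OF f h] W(1) this W(2)] show ?thesis
      by (simp only: tensor_simps(4))
  qed
  also have "\<dots> = (\<Oplus>w\<in>?W. f w \<odot> list_prod B (map y w) \<oplus> h w \<odot> list_prod B (map y w))"
    by (rule finsum_cong_all) (use W(2) in \<open>auto simp: smult_add_left\<close>)
  also have "\<dots> = (\<Oplus>w\<in>?W. f w \<odot> list_prod B (map y w)) \<oplus> (\<Oplus>w\<in>?W. h w \<odot> list_prod B (map y w))"
    by (rule finsum_addf) (use W(2) in auto)
  also have "\<dots> = ev f \<oplus> ev h"
    using ev_superset[OF f W(1) _ W(2)] ev_superset[OF h W(1) _ W(2)] by auto
  finally show "ev (f \<oplus>\<^bsub>T\<^esub> h) = ev f \<oplus> ev h" .
next
  fix c f assume f: "f \<in> carrier T"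
  then have W: "finite {w. f w \<noteq> 0}" "\<And>w. w \<in> {w. f w \<noteq> 0} \<Longrightarrow> set w \<subseteq> {1..n}"
    unfolding tensor_simps(1) by blast+
  have "ev (c \<odot>\<^bsub>T\<^esub> f) = (\<Oplus>w\<in>{w. f w \<noteq> 0}. (c * f w) \<odot> list_prod B (map y w))"
    using ev_superset[OF tensor_smult_closed[OF f] W(1) _ W(2)] by (auto simp: tensor_simps(5))
  also have "\<dots> = (\<Oplus>w\<in>{w. f w \<noteq> 0}. c \<odot> (f w \<odot> list_prod B (map y w)))"
    by (rule finsum_cong_all) (use W(2) in \<open>auto simp: smult_assoc\<close>)
  also have "\<dots> = c \<odot> ev f"
    unfolding tensor_eval_def by (rule finsum_smult[symmetric]) (use W(2) in auto)
  finally show "ev (c \<odot>\<^bsub>T\<^esub> f) = c \<odot> ev f" .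
qed

lemma ev_word: "set w \<subseteq> {1..n} \<Longrightarrow> ev (word w) = list_prod B (map y w)"
  using ev_superset[OF word_closed, of w "{w}"] by (simp add: word_def)

lemma ev_mult:
  assumes f: "f \<in> carrier T" and h: "h \<in> carrier T"
  shows "ev (f \<otimes>\<^bsub>T\<^esub> h) = ev f \<otimes> ev h"
proof -
  interpret T: kalg T by (rule kalg_tensor)
  note lin = linear_onD[OF linear_on_ev] linear_on_zero[OF kalg_tensor kalg_axioms linear_on_ev]
  have 1: "ev (word w \<otimes>\<^bsub>T\<^esub> h) = ev (word w) \<otimes> ev h" if w: "set w \<subseteq> {1..n}" for w
    using h
  proof (induction h rule: tensor_induct)
    case (word u)
    with w have "list_prod B (map y (w @ u)) = list_prod B (map y w) \<otimes> list_prod B (map y u)"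
      unfolding map_append using y_closed by (intro list_prod_append) auto
    then show ?case using w word by (simp add: word_mult ev_word)
  qed (use w in \<open>simp_all add: lin word_closed T.r_distr r_distr T.smult_mult_right smult_mult_right\<close>)
  show ?thesis using f
    by (induction f rule: tensor_induct)
      (use h 1 in \<open>simp_all add: lin word_closed T.l_distr l_distr T.smult_mult_left smult_mult_left\<close>)
qed

lemma ev_one: "ev \<one>\<^bsub>T\<^esub> = \<one>"
  using ev_word[of "[]"] by (simp add: word_Nil[of n])

end

section \<open>The quantum exterior algebra\<close>

lemma (in kalg) ideal_diff_coset:
  "ideal I A \<Longrightarrow> x \<in> carrier A \<Longrightarrow> x \<in> I \<longleftrightarrow> I +> x = I"
  by (metis a_coset_join1 a_coset_join2 additive_subgroup.a_subgroup ideal.axioms(1))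

lemma finite_mset_eq: "finite {w. mset w = mset xs}"
proof (rule finite_subset)
  show "{w. mset w = mset xs} \<subseteq> {w. set w \<subseteq> set xs \<and> length w = length xs}"
    by (auto dest: mset_eq_setD mset_eq_length)
qed (simp add: finite_lists_length_eq)

locale qext =
  fixes n :: nat and q :: "nat \<Rightarrow> nat \<Rightarrow> 'k::field"
  assumes q_nz: "i \<in> {1..n} \<Longrightarrow> j \<in> {1..n} \<Longrightarrow> q i j \<noteq> 0"
    and q_inv: "i \<in> {1..n} \<Longrightarrow> j \<in> {1..n} \<Longrightarrow> i \<noteq> j \<Longrightarrow> q j i = inverse (q i j)"
begin

abbreviation T :: "('k, nat list \<Rightarrow> 'k) module" where "T \<equiv> tensor_algebra n"
abbreviation "IE \<equiv> qext_ideal n q"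
abbreviation "Q \<equiv> qext_algebra n q"

sublocale T: kalg T by (rule kalg_tensor)

text \<open>The product of \<open>q b a\<close> over all inversions between a word with letters
  \<open>M\<close> and a later word with letters \<open>N\<close>: \<open>a\<close> stands in front,
  \<open>b\<close> behind it, and \<open>b < a\<close>.\<close>

definition inv_factor :: "nat multiset \<Rightarrow> nat multiset \<Rightarrow> 'k" where
  "inv_factor M N = prod_mset (image_mset (\<lambda>a. prod_mset (image_mset (\<lambda>b. if b < a then q b a else 1) N)) M)"

text \<open>The coefficient with which a word without repetitions is a multiple of its sorted word.\<close>

fun cf :: "nat list \<Rightarrow> 'k" where
  "cf [] = 1"
| "cf (a # w) = inv_factor {#a#} (mset w) * cf w"

text \<open>The inversions of \<open>u @ w\<close> lie in \<open>u\<close>, in \<open>w\<close> or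
  across the cut, and the last kind depends on the two multisets of letters only. This independence
  of the order is what makes \<open>nf\<close> compatible with multiplication.\<close>

lemma cf_append: "cf (u @ w) = cf u * cf w * inv_factor (mset u) (mset w)"
  by (induction u) (auto simp: inv_factor_def)

lemma cf_sorted: "sorted w \<Longrightarrow> cf w = 1"
proof (induction w)
  case (Cons a w)
  have "image_mset (\<lambda>b. if b < a then q b a else 1) (mset w) = image_mset (\<lambda>b. 1) (mset w)"
    using Cons.prems by (intro image_mset_cong) auto
  then show ?case using Cons by (simp add: inv_factor_def)
qed simp

text \<open>The coefficient of the PBW monomial of \<open>\<alpha>\<close>, as a linear functional
  on tensors. It is written down before any basis is known: its vanishing on the relations is what
  proves the monomials independent.\<close>

definition nf :: "(nat list \<Rightarrow> 'k) \<Rightarrow> (nat \<Rightarrow> nat) \<Rightarrow> 'k" where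
  "nf f \<alpha> = (\<Sum>w | mset w = mset (wd n \<alpha>). f w * cf w)"

lemma nf_add: "nf (f \<oplus>\<^bsub>T\<^esub> h) \<alpha> = nf f \<alpha> + nf h \<alpha>"
  by (simp add: nf_def tensor_simps(4) distrib_right sum.distrib)

lemma nf_smult: "nf (c \<odot>\<^bsub>T\<^esub> f) \<alpha> = c * nf f \<alpha>"
  by (simp add: nf_def tensor_simps(5) sum_distrib_left mult.assoc)

lemma nf_zero: "nf \<zero>\<^bsub>T\<^esub> \<alpha> = 0"
  by (simp add: nf_def tensor_simps(3))

lemma nf_word: "nf (word w) \<alpha> = (if mset w = mset (wd n \<alpha>) then cf w else 0)"
proof -
  have "nf (word w) \<alpha> = (\<Sum>u | mset u = mset (wd n \<alpha>). if u = w then cf w else 0)"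
    unfolding nf_def by (rule sum.cong) (auto simp: word_def)
  then show ?thesis by (simp add: finite_mset_eq)
qed

lemma nf_diff: "f \<in> carrier T \<Longrightarrow> h \<in> carrier T \<Longrightarrow> nf (f \<ominus>\<^bsub>T\<^esub> h) \<alpha> = nf f \<alpha> - nf h \<alpha>"
  by (simp add: T.diff_eq_smult nf_add nf_smult)

text \<open>The letters of a PBW monomial are distinct, so each piece of a rearrangement is itself a
  rearrangement of a PBW monomial, namely that of its own letters.\<close>

lemma mset_sub_wd:
  assumes "mset (u @ w) = mset (wd n \<alpha>)"
  shows "mset u = mset (wd n (idx n (set u)))" "mset w = mset (wd n (idx n (set w)))"
proof -
  have "distinct (u @ w)" "set (u @ w) \<subseteq> {1..n}"
    using wd_sorted(2,3)[of n \<alpha>] mset_eq_setD[OF assms] mset_eq_imp_distinct_iff[OF assms] by auto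
  then have *: "distinct u" "distinct w" "set u \<subseteq> {1..n}" "set w \<subseteq> {1..n}" by auto
  show "mset u = mset (wd n (idx n (set u)))"
    using *(1,3) wd_sorted(2) by (simp add: set_eq_iff_mset_eq_distinct[symmetric] set_wd_idx)
  show "mset w = mset (wd n (idx n (set w)))"
    using *(2,4) wd_sorted(2) by (simp add: set_eq_iff_mset_eq_distinct[symmetric] set_wd_idx)
qed

lemma word_mult_left_nonzero:
  assumes "(word u \<otimes>\<^bsub>T\<^esub> k) w \<noteq> 0" obtains w' where "w = u @ w'"
  using assms by (elim tensor_mult_nonzero) (auto simp: word_def split: if_splits)

lemma word_mult_right_nonzero:
  assumes "(k \<otimes>\<^bsub>T\<^esub> word u) w \<noteq> 0" obtains w' where "w = w' @ u"
  using assms by (elim tensor_mult_nonzero) (auto simp: word_def split: if_splits)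

lemma word_mult_left: "(word u \<otimes>\<^bsub>T\<^esub> k) (u @ w) = k w"
proof -
  have "(\<Sum>i\<le>length (u @ w). word u (take i (u @ w)) * k (drop i (u @ w))) = (\<Sum>i\<le>length (u @ w). if i = length u then k w else 0)"
  proof (rule sum.cong)
    fix i assume "i \<in> {..length (u @ w)}"
    then have "take i (u @ w) = u \<longleftrightarrow> i = length u"
      by (metis append_eq_conv_conj atMost_iff length_take min.absorb2)
    then show "word u (take i (u @ w)) * k (drop i (u @ w)) = (if i = length u then k w else 0)"
      by (auto simp: word_def)
  qed simp
  then show ?thesis by (simp add: tensor_simps(6))
qed

lemma word_mult_right: "(k \<otimes>\<^bsub>T\<^esub> word u) (w @ u) = k w"
proof -
  have "(\<Sum>i\<le>length (w @ u). k (take i (w @ u)) * word u (drop i (w @ u))) = (\<Sum>i\<le>length (w @ u). if i = length w then k w else 0)"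
  proof (rule sum.cong)
    fix i assume i: "i \<in> {..length (w @ u)}"
    have "drop i (w @ u) = u \<longleftrightarrow> i = length w"
    proof
      assume "drop i (w @ u) = u"
      then have "length (w @ u) - i = length u" by (metis length_drop)
      then show "i = length w" using i by simp
    qed simp
    then show "k (take i (w @ u)) * word u (drop i (w @ u)) = (if i = length w then k w else 0)"
      by (auto simp: word_def)
  qed simp
  then show ?thesis by (simp add: tensor_simps(6))
qed

text \<open>Up to a fixed scalar, the coefficient of \<open>\<alpha>\<close> in the product is the
  coefficient in \<open>k\<close> of the monomial formed by the letters left over after removing
  \<open>u\<close>.\<close>

lemma nf_mult_word:
  assumes k: "\<And>\<beta>. \<beta> \<in> expo n \<Longrightarrow> nf k \<beta> = 0"
  shows "nf (word u \<otimes>\<^bsub>T\<^esub> k) \<alpha> = 0" "nf (k \<otimes>\<^bsub>T\<^esub> word u) \<alpha> = 0"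
proof -
  let ?W = "\<lambda>\<alpha>. {w. mset w = mset (wd n \<alpha>)}"
  show "nf (word u \<otimes>\<^bsub>T\<^esub> k) \<alpha> = 0"
  proof (cases "\<exists>w. u @ w \<in> ?W \<alpha>")
    case True
    \<comment> \<open>\<open>w0\<close> only serves to fix the remaining letters; the words that
      matter for \<open>k\<close> are the rearrangements of \<open>w0\<close>.\<close>
    then obtain w0 where w0: "mset (u @ w0) = mset (wd n \<alpha>)" by auto
    let ?\<beta> = "idx n (set w0)"
    note \<beta> = mset_sub_wd(2)[OF w0]
    have "nf (word u \<otimes>\<^bsub>T\<^esub> k) \<alpha> = (\<Sum>w\<in>(@) u ` ?W ?\<beta>. (word u \<otimes>\<^bsub>T\<^esub> k) w * cf w)"
      unfolding nf_def
    proof (rule sum.mono_neutral_right)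
      show "(@) u ` ?W ?\<beta> \<subseteq> ?W \<alpha>" using w0 \<beta> by auto
      show "\<forall>w\<in>?W \<alpha> - (@) u ` ?W ?\<beta>. (word u \<otimes>\<^bsub>T\<^esub> k) w * cf w = 0"
      proof (rule ballI, rule ccontr)
        fix w assume w: "w \<in> ?W \<alpha> - (@) u ` ?W ?\<beta>" and "(word u \<otimes>\<^bsub>T\<^esub> k) w * cf w \<noteq> 0"
        then have "(word u \<otimes>\<^bsub>T\<^esub> k) w \<noteq> 0" by auto
        then obtain w' where w': "w = u @ w'" by (rule word_mult_left_nonzero)
        have "mset w' = mset w0" using w w0[symmetric] unfolding w' by simp
        then show False using w w' \<beta> by auto
      qed
    qed (rule finite_mset_eq)
    also have "\<dots> = (\<Sum>w\<in>?W ?\<beta>. k w * cf (u @ w))"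
      by (subst sum.reindex) (auto simp: word_mult_left inj_on_def)
    \<comment> \<open>The factor for the inversions across the cut is the same for all
      rearrangements \<open>w\<close>, so it can be taken out of the sum.\<close>
    also have "\<dots> = (\<Sum>w\<in>?W ?\<beta>. (cf u * inv_factor (mset u) (mset (wd n ?\<beta>))) * (k w * cf w))"
      by (rule sum.cong) (auto simp: cf_append)
    also have "\<dots> = (cf u * inv_factor (mset u) (mset (wd n ?\<beta>))) * nf k ?\<beta>"
      unfolding nf_def by (rule sum_distrib_left[symmetric])
    finally show ?thesis by (simp add: k idx_expo)
  next
    \<comment> \<open>Every word occurring in the product begins with \<open>u\<close>, and no
      rearrangement of the monomial does.\<close>
    case False
    then show ?thesis unfolding nf_def by (intro sum.neutral ballI) (metis word_mult_left_nonzero mult_eq_0_iff)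
  qed
  show "nf (k \<otimes>\<^bsub>T\<^esub> word u) \<alpha> = 0"
  proof (cases "\<exists>w. w @ u \<in> ?W \<alpha>")
    case True
    then obtain w0 where w0: "mset (w0 @ u) = mset (wd n \<alpha>)" by auto
    let ?\<beta> = "idx n (set w0)"
    note \<beta> = mset_sub_wd(1)[OF w0]
    have "nf (k \<otimes>\<^bsub>T\<^esub> word u) \<alpha> = (\<Sum>w\<in>(\<lambda>w. w @ u) ` ?W ?\<beta>. (k \<otimes>\<^bsub>T\<^esub> word u) w * cf w)"
      unfolding nf_def
    proof (rule sum.mono_neutral_right)
      show "(\<lambda>w. w @ u) ` ?W ?\<beta> \<subseteq> ?W \<alpha>" using w0 \<beta> by auto
      show "\<forall>w\<in>?W \<alpha> - (\<lambda>w. w @ u) ` ?W ?\<beta>. (k \<otimes>\<^bsub>T\<^esub> word u) w * cf w = 0"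
      proof (rule ballI, rule ccontr)
        fix w assume w: "w \<in> ?W \<alpha> - (\<lambda>w. w @ u) ` ?W ?\<beta>" and "(k \<otimes>\<^bsub>T\<^esub> word u) w * cf w \<noteq> 0"
        then have "(k \<otimes>\<^bsub>T\<^esub> word u) w \<noteq> 0" by auto
        then obtain w' where w': "w = w' @ u" by (rule word_mult_right_nonzero)
        have "mset w' = mset w0" using w w0[symmetric] unfolding w' by simp
        then show False using w w' \<beta> by auto
      qed
    qed (rule finite_mset_eq)
    also have "\<dots> = (\<Sum>w\<in>?W ?\<beta>. k w * cf (w @ u))"
      by (subst sum.reindex) (auto simp: word_mult_right inj_on_def)
    also have "\<dots> = (\<Sum>w\<in>?W ?\<beta>. (cf u * inv_factor (mset (wd n ?\<beta>)) (mset u)) * (k w * cf w))"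
      by (rule sum.cong) (auto simp: cf_append)
    also have "\<dots> = (cf u * inv_factor (mset (wd n ?\<beta>)) (mset u)) * nf k ?\<beta>"
      unfolding nf_def by (rule sum_distrib_left[symmetric])
    finally show ?thesis by (simp add: k idx_expo)
  next
    case False
    then show ?thesis unfolding nf_def by (intro sum.neutral ballI) (metis word_mult_right_nonzero mult_eq_0_iff)
  qed
qed

definition nf_ker :: "(nat list \<Rightarrow> 'k) set" where
  "nf_ker = {f \<in> carrier T. \<forall>\<alpha>\<in>expo n. nf f \<alpha> = 0}"

text \<open>\<open>nf_ker\<close> is the common kernel of linear functionals and not of a ring
  homomorphism; that it absorbs products comes from the formula for words, extended
  linearly.\<close>

lemma nf_mult:
  assumes x: "x \<in> carrier T" and k: "k \<in> nf_ker"
  shows "x \<otimes>\<^bsub>T\<^esub> k \<in> nf_ker \<and> k \<otimes>\<^bsub>T\<^esub> x \<in> nf_ker"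
  using x
proof (induction x rule: tensor_induct)
  case (word w)
  then show ?case using k word_closed[of w n] nf_mult_word[of k w]
    by (auto simp: nf_ker_def simp del: atLeastAtMost_iff)
qed (use k in \<open>auto simp: nf_ker_def nf_add nf_smult nf_zero T.l_distr T.r_distr T.smult_mult_left T.smult_mult_right\<close>)

lemma ideal_nf_ker: "ideal nf_ker T"
proof (rule idealI)
  show "subgroup nf_ker (add_monoid T)"
  proof
    fix x assume "x \<in> nf_ker"
    then show "inv\<^bsub>add_monoid T\<^esub> x \<in> nf_ker"
      by (simp add: nf_ker_def a_inv_def[symmetric] T.minus_eq_smult nf_smult)
  qed (auto simp: nf_ker_def nf_add nf_zero)
qed (use nf_mult T.ring_axioms in auto)

definition ext_gens :: "(nat list \<Rightarrow> 'k) set" where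
  "ext_gens = {letter j \<otimes>\<^bsub>T\<^esub> letter i \<ominus>\<^bsub>T\<^esub> q i j \<odot>\<^bsub>T\<^esub> (letter i \<otimes>\<^bsub>T\<^esub> letter j) | i j.
                i \<in> {1..n} \<and> j \<in> {1..n} \<and> i \<noteq> j} \<union>
             {letter i \<otimes>\<^bsub>T\<^esub> letter i | i. i \<in> {1..n}}"

lemma qext_ideal_eq: "IE = Idl\<^bsub>T\<^esub> ext_gens"
  by (simp only: qext_ideal_def ext_gens_def Let_def)

lemma ext_gens_closed: "ext_gens \<subseteq> carrier T"
  unfolding ext_gens_def letter_word word_mult
  by (auto intro!: T.minus_closed T.smult_closed word_closed)

lemma ideal_IE: "ideal IE T"
  unfolding qext_ideal_eq by (rule T.genideal_ideal[OF ext_gens_closed])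

sublocale IE: ideal IE T by (rule ideal_IE)

text \<open>The consistency of the relations: since \<open>nf_ker\<close> is an ideal, it suffices
  to test the generators, each of which involves words of length two.\<close>

lemma IE_subset_nf_ker: "IE \<subseteq> nf_ker"
  unfolding qext_ideal_eq
proof (rule T.genideal_minimal[OF ideal_nf_ker], rule subsetI)
  fix x assume x: "x \<in> ext_gens"
  have "nf x \<alpha> = 0" for \<alpha>
  proof -
    consider i j where "i \<in> {1..n}" "j \<in> {1..n}" "i \<noteq> j" "x = word [j, i] \<ominus>\<^bsub>T\<^esub> q i j \<odot>\<^bsub>T\<^esub> word [i, j]"
      | i where "i \<in> {1..n}" "x = word [i, i]"
      using x unfolding ext_gens_def letter_word word_mult by auto
    then show ?thesis
    proof cases
      case 1
      then have "word [j, i] \<in> carrier T" "word [i, j] \<in> carrier T" by (auto intro!: word_closed)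
      moreover have "mset [j, i] = mset [i, j]" by simp
      \<comment> \<open>For i < j the inversion is in the word on the left and the factor is
        \<open>q i j\<close> itself; for j < i it is in the word on the right, and the two factors
        cancel by \<open>q_inv\<close>.\<close>
      moreover have "cf [j, i] = q i j * cf [i, j]"
        using q_nz[OF 1(1,2)] q_inv[OF 1(1-3)] 1(3) by (auto simp: inv_factor_def)
      ultimately show ?thesis unfolding 1(4) by (simp add: nf_diff nf_smult nf_word add_mset_commute del: cf.simps)
    next
      case 2
      \<comment> \<open>A PBW monomial has distinct letters, so a repeated letter is never a
        rearrangement of one.\<close>
      have "mset [i, i] \<noteq> mset (wd n \<alpha>)"
        using wd_sorted(2)[of n \<alpha>] mset_eq_imp_distinct_iff[of "[i, i]" "wd n \<alpha>"] by auto
      then show ?thesis unfolding 2(2) nf_word by simp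
    qed
  qed
  then show "x \<in> nf_ker" using x ext_gens_closed by (auto simp: nf_ker_def)
qed

lemma nf_eq_if_coset_eq:
  assumes "x \<in> carrier T" "y \<in> carrier T" "IE +>\<^bsub>T\<^esub> x = IE +>\<^bsub>T\<^esub> y" "\<alpha> \<in> expo n"
  shows "nf x \<alpha> = nf y \<alpha>"
proof -
  have "x \<ominus>\<^bsub>T\<^esub> y \<in> nf_ker" using assms(3) T.coset_eq_iff[OF ideal_IE assms(1,2)] IE_subset_nf_ker by auto
  then show ?thesis using assms(4) nf_diff[OF assms(1,2)] by (auto simp: nf_ker_def)
qed

lemma kalg_Q: "kalg Q"
  unfolding qext_algebra_def by (rule T.kalg_quot_algebra[OF ideal_IE])

sublocale Q: kalg Q by (rule kalg_Q)

abbreviation "qc \<equiv> (+>\<^bsub>T\<^esub>) IE"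

lemma linear_on_qc: "linear_on T Q qc"
  unfolding qext_algebra_def by (rule T.linear_on_coset[OF ideal_IE])

lemmas qc_linear = linear_onD[OF linear_on_qc]

lemma Q_carrierE: assumes "X \<in> carrier Q" obtains x where "x \<in> carrier T" "X = qc x"
  using assms unfolding qext_algebra_def by (auto elim: quot_carrierE)

lemma qc_mult: "x \<in> carrier T \<Longrightarrow> y \<in> carrier T \<Longrightarrow> qc x \<otimes>\<^bsub>Q\<^esub> qc y = qc (x \<otimes>\<^bsub>T\<^esub> y)"
  by (simp add: qext_algebra_def IE.rcoset_mult_add)

lemma Q_zero: "\<zero>\<^bsub>Q\<^esub> = IE" and Q_one: "\<one>\<^bsub>Q\<^esub> = qc \<one>\<^bsub>T\<^esub>"
  by (simp_all add: qext_algebra_def)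

lemma qc_eq_zero: "x \<in> carrier T \<Longrightarrow> qc x = \<zero>\<^bsub>Q\<^esub> \<longleftrightarrow> x \<in> IE"
  unfolding Q_zero using T.ideal_diff_coset[OF ideal_IE] by simp

lemma qc_word_mult: "set u \<subseteq> {1..n} \<Longrightarrow> set w \<subseteq> {1..n} \<Longrightarrow> qc (word u) \<otimes>\<^bsub>Q\<^esub> qc (word w) = qc (word (u @ w))"
  using qc_mult[OF word_closed word_closed] by (simp add: word_mult)

lemma qc_swap:
  assumes "set (a @ i # j # b) \<subseteq> {1..n}" "i \<noteq> j"
  shows "qc (word (a @ j # i # b)) = q i j \<odot>\<^bsub>Q\<^esub> qc (word (a @ i # j # b))"
proof -
  have c: "set a \<subseteq> {1..n}" "set b \<subseteq> {1..n}" "set [i, j] \<subseteq> {1..n}" "set [j, i] \<subseteq> {1..n}" "i \<in> {1..n}" "j \<in> {1..n}"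
    using assms(1) by auto
  note wc = c(1-4)[THEN word_closed]
  have "word [j, i] \<ominus>\<^bsub>T\<^esub> q i j \<odot>\<^bsub>T\<^esub> word [i, j] \<in> ext_gens"
    unfolding ext_gens_def letter_word word_mult using c(5,6) assms(2) by auto
  then have "word [j, i] \<ominus>\<^bsub>T\<^esub> q i j \<odot>\<^bsub>T\<^esub> word [i, j] \<in> IE"
    unfolding qext_ideal_eq using T.genideal_self[OF ext_gens_closed] by blast
  then have *: "qc (word [j, i]) = q i j \<odot>\<^bsub>Q\<^esub> qc (word [i, j])"
    using T.coset_eq_iff[OF ideal_IE wc(4) T.smult_closed[OF wc(3)]] by (simp add: qc_linear wc)
  have "qc (word (a @ j # i # b)) = qc (word a) \<otimes>\<^bsub>Q\<^esub> qc (word [j, i]) \<otimes>\<^bsub>Q\<^esub> qc (word b)"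
    using c by (subst qc_word_mult, simp, simp)+ simp
  also have "\<dots> = q i j \<odot>\<^bsub>Q\<^esub> (qc (word a) \<otimes>\<^bsub>Q\<^esub> qc (word [i, j]) \<otimes>\<^bsub>Q\<^esub> qc (word b))"
    unfolding * by (simp add: Q.smult_mult_left Q.smult_mult_right qc_linear wc)
  also have "qc (word a) \<otimes>\<^bsub>Q\<^esub> qc (word [i, j]) \<otimes>\<^bsub>Q\<^esub> qc (word b) = qc (word (a @ i # j # b))"
    using c by (subst qc_word_mult, simp, simp)+ simp
  finally show ?thesis .
qed

lemma qc_adjacent:
  assumes "set (a @ i # i # b) \<subseteq> {1..n}"
  shows "qc (word (a @ i # i # b)) = \<zero>\<^bsub>Q\<^esub>"
proof -
  have c: "set a \<subseteq> {1..n}" "set b \<subseteq> {1..n}" "set [i, i] \<subseteq> {1..n}" using assms by auto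
  note wc = c[THEN word_closed]
  have "word [i, i] \<in> ext_gens"
    unfolding ext_gens_def letter_word word_mult using c(3) by auto
  then have "word [i, i] \<in> IE"
    unfolding qext_ideal_eq using T.genideal_self[OF ext_gens_closed] by blast
  then have *: "qc (word [i, i]) = \<zero>\<^bsub>Q\<^esub>" using qc_eq_zero[OF wc(3)] by simp
  have "qc (word (a @ i # i # b)) = qc (word a) \<otimes>\<^bsub>Q\<^esub> qc (word [i, i]) \<otimes>\<^bsub>Q\<^esub> qc (word b)"
    using c by (subst qc_word_mult, simp, simp)+ simp
  then show ?thesis unfolding * by (simp add: qc_linear wc)
qed

section \<open>The PBW basis of the quantum exterior algebra\<close>

abbreviation "qb \<alpha> \<equiv> qc (word (wd n \<alpha>))"

lemma qb_closed [simp]: "qb \<alpha> \<in> carrier Q"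
  by (intro qc_linear(1) word_closed wd_sorted)

text \<open>Induction along sorting. The functionals \<open>nf\<close> are constant on cosets, so
  each step changes both sides by the same factor and no product of inversions has to be
  computed.\<close>

lemma qc_word_expand:
  assumes "set w \<subseteq> {1..n}"
  shows "qc (word w) = (\<Oplus>\<^bsub>Q\<^esub>\<alpha>\<in>expo n. nf (word w) \<alpha> \<odot>\<^bsub>Q\<^esub> qb \<alpha>)"
  using assms
proof (induction w rule: sort_induct)
  case (sorted w)
  let ?\<alpha> = "idx n (set w)"
  have w: "wd n ?\<alpha> = w" using sorted by (intro wd_idx)
  have "(\<Oplus>\<^bsub>Q\<^esub>\<alpha>\<in>expo n. nf (word w) \<alpha> \<odot>\<^bsub>Q\<^esub> qb \<alpha>) = nf (word w) ?\<alpha> \<odot>\<^bsub>Q\<^esub> qb ?\<alpha>"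
  proof (rule Q.finsum_single)
    fix \<alpha> assume \<alpha>: "\<alpha> \<in> expo n" "\<alpha> \<noteq> ?\<alpha>"
    have "mset w \<noteq> mset (wd n \<alpha>)"
    proof
      assume "mset w = mset (wd n \<alpha>)"
      then have "w = wd n \<alpha>" using sorted wd_sorted[of n \<alpha>]
        by (metis mset_eq_setD sorted_distinct_set_unique)
      then show False using \<alpha> w wd_inj[OF \<alpha>(1) idx_expo] by metis
    qed
    then show "nf (word w) \<alpha> \<odot>\<^bsub>Q\<^esub> qb \<alpha> = \<zero>\<^bsub>Q\<^esub>" by (simp add: nf_word)
  qed (simp_all add: idx_expo)
  also have "\<dots> = qc (word w)"
    using sorted qc_linear(1)[OF word_closed[OF sorted(1)]] by (simp add: nf_word w cf_sorted)
  finally show ?case by simp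
next
  case (adjacent a i b)
  have "qc (word (a @ i # i # b)) = qc \<zero>\<^bsub>T\<^esub>"
    unfolding qc_adjacent[OF adjacent] using linear_on_zero[OF T.kalg_axioms Q.kalg_axioms linear_on_qc] by simp
  \<comment> \<open>A word with two equal neighbours lies in the ideal, so its coefficients vanish
    together with its coset.\<close>
  then have "nf (word (a @ i # i # b)) \<alpha> = 0" if "\<alpha> \<in> expo n" for \<alpha>
    using nf_eq_if_coset_eq[OF word_closed[OF adjacent] T.zero_closed _ that] nf_zero by simp
  then have "(\<Oplus>\<^bsub>Q\<^esub>\<alpha>\<in>expo n. nf (word (a @ i # i # b)) \<alpha> \<odot>\<^bsub>Q\<^esub> qb \<alpha>) = \<zero>\<^bsub>Q\<^esub>"
    by (intro Q.add.finprod_one_eqI) simp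
  then show ?case using qc_adjacent[OF adjacent] by simp
next
  case (swap a i j b)
  then have sw: "qc (word (a @ j # i # b)) = q i j \<odot>\<^bsub>Q\<^esub> qc (word (a @ i # j # b))" by (intro qc_swap) auto
  have c: "word (a @ i # j # b) \<in> carrier T" "word (a @ j # i # b) \<in> carrier T"
    by (intro word_closed; use swap(1) in simp)+
  have nfs: "nf (word (a @ j # i # b)) \<alpha> = q i j * nf (word (a @ i # j # b)) \<alpha>" if "\<alpha> \<in> expo n" for \<alpha>
    using nf_eq_if_coset_eq[OF c(2) T.smult_closed[OF c(1)] _ that, of "q i j"] sw
    by (simp add: nf_smult qc_linear c)
  have "(\<Oplus>\<^bsub>Q\<^esub>\<alpha>\<in>expo n. nf (word (a @ j # i # b)) \<alpha> \<odot>\<^bsub>Q\<^esub> qb \<alpha>) = 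
    (\<Oplus>\<^bsub>Q\<^esub>\<alpha>\<in>expo n. q i j \<odot>\<^bsub>Q\<^esub> (nf (word (a @ i # j # b)) \<alpha> \<odot>\<^bsub>Q\<^esub> qb \<alpha>))"
    by (rule Q.finsum_cong_all) (simp_all add: nfs Q.smult_assoc)
  also have "\<dots> = q i j \<odot>\<^bsub>Q\<^esub> qc (word (a @ i # j # b))"
    unfolding swap(3) by (rule Q.finsum_smult[symmetric]) simp
  finally show ?case using sw by simp
qed

lemma qc_expand:
  assumes "x \<in> carrier T"
  shows "qc x = (\<Oplus>\<^bsub>Q\<^esub>\<alpha>\<in>expo n. nf x \<alpha> \<odot>\<^bsub>Q\<^esub> qb \<alpha>)"
  using assms
proof (induction x rule: tensor_induct)
  case zero
  then show ?case using linear_on_zero[OF T.kalg_axioms Q.kalg_axioms linear_on_qc]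
    by (simp add: nf_zero)
next
  case (word w)
  then show ?case by (rule qc_word_expand)
next
  case (smult c x)
  have "(\<Oplus>\<^bsub>Q\<^esub>\<alpha>\<in>expo n. nf (c \<odot>\<^bsub>T\<^esub> x) \<alpha> \<odot>\<^bsub>Q\<^esub> qb \<alpha>) = (\<Oplus>\<^bsub>Q\<^esub>\<alpha>\<in>expo n. c \<odot>\<^bsub>Q\<^esub> (nf x \<alpha> \<odot>\<^bsub>Q\<^esub> qb \<alpha>))"
    by (rule Q.finsum_cong_all) (simp_all add: nf_smult Q.smult_assoc)
  also have "\<dots> = c \<odot>\<^bsub>Q\<^esub> qc x"
    unfolding smult(2) by (rule Q.finsum_smult[symmetric]) simp
  finally show ?case using smult by (simp add: qc_linear)
next
  case (add x y)
  have "(\<Oplus>\<^bsub>Q\<^esub>\<alpha>\<in>expo n. nf (x \<oplus>\<^bsub>T\<^esub> y) \<alpha> \<odot>\<^bsub>Q\<^esub> qb \<alpha>) =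
    (\<Oplus>\<^bsub>Q\<^esub>\<alpha>\<in>expo n. nf x \<alpha> \<odot>\<^bsub>Q\<^esub> qb \<alpha> \<oplus>\<^bsub>Q\<^esub> nf y \<alpha> \<odot>\<^bsub>Q\<^esub> qb \<alpha>)"
    by (rule Q.finsum_cong_all) (simp_all add: nf_add Q.smult_add_left)
  also have "\<dots> = qc x \<oplus>\<^bsub>Q\<^esub> qc y"
    unfolding add(3,4) by (rule Q.finsum_addf) simp_all
  finally show ?case using add by (simp add: qc_linear)
qed

text \<open>For independence a vanishing combination is lifted to T(V), where it lands in the ideal
  of relations; there every functional \<open>nf\<close> is zero and reads off a
  coefficient.\<close>

lemma is_basis_Q: "is_basis Q (expo n) qb"
proof (rule is_basisI[OF kalg_Q finite_expo])
  fix X assume "X \<in> carrier Q"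
  then obtain x where "x \<in> carrier T" "X = qc x" by (rule Q_carrierE)
  then show "\<exists>c. X = (\<Oplus>\<^bsub>Q\<^esub>\<alpha>\<in>expo n. c \<alpha> \<odot>\<^bsub>Q\<^esub> qb \<alpha>)" using qc_expand by blast
next
  fix c \<beta> assume 0: "(\<Oplus>\<^bsub>Q\<^esub>\<alpha>\<in>expo n. c \<alpha> \<odot>\<^bsub>Q\<^esub> qb \<alpha>) = \<zero>\<^bsub>Q\<^esub>" and \<beta>: "\<beta> \<in> expo n"
  have wc: "word (wd n \<alpha>) \<in> carrier T" for \<alpha> by (intro word_closed wd_sorted)
  let ?x = "\<Oplus>\<^bsub>T\<^esub>\<alpha>\<in>expo n. c \<alpha> \<odot>\<^bsub>T\<^esub> word (wd n \<alpha>)"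
  have x: "?x \<in> carrier T" by (intro T.finsum_in T.smult_closed wc)
  have "qc ?x = (\<Oplus>\<^bsub>Q\<^esub>\<alpha>\<in>expo n. qc (c \<alpha> \<odot>\<^bsub>T\<^esub> word (wd n \<alpha>)))"
    by (rule linear_on_finsum[OF T.kalg_axioms kalg_Q linear_on_qc]) (intro T.smult_closed wc)
  also have "\<dots> = \<zero>\<^bsub>Q\<^esub>" unfolding 0[symmetric] by (rule Q.finsum_cong_all) (simp_all add: qc_linear wc)
  finally have "?x \<in> IE" using qc_eq_zero[OF x] by simp
  then have "nf ?x \<beta> = 0" using IE_subset_nf_ker \<beta> by (auto simp: nf_ker_def)
  moreover have "nf ?x \<beta> = (\<Sum>w | mset w = mset (wd n \<beta>). (\<Sum>\<alpha>\<in>expo n. c \<alpha> * word (wd n \<alpha>) w) * cf w)"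
  proof -
    have "?x w = (\<Sum>\<alpha>\<in>expo n. (c \<alpha> \<odot>\<^bsub>T\<^esub> word (wd n \<alpha>)) w)" for w
      by (rule tensor_finsum) (intro T.smult_closed wc)
    then show ?thesis unfolding nf_def by (simp only: tensor_simps(5))
  qed
  \<comment> \<open>The lift contains increasing words only, and \<open>wd n \<beta>\<close> is the
    only increasing word among its own rearrangements.\<close>
  moreover have "(\<Sum>\<alpha>\<in>expo n. c \<alpha> * word (wd n \<alpha>) w) * cf w = (if w = wd n \<beta> then c \<beta> else 0)" 
    if "mset w = mset (wd n \<beta>)" for w
  proof (cases "w = wd n \<beta>")
    case True
    have "(\<Sum>\<alpha>\<in>expo n. c \<alpha> * word (wd n \<alpha>) w) = (\<Sum>\<alpha>\<in>expo n. if \<alpha> = \<beta> then c \<beta> else 0)"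
      using True \<beta> wd_inj by (intro sum.cong) (auto simp: word_def)
    then show ?thesis using True \<beta> by (simp add: cf_sorted wd_sorted)
  next
    case False
    have "w \<noteq> wd n \<alpha>" for \<alpha> using that False wd_sorted
      by (metis mset_eq_setD sorted_distinct_set_unique)
    then show ?thesis using False by (simp add: word_def)
  qed
  ultimately show "c \<beta> = 0" by (simp add: finite_mset_eq)
qed simp

end

text \<open>The skew group algebra is free over A on the group elements: at \<open>x\<close> a
  combination sees only the indices whose group component is \<open>x\<close>.\<close>

lemma (in skew) is_basis_skew:
  assumes J: "finite J" and "is_basis A J b"
  shows "is_basis S (J \<times> carrier H) (\<lambda>(j, g). se (b j) g)"
proof -
  interpret B: fbasis A J b by unfold_locales (fact assms)+
  interpret S: kalg S by (rule kalg_skew)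
  have se: "se (b j) g \<in> carrier S" if "(j, g) \<in> J \<times> carrier H" for j g using that by simp
  have lc: "(\<Oplus>\<^bsub>S\<^esub>i\<in>J \<times> carrier H. c i \<odot>\<^bsub>S\<^esub> (case i of (j, g) \<Rightarrow> se (b j) g)) x = 
    (if x \<in> carrier H then \<Oplus>j\<in>J. c (j, x) \<odot> b j else \<zero>)" for c x
  proof -
    have "(\<Oplus>\<^bsub>S\<^esub>i\<in>J \<times> carrier H. c i \<odot>\<^bsub>S\<^esub> (case i of (j, g) \<Rightarrow> se (b j) g)) x = 
      (\<Oplus>i\<in>J \<times> carrier H. (c i \<odot>\<^bsub>S\<^esub> (case i of (j, g) \<Rightarrow> se (b j) g)) x)"
      by (rule skew_finsum) (auto intro!: S.smult_closed)
    also have "\<dots> = (\<Oplus>i\<in>J \<times> carrier H. if snd i = x then c (fst i, x) \<odot> b (fst i) else \<zero>)"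
      by (rule finsum_cong_all) (auto simp: skew_simps(6) skew_elem_def)
    also have "\<dots> = (if x \<in> carrier H then \<Oplus>j\<in>J. c (j, x) \<odot> b j else \<zero>)"
    proof (cases "x \<in> carrier H")
      case True
      have "(\<Oplus>i\<in>J \<times> carrier H. if snd i = x then c (fst i, x) \<odot> b (fst i) else \<zero>) =
        (\<Oplus>i\<in>(\<lambda>j. (j, x)) ` J. c (fst i, x) \<odot> b (fst i))"
        by (rule add.finprod_mono_neutral_cong_right) (use True J finite_H in auto)
      also have "\<dots> = (\<Oplus>j\<in>J. c (j, x) \<odot> b j)"
        by (subst finsum_reindex) (auto simp: inj_on_def)
      finally show ?thesis using True by simp
    next
      case False
      then show ?thesis by (auto intro!: add.finprod_one_eqI)
    qed
    finally show ?thesis .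
  qed
  show ?thesis
  proof (rule is_basisI[OF kalg_skew])
    fix f assume f: "f \<in> carrier S"
    have "(\<Oplus>\<^bsub>S\<^esub>i\<in>J \<times> carrier H. (\<lambda>(j, g). B.crd (f g) j) i \<odot>\<^bsub>S\<^esub> (case i of (j, g) \<Rightarrow> se (b j) g)) = f"
      unfolding lc by (rule ext) (simp add: B.crd_expand skew_comp_closed[OF f] skew_zero_off[OF f])
    from this[symmetric] show "\<exists>c. f = (\<Oplus>\<^bsub>S\<^esub>i\<in>J \<times> carrier H. c i \<odot>\<^bsub>S\<^esub> (case i of (j, g) \<Rightarrow> se (b j) g))"
      by (rule exI[of _ "\<lambda>(j, g). B.crd (f g) j"])
  next
    fix c i assume 0: "(\<Oplus>\<^bsub>S\<^esub>i\<in>J \<times> carrier H. c i \<odot>\<^bsub>S\<^esub> (case i of (j, g) \<Rightarrow> se (b j) g)) = \<zero>\<^bsub>S\<^esub>"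
      and i: "i \<in> J \<times> carrier H"
    then obtain j g where jg: "i = (j, g)" "j \<in> J" "g \<in> carrier H" by auto
    have "(\<Oplus>j\<in>J. c (j, g) \<odot> b j) = \<zero>"
      using fun_cong[OF 0, of g] jg(3) unfolding lc by (simp add: skew_simps(4))
    then show "c i = 0" using B.crd_lc[OF jg(2), of "\<lambda>j. c (j, g)"] jg(1) by simp
  qed (use J finite_H in auto)
qed

lemma (in kalg) diff_mem_coset:
  assumes "ideal I A" "x \<in> carrier A" "y \<in> I +> x"
  shows "y \<in> carrier A \<and> I +> y = I +> x"
proof -
  interpret I: ideal I A by fact
  show ?thesis
    using assms(3) a_r_coset_subset_G[OF I.a_subset assms(2)]
      a_repr_independence[OF assms(3,2) I.a_subgroup] by auto
qed

section \<open>The algebras of the group action\<close>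

locale qdata = qext n q for n and q :: "nat \<Rightarrow> nat \<Rightarrow> 'k::field" +
  fixes scale :: "'k \<Rightarrow> 'v::ab_group_add \<Rightarrow> 'v" and v :: "nat \<Rightarrow> 'v" and G :: "('v \<Rightarrow> 'v) set"
  assumes vs: "vector_space scale"
    and v_inj: "inj_on v {1..n}"
    and v_indep: "\<not> module.dependent scale (v ` {1..n})"
    and v_span: "module.span scale (v ` {1..n}) = UNIV"
    and G_sub: "subgroup G (GL scale)" and finite_G: "finite G"
    and G_acts: "\<And>g. g \<in> G \<Longrightarrow> tensor_action scale v n g ` qext_ideal n q \<subseteq> qext_ideal n q"
begin

sublocale V: vector_space scale by (rule vs)

definition rp :: "'v \<Rightarrow> nat \<Rightarrow> 'k" where
  "rp x i = V.representation (v ` {1..n}) x (v i)"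

lemma rp_add: "rp (x + y) i = rp x i + rp y i"
  and rp_scale: "rp (scale c x) i = c * rp x i"
  using v_indep v_span by (simp_all add: rp_def V.representation_add V.representation_scale)

lemma rp_basis: "i \<in> {1..n} \<Longrightarrow> j \<in> {1..n} \<Longrightarrow> rp (v i) j = (if j = i then 1 else 0)"
  using v_indep v_inj by (auto simp: rp_def V.representation_basis inj_on_eq_iff)

lemma rp_expand: "(\<Sum>i\<in>{1..n}. scale (rp x i) (v i)) = x"
proof -
  have "(\<Sum>b\<in>v ` {1..n}. scale (V.representation (v ` {1..n}) x b) b) = x"
    by (rule V.sum_representation_eq) (use v_indep v_span in auto)
  then show ?thesis by (simp only: sum.reindex[OF v_inj] rp_def comp_def)
qed

lemma rp_sum: "rp (\<Sum>i\<in>X. f i) j = (\<Sum>i\<in>X. rp (f i) j)"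
proof (induction X rule: infinite_finite_induct)
  case empty
  show ?case using rp_scale[of 0 0 j] by simp
next
  case (infinite X)
  then show ?case using rp_scale[of 0 0 j] by simp
qed (simp add: rp_add)

abbreviation "lin g \<equiv> Vector_Spaces.linear scale scale g"

lemma lin_expand: "lin g \<Longrightarrow> g x = (\<Sum>i\<in>{1..n}. scale (rp x i) (g (v i)))"
proof -
  assume g: "lin g"
  interpret g: Vector_Spaces.linear scale scale g by (rule g)
  have "g x = g (\<Sum>i\<in>{1..n}. scale (rp x i) (v i))" by (simp only: rp_expand)
  then show ?thesis by (simp only: g.sum g.scale)
qed

section \<open>The action of linear maps on T(V)\<close>

abbreviation "tv \<equiv> tensor_vector scale v n"
abbreviation "act \<equiv> tensor_action scale v n"

lemma word_letter_closed [simp]: "i \<in> {1..n} \<Longrightarrow> word [i] \<in> carrier T"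
  by (rule word_closed) simp

lemma tv_eq: "tv x = (\<Oplus>\<^bsub>T\<^esub>i\<in>{1..n}. rp x i \<odot>\<^bsub>T\<^esub> word [i])"
  by (simp add: tensor_vector_def rp_def letter_word)

lemma tv_closed [simp]: "tv x \<in> carrier T"
  unfolding tv_eq by (intro T.finsum_in T.smult_closed word_letter_closed)

lemma tv_apply: "tv x w = (\<Sum>i\<in>{1..n}. rp x i * word [i] w)"
proof -
  have "tv x w = (\<Sum>i\<in>{1..n}. (rp x i \<odot>\<^bsub>T\<^esub> word [i]) w)"
    unfolding tv_eq by (rule tensor_finsum) (intro T.smult_closed word_letter_closed)
  then show ?thesis by (simp only: tensor_simps(5))
qed

lemma tv_basis: "i \<in> {1..n} \<Longrightarrow> tv (v i) = word [i]"
proof -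
  assume i: "i \<in> {1..n}"
  have "tv (v i) = rp (v i) i \<odot>\<^bsub>T\<^esub> word [i]"
    unfolding tv_eq by (rule T.finsum_single) (use i in \<open>simp_all add: rp_basis del: atLeastAtMost_iff\<close>)
  then show ?thesis using i by (simp add: rp_basis)
qed

lemma tv_sum: "tv (\<Sum>i\<in>X. scale (c i) (f i)) = (\<Oplus>\<^bsub>T\<^esub>i\<in>X. c i \<odot>\<^bsub>T\<^esub> tv (f i))"
proof
  fix w
  have "(\<Oplus>\<^bsub>T\<^esub>i\<in>X. c i \<odot>\<^bsub>T\<^esub> tv (f i)) w = (\<Sum>i\<in>X. (c i \<odot>\<^bsub>T\<^esub> tv (f i)) w)"
    by (rule tensor_finsum) (intro T.smult_closed tv_closed)
  also have "\<dots> = (\<Sum>i\<in>X. \<Sum>j\<in>{1..n}. c i * (rp (f i) j * word [j] w))"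
    by (simp only: tensor_simps(5) tv_apply sum_distrib_left)
  also have "\<dots> = (\<Sum>j\<in>{1..n}. \<Sum>i\<in>X. c i * (rp (f i) j * word [j] w))"
    by (rule sum.swap)
  also have "\<dots> = tv (\<Sum>i\<in>X. scale (c i) (f i)) w"
    by (simp only: tv_apply rp_sum rp_scale sum_distrib_right mult.assoc)
  finally show "tv (\<Sum>i\<in>X. scale (c i) (f i)) w = (\<Oplus>\<^bsub>T\<^esub>i\<in>X. c i \<odot>\<^bsub>T\<^esub> tv (f i)) w" by simp
qed

text \<open>Recognises the action as the endomorphism of the free algebra with v_i going to g v_i;
  its linearity and multiplicativity are then those of an evaluation.\<close>

lemma act_eval: "act g = tensor_eval T (\<lambda>i. tv (g (v i)))"
  by (simp add: tensor_action_def tensor_eval_def fun_eq_iff)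

lemma teval_act: "teval T n (\<lambda>i. tv (g (v i)))"
  by (intro teval.intro T.kalg_axioms teval_axioms.intro) simp

lemma linear_on_act: "linear_on T T (act g)"
  and act_mult: "x \<in> carrier T \<Longrightarrow> y \<in> carrier T \<Longrightarrow> act g (x \<otimes>\<^bsub>T\<^esub> y) = act g x \<otimes>\<^bsub>T\<^esub> act g y"
  and act_one: "act g \<one>\<^bsub>T\<^esub> = \<one>\<^bsub>T\<^esub>"
  and act_word: "set w \<subseteq> {1..n} \<Longrightarrow> act g (word w) = list_prod T (map (\<lambda>i. tv (g (v i))) w)"
  unfolding act_eval
  using teval.linear_on_ev[OF teval_act] teval.ev_mult[OF teval_act] teval.ev_one[OF teval_act] teval.ev_word[OF teval_act]
  by auto

lemma act_letter: "i \<in> {1..n} \<Longrightarrow> act g (word [i]) = tv (g (v i))"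
  by (subst act_word) simp_all

lemma act_tv:
  assumes g: "lin g" shows "act g (tv x) = tv (g x)"
proof -
  have "act g (tv x) = (\<Oplus>\<^bsub>T\<^esub>i\<in>{1..n}. act g (rp x i \<odot>\<^bsub>T\<^esub> word [i]))"
    unfolding tv_eq
    by (rule linear_on_finsum[OF T.kalg_axioms T.kalg_axioms linear_on_act]) (intro T.smult_closed word_letter_closed)
  also have "\<dots> = (\<Oplus>\<^bsub>T\<^esub>i\<in>{1..n}. rp x i \<odot>\<^bsub>T\<^esub> tv (g (v i)))"
    by (rule T.finsum_cong_all) (simp_all add: linear_onD[OF linear_on_act] act_letter del: atLeastAtMost_iff)
  also have "\<dots> = tv (g x)"
    using tv_sum[of "\<lambda>i. rp x i" "\<lambda>i. g (v i)" "{1..n}"] lin_expand[OF g, of x] by simp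
  finally show ?thesis .
qed

lemma act_list_prod:
  "set w \<subseteq> carrier T \<Longrightarrow> act g (list_prod T w) = list_prod T (map (act g) w)"
  by (induction w) (auto simp: act_one act_mult)

text \<open>On a word, \<open>act h\<close> yields a product of vectors h v_i, and
  \<open>act g\<close> is multiplicative, so everything rests on \<open>act_tv\<close>, that is, on
  the linearity of the outer map \<open>g\<close>.\<close>

lemma act_comp:
  assumes g: "lin g" and x: "x \<in> carrier T" shows "act (g \<circ> h) x = act g (act h x)"
  using x
proof (induction x rule: tensor_induct)
  case (word w)
  then show ?case by (simp add: act_word act_list_prod image_subset_iff act_tv[OF g] comp_def)
qed (simp_all add: linear_onD[OF linear_on_act] linear_on_zero[OF T.kalg_axioms T.kalg_axioms linear_on_act])

lemma list_prod_words: "set w \<subseteq> {1..n} \<Longrightarrow> list_prod T (map (\<lambda>i. word [i]) w) = word w"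
proof (induction w)
  case (Cons a w)
  then show ?case by (simp add: word_mult)
qed (simp add: word_Nil[of n])

lemma act_id:
  assumes x: "x \<in> carrier T" shows "act id x = x"
  using x
proof (induction x rule: tensor_induct)
  case (word w)
  have "map (\<lambda>i. tv (id (v i))) w = map (\<lambda>i. word [i]) w"
    using word by (auto simp: tv_basis simp del: atLeastAtMost_iff)
  then show ?case using word by (simp only: act_word list_prod_words)
qed (simp_all add: linear_onD[OF linear_on_act] linear_on_zero[OF T.kalg_axioms T.kalg_axioms linear_on_act])

lemma G_lin: "g \<in> G \<Longrightarrow> lin g"
  using subgroup.subset[OF G_sub] by (auto simp: GL_def comp_monoid_def)

text \<open>The point is that the inverse of a linear bijection is linear.\<close>

lemma group_GL: "group (GL scale)"
proof (rule groupI)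
  fix g assume "g \<in> carrier (GL scale)"
  then have g: "lin g" "bij g" by (auto simp: GL_def comp_monoid_def)
  interpret g: Vector_Spaces.linear scale scale g by (rule g(1))
  have "inj g" "surj g" using g(2) by (auto simp: bij_def)
  have "lin (inv_into UNIV g)"
    unfolding Vector_Spaces.linear_iff
  proof (intro conjI allI V.vector_space_axioms)
    fix x y c
    show "inv_into UNIV g (x + y) = inv_into UNIV g x + inv_into UNIV g y"
      using \<open>inj g\<close> \<open>surj g\<close> by (intro inv_f_eq) (simp_all add: g.add surj_f_inv_f)
    show "inv_into UNIV g (scale c x) = scale c (inv_into UNIV g x)"
      using \<open>inj g\<close> \<open>surj g\<close> by (intro inv_f_eq) (simp_all add: g.scale surj_f_inv_f)
  qed
  then show "\<exists>h\<in>carrier (GL scale). h \<otimes>\<^bsub>GL scale\<^esub> g = \<one>\<^bsub>GL scale\<^esub>"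
    using g \<open>inj g\<close> by (intro bexI[of _ "inv_into UNIV g"]) (auto simp: GL_def comp_monoid_def bij_imp_bij_inv)
next
  show "\<one>\<^bsub>GL scale\<^esub> \<in> carrier (GL scale)"
    using V.linear_id bij_id by (auto simp: GL_def comp_monoid_def id_def)
next
  fix g h assume "g \<in> carrier (GL scale)" "h \<in> carrier (GL scale)"
  then show "g \<otimes>\<^bsub>GL scale\<^esub> h \<in> carrier (GL scale)"
    by (auto simp: GL_def comp_monoid_def bij_comp Vector_Spaces.linear_iff)
qed (auto simp: GL_def comp_monoid_def)

abbreviation "H \<equiv> comp_monoid G"

lemma H_simps: "carrier H = G" "g \<otimes>\<^bsub>H\<^esub> h = g \<circ> h" "\<one>\<^bsub>H\<^esub> = id"
  by (simp_all add: comp_monoid_def)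

lemma group_H: "group H"
  using subgroup.subgroup_is_group[OF G_sub group_GL] by (simp add: GL_def comp_monoid_def)

sublocale H: group H by (rule group_H)

lemma G_comp [simp]: "g \<in> G \<Longrightarrow> h \<in> G \<Longrightarrow> g \<circ> h \<in> G"
  and G_id [simp]: "id \<in> G"
  using H.m_closed H.one_closed by (auto simp: H_simps)

lemma skew_TS: "skew T H act"
  by unfold_locales
    (auto simp: H_simps finite_G linear_on_act act_mult act_one act_id act_comp[OF G_lin])

sublocale TS: skew T H act by (rule skew_TS)

abbreviation "qact \<equiv> qext_action scale v n q"

text \<open>Here the invariance of the relations under G enters: it makes the union over
  representatives in \<open>qext_action\<close> a single coset.\<close>

lemma qact_qc:
  assumes g: "g \<in> G" and x: "x \<in> carrier T"
  shows "qact g (qc x) = qc (act g x)"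
proof -
  have "qc (act g y) = qc (act g x)" if "y \<in> qc x" for y
  proof -
    have y: "y \<in> carrier T" "qc y = qc x" using T.diff_mem_coset[OF ideal_IE x that] by auto
    then have "y \<ominus>\<^bsub>T\<^esub> x \<in> IE" using T.coset_eq_iff[OF ideal_IE y(1) x] by simp
    then have "act g (y \<ominus>\<^bsub>T\<^esub> x) \<in> IE" using G_acts[OF g] by blast
    then have "act g y \<ominus>\<^bsub>T\<^esub> act g x \<in> IE"
      using linear_on_diff[OF T.kalg_axioms T.kalg_axioms linear_on_act y(1) x] by simp
    then show ?thesis using T.coset_eq_iff[OF ideal_IE] linear_onD(1)[OF linear_on_act] y(1) x by simp
  qed
  moreover have "x \<in> qc x" using x by (rule IE.a_rcos_self)
  ultimately have "(\<Union>y\<in>qc x. qc (act g y)) = qc (act g x)"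
    by (intro UN_constant_eq[of x]) blast+
  then show ?thesis by (simp only: qext_action_def)
qed

lemma skew_QS: "skew Q H qact"
proof unfold_locales
  note act_c = linear_onD[OF linear_on_act]
  show "finite (carrier H)" by (simp add: H_simps finite_G)
  fix g assume "g \<in> carrier H" then have g: "g \<in> G" by (simp add: H_simps)
  note qq = qact_qc[OF g]
  show "linear_on Q Q (qact g)"
  proof (rule linear_onI)
    fix X assume "X \<in> carrier Q"
    then obtain x where x: "x \<in> carrier T" "X = qc x" by (rule Q_carrierE)
    show "qact g X \<in> carrier Q" by (simp add: x qq qc_linear act_c)
    show "qact g (c \<odot>\<^bsub>Q\<^esub> X) = c \<odot>\<^bsub>Q\<^esub> qact g X" for c
      by (simp add: x qq qc_linear(2,3)[symmetric] act_c)
  next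
    fix X Y assume "X \<in> carrier Q" "Y \<in> carrier Q"
    then obtain x y where x: "x \<in> carrier T" "X = qc x" "y \<in> carrier T" "Y = qc y" by (metis Q_carrierE)
    show "qact g (X \<oplus>\<^bsub>Q\<^esub> Y) = qact g X \<oplus>\<^bsub>Q\<^esub> qact g Y"
      by (simp add: x qq qc_linear(2,3)[symmetric] act_c)
  qed
  show "qact g \<one>\<^bsub>Q\<^esub> = \<one>\<^bsub>Q\<^esub>" by (simp add: Q_one qq act_one)
  show "qact g (X \<otimes>\<^bsub>Q\<^esub> Y) = qact g X \<otimes>\<^bsub>Q\<^esub> qact g Y" if "X \<in> carrier Q" "Y \<in> carrier Q" for X Y
  proof -
    from that obtain x y where x: "x \<in> carrier T" "X = qc x" "y \<in> carrier T" "Y = qc y" by (metis Q_carrierE)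
    show ?thesis by (simp add: x qq qc_mult act_mult act_c)
  qed
  show "qact (g \<otimes>\<^bsub>H\<^esub> h) X = qact g (qact h X)" if "h \<in> carrier H" "X \<in> carrier Q" for h X
  proof -
    from that obtain x where x: "x \<in> carrier T" "X = qc x" by (metis Q_carrierE)
    show ?thesis using g that(1) by (simp add: x H_simps qact_qc act_c act_comp[OF G_lin])
  qed
next
  fix X assume "X \<in> carrier Q"
  then obtain x where x: "x \<in> carrier T" "X = qc x" by (rule Q_carrierE)
  show "qact \<one>\<^bsub>H\<^esub> X = X" by (simp add: x H_simps qact_qc act_id)
qed

sublocale QS: skew Q H qact by (rule skew_QS)

abbreviation "S \<equiv> tensor_skew scale v n G"
abbreviation "A \<equiv> qext_skew scale v n G q"

lemma S_eq: "S = TS.S" and A_eq: "A = QS.S"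
  by (simp_all add: tensor_skew_def qext_skew_def)

sublocale S: kalg S unfolding S_eq by (rule TS.kalg_skew)
sublocale A: kalg A unfolding A_eq by (rule QS.kalg_skew)
sublocale PS: kpoly S ..
sublocale PA: kpoly A ..

abbreviation "yA \<equiv> qext_v n q"
abbreviation "uA \<equiv> qext_g n q"
abbreviation "bI \<equiv> expo n \<times> G"
abbreviation "bA \<equiv> \<lambda>(\<alpha>, g). list_prod A (map yA (wd n \<alpha>)) \<otimes>\<^bsub>A\<^esub> uA g"

lemma finite_bI: "finite bI" by (simp add: finite_G)

lemma yA_eq: "yA i = QS.se (qc (word [i])) id" and uA_eq: "uA g = QS.se \<one>\<^bsub>Q\<^esub> g"
  by (simp_all add: qext_v_def qext_g_def letter_word)

lemma yA_closed [simp]: "i \<in> {1..n} \<Longrightarrow> yA i \<in> carrier A"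
  unfolding A_eq yA_eq by (intro QS.se_closed qc_linear(1) word_letter_closed) (simp_all add: H_simps)

lemma uA_closed [simp]: "g \<in> G \<Longrightarrow> uA g \<in> carrier A"
  unfolding A_eq uA_eq by (intro QS.se_closed Q.one_closed) (simp_all add: H_simps)

lemma se_mult_Q:
  assumes "x \<in> carrier T" "y \<in> carrier T" "g \<in> G" "h \<in> G"
  shows "QS.se (qc x) g \<otimes>\<^bsub>A\<^esub> QS.se (qc y) h = QS.se (qc (x \<otimes>\<^bsub>T\<^esub> act g y)) (g \<circ> h)"
proof -
  have "QS.se (qc x) g \<otimes>\<^bsub>A\<^esub> QS.se (qc y) h = QS.se (qc x \<otimes>\<^bsub>Q\<^esub> qact g (qc y)) (g \<otimes>\<^bsub>H\<^esub> h)"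
    unfolding A_eq by (rule QS.se_mult) (simp_all only: H_simps assms qc_linear)
  then show ?thesis
    by (simp only: H_simps qact_qc[OF assms(3,2)] qc_mult[OF assms(1) linear_onD(1)[OF linear_on_act assms(2)]])
qed

lemma A_one: "\<one>\<^bsub>A\<^esub> = QS.se \<one>\<^bsub>Q\<^esub> id"
  by (simp only: A_eq QS.skew_simps(3) H_simps)

lemma yA_word: "set w \<subseteq> {1..n} \<Longrightarrow> list_prod A (map yA w) = QS.se (qc (word w)) id"
proof (induction w)
  case Nil
  show ?case unfolding list.map A.list_prod_Nil A_one Q_one word_Nil[of n] by (rule refl)
next
  case (Cons a w)
  then have w: "word w \<in> carrier T" "word [a] \<in> carrier T" "set w \<subseteq> {1..n}" by (auto intro!: word_closed)
  have "list_prod A (map yA (a # w)) = QS.se (qc (word [a])) id \<otimes>\<^bsub>A\<^esub> QS.se (qc (word w)) id"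
    by (simp only: list.map A.list_prod_Cons Cons.IH[OF w(3)] yA_eq)
  also have "\<dots> = QS.se (qc (word [a] \<otimes>\<^bsub>T\<^esub> act id (word w))) (id \<circ> id)"
    by (rule se_mult_Q) (simp_all only: w G_id)
  also have "\<dots> = QS.se (qc (word (a # w))) id"
    by (simp only: act_id[OF w(1)] word_mult comp_id append.simps)
  finally show ?case .
qed

lemma yA_word_uA:
  assumes "set w \<subseteq> {1..n}" "g \<in> G"
  shows "list_prod A (map yA w) \<otimes>\<^bsub>A\<^esub> uA g = QS.se (qc (word w)) g"
proof -
  have w: "word w \<in> carrier T" using assms by (intro word_closed)
  have "list_prod A (map yA w) \<otimes>\<^bsub>A\<^esub> uA g = QS.se (qc (word w \<otimes>\<^bsub>T\<^esub> act id \<one>\<^bsub>T\<^esub>)) (id \<circ> g)"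
    unfolding yA_word[OF assms(1)] uA_eq Q_one by (rule se_mult_Q) (simp_all only: w T.one_closed assms G_id)
  then show ?thesis by (simp only: act_one T.r_one[OF w] id_comp)
qed

lemma is_basis_A: "is_basis A bI bA"
proof -
  have eq: "bA i = (case i of (\<alpha>, g) \<Rightarrow> QS.se (qb \<alpha>) g)" if "i \<in> bI" for i
    using that yA_word_uA[OF wd_sorted(3)] by auto
  have bas: "is_basis A bI (\<lambda>(\<alpha>, g). QS.se (qb \<alpha>) g)"
    unfolding A_eq using QS.is_basis_skew[OF finite_expo is_basis_Q] by (simp only: H_simps)
  interpret B: fbasis A bI "\<lambda>(\<alpha>, g). QS.se (qb \<alpha>) g" by unfold_locales (rule finite_bI bas)+
  have lc: "(\<Oplus>\<^bsub>A\<^esub>i\<in>bI. c i \<odot>\<^bsub>A\<^esub> bA i) = (\<Oplus>\<^bsub>A\<^esub>i\<in>bI. c i \<odot>\<^bsub>A\<^esub> (case i of (\<alpha>, g) \<Rightarrow> QS.se (qb \<alpha>) g))" for c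
    by (rule A.finsum_cong_all) (simp_all add: eq B.b_closed del: split_paired_All)
  show ?thesis
  proof (rule is_basisI[OF A.kalg_axioms finite_bI])
    fix i assume "i \<in> bI" then show "bA i \<in> carrier A" using B.b_closed by (simp add: eq)
  next
    fix x assume x: "x \<in> carrier A"
    show "\<exists>c. x = (\<Oplus>\<^bsub>A\<^esub>i\<in>bI. c i \<odot>\<^bsub>A\<^esub> bA i)"
      unfolding lc by (rule exI[of _ "B.crd x"]) (simp only: B.crd_expand[OF x])
  next
    fix c i assume "(\<Oplus>\<^bsub>A\<^esub>i\<in>bI. c i \<odot>\<^bsub>A\<^esub> bA i) = \<zero>\<^bsub>A\<^esub>" and i: "i \<in> bI"
    then show "c i = 0" unfolding lc using B.crd_lc[OF i, of c] by (simp only: B.crd_zero)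
  qed
qed

sublocale BA: fbasis A bI bA
  by unfold_locales (fact finite_bI is_basis_A)+

lemma uA_mult: "g \<in> G \<Longrightarrow> h \<in> G \<Longrightarrow> uA g \<otimes>\<^bsub>A\<^esub> uA h = uA (g \<circ> h)"
  unfolding uA_eq Q_one using se_mult_Q[OF T.one_closed T.one_closed]
  by (simp only: act_one T.r_one[OF T.one_closed])

lemma uA_id: "uA id = \<one>\<^bsub>A\<^esub>"
  by (simp only: uA_eq A_one)

text \<open>The relation g v_i = (g v_i) g of a skew group algebra, expanded in the basis of V,
  which is the form that \<open>xalg\<close> asks for.\<close>

lemma uA_yA:
  assumes "g \<in> G" "i \<in> {1..n}"
  shows "uA g \<otimes>\<^bsub>A\<^esub> yA i = (\<Oplus>\<^bsub>A\<^esub>j\<in>{1..n}. rp (g (v i)) j \<odot>\<^bsub>A\<^esub> yA j) \<otimes>\<^bsub>A\<^esub> uA g"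
proof -
  have "uA g \<otimes>\<^bsub>A\<^esub> yA i = QS.se (qc (tv (g (v i)))) g"
    unfolding uA_eq yA_eq Q_one using assms by (subst se_mult_Q) (simp_all add: act_letter)
  also have "\<dots> = QS.se (qc (tv (g (v i)))) id \<otimes>\<^bsub>A\<^esub> uA g"
    unfolding uA_eq Q_one using assms by (subst se_mult_Q) (simp_all add: act_id)
  also have "QS.se (qc (tv (g (v i)))) id = (\<Oplus>\<^bsub>A\<^esub>j\<in>{1..n}. rp (g (v i)) j \<odot>\<^bsub>A\<^esub> yA j)"
  proof -
    have 1: "qc (tv x) = (\<Oplus>\<^bsub>Q\<^esub>j\<in>{1..n}. rp x j \<odot>\<^bsub>Q\<^esub> qc (word [j]))" for x
    proof -
      have "qc (tv x) = (\<Oplus>\<^bsub>Q\<^esub>j\<in>{1..n}. qc (rp x j \<odot>\<^bsub>T\<^esub> word [j]))"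
        unfolding tv_eq by (rule linear_on_finsum[OF T.kalg_axioms Q.kalg_axioms linear_on_qc])
          (intro T.smult_closed word_letter_closed)
      also have "\<dots> = (\<Oplus>\<^bsub>Q\<^esub>j\<in>{1..n}. rp x j \<odot>\<^bsub>Q\<^esub> qc (word [j]))"
        by (rule Q.finsum_cong_all) (simp_all add: qc_linear del: atLeastAtMost_iff)
      finally show ?thesis .
    qed
    have lin: "linear_on Q A (\<lambda>a. QS.se a id)" unfolding A_eq by (rule QS.linear_on_se) (simp add: H_simps)
    have "QS.se (qc (tv (g (v i)))) id = (\<Oplus>\<^bsub>A\<^esub>j\<in>{1..n}. QS.se (rp (g (v i)) j \<odot>\<^bsub>Q\<^esub> qc (word [j])) id)"
      unfolding 1 by (rule linear_on_finsum[OF Q.kalg_axioms A.kalg_axioms lin])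
        (intro Q.smult_closed qc_linear(1) word_letter_closed)
    also have "\<dots> = (\<Oplus>\<^bsub>A\<^esub>j\<in>{1..n}. rp (g (v i)) j \<odot>\<^bsub>A\<^esub> yA j)"
      by (rule A.finsum_cong_all) (simp_all add: linear_onD(3)[OF lin] qc_linear yA_eq[symmetric] del: atLeastAtMost_iff)
    finally show ?thesis .
  qed
  finally show ?thesis .
qed

lemma yA_swap:
  assumes "i \<in> {1..n}" "j \<in> {1..n}" "i \<noteq> j"
  shows "yA j \<otimes>\<^bsub>A\<^esub> yA i = q i j \<odot>\<^bsub>A\<^esub> (yA i \<otimes>\<^bsub>A\<^esub> yA j)"
proof -
  have lin: "linear_on Q A (\<lambda>a. QS.se a id)" unfolding A_eq by (rule QS.linear_on_se) (simp add: H_simps)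
  have "qc (word [j, i]) = q i j \<odot>\<^bsub>Q\<^esub> qc (word [i, j])"
    using qc_swap[of "[]" i j "[]"] assms by simp
  then show ?thesis
    using yA_word[of "[j, i]"] yA_word[of "[i, j]"] assms
      linear_onD(3)[OF lin qc_linear(1)[OF word_closed[of "[i, j]" n]]]
    by simp
qed

lemma yA_square:
  assumes "i \<in> {1..n}" shows "yA i \<otimes>\<^bsub>A\<^esub> yA i = \<zero>\<^bsub>A\<^esub>"
proof -
  have lin: "linear_on Q A (\<lambda>a. QS.se a id)" unfolding A_eq by (rule QS.linear_on_se) (simp add: H_simps)
  have "qc (word [i, i]) = \<zero>\<^bsub>Q\<^esub>"
    using qc_adjacent[of "[]" i "[]"] assms by simp
  then show ?thesis
    using yA_word[of "[i, i]"] assms linear_on_zero[OF Q.kalg_axioms A.kalg_axioms lin] by simp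
qed

section \<open>The grading in PBW coordinates\<close>

abbreviation "Deg \<equiv> qext_skew_degree scale v n G q"

lemma lc_bA_apply:
  "(\<Oplus>\<^bsub>A\<^esub>i\<in>bI. c i \<odot>\<^bsub>A\<^esub> bA i) g = (if g \<in> G then \<Oplus>\<^bsub>Q\<^esub>\<alpha>\<in>expo n. c (\<alpha>, g) \<odot>\<^bsub>Q\<^esub> qb \<alpha> else \<zero>\<^bsub>Q\<^esub>)"
proof -
  have comp: "(c i \<odot>\<^bsub>A\<^esub> bA i) g = (if snd i = g then c (fst i, g) \<odot>\<^bsub>Q\<^esub> qb (fst i) else \<zero>\<^bsub>Q\<^esub>)" if i: "i \<in> bI" for i
  proof -
    obtain \<alpha> h where ih: "i = (\<alpha>, h)" "h \<in> G" using i by auto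
    have "bA i = QS.se (qb \<alpha>) h" unfolding ih prod.case by (rule yA_word_uA[OF wd_sorted(3) ih(2)])
    then show ?thesis unfolding A_eq QS.skew_simps(6) ih by (simp add: skew_elem_def)
  qed
  have "(\<Oplus>\<^bsub>A\<^esub>i\<in>bI. c i \<odot>\<^bsub>A\<^esub> bA i) g = (\<Oplus>\<^bsub>Q\<^esub>i\<in>bI. (c i \<odot>\<^bsub>A\<^esub> bA i) g)"
    using A.smult_closed[OF BA.b_closed] unfolding A_eq by (intro QS.skew_finsum) blast
  also have "\<dots> = (\<Oplus>\<^bsub>Q\<^esub>i\<in>bI. if snd i = g then c (fst i, g) \<odot>\<^bsub>Q\<^esub> qb (fst i) else \<zero>\<^bsub>Q\<^esub>)"
    by (rule Q.finsum_cong_all) (simp_all only: comp, simp)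
  also have "\<dots> = (if g \<in> G then \<Oplus>\<^bsub>Q\<^esub>\<alpha>\<in>expo n. c (\<alpha>, g) \<odot>\<^bsub>Q\<^esub> qb \<alpha> else \<zero>\<^bsub>Q\<^esub>)"
  proof (cases "g \<in> G")
    case True
    have "(\<Oplus>\<^bsub>Q\<^esub>i\<in>bI. if snd i = g then c (fst i, g) \<odot>\<^bsub>Q\<^esub> qb (fst i) else \<zero>\<^bsub>Q\<^esub>) =
      (\<Oplus>\<^bsub>Q\<^esub>i\<in>(\<lambda>\<alpha>. (\<alpha>, g)) ` expo n. c (fst i, g) \<odot>\<^bsub>Q\<^esub> qb (fst i))"
      by (rule Q.add.finprod_mono_neutral_cong_right) (use True finite_G in auto)
    also have "\<dots> = (\<Oplus>\<^bsub>Q\<^esub>\<alpha>\<in>expo n. c (\<alpha>, g) \<odot>\<^bsub>Q\<^esub> qb \<alpha>)"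
      by (subst Q.finsum_reindex) (auto simp: inj_on_def)
    finally show ?thesis using True by simp
  next
    case False
    then have "snd i \<noteq> g" if "i \<in> bI" for i using that by auto
    then show ?thesis using False by (simp add: Q.add.finprod_one_eqI)
  qed
  finally show ?thesis .
qed

text \<open>The grading is defined through homogeneous lifts to T(V). The coordinates of an element
  are the \<open>nf\<close> of its lifts, and \<open>nf\<close> only compares words of equal length;
  conversely the combination of increasing words with these coordinates is a homogeneous
  lift.\<close>

lemma Deg_iff: "a \<in> Deg d \<longleftrightarrow> a \<in> carrier A \<and> (\<forall>i\<in>bI. BA.crd a i \<noteq> 0 \<longrightarrow> int (length (wd n (fst i))) = d)"
proof
  assume a: "a \<in> Deg d"
  then have ac: "a \<in> carrier A" by (simp add: qext_skew_degree_def)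
  \<comment> \<open>Chooses the lifts for all group elements at once, so that one coefficient family
    can be formed from them.\<close>
  have "\<exists>x. \<forall>g\<in>G. x g \<in> carrier T \<and> (\<forall>w. x g w \<noteq> 0 \<longrightarrow> int (length w) = d) \<and> a g = qc (x g)"
    using a unfolding qext_skew_degree_def by (intro bchoice) auto
  then obtain x where x: "\<And>g. g \<in> G \<Longrightarrow> x g \<in> carrier T" "\<And>g. g \<in> G \<Longrightarrow> a g = qc (x g)"
    and hom: "\<And>g w. g \<in> G \<Longrightarrow> x g w \<noteq> 0 \<Longrightarrow> int (length w) = d" by blast
  let ?c = "\<lambda>(\<alpha>, g). nf (x g) \<alpha>"
  have "(\<Oplus>\<^bsub>A\<^esub>i\<in>bI. ?c i \<odot>\<^bsub>A\<^esub> bA i) = a"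
  proof
    fix g
    have "a g = \<zero>\<^bsub>Q\<^esub>" if "g \<notin> G"
      using ac that unfolding A_eq by (intro QS.skew_zero_off) (simp_all add: H_simps)
    then show "(\<Oplus>\<^bsub>A\<^esub>i\<in>bI. ?c i \<odot>\<^bsub>A\<^esub> bA i) g = a g"
      unfolding lc_bA_apply using qc_expand[OF x(1)] x(2) by simp
  qed
  then have c: "BA.crd a i = ?c i" if "i \<in> bI" for i using BA.crd_lc[OF that, of ?c] by simp
  have "int (length (wd n (fst i))) = d" if i: "i \<in> bI" "BA.crd a i \<noteq> 0" for i
  proof -
    obtain \<alpha> g where ih: "i = (\<alpha>, g)" "g \<in> G" using i by auto
    have "nf (x g) \<alpha> \<noteq> 0" using c[OF i(1)] i(2) ih(1) by simp
    then obtain w where "mset w = mset (wd n \<alpha>)" "x g w * cf w \<noteq> 0"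
      unfolding nf_def by (auto elim!: sum.not_neutral_contains_not_neutral)
    then show ?thesis using hom[OF ih(2), of w] ih(1) by (auto dest: mset_eq_length)
  qed
  then show "a \<in> carrier A \<and> (\<forall>i\<in>bI. BA.crd a i \<noteq> 0 \<longrightarrow> int (length (wd n (fst i))) = d)"
    using ac by blast
next
  assume a: "a \<in> carrier A \<and> (\<forall>i\<in>bI. BA.crd a i \<noteq> 0 \<longrightarrow> int (length (wd n (fst i))) = d)"
  have "\<exists>x\<in>carrier T. (\<forall>w. x w \<noteq> 0 \<longrightarrow> int (length w) = d) \<and> a g = qc x" if g: "g \<in> G" for g
  proof -
    let ?x = "\<Oplus>\<^bsub>T\<^esub>\<alpha>\<in>expo n. BA.crd a (\<alpha>, g) \<odot>\<^bsub>T\<^esub> word (wd n \<alpha>)"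
    have wc: "word (wd n \<alpha>) \<in> carrier T" for \<alpha> by (intro word_closed wd_sorted)
    have x: "?x \<in> carrier T" by (intro T.finsum_in T.smult_closed wc)
    have "int (length w) = d" if "?x w \<noteq> 0" for w
    proof -
      have "?x w = (\<Sum>\<alpha>\<in>expo n. (BA.crd a (\<alpha>, g) \<odot>\<^bsub>T\<^esub> word (wd n \<alpha>)) w)"
        by (rule tensor_finsum) (intro T.smult_closed wc)
      then have "(\<Sum>\<alpha>\<in>expo n. BA.crd a (\<alpha>, g) * word (wd n \<alpha>) w) \<noteq> 0"
        using that by (simp add: tensor_simps(5))
      then obtain \<alpha> where "\<alpha> \<in> expo n" "BA.crd a (\<alpha>, g) * word (wd n \<alpha>) w \<noteq> 0"
        by (meson sum.not_neutral_contains_not_neutral)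
      then show ?thesis using a g by (auto simp: word_def split: if_splits)
    qed
    moreover have "a g = qc ?x"
    proof -
      have "a g = (\<Oplus>\<^bsub>A\<^esub>i\<in>bI. BA.crd a i \<odot>\<^bsub>A\<^esub> bA i) g" using BA.crd_expand a by simp
      also have "\<dots> = (\<Oplus>\<^bsub>Q\<^esub>\<alpha>\<in>expo n. BA.crd a (\<alpha>, g) \<odot>\<^bsub>Q\<^esub> qb \<alpha>)"
        unfolding lc_bA_apply using g by simp
      also have "\<dots> = (\<Oplus>\<^bsub>Q\<^esub>\<alpha>\<in>expo n. qc (BA.crd a (\<alpha>, g) \<odot>\<^bsub>T\<^esub> word (wd n \<alpha>)))"
        by (rule Q.finsum_cong_all) (simp_all add: qc_linear wc)
      also have "\<dots> = qc ?x"
        by (rule linear_on_finsum[OF T.kalg_axioms Q.kalg_axioms linear_on_qc, symmetric]) (intro T.smult_closed wc)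
      finally show ?thesis .
    qed
    ultimately show ?thesis using x by blast
  qed
  then show "a \<in> Deg d" using a by (simp add: qext_skew_degree_def)
qed

end

section \<open>Algebras over \<open>K[t]\<close> with generators \<open>v i\<close> and \<open>g\<close>\<close>

text \<open>Subspaces over K, as opposed to K[t]-submodules: homogeneous elements of a fixed degree
  are closed under constants, while t raises the degree.\<close>

definition ksub :: "('k::field poly, 'b) module \<Rightarrow> 'b set \<Rightarrow> bool" where
  "ksub M N \<longleftrightarrow> \<zero>\<^bsub>M\<^esub> \<in> N \<and> (\<forall>x\<in>N. \<forall>y\<in>N. x \<oplus>\<^bsub>M\<^esub> y \<in> N) \<and> (\<forall>c. \<forall>x\<in>N. [:c:] \<odot>\<^bsub>M\<^esub> x \<in> N)"

definition psub :: "('k::field poly, 'b) module \<Rightarrow> 'b set \<Rightarrow> bool" where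
  "psub M N \<longleftrightarrow> \<zero>\<^bsub>M\<^esub> \<in> N \<and> (\<forall>x\<in>N. \<forall>y\<in>N. x \<oplus>\<^bsub>M\<^esub> y \<in> N) \<and> (\<forall>p. \<forall>x\<in>N. p \<odot>\<^bsub>M\<^esub> x \<in> N)"

lemma psub_ksub: "psub M N \<Longrightarrow> ksub M N"
  by (simp add: psub_def ksub_def)

lemma (in kalg) sub_finsum:
  assumes N: "\<zero> \<in> N" "\<And>x y. x \<in> N \<Longrightarrow> y \<in> N \<Longrightarrow> x \<oplus> y \<in> N" "N \<subseteq> carrier A"
    and f: "\<And>i. i \<in> X \<Longrightarrow> f i \<in> N"
  shows "finsum A f X \<in> N"
  using f
proof (induction X rule: infinite_finite_induct)
  case (insert a F)
  then have "f \<in> F \<rightarrow> carrier A" "f a \<in> carrier A" using N(3) by auto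
  then show ?case using insert N by simp
qed (use N in auto)

text \<open>Letters \<open>x i\<close> and group elements \<open>u g\<close> in a K[t]-algebra with
  the relations of a skew group algebra and none between the letters. It is instantiated in T(V) x G
  [t], its quotient, A[t] and the deformed algebra; \<open>r g i\<close> holds the coordinates of g
  v_i.\<close>

locale xalg = kalg M for M :: "('k::field poly, 'b) module" (structure) +
  fixes n :: nat and G :: "('v \<Rightarrow> 'v) set" and r :: "('v \<Rightarrow> 'v) \<Rightarrow> nat \<Rightarrow> nat \<Rightarrow> 'k"
    and x :: "nat \<Rightarrow> 'b" and u :: "('v \<Rightarrow> 'v) \<Rightarrow> 'b"
  assumes G1: "id \<in> G" and G2: "g \<in> G \<Longrightarrow> h \<in> G \<Longrightarrow> g \<circ> h \<in> G"
    and x_closed [simp]: "i \<in> {1..n} \<Longrightarrow> x i \<in> carrier M"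
    and u_closed [simp]: "g \<in> G \<Longrightarrow> u g \<in> carrier M"
    and u_mult: "g \<in> G \<Longrightarrow> h \<in> G \<Longrightarrow> u g \<otimes> u h = u (g \<circ> h)"
    and u_id: "u id = \<one>"
    and u_x: "g \<in> G \<Longrightarrow> i \<in> {1..n} \<Longrightarrow> u g \<otimes> x i = (\<Oplus>j\<in>{1..n}. [:r g i j:] \<odot> x j) \<otimes> u g"
begin

definition xw :: "nat list \<Rightarrow> 'b" where "xw w = list_prod M (map x w)"

definition e :: "nat list \<Rightarrow> ('v \<Rightarrow> 'v) \<Rightarrow> 'b" where "e w g = xw w \<otimes> u g"

lemma xw_closed [simp]: "set w \<subseteq> {1..n} \<Longrightarrow> xw w \<in> carrier M"
  unfolding xw_def using x_closed by (intro list_prod_closed) (auto simp del: atLeastAtMost_iff)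

lemma e_closed [simp]: "set w \<subseteq> {1..n} \<Longrightarrow> g \<in> G \<Longrightarrow> e w g \<in> carrier M"
  by (simp add: e_def del: One_nat_def)

lemma xw_append: "set a \<subseteq> {1..n} \<Longrightarrow> set b \<subseteq> {1..n} \<Longrightarrow> xw (a @ b) = xw a \<otimes> xw b"
  unfolding xw_def map_append using x_closed by (intro list_prod_append) (auto simp del: atLeastAtMost_iff)

lemma xw_simps: "xw [] = \<one>" "xw (i # w) = x i \<otimes> xw w" "i \<in> {1..n} \<Longrightarrow> xw [i] = x i"
  by (simp_all add: xw_def del: One_nat_def atLeastAtMost_iff)

lemma e_Nil: "g \<in> G \<Longrightarrow> e [] g = u g"
  by (simp add: e_def xw_simps)

lemma e_single: "i \<in> {1..n} \<Longrightarrow> e [i] id = x i"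
  by (simp add: e_def xw_simps u_id del: One_nat_def atLeastAtMost_iff)

lemma e_u: "set w \<subseteq> {1..n} \<Longrightarrow> g \<in> G \<Longrightarrow> h \<in> G \<Longrightarrow> e w g \<otimes> u h = e w (g \<circ> h)"
  by (simp add: e_def m_assoc u_mult del: One_nat_def)

text \<open>Carrying a letter leftwards past \<open>u g\<close> replaces it by a combination of
  letters but keeps the length; the remaining factor \<open>z\<close> is left in place, which allows
  the step to be repeated.\<close>

lemma e_mid_x:
  assumes w: "set w \<subseteq> {1..n}" and g: "g \<in> G" and i: "i \<in> {1..n}" and z: "z \<in> carrier M"
  shows "xw w \<otimes> u g \<otimes> (x i \<otimes> z) = (\<Oplus>j\<in>{1..n}. [:r g i j:] \<odot> (xw (w @ [j]) \<otimes> u g \<otimes> z))"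
proof -
  have xj: "x j \<in> carrier M" if "j \<in> {1..n}" for j using that by (rule x_closed)
  have s: "(\<Oplus>j\<in>{1..n}. [:r g i j:] \<odot> x j) \<in> carrier M"
    by (intro finsum_in smult_closed xj)
  have "xw w \<otimes> u g \<otimes> (x i \<otimes> z) = xw w \<otimes> (u g \<otimes> x i) \<otimes> z"
    by (simp only: m_assoc m_closed xw_closed[OF w] u_closed[OF g] xj[OF i] z)
  also have "\<dots> = xw w \<otimes> (\<Oplus>j\<in>{1..n}. [:r g i j:] \<odot> x j) \<otimes> (u g \<otimes> z)"
    unfolding u_x[OF g i] by (simp only: m_assoc m_closed xw_closed[OF w] u_closed[OF g] s z)
  also have "xw w \<otimes> (\<Oplus>j\<in>{1..n}. [:r g i j:] \<odot> x j) = (\<Oplus>j\<in>{1..n}. xw w \<otimes> ([:r g i j:] \<odot> x j))"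
    by (rule finsum_rdistr) (use xj w in auto)
  also have "\<dots> \<otimes> (u g \<otimes> z) = (\<Oplus>j\<in>{1..n}. xw w \<otimes> ([:r g i j:] \<odot> x j) \<otimes> (u g \<otimes> z))"
    by (rule finsum_ldistr) (use xj w g z in auto)
  also have "\<dots> = (\<Oplus>j\<in>{1..n}. [:r g i j:] \<odot> (xw (w @ [j]) \<otimes> u g \<otimes> z))"
  proof (rule finsum_cong_all)
    fix j assume j: "j \<in> {1..n}"
    have "xw (w @ [j]) = xw w \<otimes> x j" using xw_append[of w "[j]"] w j by (simp add: xw_simps(3) del: One_nat_def)
    then show "xw w \<otimes> ([:r g i j:] \<odot> x j) \<otimes> (u g \<otimes> z) = [:r g i j:] \<odot> (xw (w @ [j]) \<otimes> u g \<otimes> z)"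
      by (simp only: smult_mult_left smult_mult_right m_assoc m_closed xw_closed[OF w] u_closed[OF g] xj[OF j] z smult_closed)
    show "[:r g i j:] \<odot> (xw (w @ [j]) \<otimes> u g \<otimes> z) \<in> carrier M"
      using w j g z by (intro smult_closed m_closed xw_closed u_closed) auto
  qed
  finally show ?thesis .
qed

lemma e_x:
  assumes "set w \<subseteq> {1..n}" "g \<in> G" "i \<in> {1..n}"
  shows "e w g \<otimes> x i = (\<Oplus>j\<in>{1..n}. [:r g i j:] \<odot> e (w @ [j]) g)"
proof -
  have c: "e (w @ [j]) g \<in> carrier M" if "j \<in> {1..n}" for j
    using that assms by (intro e_closed) auto
  have "e w g \<otimes> x i = xw w \<otimes> u g \<otimes> (x i \<otimes> \<one>)" using x_closed[OF assms(3)] by (simp add: e_def)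
  also have "\<dots> = (\<Oplus>j\<in>{1..n}. [:r g i j:] \<odot> (e (w @ [j]) g \<otimes> \<one>))"
    unfolding e_def by (rule e_mid_x) (use assms in auto)
  also have "\<dots> = (\<Oplus>j\<in>{1..n}. [:r g i j:] \<odot> e (w @ [j]) g)"
    by (rule finsum_cong_all) (simp_all only: r_one c smult_closed)
  finally show ?thesis .
qed

text \<open>The letters of \<open>b\<close> cross \<open>h\<close> one after the other, so the
  product lies in the K-span of monomials whose word has length
  \<open>length a + length b\<close>.\<close>

lemma e_straight:
  assumes N: "ksub M N" "N \<subseteq> carrier M"
    and e: "\<And>w g. set w \<subseteq> {1..n} \<Longrightarrow> length w = k \<Longrightarrow> g \<in> G \<Longrightarrow> e w g \<in> N"
  shows "set a \<subseteq> {1..n} \<Longrightarrow> set b \<subseteq> {1..n} \<Longrightarrow> length a + length b = k \<Longrightarrow> h \<in> G \<Longrightarrow> g \<in> G \<Longrightarrow>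
    e a h \<otimes> e b g \<in> N"
proof (induction b arbitrary: a)
  case Nil
  then show ?case using e[of a "h \<circ> g"] by (simp add: e_Nil e_u G2 del: One_nat_def)
next
  case (Cons i b)
  have i: "i \<in> {1..n}" "set b \<subseteq> {1..n}" using Cons.prems by auto
  have "e a h \<otimes> e (i # b) g = xw a \<otimes> u h \<otimes> (x i \<otimes> (xw b \<otimes> u g))"
    unfolding e_def xw_simps(2) using Cons.prems i x_closed[OF i(1)] by (simp add: m_assoc del: One_nat_def)
  also have "\<dots> = (\<Oplus>j\<in>{1..n}. [:r h i j:] \<odot> (e (a @ [j]) h \<otimes> e b g))"
    unfolding e_def using Cons.prems i by (intro e_mid_x) (auto intro!: m_closed)
  also have "\<dots> \<in> N"
  proof (rule sub_finsum)
    fix j assume "j \<in> {1..n}"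
    then have "e (a @ [j]) h \<otimes> e b g \<in> N" using Cons.prems i by (intro Cons.IH) auto
    then show "[:r h i j:] \<odot> (e (a @ [j]) h \<otimes> e b g) \<in> N" using N(1) by (simp add: ksub_def)
  qed (use N in \<open>auto simp: ksub_def\<close>)
  finally show ?case .
qed

text \<open>Sorting the letters changes a word only by shorter ones, so PBW monomials span.\<close>

lemma e_span:
  assumes N: "psub M N" "N \<subseteq> carrier M" and finG: "finite G"
    and swap: "\<And>i j. i \<in> {1..n} \<Longrightarrow> j \<in> {1..n} \<Longrightarrow> i \<noteq> j \<Longrightarrow>
      x j \<otimes> x i = [:qq i j:] \<odot> (x i \<otimes> x j) \<oplus> [:0, 1:] \<odot> (\<Oplus>h\<in>G. [:\<kappa> i j h:] \<odot> u h)"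
    and square: "\<And>i. i \<in> {1..n} \<Longrightarrow> x i \<otimes> x i = \<zero>"
    and e: "\<And>\<alpha> g. \<alpha> \<in> expo n \<Longrightarrow> g \<in> G \<Longrightarrow> e (wd n \<alpha>) g \<in> N"
  shows "set w \<subseteq> {1..n} \<Longrightarrow> g \<in> G \<Longrightarrow> e w g \<in> N"
proof (induction "length w" arbitrary: w g rule: less_induct)
  case less
  note IH = less.hyps
  note N' = N[unfolded psub_def]
  \<comment> \<open>Inside the induction on length, an induction along sorting; its claim is
    confined to words of the length of \<open>w\<close>, so that the outer hypothesis covers the
    shorter words that appear.\<close>
  have "\<forall>g\<in>G. length z = length w \<longrightarrow> e z g \<in> N" if "set z \<subseteq> {1..n}" for z
    using that
  proof (induction z rule: sort_induct)
    case (sorted z)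
    then show ?case using e[OF idx_expo[of n "set z"]] by (simp add: wd_idx del: One_nat_def)
  next
    case (adjacent a i b)
    have c: "set a \<subseteq> {1..n}" "set b \<subseteq> {1..n}" "i \<in> {1..n}" using adjacent by auto
    have "xw (a @ i # i # b) = xw a \<otimes> (x i \<otimes> x i) \<otimes> xw b"
      using xw_append[OF c(1), of "i # i # b"] c x_closed[OF c(3)] by (simp add: xw_simps m_assoc del: One_nat_def atLeastAtMost_iff)
    also have "\<dots> = \<zero>" using c by (simp add: square del: One_nat_def atLeastAtMost_iff)
    finally show ?case using N' by (simp add: e_def)
  next
    case (swap a i j b)
    have c: "set a \<subseteq> {1..n}" "set b \<subseteq> {1..n}" "i \<in> {1..n}" "j \<in> {1..n}" using swap(1) by auto
    show ?case
    proof (intro ballI impI)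
      fix g assume g: "g \<in> G" and len: "length (a @ j # i # b) = length w"
      let ?k = "\<Oplus>h\<in>G. [:\<kappa> i j h:] \<odot> u h"
      note cl = xw_closed[OF c(1)] xw_closed[OF c(2)] x_closed[OF c(3)] x_closed[OF c(4)] u_closed[OF g]
      have uc: "u h \<in> carrier M" if "h \<in> G" for h using that by simp
      have k: "?k \<in> carrier M" by (intro finsum_in smult_closed uc)
      have "e (a @ j # i # b) g = xw a \<otimes> (x j \<otimes> x i) \<otimes> (xw b \<otimes> u g)"
        unfolding e_def using xw_append[OF c(1), of "j # i # b"] c(2-4) cl
        by (simp add: xw_simps m_assoc del: One_nat_def atLeastAtMost_iff)
      also have "\<dots> = [:qq i j:] \<odot> (xw a \<otimes> (x i \<otimes> x j) \<otimes> (xw b \<otimes> u g)) \<oplus> [:0, 1:] \<odot> (xw a \<otimes> ?k \<otimes> (xw b \<otimes> u g))"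
        unfolding assms(4)[OF c(3,4) less_imp_neq[OF swap(2)]]
        using cl k by (simp add: l_distr r_distr smult_mult_left smult_mult_right)
      also have "xw a \<otimes> (x i \<otimes> x j) \<otimes> (xw b \<otimes> u g) = e (a @ i # j # b) g"
        unfolding e_def using xw_append[OF c(1), of "i # j # b"] c(2-4) cl
        by (simp add: xw_simps m_assoc del: One_nat_def atLeastAtMost_iff)
      also have "xw a \<otimes> ?k \<otimes> (xw b \<otimes> u g) = (\<Oplus>h\<in>G. [:\<kappa> i j h:] \<odot> (e a h \<otimes> e b g))"
      proof -
        have "xw a \<otimes> ?k = (\<Oplus>h\<in>G. xw a \<otimes> ([:\<kappa> i j h:] \<odot> u h))"
          by (rule finsum_rdistr) (use finG cl in auto)
        also have "\<dots> \<otimes> (xw b \<otimes> u g) = (\<Oplus>h\<in>G. xw a \<otimes> ([:\<kappa> i j h:] \<odot> u h) \<otimes> (xw b \<otimes> u g))"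
          by (rule finsum_ldistr) (use finG cl in auto)
        also have "\<dots> = (\<Oplus>h\<in>G. [:\<kappa> i j h:] \<odot> (e a h \<otimes> e b g))"
          by (rule finsum_cong_all) (use cl in \<open>simp_all add: e_def smult_mult_left smult_mult_right\<close>)
        finally show ?thesis .
      qed
      finally have eq: "e (a @ j # i # b) g = [:qq i j:] \<odot> e (a @ i # j # b) g \<oplus>
        [:0, 1:] \<odot> (\<Oplus>h\<in>G. [:\<kappa> i j h:] \<odot> (e a h \<otimes> e b g))" .
      \<comment> \<open>The correction term of a swap has lost two letters. Straightening it gives
        words of length \<open>length a + length b\<close>, to which the induction on length
        applies.\<close>
      have "e a h \<otimes> e b g \<in> N" if "h \<in> G" for h
      proof (rule e_straight[OF psub_ksub[OF N(1)] N(2)])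
        fix w' g' assume "set w' \<subseteq> {1..n}" "length w' = length a + length b" "g' \<in> G"
        then show "e w' g' \<in> N" using len by (intro IH) auto
      qed (use c g that in auto)
      then have "(\<Oplus>h\<in>G. [:\<kappa> i j h:] \<odot> (e a h \<otimes> e b g)) \<in> N"
        using N' by (intro sub_finsum) auto
      moreover have "e (a @ i # j # b) g \<in> N" using swap(3) g len by simp
      ultimately show "e (a @ j # i # b) g \<in> N" unfolding eq using N' by blast
    qed
  qed
  then show ?case using less.prems by blast
qed

end

section \<open>The polynomial algebra over \<open>T(V) \<rtimes> G\<close>\<close>

context qdata
begin

abbreviation "P \<equiv> poly_algebra S"
abbreviation "rr \<equiv> \<lambda>g i. rp (g (v i))"
abbreviation "xP i \<equiv> tmonom S (tensor_v n i) 0"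
abbreviation "uP g \<equiv> tmonom S (tensor_g n g) 0"

lemma tensor_v_eq: "tensor_v n i = TS.se (word [i]) id" and tensor_g_eq: "tensor_g n g = TS.se \<one>\<^bsub>T\<^esub> g"
  by (simp_all add: tensor_v_def tensor_g_def letter_word)

lemma se_closed_S: "a \<in> carrier T \<Longrightarrow> g \<in> G \<Longrightarrow> TS.se a g \<in> carrier S"
  unfolding S_eq by (rule TS.se_closed) (simp_all add: H_simps)

lemma se_mult_S:
  "a \<in> carrier T \<Longrightarrow> b \<in> carrier T \<Longrightarrow> g \<in> G \<Longrightarrow> h \<in> G \<Longrightarrow>
    TS.se a g \<otimes>\<^bsub>S\<^esub> TS.se b h = TS.se (a \<otimes>\<^bsub>T\<^esub> act g b) (g \<circ> h)"
  unfolding S_eq by (subst TS.se_mult) (simp_all add: H_simps)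

lemma linear_on_se_S: "g \<in> G \<Longrightarrow> linear_on T S (\<lambda>a. TS.se a g)"
  unfolding S_eq by (rule TS.linear_on_se) (simp add: H_simps)

lemma tensor_v_closed: "i \<in> {1..n} \<Longrightarrow> tensor_v n i \<in> carrier S"
  unfolding tensor_v_eq by (intro se_closed_S word_letter_closed G_id)

lemma tensor_g_closed: "g \<in> G \<Longrightarrow> tensor_g n g \<in> carrier S"
  unfolding tensor_g_eq by (intro se_closed_S T.one_closed)

lemma S_one: "\<one>\<^bsub>S\<^esub> = TS.se \<one>\<^bsub>T\<^esub> id"
  by (simp only: S_eq TS.skew_simps(3) H_simps)

lemma tensor_g_mult: "g \<in> G \<Longrightarrow> h \<in> G \<Longrightarrow> tensor_g n g \<otimes>\<^bsub>S\<^esub> tensor_g n h = tensor_g n (g \<circ> h)"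
  unfolding tensor_g_eq using se_mult_S[OF T.one_closed T.one_closed]
  by (simp only: act_one T.r_one[OF T.one_closed])

lemma tensor_g_v:
  assumes "g \<in> G" "i \<in> {1..n}"
  shows "tensor_g n g \<otimes>\<^bsub>S\<^esub> tensor_v n i = (\<Oplus>\<^bsub>S\<^esub>j\<in>{1..n}. rp (g (v i)) j \<odot>\<^bsub>S\<^esub> tensor_v n j) \<otimes>\<^bsub>S\<^esub> tensor_g n g"
proof -
  have "tensor_g n g \<otimes>\<^bsub>S\<^esub> tensor_v n i = TS.se (\<one>\<^bsub>T\<^esub> \<otimes>\<^bsub>T\<^esub> act g (word [i])) (g \<circ> id)"
    unfolding tensor_g_eq tensor_v_eq by (rule se_mult_S) (simp_all add: assms(1) word_letter_closed[OF assms(2)])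
  also have "\<dots> = TS.se (tv (g (v i))) g" by (simp add: act_letter[OF assms(2)])
  also have "\<dots> = TS.se (tv (g (v i)) \<otimes>\<^bsub>T\<^esub> act id \<one>\<^bsub>T\<^esub>) (id \<circ> g)" by (simp add: act_one)
  also have "\<dots> = TS.se (tv (g (v i))) id \<otimes>\<^bsub>S\<^esub> tensor_g n g"
    unfolding tensor_g_eq by (rule se_mult_S[symmetric]) (simp_all add: assms(1))
  also have "TS.se (tv (g (v i))) id = (\<Oplus>\<^bsub>S\<^esub>j\<in>{1..n}. rp (g (v i)) j \<odot>\<^bsub>S\<^esub> tensor_v n j)"
  proof -
    note lin = linear_on_se_S[OF G_id]
    have "TS.se (tv (g (v i))) id = (\<Oplus>\<^bsub>S\<^esub>j\<in>{1..n}. TS.se (rp (g (v i)) j \<odot>\<^bsub>T\<^esub> word [j]) id)"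
      unfolding tv_eq by (rule linear_on_finsum[OF T.kalg_axioms S.kalg_axioms lin])
        (intro T.smult_closed word_letter_closed)
    also have "\<dots> = (\<Oplus>\<^bsub>S\<^esub>j\<in>{1..n}. rp (g (v i)) j \<odot>\<^bsub>S\<^esub> tensor_v n j)"
    proof (rule S.finsum_cong_all)
      fix j assume j: "j \<in> {1..n}"
      show "TS.se (rp (g (v i)) j \<odot>\<^bsub>T\<^esub> word [j]) id = rp (g (v i)) j \<odot>\<^bsub>S\<^esub> tensor_v n j"
        unfolding tensor_v_eq by (rule linear_onD(3)[OF lin word_letter_closed[OF j]])
      show "rp (g (v i)) j \<odot>\<^bsub>S\<^esub> tensor_v n j \<in> carrier S" by (intro S.smult_closed tensor_v_closed j)
    qed
    finally show ?thesis .
  qed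
  finally show ?thesis .
qed

end

declare (in kpoly) U.monom_add [simp del] U.monom_one [simp del] U.monom_zero [simp del]

lemma (in kpoly) tmonom_zero: "tmonom A \<zero> m = \<zero>\<^bsub>PA\<^esub>"
  by (simp add: tmonom_eq PA_simps(3))

lemma (in kpoly) tmonom_mult:
  assumes a: "a \<in> carrier A" and b: "b \<in> carrier A"
  shows "tmonom A a 0 \<otimes>\<^bsub>PA\<^esub> tmonom A b 0 = tmonom A (a \<otimes> b) 0"
proof
  fix m
  have "(tmonom A a 0 \<otimes>\<^bsub>PA\<^esub> tmonom A b 0) m = tmonom A a 0 0 \<otimes> tmonom A b 0 (m - 0)"
    unfolding PA_mult[OF tmonom_closed[OF a] tmonom_closed[OF b]]
    by (rule finsum_single) (use a b in \<open>auto simp: tmonom_eq\<close>)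
  then show "(tmonom A a 0 \<otimes>\<^bsub>PA\<^esub> tmonom A b 0) m = tmonom A (a \<otimes> b) 0 m"
    using a b by (simp add: tmonom_eq)
qed

lemma (in kpoly) tmonom_one: "tmonom A \<one> 0 = \<one>\<^bsub>PA\<^esub>"
  by (simp add: tmonom_eq PA_simps(2))

lemma (in kpoly) tmonom_finsum:
  "(\<And>i. i \<in> X \<Longrightarrow> f i \<in> carrier A) \<Longrightarrow> tmonom A (finsum A f X) m = (\<Oplus>\<^bsub>PA\<^esub>i\<in>X. tmonom A (f i) m)"
  by (rule additive_finsum[OF is_abelian_group P.is_abelian_group])
    (auto simp: tmonom_linear)

lemma (in kpoly) tmonom_lc:
  assumes "\<And>i. i \<in> X \<Longrightarrow> f i \<in> carrier A"
  shows "tmonom A (\<Oplus>i\<in>X. c i \<odot> f i) 0 = (\<Oplus>\<^bsub>PA\<^esub>i\<in>X. [:c i:] \<odot>\<^bsub>PA\<^esub> tmonom A (f i) 0)"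
proof -
  have "tmonom A (\<Oplus>i\<in>X. c i \<odot> f i) 0 = (\<Oplus>\<^bsub>PA\<^esub>i\<in>X. tmonom A (c i \<odot> f i) 0)"
    by (rule tmonom_finsum) (simp add: assms)
  also have "\<dots> = (\<Oplus>\<^bsub>PA\<^esub>i\<in>X. [:c i:] \<odot>\<^bsub>PA\<^esub> tmonom A (f i) 0)"
    by (rule P.finsum_cong_all) (simp_all add: tmonom_linear(2)[OF assms assms] assms)
  finally show ?thesis .
qed

lemma (in kpoly) xalg_PA:
  assumes G: "id \<in> G" "\<And>g h. g \<in> G \<Longrightarrow> h \<in> G \<Longrightarrow> g \<circ> h \<in> G"
    and y: "\<And>i. i \<in> {1..n} \<Longrightarrow> y i \<in> carrier A" and w: "\<And>g. g \<in> G \<Longrightarrow> w g \<in> carrier A"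
    and ww: "\<And>g h. g \<in> G \<Longrightarrow> h \<in> G \<Longrightarrow> w g \<otimes> w h = w (g \<circ> h)" and w1: "w id = \<one>"
    and wy: "\<And>g i. g \<in> G \<Longrightarrow> i \<in> {1..n} \<Longrightarrow> w g \<otimes> y i = (\<Oplus>j\<in>{1..n}. r g i j \<odot> y j) \<otimes> w g"
  shows "xalg PA n G r (\<lambda>i. tmonom A (y i) 0) (\<lambda>g. tmonom A (w g) 0)"
proof (intro xalg.intro xalg_axioms.intro kalg_PA)
  fix g i assume g: "g \<in> G" and i: "i \<in> {1..n}"
  have s: "(\<Oplus>j\<in>{1..n}. r g i j \<odot> y j) \<in> carrier A" by (intro finsum_in smult_closed y)
  show "tmonom A (w g) 0 \<otimes>\<^bsub>PA\<^esub> tmonom A (y i) 0 =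
    (\<Oplus>\<^bsub>PA\<^esub>j\<in>{1..n}. [:r g i j:] \<odot>\<^bsub>PA\<^esub> tmonom A (y j) 0) \<otimes>\<^bsub>PA\<^esub> tmonom A (w g) 0"
    unfolding tmonom_mult[OF w[OF g] y[OF i]] wy[OF g i] tmonom_mult[OF s w[OF g], symmetric]
    by (subst tmonom_lc) (simp_all add: y del: atLeastAtMost_iff)
qed (simp_all add: G y w ww w1 tmonom_mult tmonom_one tmonom_closed del: atLeastAtMost_iff)

context qdata
begin

sublocale PX: xalg P n G rr xP uP
  by (rule PS.xalg_PA)
    (simp_all only: G_id G_comp tensor_v_closed tensor_g_closed tensor_g_mult tensor_g_v, simp only: tensor_g_eq S_one)

lemma PX_xw: "set w \<subseteq> {1..n} \<Longrightarrow> PX.xw w = tmonom S (TS.se (word w) id) 0"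
proof (induction w)
  case Nil
  show ?case unfolding PX.xw_simps PS.tmonom_one[symmetric] S_one word_Nil[of n] by (rule refl)
next
  case (Cons a w)
  then have w: "word w \<in> carrier T" "word [a] \<in> carrier T" "set w \<subseteq> {1..n}" by (auto intro!: word_closed)
  have "PX.xw (a # w) = xP a \<otimes>\<^bsub>P\<^esub> tmonom S (TS.se (word w) id) 0"
    by (simp only: PX.xw_simps Cons.IH[OF w(3)])
  also have "\<dots> = tmonom S (TS.se (word [a]) id \<otimes>\<^bsub>S\<^esub> TS.se (word w) id) 0"
    unfolding tensor_v_eq by (rule PS.tmonom_mult) (intro se_closed_S w G_id)+
  also have "TS.se (word [a]) id \<otimes>\<^bsub>S\<^esub> TS.se (word w) id = TS.se (word [a] \<otimes>\<^bsub>T\<^esub> act id (word w)) (id \<circ> id)"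
    by (rule se_mult_S) (simp_all only: w G_id)
  also have "\<dots> = TS.se (word (a # w)) id"
    by (simp only: act_id[OF w(1)] word_mult comp_id append.simps)
  finally show ?case .
qed

lemma PX_e:
  assumes "set w \<subseteq> {1..n}" "g \<in> G"
  shows "PX.e w g = tmonom S (TS.se (word w) g) 0"
proof -
  have w: "word w \<in> carrier T" using assms by (intro word_closed)
  have "PX.e w g = tmonom S (TS.se (word w) id \<otimes>\<^bsub>S\<^esub> TS.se \<one>\<^bsub>T\<^esub> g) 0"
    unfolding PX.e_def PX_xw[OF assms(1)] unfolding tensor_g_eq
    by (rule PS.tmonom_mult) (intro se_closed_S w G_id T.one_closed assms)+
  also have "TS.se (word w) id \<otimes>\<^bsub>S\<^esub> TS.se \<one>\<^bsub>T\<^esub> g = TS.se (word w \<otimes>\<^bsub>T\<^esub> act id \<one>\<^bsub>T\<^esub>) (id \<circ> g)"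
    by (rule se_mult_S) (simp_all only: w G_id assms T.one_closed)
  finally show ?thesis by (simp only: act_one T.r_one[OF w] id_comp)
qed

lemma smult_e_apply:
  assumes "set w \<subseteq> {1..n}" "g \<in> G"
  shows "(p \<odot>\<^bsub>P\<^esub> PX.e w g) m h z = (if h = g \<and> z = w then Polynomial.coeff p m else 0)"
proof -
  have w: "word w \<in> carrier T" using assms by (intro word_closed)
  have "(p \<odot>\<^bsub>P\<^esub> PX.e w g) m = Polynomial.coeff p m \<odot>\<^bsub>S\<^esub> TS.se (word w) g"
    unfolding PX_e[OF assms] using PS.smult_tmonom[OF se_closed_S[OF w assms(2)], of p 0 m] by simp
  then show ?thesis
    by (simp add: S_eq TS.skew_simps(6) skew_elem_def tensor_simps(3,5) word_def)
qed

text \<open>The scalar is part of the base case and not of a closure condition, because homogeneous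
  components, to which this induction is applied, do not commute with scalars from K[t].\<close>

lemma P_induct [consumes 1, case_names zero elem add]:
  assumes f: "f \<in> carrier P" and zero: "R \<zero>\<^bsub>P\<^esub>"
    and elem: "\<And>p w g. set w \<subseteq> {1..n} \<Longrightarrow> g \<in> G \<Longrightarrow> R (p \<odot>\<^bsub>P\<^esub> PX.e w g)"
    and add: "\<And>f h. f \<in> carrier P \<Longrightarrow> h \<in> carrier P \<Longrightarrow> R f \<Longrightarrow> R h \<Longrightarrow> R (f \<oplus>\<^bsub>P\<^esub> h)"
  shows "R f"
proof -
  have 1: "R (p \<odot>\<^bsub>P\<^esub> tmonom S (TS.se a g) 0)" if a: "a \<in> carrier T" and g: "g \<in> G" for a g p
    using a
  proof (induction a arbitrary: p rule: tensor_induct)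
    case zero
    have "TS.se \<zero>\<^bsub>T\<^esub> g = \<zero>\<^bsub>S\<^esub>"
      using linear_on_zero[OF T.kalg_axioms S.kalg_axioms linear_on_se_S[OF g]] .
    then show ?case using assms(2) by (simp add: PS.tmonom_zero)
  next
    case (word w)
    then show ?case using elem[OF word g, of p] by (simp only: PX_e g)
  next
    case (smult c a)
    have "tmonom S (TS.se (c \<odot>\<^bsub>T\<^esub> a) g) 0 = [:c:] \<odot>\<^bsub>P\<^esub> tmonom S (TS.se a g) 0"
      using linear_onD(3)[OF linear_on_se_S[OF g] smult(1)] PS.tmonom_linear(2) se_closed_S[OF smult(1) g] by simp
    then show ?case using smult(2)[of "p * [:c:]"] se_closed_S[OF smult(1) g] by (simp add: PS.P.smult_assoc del: mult_pCons_right)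
  next
    case (add a b)
    have c: "TS.se a g \<in> carrier S" "TS.se b g \<in> carrier S" using add g by (simp_all add: se_closed_S)
    have "tmonom S (TS.se (a \<oplus>\<^bsub>T\<^esub> b) g) 0 = tmonom S (TS.se a g) 0 \<oplus>\<^bsub>P\<^esub> tmonom S (TS.se b g) 0"
      using linear_onD(2)[OF linear_on_se_S[OF g] add(1,2)] PS.tmonom_linear(1)[OF c] by simp
    then show ?case using assms(4) add(3,4) c by (simp add: PS.P.smult_add_right)
  qed
  have 2: "R (p \<odot>\<^bsub>P\<^esub> tmonom S a 0)" if "a \<in> carrier S" for a p
    using that unfolding S_eq
  proof (induction a rule: TS.skew_induct)
    case zero
    have "(\<lambda>_. \<zero>\<^bsub>T\<^esub>) = \<zero>\<^bsub>S\<^esub>" by (simp only: S_eq TS.skew_simps(4))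
    then show ?case using assms(2) unfolding S_eq[symmetric] by (simp add: PS.tmonom_zero)
  next
    case (elem a g)
    then show ?case using 1[of a g p] by (simp add: H_simps S_eq)
  next
    case (add f h)
    then show ?case using assms(4) unfolding S_eq[symmetric] by (simp add: PS.tmonom_linear(1) PS.P.smult_add_right)
  qed
  show ?thesis using f
  proof (induction f rule: PS.PA_induct)
    case (monom a m)
    have "tmonom S a m = Polynomial.monom 1 m \<odot>\<^bsub>P\<^esub> tmonom S a 0"
      using PS.smult_monom_tmonom[OF monom, of 1 m 0] monom by simp
    then show ?case using 2[OF monom] by simp
  qed (use assms in auto)
qed

end

section \<open>Homomorphisms out of T(V) x G [t]\<close>

context qdata
begin

lemma P_add_apply: "f \<in> carrier P \<Longrightarrow> h \<in> carrier P \<Longrightarrow> (f \<oplus>\<^bsub>P\<^esub> h) m g w = f m g w + h m g w"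
  by (simp add: PS.PA_add) (simp add: S_eq TS.skew_simps(5) tensor_simps(4))

lemma P_zero_apply: "\<zero>\<^bsub>P\<^esub> m g w = 0"
  by (simp add: PS.PA_simps(3)) (simp add: S_eq TS.skew_simps(4) tensor_simps(3))

definition supp :: "(nat \<Rightarrow> ('v \<Rightarrow> 'v) \<Rightarrow> nat list \<Rightarrow> 'k) \<Rightarrow> (nat \<times> ('v \<Rightarrow> 'v) \<times> nat list) set" where
  "supp p = {(m, g, w). p m g w \<noteq> 0}"

lemma supp_zero: "supp \<zero>\<^bsub>P\<^esub> = {}"
  by (auto simp: supp_def P_zero_apply)

definition letters :: "(nat \<times> ('v \<Rightarrow> 'v) \<times> nat list) set" where
  "letters = {(m, g, w). g \<in> G \<and> set w \<subseteq> {1..n}}"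

lemma supp_elem: "set w \<subseteq> {1..n} \<Longrightarrow> g \<in> G \<Longrightarrow> supp (p \<odot>\<^bsub>P\<^esub> PX.e w g) \<subseteq> (\<lambda>m. (m, g, w)) ` {..degree p}"
  unfolding supp_def using le_degree by (auto simp: smult_e_apply simp del: atLeastAtMost_iff split: if_splits)

lemma supp_finite: "p \<in> carrier P \<Longrightarrow> finite (supp p) \<and> supp p \<subseteq> letters"
proof (induction p rule: P_induct)
  case zero
  show ?case by (simp add: supp_zero)
next
  case (elem p w g)
  have "supp (p \<odot>\<^bsub>P\<^esub> PX.e w g) \<subseteq> letters"
    using elem by (auto simp: supp_def smult_e_apply letters_def simp del: atLeastAtMost_iff split: if_splits)
  then show ?case using finite_subset[OF supp_elem[OF elem]] by simp
next
  case (add f h)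
  have "supp (f \<oplus>\<^bsub>P\<^esub> h) \<subseteq> supp f \<union> supp h" using add by (auto simp: supp_def P_add_apply)
  then show ?case using add finite_subset by blast
qed

text \<open>The \<open>K[t]\<close>-algebra map from \<open>T(V) \<rtimes> G[t]\<close> to \<open>B\<close> with \<open>v i \<mapsto> x i\<close> and \<open>g \<mapsto> u g\<close>.\<close>

definition F :: "('k poly, 'b) module \<Rightarrow> (nat \<Rightarrow> 'b) \<Rightarrow> (('v \<Rightarrow> 'v) \<Rightarrow> 'b) \<Rightarrow> (nat \<Rightarrow> ('v \<Rightarrow> 'v) \<Rightarrow> nat list \<Rightarrow> 'k) \<Rightarrow> 'b" where
  "F B x u p = finsum B (\<lambda>(m, g, w). Polynomial.monom (p m g w) m \<odot>\<^bsub>B\<^esub> xalg.e B x u w g) (supp p)"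

context
  fixes B :: "('k poly, 'b) module" and x :: "nat \<Rightarrow> 'b" and u :: "('v \<Rightarrow> 'v) \<Rightarrow> 'b"
  assumes B: "xalg B n G rr x u"
begin

interpretation B: xalg B n G rr x u by (rule B)

abbreviation (input) "term p \<equiv> (\<lambda>(m, g, w). Polynomial.monom (p m g w) m \<odot>\<^bsub>B\<^esub> B.e w g)"

lemma term_closed: "z \<in> letters \<Longrightarrow> term p z \<in> carrier B"
  by (auto simp: letters_def intro!: B.smult_closed B.e_closed)

lemma F_superset:
  assumes "p \<in> carrier P" "finite Z" "supp p \<subseteq> Z" "Z \<subseteq> letters"
  shows "F B x u p = finsum B (term p) Z"
  unfolding F_def
proof (rule B.finsum_mono_neutral[OF assms(2,3)])
  fix z assume "z \<in> Z - supp p"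
  then show "term p z = \<zero>\<^bsub>B\<^esub>" using assms(4) by (auto simp: supp_def letters_def)
qed (use assms term_closed in blast)

lemma F_closed: "p \<in> carrier P \<Longrightarrow> F B x u p \<in> carrier B"
  unfolding F_def using supp_finite[of p] term_closed by (intro B.finsum_in) blast

lemma F_add:
  assumes f: "f \<in> carrier P" and h: "h \<in> carrier P"
  shows "F B x u (f \<oplus>\<^bsub>P\<^esub> h) = F B x u f \<oplus>\<^bsub>B\<^esub> F B x u h"
proof -
  let ?Z = "supp f \<union> supp h"
  have Z: "finite ?Z" "?Z \<subseteq> letters" using supp_finite[OF f] supp_finite[OF h] by auto
  have s: "supp (f \<oplus>\<^bsub>P\<^esub> h) \<subseteq> ?Z" using f h by (auto simp: supp_def P_add_apply)
  have "F B x u (f \<oplus>\<^bsub>P\<^esub> h) = finsum B (term (f \<oplus>\<^bsub>P\<^esub> h)) ?Z"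
    using f h by (intro F_superset Z s PS.P.a_closed)
  also have "\<dots> = (\<Oplus>\<^bsub>B\<^esub>z\<in>?Z. term f z \<oplus>\<^bsub>B\<^esub> term h z)"
  proof (rule B.finsum_cong_all)
    fix z assume "z \<in> ?Z"
    then have z: "z \<in> letters" using Z by blast
    then show "term f z \<oplus>\<^bsub>B\<^esub> term h z \<in> carrier B" using term_closed by simp
    obtain m g w where mgw: "z = (m, g, w)" "g \<in> G" "set w \<subseteq> {1..n}" using z by (auto simp: letters_def)
    show "term (f \<oplus>\<^bsub>P\<^esub> h) z = term f z \<oplus>\<^bsub>B\<^esub> term h z"
      unfolding mgw(1) prod.case P_add_apply[OF f h] add_monom[symmetric]
      by (rule B.smult_add_left[OF B.e_closed[OF mgw(3,2)]])
  qed
  also have "\<dots> = finsum B (term f) ?Z \<oplus>\<^bsub>B\<^esub> finsum B (term h) ?Z"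
    by (rule B.finsum_addf) (use Z term_closed in blast)+
  also have "\<dots> = F B x u f \<oplus>\<^bsub>B\<^esub> F B x u h"
    using F_superset[OF f Z(1) _ Z(2)] F_superset[OF h Z(1) _ Z(2)] by simp
  finally show ?thesis .
qed

lemma F_zero: "F B x u \<zero>\<^bsub>P\<^esub> = \<zero>\<^bsub>B\<^esub>"
  by (simp add: F_def supp_zero)

lemma F_elem:
  assumes w: "set w \<subseteq> {1..n}" and g: "g \<in> G"
  shows "F B x u (p \<odot>\<^bsub>P\<^esub> PX.e w g) = p \<odot>\<^bsub>B\<^esub> B.e w g"
proof -
  let ?Z = "(\<lambda>m. (m, g, w)) ` {..degree p}"
  have "F B x u (p \<odot>\<^bsub>P\<^esub> PX.e w g) = finsum B (term (p \<odot>\<^bsub>P\<^esub> PX.e w g)) ?Z"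
    using w g by (intro F_superset supp_elem PS.P.smult_closed PX.e_closed) (auto simp: letters_def)
  also have "\<dots> = (\<Oplus>\<^bsub>B\<^esub>m\<in>{..degree p}. term (p \<odot>\<^bsub>P\<^esub> PX.e w g) (m, g, w))"
    by (rule B.finsum_reindex) (use w g in \<open>auto simp: inj_on_def intro!: B.smult_closed B.e_closed\<close>)
  also have "\<dots> = (\<Oplus>\<^bsub>B\<^esub>m\<in>{..degree p}. Polynomial.monom (Polynomial.coeff p m) m \<odot>\<^bsub>B\<^esub> B.e w g)"
    by (rule B.finsum_cong_all) (simp_all add: smult_e_apply[OF w g] B.e_closed[OF w g])
  also have "\<dots> = p \<odot>\<^bsub>B\<^esub> B.e w g"
    by (simp only: B.sum_smult[OF B.e_closed[OF w g], symmetric] poly_as_sum_of_monoms)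
  finally show ?thesis .
qed

lemma F_e: "set w \<subseteq> {1..n} \<Longrightarrow> g \<in> G \<Longrightarrow> F B x u (PX.e w g) = B.e w g"
  using F_elem[of w g 1] by (simp del: atLeastAtMost_iff One_nat_def)

lemma F_smult: "f \<in> carrier P \<Longrightarrow> F B x u (p \<odot>\<^bsub>P\<^esub> f) = p \<odot>\<^bsub>B\<^esub> F B x u f"
proof (induction f rule: P_induct)
  case zero
  then show ?case by (simp add: F_zero)
next
  case (elem p' w g)
  then show ?case
    using F_elem[OF elem, of "p * p'"] by (simp add: F_elem PS.P.smult_assoc B.smult_assoc del: atLeastAtMost_iff One_nat_def)
next
  case (add f h)
  then show ?case by (simp add: F_add PS.P.smult_add_right B.smult_add_right F_closed)
qed

lemma linear_on_F: "linear_on P B (F B x u)"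
  by (rule linear_onI) (simp_all add: F_closed F_add F_smult)

text \<open>Multiplicativity is shown for single generators on the right first: in source and target
  \<open>e_x\<close> expands the product with the same coefficients, so \<open>F\<close> matches the
  two expansions term by term.\<close>

lemma F_mult_x:
  assumes f: "f \<in> carrier P" and i: "i \<in> {1..n}"
  shows "F B x u (f \<otimes>\<^bsub>P\<^esub> xP i) = F B x u f \<otimes>\<^bsub>B\<^esub> x i"
  using f
proof (induction f rule: P_induct)
  case zero
  then show ?case using PX.x_closed[OF i] B.x_closed[OF i] by (simp add: F_zero)
next
  case (elem p w g)
  note xc = PX.x_closed[OF i] B.x_closed[OF i]
  have wj: "set (w @ [j]) \<subseteq> {1..n}" if "j \<in> {1..n}" for j using that elem by auto
  have "F B x u ((p \<odot>\<^bsub>P\<^esub> PX.e w g) \<otimes>\<^bsub>P\<^esub> xP i) = p \<odot>\<^bsub>B\<^esub> F B x u (PX.e w g \<otimes>\<^bsub>P\<^esub> xP i)"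
    using elem xc by (simp only: PS.P.smult_mult_left PX.e_closed F_smult PS.P.m_closed)
  also have "F B x u (PX.e w g \<otimes>\<^bsub>P\<^esub> xP i) = (\<Oplus>\<^bsub>B\<^esub>j\<in>{1..n}. F B x u ([:rr g i j:] \<odot>\<^bsub>P\<^esub> PX.e (w @ [j]) g))"
    unfolding PX.e_x[OF elem i]
    by (rule linear_on_finsum[OF PS.P.kalg_axioms B.kalg_axioms linear_on_F])
      (intro PS.P.smult_closed PX.e_closed wj elem)
  also have "\<dots> = (\<Oplus>\<^bsub>B\<^esub>j\<in>{1..n}. [:rr g i j:] \<odot>\<^bsub>B\<^esub> B.e (w @ [j]) g)"
    by (rule B.finsum_cong_all) (simp_all only: F_elem[OF wj elem(2)] B.smult_closed B.e_closed[OF wj elem(2)])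
  also have "\<dots> = B.e w g \<otimes>\<^bsub>B\<^esub> x i" by (rule B.e_x[OF elem i, symmetric])
  finally show ?case using elem xc by (simp only: F_elem B.smult_mult_left B.e_closed)
next
  case (add f h)
  then show ?case using PX.x_closed[OF i] B.x_closed[OF i]
    by (simp add: F_add PS.P.l_distr B.l_distr F_closed)
qed

lemma F_mult_u:
  assumes f: "f \<in> carrier P" and h: "h \<in> G"
  shows "F B x u (f \<otimes>\<^bsub>P\<^esub> uP h) = F B x u f \<otimes>\<^bsub>B\<^esub> u h"
  using f
proof (induction f rule: P_induct)
  case zero
  then show ?case using PX.u_closed[OF h] B.u_closed[OF h] by (simp add: F_zero)
next
  case (elem p w g)
  note uc = PX.u_closed[OF h] B.u_closed[OF h]
  have "(p \<odot>\<^bsub>P\<^esub> PX.e w g) \<otimes>\<^bsub>P\<^esub> uP h = p \<odot>\<^bsub>P\<^esub> PX.e w (g \<circ> h)"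
    using elem uc h by (simp only: PS.P.smult_mult_left PX.e_closed PX.e_u)
  then show ?case using elem uc h by (simp only: F_elem G_comp B.smult_mult_left B.e_closed B.e_u)
next
  case (add f f')
  then show ?case using PX.u_closed[OF h] B.u_closed[OF h]
    by (simp add: F_add PS.P.l_distr B.l_distr F_closed)
qed

lemma F_mult_e:
  assumes f: "f \<in> carrier P" and w: "set w \<subseteq> {1..n}" and g: "g \<in> G"
  shows "F B x u (f \<otimes>\<^bsub>P\<^esub> PX.e w g) = F B x u f \<otimes>\<^bsub>B\<^esub> B.e w g"
proof -
  have "F B x u (f \<otimes>\<^bsub>P\<^esub> PX.xw w) = F B x u f \<otimes>\<^bsub>B\<^esub> B.xw w"
    using f w
  proof (induction w arbitrary: f)
    case Nil
    then show ?case by (simp add: PX.xw_simps B.xw_simps F_closed)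
  next
    case (Cons i w)
    then have i: "i \<in> {1..n}" and w: "set w \<subseteq> {1..n}" by auto
    note c = PX.x_closed[OF i] B.x_closed[OF i] PX.xw_closed[OF w] B.xw_closed[OF w] Cons.prems(1)
    have "F B x u (f \<otimes>\<^bsub>P\<^esub> PX.xw (i # w)) = F B x u (f \<otimes>\<^bsub>P\<^esub> xP i) \<otimes>\<^bsub>B\<^esub> B.xw w"
      unfolding PX.xw_simps using c Cons.IH[of "f \<otimes>\<^bsub>P\<^esub> xP i"] w by (simp only: PS.P.m_assoc PS.P.m_closed)
    then show ?case using c by (simp only: F_mult_x[OF c(5) i] B.xw_simps B.m_assoc F_closed)
  qed
  then show ?thesis
    using f PX.xw_closed[OF w] B.xw_closed[OF w] PX.u_closed[OF g] B.u_closed[OF g] F_mult_u[of "f \<otimes>\<^bsub>P\<^esub> PX.xw w" g] g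
    by (simp only: PX.e_def B.e_def PS.P.m_assoc[symmetric] B.m_assoc F_closed PS.P.m_closed)
qed

lemma F_mult:
  assumes f: "f \<in> carrier P" and h: "h \<in> carrier P"
  shows "F B x u (f \<otimes>\<^bsub>P\<^esub> h) = F B x u f \<otimes>\<^bsub>B\<^esub> F B x u h"
  using h
proof (induction h rule: P_induct)
  case zero
  then show ?case using f by (simp add: F_zero F_closed)
next
  case (elem p w g)
  then show ?case using f
    by (simp only: F_elem PS.P.smult_mult_right B.smult_mult_right PX.e_closed B.e_closed F_smult F_mult_e F_e F_closed PS.P.m_closed)
next
  case (add h k)
  then show ?case using f by (simp add: F_add PS.P.r_distr B.r_distr F_closed)
qed

lemma F_one: "F B x u \<one>\<^bsub>P\<^esub> = \<one>\<^bsub>B\<^esub>"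
  using F_e[of "[]" id] by (simp add: PX.e_Nil B.e_Nil PX.u_id B.u_id)

lemma F_x: "i \<in> {1..n} \<Longrightarrow> F B x u (xP i) = x i"
  using F_e[of "[i]" id] by (simp add: PX.e_single B.e_single del: atLeastAtMost_iff One_nat_def)

lemma F_u: "g \<in> G \<Longrightarrow> F B x u (uP g) = u g"
  using F_e[of "[]" g] by (simp add: PX.e_Nil B.e_Nil)

lemma ring_hom_F: "F B x u \<in> ring_hom P B"
  by (rule ring_hom_memI) (simp_all add: F_closed F_mult F_add F_one)

end

section \<open>The grading of \<open>T(V) \<rtimes> G[t]\<close> with \<open>t\<close> of degree 2\<close>

definition comp :: "nat \<Rightarrow> (nat \<Rightarrow> ('v \<Rightarrow> 'v) \<Rightarrow> nat list \<Rightarrow> 'k) \<Rightarrow> nat \<Rightarrow> ('v \<Rightarrow> 'v) \<Rightarrow> nat list \<Rightarrow> 'k" where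
  "comp d p = (\<lambda>m g w. if 2 * m + length w = d then p m g w else 0)"

text \<open>The part of a scalar p that, in front of an element of degree \<open>k\<close>,
  contributes to degree \<open>d\<close>: with t in degree 2 this is its term at t^((d-k)/2), or
  nothing if d - k is negative or odd.\<close>

definition hp :: "nat \<Rightarrow> nat \<Rightarrow> 'k poly \<Rightarrow> 'k poly" where
  "hp d k p = (if k \<le> d \<and> even (d - k) then Polynomial.monom (Polynomial.coeff p ((d - k) div 2)) ((d - k) div 2) else 0)"

lemma hp_coeff: "Polynomial.coeff (hp d k p) m = (if 2 * m + k = d then Polynomial.coeff p m else 0)"
proof (cases "2 * m + k = d")
  case True
  then have "d - k = 2 * m" "k \<le> d" by auto
  then show ?thesis using True by (simp add: hp_def)
next
  case False
  then have "(d - k) div 2 \<noteq> m" if "k \<le> d" "even (d - k)"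
    using that by (metis dvd_mult_div_cancel le_add_diff_inverse2)
  then show ?thesis using False by (auto simp: hp_def)
qed

lemma P_eqI:
  assumes "\<And>m g w. f m g w = h m g w" shows "f = h"
  by (intro ext assms)

lemma comp_elem:
  assumes "set w \<subseteq> {1..n}" "g \<in> G"
  shows "comp d (p \<odot>\<^bsub>P\<^esub> PX.e w g) = hp d (length w) p \<odot>\<^bsub>P\<^esub> PX.e w g"
  by (rule P_eqI) (auto simp: comp_def smult_e_apply[OF assms] hp_coeff)

lemma comp_add: "f \<in> carrier P \<Longrightarrow> h \<in> carrier P \<Longrightarrow> comp d f \<in> carrier P \<Longrightarrow> comp d h \<in> carrier P \<Longrightarrow>
    comp d (f \<oplus>\<^bsub>P\<^esub> h) = comp d f \<oplus>\<^bsub>P\<^esub> comp d h"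
  by (rule P_eqI) (simp add: comp_def P_add_apply[unfolded comp_def] P_add_apply)

lemma comp_zero: "comp d \<zero>\<^bsub>P\<^esub> = \<zero>\<^bsub>P\<^esub>"
  by (rule P_eqI) (simp add: comp_def P_zero_apply)

lemma comp_closed: "f \<in> carrier P \<Longrightarrow> comp d f \<in> carrier P"
proof (induction f rule: P_induct)
  case (elem p w g)
  then show ?case by (simp only: comp_elem PS.P.smult_closed PX.e_closed)
qed (simp_all add: comp_zero comp_add)

text \<open>A scalar c t^l has degree 2 l, so it shifts the index of the component; if 2 l exceeds
  \<open>d\<close>, nothing is left.\<close>

lemma comp_monom:
  assumes "f \<in> carrier P"
  shows "comp d (Polynomial.monom c l \<odot>\<^bsub>P\<^esub> f) =
    (if 2 * l \<le> d then Polynomial.monom c l \<odot>\<^bsub>P\<^esub> comp (d - 2 * l) f else \<zero>\<^bsub>P\<^esub>)"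
  using assms
proof (induction f rule: P_induct)
  case zero
  then show ?case by (simp add: comp_zero)
next
  case (elem p w g)
  have h: "hp d (length w) (Polynomial.monom c l * p) = (if 2 * l \<le> d then Polynomial.monom c l * hp (d - 2 * l) (length w) p else 0)"
  proof (rule poly_eqI)
    fix m
    have "2 * (m - l) + length w = d - 2 * l \<longleftrightarrow> 2 * m + length w = d" if "l \<le> m" "2 * l \<le> d"
      using that by arith
    then show "Polynomial.coeff (hp d (length w) (Polynomial.monom c l * p)) m =
      Polynomial.coeff (if 2 * l \<le> d then Polynomial.monom c l * hp (d - 2 * l) (length w) p else 0) m"
      by (auto simp: hp_coeff coeff_monom_mult)
  qed
  have ec: "PX.e w g \<in> carrier P" using elem by (rule PX.e_closed)
  show ?case
    unfolding PS.P.smult_assoc[OF ec, symmetric] comp_elem[OF elem] h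
    by (simp add: PS.P.smult_assoc ec)
next
  case (add f h)
  then show ?case by (simp add: PS.P.smult_add_right comp_add comp_closed)
qed

text \<open>Homogeneity is imposed on all K[t]-multiples of \<open>z\<close> at once. In this form
  it yields the components of a scalar multiple without expanding \<open>z\<close> in words.\<close>

definition homog :: "nat \<Rightarrow> (nat \<Rightarrow> ('v \<Rightarrow> 'v) \<Rightarrow> nat list \<Rightarrow> 'k) set" where
  "homog k = {z \<in> carrier P. \<forall>p d. comp d (p \<odot>\<^bsub>P\<^esub> z) = hp d k p \<odot>\<^bsub>P\<^esub> z}"

lemma homog_e: "set w \<subseteq> {1..n} \<Longrightarrow> g \<in> G \<Longrightarrow> PX.e w g \<in> homog (length w)"
  unfolding homog_def by (simp add: comp_elem del: atLeastAtMost_iff One_nat_def)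

lemma ksub_homog: "ksub P (homog k)"
  unfolding ksub_def
proof (intro conjI ballI allI)
  show "\<zero>\<^bsub>P\<^esub> \<in> homog k" by (simp add: homog_def comp_zero)
next
  fix f h assume "f \<in> homog k" "h \<in> homog k"
  then show "f \<oplus>\<^bsub>P\<^esub> h \<in> homog k"
    by (simp add: homog_def PS.P.smult_add_right comp_add comp_closed)
next
  fix c f assume f: "f \<in> homog k"
  have "hp d k (p * [:c:]) = hp d k p * [:c:]" for d p
    by (rule poly_eqI) (simp add: hp_coeff)
  then show "[:c:] \<odot>\<^bsub>P\<^esub> f \<in> homog k"
    using f by (simp add: homog_def PS.P.smult_assoc[symmetric] del: mult_pCons_right)
qed

text \<open>\<open>e_straight\<close> with the homogeneous elements as subspace: the letters are
  mixed by the matrices of G but their number is kept.\<close>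

lemma homog_e_e:
  assumes "set a \<subseteq> {1..n}" "set b \<subseteq> {1..n}" "h \<in> G" "g \<in> G"
  shows "PX.e a h \<otimes>\<^bsub>P\<^esub> PX.e b g \<in> homog (length a + length b)"
proof (rule PX.e_straight[OF ksub_homog])
  show "homog (length a + length b) \<subseteq> carrier P" by (auto simp: homog_def)
  fix w g assume "set w \<subseteq> {1..n}" "length w = length a + length b" "g \<in> G"
  then show "PX.e w g \<in> homog (length a + length b)" using homog_e[of w g] by simp
qed (fact assms refl)+

lemma hp_add: "hp d (k + l) p = (if l \<le> d then hp (d - l) k p else 0)" "hp d (l + k) p = (if l \<le> d then hp (d - l) k p else 0)"
  by (rule poly_eqI, auto simp: hp_coeff)+

text \<open>A monomial is homogeneous, so multiplying by it shifts components by the length of its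
  word; the case distinction avoids a truncated subtraction.\<close>

lemma comp_mult_e:
  assumes f: "f \<in> carrier P" and b: "set b \<subseteq> {1..n}" "g \<in> G"
  shows "comp d (f \<otimes>\<^bsub>P\<^esub> PX.e b g) = (if length b \<le> d then comp (d - length b) f \<otimes>\<^bsub>P\<^esub> PX.e b g else \<zero>\<^bsub>P\<^esub>)"
    and "comp d (PX.e b g \<otimes>\<^bsub>P\<^esub> f) = (if length b \<le> d then PX.e b g \<otimes>\<^bsub>P\<^esub> comp (d - length b) f else \<zero>\<^bsub>P\<^esub>)"
proof -
  have ec: "PX.e b g \<in> carrier P" using b by (rule PX.e_closed)
  have "comp d (f \<otimes>\<^bsub>P\<^esub> PX.e b g) = (if length b \<le> d then comp (d - length b) f \<otimes>\<^bsub>P\<^esub> PX.e b g else \<zero>\<^bsub>P\<^esub>) \<and>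
    comp d (PX.e b g \<otimes>\<^bsub>P\<^esub> f) = (if length b \<le> d then PX.e b g \<otimes>\<^bsub>P\<^esub> comp (d - length b) f else \<zero>\<^bsub>P\<^esub>)"
    using f
  proof (induction f rule: P_induct)
    case zero
    then show ?case using ec by (simp add: comp_zero)
  next
    case (elem p w h)
    have wc: "PX.e w h \<in> carrier P" using elem by (rule PX.e_closed)
    have "comp d (p \<odot>\<^bsub>P\<^esub> (PX.e w h \<otimes>\<^bsub>P\<^esub> PX.e b g)) = hp d (length w + length b) p \<odot>\<^bsub>P\<^esub> (PX.e w h \<otimes>\<^bsub>P\<^esub> PX.e b g)"
      "comp d (p \<odot>\<^bsub>P\<^esub> (PX.e b g \<otimes>\<^bsub>P\<^esub> PX.e w h)) = hp d (length b + length w) p \<odot>\<^bsub>P\<^esub> (PX.e b g \<otimes>\<^bsub>P\<^esub> PX.e w h)"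
      using homog_e_e[OF elem(1) b(1) elem(2) b(2)] homog_e_e[OF b(1) elem(1) b(2) elem(2)] by (auto simp: homog_def)
    note this(1)[unfolded hp_add(1)] this(2)[unfolded hp_add(2)]
    then show ?case
      using ec wc comp_elem[OF elem] by (simp add: PS.P.smult_mult_left PS.P.smult_mult_right)
  next
    case (add f h)
    then show ?case using ec by (simp add: PS.P.l_distr PS.P.r_distr comp_add comp_closed)
  qed
  then show "comp d (f \<otimes>\<^bsub>P\<^esub> PX.e b g) = (if length b \<le> d then comp (d - length b) f \<otimes>\<^bsub>P\<^esub> PX.e b g else \<zero>\<^bsub>P\<^esub>)"
    "comp d (PX.e b g \<otimes>\<^bsub>P\<^esub> f) = (if length b \<le> d then PX.e b g \<otimes>\<^bsub>P\<^esub> comp (d - length b) f else \<zero>\<^bsub>P\<^esub>)" by blast+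
qed

text \<open>The elements all of whose components lie in the ideal form an ideal again, and this one
  contains the generators.\<close>

lemma homogeneous_ideal:
  assumes gens: "Z \<subseteq> carrier P" and Z: "\<And>z d. z \<in> Z \<Longrightarrow> comp d z \<in> Idl\<^bsub>P\<^esub> Z" and p: "p \<in> Idl\<^bsub>P\<^esub> Z"
  shows "comp d p \<in> Idl\<^bsub>P\<^esub> Z"
proof -
  let ?I = "Idl\<^bsub>P\<^esub> Z"
  have I: "ideal ?I P" by (rule PS.P.genideal_ideal[OF gens])
  interpret I: ideal ?I P by (rule I)
  let ?J = "{f \<in> carrier P. \<forall>d. comp d f \<in> ?I}"
  have add: "f \<oplus>\<^bsub>P\<^esub> h \<in> ?J" if "f \<in> ?J" "h \<in> ?J" for f h
    using that by (simp add: comp_add comp_closed)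
  have zero: "\<zero>\<^bsub>P\<^esub> \<in> ?J" by (simp add: comp_zero)
  \<comment> \<open>Components are not K[t]-linear; a scalar c t^l permits a direct computation, and
    general scalars are sums of such.\<close>
  have monom: "Polynomial.monom c l \<odot>\<^bsub>P\<^esub> f \<in> ?J" if "f \<in> ?J" for f c l
    using that PS.P.ideal_smult[OF I] by (simp add: comp_monom)
  have smult: "p \<odot>\<^bsub>P\<^esub> f \<in> ?J" if f: "f \<in> ?J" for f p
  proof -
    have "(\<Sum>i\<le>k. Polynomial.monom (Polynomial.coeff p i) i) \<odot>\<^bsub>P\<^esub> f \<in> ?J" for k
    proof (induction k)
      case (Suc k)
      then show ?case using f add[OF Suc monom[OF f]] by (simp add: PS.P.smult_add_left)
    qed (use f monom in simp)
    from this[of "degree p"] show ?thesis by (simp only: poly_as_sum_of_monoms)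
  qed
  have mult: "f \<otimes>\<^bsub>P\<^esub> y \<in> ?J \<and> y \<otimes>\<^bsub>P\<^esub> f \<in> ?J" if f: "f \<in> ?J" and y: "y \<in> carrier P" for f y
    using y
  proof (induction y rule: P_induct)
    case zero
    then show ?case using f by (simp add: comp_zero)
  next
    case (elem p w g)
    have wc: "PX.e w g \<in> carrier P" using elem by (rule PX.e_closed)
    have "f \<otimes>\<^bsub>P\<^esub> PX.e w g \<in> ?J" "PX.e w g \<otimes>\<^bsub>P\<^esub> f \<in> ?J"
      using f elem wc by (simp_all add: comp_mult_e I.I_l_closed I.I_r_closed del: atLeastAtMost_iff One_nat_def)
    then show ?case using f wc smult by (simp add: PS.P.smult_mult_left PS.P.smult_mult_right)
  next
    case (add y y')
    then show ?case using f assms(1) \<open>\<And>f h. f \<in> ?J \<Longrightarrow> h \<in> ?J \<Longrightarrow> f \<oplus>\<^bsub>P\<^esub> h \<in> ?J\<close>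
      by (simp add: PS.P.l_distr PS.P.r_distr)
  qed
  have "ideal ?J P"
  proof (rule idealI[OF PS.P.ring_axioms])
    show "subgroup ?J (add_monoid P)"
    proof
      fix f assume f: "f \<in> ?J"
      have "inv\<^bsub>add_monoid P\<^esub> f = (- 1) \<odot>\<^bsub>P\<^esub> f"
        using f by (simp add: a_inv_def[symmetric] PS.P.minus_eq_smult)
      then show "inv\<^bsub>add_monoid P\<^esub> f \<in> ?J" using smult[OF f] by simp
    qed (use add zero in auto)
  qed (use mult in blast)+
  moreover have "Z \<subseteq> ?J" using Z gens by auto
  ultimately have "?I \<subseteq> ?J" by (rule PS.P.genideal_minimal)
  then show ?thesis using p by auto
qed

end

lemma (in kalg) eq_add_if_diff_zero:
  assumes "a \<in> carrier A" "b \<in> carrier A" "c \<in> carrier A" "(a \<ominus> b) \<ominus> c = \<zero>"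
  shows "a = b \<oplus> c"
proof -
  have "a \<ominus> b = (a \<ominus> b) \<ominus> c \<oplus> c" using assms(1-3) by (simp add: a_minus_def a_assoc l_neg)
  then have "a \<ominus> b = c" unfolding assms(4) using assms(3) by simp
  then have "b \<oplus> c = b \<oplus> (a \<ominus> b)" by simp
  also have "\<dots> = a" using assms by (simp add: a_minus_def a_lcomm r_neg)
  finally show ?thesis by simp
qed

lemma is_basis_cong:
  assumes "kalg M" "finite I" "\<And>i. i \<in> I \<Longrightarrow> b i = d i" "is_basis M I b"
  shows "is_basis M I d"
proof -
  interpret M: fbasis M I b by (intro fbasis.intro fbasis_axioms.intro assms)
  have lc: "(\<Oplus>\<^bsub>M\<^esub>i\<in>I. c i \<odot>\<^bsub>M\<^esub> d i) = (\<Oplus>\<^bsub>M\<^esub>i\<in>I. c i \<odot>\<^bsub>M\<^esub> b i)" for c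
    by (rule M.finsum_cong_all) (simp_all add: assms(3)[symmetric])
  show ?thesis
  proof (rule is_basisI[OF assms(1,2)])
    show "d i \<in> carrier M" if "i \<in> I" for i using M.b_closed[OF that] assms(3)[OF that] by simp
    show "\<exists>c. x = (\<Oplus>\<^bsub>M\<^esub>i\<in>I. c i \<odot>\<^bsub>M\<^esub> d i)" if x: "x \<in> carrier M" for x
      unfolding lc by (rule exI[of _ "M.crd x"]) (simp only: M.crd_expand[OF x])
    show "c i = 0" if "(\<Oplus>\<^bsub>M\<^esub>i\<in>I. c i \<odot>\<^bsub>M\<^esub> d i) = \<zero>\<^bsub>M\<^esub>" "i \<in> I" for c i
      using that M.crd_lc[OF that(2), of c] unfolding lc by simp
  qed
qed

section \<open>Spans and triangular changes of basis\<close>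

definition lcs :: "('s, 'a) module \<Rightarrow> 'i set \<Rightarrow> ('i \<Rightarrow> 'a) \<Rightarrow> 'a set" where
  "lcs M I e = {x. \<exists>c. x = (\<Oplus>\<^bsub>M\<^esub>i\<in>I. c i \<odot>\<^bsub>M\<^esub> e i)}"

context kalg
begin

context
  fixes I :: "'i set" and e :: "'i \<Rightarrow> 'a"
  assumes I: "finite I" and eI: "e ` I \<subseteq> carrier A"
begin

private lemma e: "i \<in> I \<Longrightarrow> e i \<in> carrier A"
  using eI by blast

lemma lcs_closed: "lcs A I e \<subseteq> carrier A"
  unfolding lcs_def using e by (auto intro!: finsum_in)

lemma lcs_zero: "\<zero> \<in> lcs A I e"
  unfolding lcs_def using e by (auto intro!: exI[of _ "\<lambda>_. 0"] add.finprod_one_eqI[symmetric])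

lemma lcs_add:
  assumes "x \<in> lcs A I e" "y \<in> lcs A I e" shows "x \<oplus> y \<in> lcs A I e"
proof -
  obtain c d where cd: "x = (\<Oplus>i\<in>I. c i \<odot> e i)" "y = (\<Oplus>i\<in>I. d i \<odot> e i)" using assms by (auto simp: lcs_def)
  have "(\<Oplus>i\<in>I. (c i + d i) \<odot> e i) = (\<Oplus>i\<in>I. c i \<odot> e i \<oplus> d i \<odot> e i)"
    by (rule finsum_cong_all) (simp_all add: smult_add_left e)
  also have "\<dots> = x \<oplus> y" unfolding cd by (rule finsum_addf) (auto simp: e)
  finally show ?thesis unfolding lcs_def by (auto intro!: exI[of _ "\<lambda>i. c i + d i"])
qed

lemma lcs_smult:
  assumes "x \<in> lcs A I e" shows "p \<odot> x \<in> lcs A I e"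
proof -
  obtain c where c: "x = (\<Oplus>i\<in>I. c i \<odot> e i)" using assms by (auto simp: lcs_def)
  have "(\<Oplus>i\<in>I. (p * c i) \<odot> e i) = (\<Oplus>i\<in>I. p \<odot> (c i \<odot> e i))"
    by (rule finsum_cong_all) (simp_all add: smult_assoc e)
  also have "\<dots> = p \<odot> x" unfolding c by (rule finsum_smult[symmetric]) (auto simp: e)
  finally show ?thesis unfolding lcs_def by (auto intro!: exI[of _ "\<lambda>i. p * c i"])
qed

lemma lcs_gen:
  assumes i: "i \<in> I" shows "e i \<in> lcs A I e"
proof -
  have "(\<Oplus>j\<in>I. (if j = i then 1 else 0) \<odot> e j) = (if i = i then 1 else 0) \<odot> e i"
    by (rule finsum_single) (use I i e in auto)
  then show ?thesis unfolding lcs_def using e[OF i] by (auto intro!: exI[of _ "\<lambda>j. if j = i then 1 else 0"])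
qed

end

end

lemma finite_maximizer:
  fixes d :: "'i \<Rightarrow> nat"
  assumes "finite J" "J \<noteq> {}"
  shows "\<exists>i\<in>J. \<forall>j\<in>J. d j \<le> d i"
  using assms
proof (induction J rule: finite_ne_induct)
  case (insert x J)
  then obtain i where i: "i \<in> J" "\<forall>j\<in>J. d j \<le> d i" by blast
  show ?case
  proof (cases "d x \<le> d i")
    case True
    then show ?thesis using i by (intro bexI[of _ i]) auto
  next
    case False
    then show ?thesis using i by (intro bexI[of _ x]) (auto intro: order_trans less_imp_le)
  qed
qed simp

text \<open>Each \<open>b i\<close> is \<open>e i\<close> minus a combination of basis elements of
  smaller degree, so induction on the degree gives spanning. For independence one looks at a
  coefficient of maximal degree.\<close>

lemma (in fbasis) is_basis_triangular:
  fixes e :: "'i \<Rightarrow> 'a" and deg :: "'i \<Rightarrow> nat"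
  assumes e: "\<And>i. i \<in> I \<Longrightarrow> e i \<in> carrier M"
    and diag: "\<And>i. i \<in> I \<Longrightarrow> crd (e i) i = 1"
    and tri: "\<And>i j. i \<in> I \<Longrightarrow> j \<in> I \<Longrightarrow> crd (e i) j \<noteq> 0 \<Longrightarrow> j = i \<or> deg j < deg i"
  shows "is_basis M I e"
proof (rule is_basisI[OF kalg_axioms finite_I])
  show "i \<in> I \<Longrightarrow> e i \<in> carrier M" for i by (rule e)
  define N where "N = lcs M I e"
  have eI: "e ` I \<subseteq> carrier M" using e by blast
  note N = lcs_closed[OF finite_I eI] lcs_zero[OF finite_I eI] lcs_add[OF finite_I eI]
    lcs_smult[OF finite_I eI] lcs_gen[OF finite_I eI]
  note N = N[folded N_def]
  have bN: "i \<in> I \<Longrightarrow> b i \<in> N" for i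
  proof (induction "deg i" arbitrary: i rule: less_induct)
    case less
    let ?f = "\<lambda>j. crd (e i) j \<odot> b j"
    have "(\<Oplus>j\<in>insert i (I - {i}). ?f j) = ?f i \<oplus> (\<Oplus>j\<in>I - {i}. ?f j)"
      using finite_I less.prems by (intro finsum_insert) auto
    moreover have "insert i (I - {i}) = I" using less.prems by auto
    ultimately have ei: "e i = b i \<oplus> (\<Oplus>j\<in>I - {i}. ?f j)"
      using crd_expand[OF e[OF less.prems]] diag[OF less.prems] less.prems by simp
    have "(\<Oplus>j\<in>I - {i}. ?f j) \<in> N"
    proof (rule sub_finsum[OF N(2,3,1)])
      fix j assume j: "j \<in> I - {i}"
      show "?f j \<in> N"
      proof (cases "crd (e i) j = 0")
        case True
        then show ?thesis using N(2) j by simp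
      next
        case False
        then have "deg j < deg i" using tri[OF less.prems, of j] j by auto
        then show ?thesis using less.hyps[of j] j by (auto intro: N(4))
      qed
    qed
    then obtain s where s: "s \<in> N" "e i = b i \<oplus> s" using ei by blast
    then have sc: "s \<in> carrier M" using N(1) by blast
    have "e i \<oplus> (- 1) \<odot> s = b i"
      unfolding s(2) using less.prems sc by (simp add: a_assoc r_neg minus_eq_smult[symmetric])
    then show ?case using N(3)[OF N(5)[OF less.prems] N(4)[OF s(1), of "- 1"]] by simp
  qed
  fix x assume x: "x \<in> carrier M"
  have "(\<Oplus>i\<in>I. crd x i \<odot> b i) \<in> N"
    by (rule sub_finsum[OF N(2,3,1)]) (auto intro: N(4) bN)
  then show "\<exists>c. x = (\<Oplus>i\<in>I. c i \<odot> e i)" using crd_expand[OF x] by (simp add: N_def lcs_def)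
next
  fix c i0 assume 0: "(\<Oplus>i\<in>I. c i \<odot> e i) = \<zero>" and i0: "i0 \<in> I"
  show "c i0 = 0"
  proof (rule ccontr)
    assume "c i0 \<noteq> 0"
    let ?J = "{i \<in> I. c i \<noteq> 0}"
    have J: "finite ?J" "?J \<noteq> {}" using finite_I i0 \<open>c i0 \<noteq> 0\<close> by auto
    \<comment> \<open>Another \<open>e j\<close> with nonzero coefficient could reach the coordinate
      at \<open>i\<close> only if its degree exceeded that of \<open>i\<close>, against
      maximality.\<close>
    obtain i where i: "i \<in> ?J" and max: "\<And>j. j \<in> ?J \<Longrightarrow> deg j \<le> deg i"
      using finite_maximizer[OF J, of deg] by blast
    have "crd (\<Oplus>j\<in>I. c j \<odot> e j) i = (\<Sum>j\<in>I. crd (c j \<odot> e j) i)"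
      by (rule crd_finsum) (simp add: e)
    also have "\<dots> = (\<Sum>j\<in>I. if j = i then c i else 0)"
    proof (rule sum.cong)
      fix j assume j: "j \<in> I"
      show "crd (c j \<odot> e j) i = (if j = i then c i else 0)"
      proof (cases "j = i")
        case False
        have "c j * crd (e j) i = 0"
        proof (rule ccontr)
          assume "c j * crd (e j) i \<noteq> 0"
          then have "c j \<noteq> 0" "crd (e j) i \<noteq> 0" by auto
          then show False using tri[OF j, of i] i max[of j] j False by fastforce
        qed
        then show ?thesis using False e[OF j] by (simp add: crd_smult)
      qed (use e[OF j] diag[OF j] in \<open>simp add: crd_smult\<close>)
    qed simp
    also have "\<dots> = c i" using finite_I i by simp
    finally show False using 0 i by simp
  qed
qed

text \<open>Passes the relations and the monomials from T(V) x G [t] to its quotient.\<close>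

lemma xalg_hom:
  assumes M: "xalg M n G r x u" and M': "kalg M'"
    and lin: "linear_on M M' h"
    and mult: "\<And>a b. a \<in> carrier M \<Longrightarrow> b \<in> carrier M \<Longrightarrow> h (a \<otimes>\<^bsub>M\<^esub> b) = h a \<otimes>\<^bsub>M'\<^esub> h b"
    and one: "h \<one>\<^bsub>M\<^esub> = \<one>\<^bsub>M'\<^esub>"
  shows "xalg M' n G r (\<lambda>i. h (x i)) (\<lambda>g. h (u g))"
    and "set w \<subseteq> {1..n} \<Longrightarrow> g \<in> G \<Longrightarrow> xalg.e M' (\<lambda>i. h (x i)) (\<lambda>g. h (u g)) w g = h (xalg.e M x u w g)"
proof -
  interpret M: xalg M n G r x u by (rule M)
  interpret M': kalg M' by (rule M')
  note hl = linear_onD[OF lin]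
  show X: "xalg M' n G r (\<lambda>i. h (x i)) (\<lambda>g. h (u g))"
  proof (intro xalg.intro M' xalg_axioms.intro)
    fix g i assume g: "g \<in> G" and i: "i \<in> {1..n}"
    have xj: "x j \<in> carrier M" if "j \<in> {1..n}" for j using that by (rule M.x_closed)
    have s: "(\<Oplus>\<^bsub>M\<^esub>j\<in>{1..n}. [:r g i j:] \<odot>\<^bsub>M\<^esub> x j) \<in> carrier M"
      by (intro M.finsum_in M.smult_closed xj)
    have "h (\<Oplus>\<^bsub>M\<^esub>j\<in>{1..n}. [:r g i j:] \<odot>\<^bsub>M\<^esub> x j) = (\<Oplus>\<^bsub>M'\<^esub>j\<in>{1..n}. h ([:r g i j:] \<odot>\<^bsub>M\<^esub> x j))"
      by (rule linear_on_finsum[OF M.kalg_axioms M' lin]) (intro M.smult_closed xj)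
    also have "\<dots> = (\<Oplus>\<^bsub>M'\<^esub>j\<in>{1..n}. [:r g i j:] \<odot>\<^bsub>M'\<^esub> h (x j))"
      by (rule M'.finsum_cong_all) (simp_all only: hl xj M'.smult_closed)
    finally show "h (u g) \<otimes>\<^bsub>M'\<^esub> h (x i) = (\<Oplus>\<^bsub>M'\<^esub>j\<in>{1..n}. [:r g i j:] \<odot>\<^bsub>M'\<^esub> h (x j)) \<otimes>\<^bsub>M'\<^esub> h (u g)"
      using M.u_x[OF g i] mult[OF M.u_closed[OF g] xj[OF i]] mult[OF s M.u_closed[OF g]] by simp
  qed (simp_all only: M.G1 M.G2 hl M.x_closed M.u_closed M.u_mult mult[symmetric] M.u_id one)
  interpret X: xalg M' n G r "\<lambda>i. h (x i)" "\<lambda>g. h (u g)" by (rule X)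
  assume w: "set w \<subseteq> {1..n}" and g: "g \<in> G"
  have "X.xw w = h (M.xw w)" using w
  proof (induction w)
    case (Cons i w)
    then have "i \<in> {1..n}" "set w \<subseteq> {1..n}" by auto
    then show ?case using Cons.IH mult[OF M.x_closed M.xw_closed] by (simp add: X.xw_simps(2) M.xw_simps(2) del: atLeastAtMost_iff One_nat_def)
  qed (simp add: X.xw_simps M.xw_simps one)
  then show "X.e w g = h (M.e w g)"
    using mult[OF M.xw_closed[OF w] M.u_closed[OF g]] by (simp add: X.e_def M.e_def)
qed

section \<open>The algebra of a bilinear function\<close>

locale qkappa = qdata n q scale v G for n and q :: "nat \<Rightarrow> nat \<Rightarrow> 'k::field" and scale :: "'k \<Rightarrow> 'v::ab_group_add \<Rightarrow> 'v" and v G +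
  fixes \<kappa> :: "'v \<Rightarrow> 'v \<Rightarrow> ('v \<Rightarrow> 'v) \<Rightarrow> 'k"
  assumes kappa_off: "g \<notin> G \<Longrightarrow> \<kappa> a b g = 0"
begin

abbreviation "k0 i j g \<equiv> \<kappa> (v i) (v j) g"

text \<open>The generator of the ideal rewritten with t as a scalar and the group algebra element as
  a combination of the \<open>uP g\<close>, so that a homomorphism out of T(V) x G [t] can be
  applied to it directly.\<close>

definition gen :: "nat \<Rightarrow> nat \<Rightarrow> nat \<Rightarrow> ('v \<Rightarrow> 'v) \<Rightarrow> nat list \<Rightarrow> 'k" where
  "gen i j = (xP j \<otimes>\<^bsub>P\<^esub> xP i \<ominus>\<^bsub>P\<^esub> [:q i j:] \<odot>\<^bsub>P\<^esub> (xP i \<otimes>\<^bsub>P\<^esub> xP j)) \<ominus>\<^bsub>P\<^esub> [:0, 1:] \<odot>\<^bsub>P\<^esub> (\<Oplus>\<^bsub>P\<^esub>g\<in>G. [:k0 i j g:] \<odot>\<^bsub>P\<^esub> uP g)"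

definition gens :: "(nat \<Rightarrow> ('v \<Rightarrow> 'v) \<Rightarrow> nat list \<Rightarrow> 'k) set" where
  "gens = {gen i j | i j. i \<in> {1..n} \<and> j \<in> {1..n}} \<union> {xP i \<otimes>\<^bsub>P\<^esub> xP i | i. i \<in> {1..n}}"

lemma embed_eq: "group_algebra_embed n (\<kappa> a b) = (\<Oplus>\<^bsub>S\<^esub>g\<in>G. \<kappa> a b g \<odot>\<^bsub>S\<^esub> tensor_g n g)"
proof
  fix h
  have "(\<Oplus>\<^bsub>S\<^esub>g\<in>G. \<kappa> a b g \<odot>\<^bsub>S\<^esub> tensor_g n g) h = (\<Oplus>\<^bsub>T\<^esub>g\<in>G. (\<kappa> a b g \<odot>\<^bsub>S\<^esub> tensor_g n g) h)"
    using S.smult_closed[OF tensor_g_closed] unfolding S_eq by (rule TS.skew_finsum)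
  also have "\<dots> = (\<Oplus>\<^bsub>T\<^esub>g\<in>G. if g = h then \<kappa> a b g \<odot>\<^bsub>T\<^esub> \<one>\<^bsub>T\<^esub> else \<zero>\<^bsub>T\<^esub>)"
    unfolding tensor_g_eq S_eq TS.skew_simps(6) by (rule T.finsum_cong_all) (auto simp: skew_elem_def)
  also have "\<dots> = \<kappa> a b h \<odot>\<^bsub>T\<^esub> \<one>\<^bsub>T\<^esub>"
  proof (cases "h \<in> G")
    case True
    then show ?thesis using T.finsum_delta[OF finite_G True, of "\<lambda>g. \<kappa> a b g \<odot>\<^bsub>T\<^esub> \<one>\<^bsub>T\<^esub>"] by simp
  next
    case False
    then have "(\<Oplus>\<^bsub>T\<^esub>g\<in>G. if g = h then \<kappa> a b g \<odot>\<^bsub>T\<^esub> \<one>\<^bsub>T\<^esub> else \<zero>\<^bsub>T\<^esub>) = \<zero>\<^bsub>T\<^esub>"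
      by (intro T.add.finprod_one_eqI) auto
    then show ?thesis using False by (simp add: kappa_off)
  qed
  finally show "group_algebra_embed n (\<kappa> a b) h = (\<Oplus>\<^bsub>S\<^esub>g\<in>G. \<kappa> a b g \<odot>\<^bsub>S\<^esub> tensor_g n g) h"
    by (simp add: group_algebra_embed_def)
qed

lemma gen_eq:
  assumes i: "i \<in> {1..n}" and j: "j \<in> {1..n}"
  shows "tmonom S (tensor_v n j \<otimes>\<^bsub>S\<^esub> tensor_v n i \<ominus>\<^bsub>S\<^esub> q i j \<odot>\<^bsub>S\<^esub> (tensor_v n i \<otimes>\<^bsub>S\<^esub> tensor_v n j)) 0
     \<ominus>\<^bsub>P\<^esub> tmonom S (group_algebra_embed n (\<kappa> (v i) (v j))) 1 = gen i j"
proof -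
  note c = tensor_v_closed[OF i] tensor_v_closed[OF j]
  note m = S.m_closed[OF c(2,1)] S.m_closed[OF c]
  have diff: "tmonom S (a \<ominus>\<^bsub>S\<^esub> b) 0 = tmonom S a 0 \<ominus>\<^bsub>P\<^esub> tmonom S b 0" if "a \<in> carrier S" "b \<in> carrier S" for a b
  proof -
    have "tmonom S ((- 1) \<odot>\<^bsub>S\<^esub> b) 0 = [:- 1:] \<odot>\<^bsub>P\<^esub> tmonom S b 0" by (rule PS.tmonom_linear(2)[OF that(2) that(2)])
    moreover have "[:- 1:] = (- 1 :: 'k poly)" by (simp add: one_pCons)
    ultimately show ?thesis
      using that by (simp add: S.diff_eq_smult PS.P.diff_eq_smult PS.tmonom_linear(1))
  qed
  have 1: "tmonom S (tensor_v n j \<otimes>\<^bsub>S\<^esub> tensor_v n i \<ominus>\<^bsub>S\<^esub> q i j \<odot>\<^bsub>S\<^esub> (tensor_v n i \<otimes>\<^bsub>S\<^esub> tensor_v n j)) 0 =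
     xP j \<otimes>\<^bsub>P\<^esub> xP i \<ominus>\<^bsub>P\<^esub> [:q i j:] \<odot>\<^bsub>P\<^esub> (xP i \<otimes>\<^bsub>P\<^esub> xP j)"
    using m by (simp only: diff S.smult_closed PS.tmonom_linear(2)[OF m(2) m(2)] PS.tmonom_mult c)
  have s: "(\<Oplus>\<^bsub>S\<^esub>g\<in>G. k0 i j g \<odot>\<^bsub>S\<^esub> tensor_g n g) \<in> carrier S"
    by (intro S.finsum_in S.smult_closed tensor_g_closed)
  have "tmonom S (group_algebra_embed n (\<kappa> (v i) (v j))) 1 = [:0, 1:] \<odot>\<^bsub>P\<^esub> tmonom S (\<Oplus>\<^bsub>S\<^esub>g\<in>G. k0 i j g \<odot>\<^bsub>S\<^esub> tensor_g n g) 0"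
    unfolding embed_eq using PS.smult_monom_tmonom[OF s, of 1 1 0] s by (simp add: monom_altdef)
  also have "tmonom S (\<Oplus>\<^bsub>S\<^esub>g\<in>G. k0 i j g \<odot>\<^bsub>S\<^esub> tensor_g n g) 0 = (\<Oplus>\<^bsub>P\<^esub>g\<in>G. [:k0 i j g:] \<odot>\<^bsub>P\<^esub> uP g)"
    by (rule PS.tmonom_lc) (rule tensor_g_closed)
  finally show ?thesis unfolding 1 gen_def by simp
qed

section \<open>The quotient by the relations of a bilinear function\<close>

abbreviation "I \<equiv> qdh_ideal scale v n G q \<kappa>"
abbreviation "HK \<equiv> qdh_algebra scale v n G q \<kappa>"
abbreviation "hx \<equiv> qdh_v scale v n G q \<kappa>"
abbreviation "hu \<equiv> qdh_g scale v n G q \<kappa>"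

lemma I_eq: "I = Idl\<^bsub>P\<^esub> gens"
proof -
  have sq: "tmonom S (tensor_v n i \<otimes>\<^bsub>S\<^esub> tensor_v n i) 0 = xP i \<otimes>\<^bsub>P\<^esub> xP i" if "i \<in> {1..n}" for i
    using that by (simp only: PS.tmonom_mult tensor_v_closed)
  have "{tmonom S (tensor_v n j \<otimes>\<^bsub>S\<^esub> tensor_v n i \<ominus>\<^bsub>S\<^esub> q i j \<odot>\<^bsub>S\<^esub> (tensor_v n i \<otimes>\<^bsub>S\<^esub> tensor_v n j)) 0
     \<ominus>\<^bsub>P\<^esub> tmonom S (group_algebra_embed n (\<kappa> (v i) (v j))) 1 | i j. i \<in> {1..n} \<and> j \<in> {1..n}} = {gen i j | i j. i \<in> {1..n} \<and> j \<in> {1..n}}"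
    by (intro Collect_cong ex_cong1, rule rev_conj_cong, rule refl, erule conjE, simp only: gen_eq)
  moreover have "{tmonom S (tensor_v n i \<otimes>\<^bsub>S\<^esub> tensor_v n i) 0 | i. i \<in> {1..n}} = {xP i \<otimes>\<^bsub>P\<^esub> xP i | i. i \<in> {1..n}}"
    by (intro Collect_cong ex_cong1, rule rev_conj_cong, rule refl, simp only: sq)
  ultimately show ?thesis unfolding qdh_ideal_def Let_def gens_def by (simp only:)
qed

lemma k_sum_closed: "(\<Oplus>\<^bsub>P\<^esub>g\<in>G. [:k0 i j g:] \<odot>\<^bsub>P\<^esub> uP g) \<in> carrier P"
  by (intro PS.P.finsum_in PS.P.smult_closed PX.u_closed)

lemma gen_closed: "i \<in> {1..n} \<Longrightarrow> j \<in> {1..n} \<Longrightarrow> gen i j \<in> carrier P"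
  unfolding gen_def by (intro PS.P.minus_closed PS.P.smult_closed PS.P.m_closed PX.x_closed k_sum_closed)

lemma gens_closed: "gens \<subseteq> carrier P"
  unfolding gens_def by (safe; intro gen_closed PS.P.m_closed PX.x_closed)

lemma ideal_I: "ideal I P"
  unfolding I_eq by (rule PS.P.genideal_ideal[OF gens_closed])

lemma gens_I: "z \<in> gens \<Longrightarrow> z \<in> I"
  unfolding I_eq using PS.P.genideal_self[OF gens_closed] by blast

lemma H_eq: "HK = quot_algebra P I"
  by (simp add: qdh_algebra_def)

sublocale I: ideal I P by (rule ideal_I)
sublocale HK: kalg HK unfolding H_eq by (rule PS.P.kalg_quot_algebra[OF ideal_I])

abbreviation "hc \<equiv> (+>\<^bsub>P\<^esub>) I"

lemma linear_on_hc: "linear_on P HK hc"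
  unfolding H_eq by (rule PS.P.linear_on_coset[OF ideal_I])

lemmas hc_linear = linear_onD[OF linear_on_hc]

lemma hc_mult: "a \<in> carrier P \<Longrightarrow> b \<in> carrier P \<Longrightarrow> hc (a \<otimes>\<^bsub>P\<^esub> b) = hc a \<otimes>\<^bsub>HK\<^esub> hc b"
  unfolding H_eq by (simp add: I.rcoset_mult_add)

lemma hc_one: "hc \<one>\<^bsub>P\<^esub> = \<one>\<^bsub>HK\<^esub>" and H_zero: "\<zero>\<^bsub>HK\<^esub> = I"
  unfolding H_eq by simp_all

lemma hc_eq_zero: "a \<in> carrier P \<Longrightarrow> hc a = \<zero>\<^bsub>HK\<^esub> \<longleftrightarrow> a \<in> I"
  unfolding H_zero using PS.P.ideal_diff_coset[OF ideal_I] by simp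

lemma H_carrierE: assumes "X \<in> carrier HK" obtains a where "a \<in> carrier P" "X = hc a"
  using assms unfolding H_eq quot_algebra_simps by (rule quot_carrierE) (rule that)

lemma hx_eq: "hx i = hc (xP i)" and hu_eq: "hu g = hc (uP g)"
  by (simp_all add: qdh_v_def qdh_g_def Let_def)

sublocale HX: xalg HK n G rr hx hu
  unfolding hx_eq[abs_def] hu_eq[abs_def] 
  by (rule xalg_hom(1)[OF PX.xalg_axioms HK.kalg_axioms linear_on_hc]) (simp_all only: hc_mult hc_one)

lemma HX_e: "set w \<subseteq> {1..n} \<Longrightarrow> g \<in> G \<Longrightarrow> HX.e w g = hc (PX.e w g)"
  unfolding hx_eq[abs_def] hu_eq[abs_def]
  by (rule xalg_hom(2)[OF PX.xalg_axioms HK.kalg_axioms linear_on_hc]) (simp_all only: hc_mult hc_one)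

lemma H_square: "i \<in> {1..n} \<Longrightarrow> hx i \<otimes>\<^bsub>HK\<^esub> hx i = \<zero>\<^bsub>HK\<^esub>"
proof -
  assume i: "i \<in> {1..n}"
  have "xP i \<otimes>\<^bsub>P\<^esub> xP i \<in> gens" unfolding gens_def by (intro UnI2 CollectI exI[of _ i] conjI refl i)
  then have "hc (xP i \<otimes>\<^bsub>P\<^esub> xP i) = \<zero>\<^bsub>HK\<^esub>"
    using hc_eq_zero[OF PS.P.m_closed[OF PX.x_closed[OF i] PX.x_closed[OF i]]] gens_I by simp
  then show ?thesis by (simp only: hx_eq hc_mult[OF PX.x_closed[OF i] PX.x_closed[OF i]])
qed

lemma H_swap:
  assumes i: "i \<in> {1..n}" and j: "j \<in> {1..n}"
  shows "hx j \<otimes>\<^bsub>HK\<^esub> hx i = [:q i j:] \<odot>\<^bsub>HK\<^esub> (hx i \<otimes>\<^bsub>HK\<^esub> hx j) \<oplus>\<^bsub>HK\<^esub> [:0, 1:] \<odot>\<^bsub>HK\<^esub> (\<Oplus>\<^bsub>HK\<^esub>g\<in>G. [:k0 i j g:] \<odot>\<^bsub>HK\<^esub> hu g)"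
proof -
  let ?k = "\<Oplus>\<^bsub>P\<^esub>g\<in>G. [:k0 i j g:] \<odot>\<^bsub>P\<^esub> uP g"
  note c = PX.x_closed[OF i] PX.x_closed[OF j]
  note m = PS.P.m_closed[OF c(2,1)] PS.P.m_closed[OF c]
  have "gen i j \<in> I" using i j by (intro gens_I) (auto simp: gens_def)
  then have "hc (gen i j) = \<zero>\<^bsub>HK\<^esub>" using hc_eq_zero gen_closed[OF i j] by blast
  moreover have "hc (gen i j) = (hc (xP j \<otimes>\<^bsub>P\<^esub> xP i) \<ominus>\<^bsub>HK\<^esub> [:q i j:] \<odot>\<^bsub>HK\<^esub> hc (xP i \<otimes>\<^bsub>P\<^esub> xP j)) \<ominus>\<^bsub>HK\<^esub> [:0, 1:] \<odot>\<^bsub>HK\<^esub> hc ?k"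
    unfolding gen_def using m k_sum_closed[of i j]
    by (simp only: linear_on_diff[OF PS.P.kalg_axioms HK.kalg_axioms linear_on_hc] PS.P.minus_closed PS.P.smult_closed hc_linear)
  ultimately have "(hc (xP j \<otimes>\<^bsub>P\<^esub> xP i) \<ominus>\<^bsub>HK\<^esub> [:q i j:] \<odot>\<^bsub>HK\<^esub> hc (xP i \<otimes>\<^bsub>P\<^esub> xP j)) \<ominus>\<^bsub>HK\<^esub> [:0, 1:] \<odot>\<^bsub>HK\<^esub> hc ?k = \<zero>\<^bsub>HK\<^esub>" by simp
  then have "hc (xP j \<otimes>\<^bsub>P\<^esub> xP i) = [:q i j:] \<odot>\<^bsub>HK\<^esub> hc (xP i \<otimes>\<^bsub>P\<^esub> xP j) \<oplus>\<^bsub>HK\<^esub> [:0, 1:] \<odot>\<^bsub>HK\<^esub> hc ?k"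
    by (rule HK.eq_add_if_diff_zero[rotated 3]) (intro HK.smult_closed hc_linear(1) m k_sum_closed)+
  moreover have "hc ?k = (\<Oplus>\<^bsub>HK\<^esub>g\<in>G. [:k0 i j g:] \<odot>\<^bsub>HK\<^esub> hu g)"
  proof -
    have "hc ?k = (\<Oplus>\<^bsub>HK\<^esub>g\<in>G. hc ([:k0 i j g:] \<odot>\<^bsub>P\<^esub> uP g))"
      by (rule linear_on_finsum[OF PS.P.kalg_axioms HK.kalg_axioms linear_on_hc]) (intro PS.P.smult_closed PX.u_closed)
    also have "\<dots> = (\<Oplus>\<^bsub>HK\<^esub>g\<in>G. [:k0 i j g:] \<odot>\<^bsub>HK\<^esub> hu g)"
      by (rule HK.finsum_cong_all) (simp_all only: hc_linear PX.u_closed hu_eq HK.smult_closed)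
    finally show ?thesis .
  qed
  ultimately show ?thesis unfolding hx_eq hc_mult[OF c] hc_mult[OF c(2,1)] by simp
qed

abbreviation "E \<equiv> \<lambda>(\<alpha>, g). PX.e (wd n \<alpha>) g"
abbreviation "hE \<equiv> \<lambda>(\<alpha>, g). HX.e (wd n \<alpha>) g"

lemma E_closed: "i \<in> bI \<Longrightarrow> E i \<in> carrier P"
  by (cases i) (simp add: PX.e_closed[OF wd_sorted(3)])

lemma hE_eq: "i \<in> bI \<Longrightarrow> hE i = hc (E i)"
  by (cases i) (simp add: HX_e[OF wd_sorted(3)])

lemma hc_lc: "hc (\<Oplus>\<^bsub>P\<^esub>i\<in>bI. c i \<odot>\<^bsub>P\<^esub> E i) = (\<Oplus>\<^bsub>HK\<^esub>i\<in>bI. c i \<odot>\<^bsub>HK\<^esub> hE i)"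
proof -
  have "hc (\<Oplus>\<^bsub>P\<^esub>i\<in>bI. c i \<odot>\<^bsub>P\<^esub> E i) = (\<Oplus>\<^bsub>HK\<^esub>i\<in>bI. hc (c i \<odot>\<^bsub>P\<^esub> E i))"
    by (rule linear_on_finsum[OF PS.P.kalg_axioms HK.kalg_axioms linear_on_hc]) (intro PS.P.smult_closed E_closed)
  also have "\<dots> = (\<Oplus>\<^bsub>HK\<^esub>i\<in>bI. c i \<odot>\<^bsub>HK\<^esub> hE i)"
    by (rule HK.finsum_cong_all) (simp_all only: hc_linear E_closed hE_eq HK.smult_closed)
  finally show ?thesis .
qed

lemma P_lc_closed: "(\<Oplus>\<^bsub>P\<^esub>i\<in>bI. c i \<odot>\<^bsub>P\<^esub> E i) \<in> carrier P"
  by (intro PS.P.finsum_in PS.P.smult_closed E_closed)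

text \<open>Spanning holds for every bilinear function; it is independence that singles out the
  truncated quantum Drinfeld Hecke algebras.\<close>

lemma H_span:
  assumes "X \<in> carrier HK"
  shows "\<exists>c. X = (\<Oplus>\<^bsub>HK\<^esub>i\<in>bI. c i \<odot>\<^bsub>HK\<^esub> hE i)"
proof -
  have e: "hE i \<in> carrier HK" if "i \<in> bI" for i using that HX.e_closed[OF wd_sorted(3)] by auto
  define N where "N = lcs HK bI hE"
  from e have eI: "hE ` bI \<subseteq> carrier HK" by blast
  note N' = HK.lcs_closed[OF finite_bI eI] HK.lcs_zero[OF finite_bI eI] HK.lcs_add[OF finite_bI eI]
    HK.lcs_smult[OF finite_bI eI] HK.lcs_gen[OF finite_bI eI]
  note N' = N'[folded N_def]
  have N: "psub HK N" unfolding psub_def using N' by blast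
  note Nc = N'(1)
  have base: "HX.e (wd n \<alpha>) g \<in> N" if "\<alpha> \<in> expo n" "g \<in> G" for \<alpha> g
    using N'(5)[of "(\<alpha>, g)"] that by auto
  have words: "HX.e w g \<in> N" if "set w \<subseteq> {1..n}" "g \<in> G" for w g
  proof (rule HX.e_span[OF N Nc finite_G])
    fix i j assume "i \<in> {1..n}" "j \<in> {1..n}"
    then show "hx j \<otimes>\<^bsub>HK\<^esub> hx i = [:q i j:] \<odot>\<^bsub>HK\<^esub> (hx i \<otimes>\<^bsub>HK\<^esub> hx j) \<oplus>\<^bsub>HK\<^esub> [:0, 1:] \<odot>\<^bsub>HK\<^esub> (\<Oplus>\<^bsub>HK\<^esub>g\<in>G. [:k0 i j g:] \<odot>\<^bsub>HK\<^esub> hu g)"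
      by (rule H_swap)
  qed (rule H_square base that; assumption)+
  obtain p where p: "p \<in> carrier P" "X = hc p" using assms by (rule H_carrierE)
  have "hc p \<in> N" using p(1)
  proof (induction p rule: P_induct)
    case zero
    then show ?case using N hc_eq_zero[of "\<zero>\<^bsub>P\<^esub>"] by (simp add: psub_def)
  next
    case (elem p w g)
    then show ?case using N words[OF elem] HX_e[OF elem] PX.e_closed[OF elem] by (simp add: hc_linear psub_def)
  next
    case (add f h)
    then show ?case using N by (simp add: hc_linear psub_def)
  qed
  then show ?thesis using p(2) by (simp add: N_def lcs_def)
qed

text \<open>An exponent 0 contributes the unit and an exponent 1 the letter, so the ordered product
  of powers is the product along the increasing word.\<close>

lemma pbw_monomial:
  assumes \<alpha>: "\<alpha> \<in> expo n" 
  shows "list_prod HK (map (\<lambda>i. hx i [^]\<^bsub>HK\<^esub> (\<alpha> i :: nat)) [1..<Suc n]) = HX.xw (wd n \<alpha>)"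
proof -
  have "set xs \<subseteq> {1..n} \<Longrightarrow> list_prod HK (map (\<lambda>i. hx i [^]\<^bsub>HK\<^esub> \<alpha> i) xs) = list_prod HK (map hx (filter (\<lambda>i. \<alpha> i = 1) xs))" for xs
  proof (induction xs)
    case (Cons i xs)
    then have i: "i \<in> {1..n}" and xs: "set xs \<subseteq> {1..n}" by auto
    have "\<alpha> i \<in> {0, 1}" using \<alpha> i unfolding expo_def by (rule PiE_mem)
    then have "\<alpha> i = 0 \<or> \<alpha> i = 1" by simp
    moreover have "list_prod HK (map hx (filter (\<lambda>i. \<alpha> i = 1) xs)) \<in> carrier HK"
      using xs HX.x_closed by (intro HK.list_prod_closed) (auto simp del: atLeastAtMost_iff One_nat_def)
    ultimately show ?case using Cons.IH[OF xs] HX.x_closed[OF i] by (elim disjE) simp_all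
  qed simp
  from this[of "[1..<Suc n]"] show ?thesis by (simp add: HX.xw_def wd_def atLeastLessThanSuc_atLeastAtMost del: upt_Suc One_nat_def)
qed

lemma is_truncated_qdh_iff: "is_truncated_qdh scale v n G q \<kappa> \<longleftrightarrow> is_basis HK bI hE"
proof -
  let ?b = "\<lambda>(\<alpha>, g). list_prod HK (map (\<lambda>i. hx i [^]\<^bsub>HK\<^esub> (\<alpha> i :: nat)) [1..<Suc n]) \<otimes>\<^bsub>HK\<^esub> hu g"
  have eq: "?b i = hE i" if ibI: "i \<in> bI" for i
  proof -
    obtain \<alpha> g where i: "i = (\<alpha>, g)" "\<alpha> \<in> expo n" using ibI by auto
    show ?thesis unfolding i(1) prod.case HX.e_def pbw_monomial[OF i(2)] by (rule refl)
  qed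
  have "is_basis HK bI ?b \<longleftrightarrow> is_basis HK bI hE"
  proof
    show "is_basis HK bI hE" if "is_basis HK bI ?b"
      by (rule is_basis_cong[OF HK.kalg_axioms finite_bI eq that])
    show "is_basis HK bI ?b" if "is_basis HK bI hE"
      by (rule is_basis_cong[OF HK.kalg_axioms finite_bI eq[symmetric] that])
  qed
  then show ?thesis unfolding is_truncated_qdh_def Let_def expo_def .
qed

end

section \<open>Isomorphism with an algebra satisfying the relations\<close>

lemma (in kalg) diff_zero_if_eq_add:
  assumes "b \<in> carrier A" "c \<in> carrier A" shows "((b \<oplus> c) \<ominus> b) \<ominus> c = \<zero>"
proof -
  have "(b \<oplus> c) \<ominus> b = c \<oplus> (b \<ominus> b)" using assms by (simp add: a_minus_def a_ac)
  then show ?thesis using assms by (simp add: r_neg a_minus_def)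
qed

lemma (in kpoly) PA_lc_apply:
  assumes "\<And>i. i \<in> X \<Longrightarrow> b i \<in> carrier A"
  shows "(\<Oplus>\<^bsub>PA\<^esub>i\<in>X. c i \<odot>\<^bsub>PA\<^esub> tmonom A (b i) 0) m = (\<Oplus>i\<in>X. Polynomial.coeff (c i) m \<odot> b i)"
proof -
  have "(\<Oplus>\<^bsub>PA\<^esub>i\<in>X. c i \<odot>\<^bsub>PA\<^esub> tmonom A (b i) 0) m = (\<Oplus>i\<in>X. (c i \<odot>\<^bsub>PA\<^esub> tmonom A (b i) 0) m)"
    by (rule PA_finsum) (intro P.smult_closed tmonom_closed assms)
  also have "\<dots> = (\<Oplus>i\<in>X. Polynomial.coeff (c i) m \<odot> b i)"
    by (rule finsum_cong_all) (simp_all add: smult_tmonom assms)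
  finally show ?thesis .
qed

text \<open>Spanning in the quotient and independence of the image monomials in B squeeze the
  kernel: modulo I every element is a combination of PBW monomials, and such a combination is
  detected by its image. Both conclusions follow together.\<close>

lemma (in qkappa) pbw_iso:
  fixes B :: "('k poly, 'b) module"
  assumes X: "xalg B n G rr x u"
    and swap: "\<And>i j. i \<in> {1..n} \<Longrightarrow> j \<in> {1..n} \<Longrightarrow> x j \<otimes>\<^bsub>B\<^esub> x i =
      [:q i j:] \<odot>\<^bsub>B\<^esub> (x i \<otimes>\<^bsub>B\<^esub> x j) \<oplus>\<^bsub>B\<^esub> [:0, 1:] \<odot>\<^bsub>B\<^esub> (\<Oplus>\<^bsub>B\<^esub>g\<in>G. [:k0 i j g:] \<odot>\<^bsub>B\<^esub> u g)"
    and square: "\<And>i. i \<in> {1..n} \<Longrightarrow> x i \<otimes>\<^bsub>B\<^esub> x i = \<zero>\<^bsub>B\<^esub>"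
    and basis: "is_basis B bI (\<lambda>(\<alpha>, g). xalg.e B x u (wd n \<alpha>) g)"
  shows "is_basis HK bI hE"
    and "\<exists>\<phi>\<in>alg_iso HK B. (\<forall>i\<in>{1..n}. \<phi> (hx i) = x i) \<and> (\<forall>g\<in>G. \<phi> (hu g) = u g)"
proof -
  interpret B: xalg B n G rr x u by (rule X)
  let ?b = "\<lambda>(\<alpha>, g). B.e (wd n \<alpha>) g"
  interpret BB: fbasis B bI ?b
    by (intro fbasis.intro fbasis_axioms.intro B.kalg_axioms finite_bI basis)
  let ?F = "F B x u"
  note Fl = linear_onD[OF linear_on_F[OF X]]
  interpret Fh: ring_hom_ring P B ?F
    by (rule ring_hom_ringI2[OF PS.P.ring_axioms B.ring_axioms ring_hom_F[OF X]])
  have ker: "a_kernel P B ?F = {p \<in> carrier P. ?F p = \<zero>\<^bsub>B\<^esub>}" by (rule a_kernel_def')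
  have lc: "?F (\<Oplus>\<^bsub>P\<^esub>i\<in>bI. c i \<odot>\<^bsub>P\<^esub> E i) = (\<Oplus>\<^bsub>B\<^esub>i\<in>bI. c i \<odot>\<^bsub>B\<^esub> ?b i)" for c
  proof -
    have "?F (\<Oplus>\<^bsub>P\<^esub>i\<in>bI. c i \<odot>\<^bsub>P\<^esub> E i) = (\<Oplus>\<^bsub>B\<^esub>i\<in>bI. ?F (c i \<odot>\<^bsub>P\<^esub> E i))"
      by (rule linear_on_finsum[OF PS.P.kalg_axioms B.kalg_axioms linear_on_F[OF X]]) (intro PS.P.smult_closed E_closed)
    also have "\<dots> = (\<Oplus>\<^bsub>B\<^esub>i\<in>bI. c i \<odot>\<^bsub>B\<^esub> ?b i)"
    proof (rule B.finsum_cong_all)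
      fix i assume i: "i \<in> bI"
      obtain \<alpha> g where ih: "i = (\<alpha>, g)" "g \<in> G" using i by auto
      show "?F (c i \<odot>\<^bsub>P\<^esub> E i) = c i \<odot>\<^bsub>B\<^esub> ?b i"
        unfolding ih(1) prod.case by (rule F_elem[OF X wd_sorted(3) ih(2)])
      show "c i \<odot>\<^bsub>B\<^esub> ?b i \<in> carrier B" using BB.b_closed[OF i] by (rule B.smult_closed)
    qed
    finally show ?thesis .
  qed
  have gens0: "z \<in> a_kernel P B ?F" if z: "z \<in> gens" for z
  proof -
    consider i j where "i \<in> {1..n}" "j \<in> {1..n}" "z = gen i j" | i where "i \<in> {1..n}" "z = xP i \<otimes>\<^bsub>P\<^esub> xP i"
      using z unfolding gens_def by blast
    then show ?thesis
    proof cases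
      case 1
      note c = PX.x_closed[OF 1(1)] PX.x_closed[OF 1(2)] B.x_closed[OF 1(1)] B.x_closed[OF 1(2)]
      have uc: "u g \<in> carrier B" if "g \<in> G" for g using that by simp
      let ?k = "\<Oplus>\<^bsub>B\<^esub>g\<in>G. [:k0 i j g:] \<odot>\<^bsub>B\<^esub> u g"
      have kc: "?k \<in> carrier B" by (intro B.finsum_in B.smult_closed uc)
      have "?F (\<Oplus>\<^bsub>P\<^esub>g\<in>G. [:k0 i j g:] \<odot>\<^bsub>P\<^esub> uP g) = (\<Oplus>\<^bsub>B\<^esub>g\<in>G. ?F ([:k0 i j g:] \<odot>\<^bsub>P\<^esub> uP g))"
        by (rule linear_on_finsum[OF PS.P.kalg_axioms B.kalg_axioms linear_on_F[OF X]]) (intro PS.P.smult_closed PX.u_closed)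
      also have "\<dots> = ?k"
        by (rule B.finsum_cong_all) (simp_all only: Fl PX.u_closed F_u[OF X] B.smult_closed uc)
      finally have Fk: "?F (\<Oplus>\<^bsub>P\<^esub>g\<in>G. [:k0 i j g:] \<odot>\<^bsub>P\<^esub> uP g) = ?k" .
      have m: "xP j \<otimes>\<^bsub>P\<^esub> xP i \<in> carrier P" "xP i \<otimes>\<^bsub>P\<^esub> xP j \<in> carrier P" "x i \<otimes>\<^bsub>B\<^esub> x j \<in> carrier B"
        by (intro PS.P.m_closed B.m_closed c)+
      have "?F z = (x j \<otimes>\<^bsub>B\<^esub> x i \<ominus>\<^bsub>B\<^esub> [:q i j:] \<odot>\<^bsub>B\<^esub> (x i \<otimes>\<^bsub>B\<^esub> x j)) \<ominus>\<^bsub>B\<^esub> [:0, 1:] \<odot>\<^bsub>B\<^esub> ?k"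
        unfolding 1(3) gen_def
        by (simp only: linear_on_diff[OF PS.P.kalg_axioms B.kalg_axioms linear_on_F[OF X]] PS.P.minus_closed
            PS.P.smult_closed m k_sum_closed Fl Fk F_mult[OF X] c F_x[OF X] 1(1,2))
      also have "\<dots> = \<zero>\<^bsub>B\<^esub>"
        unfolding swap[OF 1(1,2)] by (rule B.diff_zero_if_eq_add) (intro B.smult_closed m kc)+
      finally show ?thesis unfolding ker using gen_closed[OF 1(1,2)] unfolding 1(3) by blast
    next
      case 2
      note c = PX.x_closed[OF 2(1)]
      have "?F z = \<zero>\<^bsub>B\<^esub>" unfolding 2(2) by (simp only: F_mult[OF X] c F_x[OF X] 2(1) square)
      then show ?thesis unfolding ker 2(2) using PS.P.m_closed[OF c c] by blast
    qed
  qed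
  \<comment> \<open>The relations assumed in B say that all generators are mapped to zero, and a
    kernel is an ideal.\<close>
  then have "I \<subseteq> a_kernel P B ?F"
    unfolding I_eq by (intro PS.P.genideal_minimal Fh.kernel_is_ideal) blast
  have zero: "c i = 0" if "p \<in> I" "p = (\<Oplus>\<^bsub>P\<^esub>i\<in>bI. c i \<odot>\<^bsub>P\<^esub> E i)" "i \<in> bI" for p c i
  proof -
    have "?F p = \<zero>\<^bsub>B\<^esub>" using \<open>I \<subseteq> _\<close> that(1) unfolding ker by blast
    then have "(\<Oplus>\<^bsub>B\<^esub>i\<in>bI. c i \<odot>\<^bsub>B\<^esub> ?b i) = \<zero>\<^bsub>B\<^esub>" unfolding that(2) lc .
    then show ?thesis using BB.crd_lc[OF that(3), of c] by (simp only: BB.crd_zero)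
  qed
  have rep: "\<exists>c. p \<ominus>\<^bsub>P\<^esub> (\<Oplus>\<^bsub>P\<^esub>i\<in>bI. c i \<odot>\<^bsub>P\<^esub> E i) \<in> I" if p: "p \<in> carrier P" for p
  proof -
    obtain c where "hc p = (\<Oplus>\<^bsub>HK\<^esub>i\<in>bI. c i \<odot>\<^bsub>HK\<^esub> hE i)" using H_span[OF hc_linear(1)[OF p]] by blast
    then have "hc p = hc (\<Oplus>\<^bsub>P\<^esub>i\<in>bI. c i \<odot>\<^bsub>P\<^esub> E i)" by (simp only: hc_lc)
    then show ?thesis using PS.P.coset_eq_iff[OF ideal_I p P_lc_closed[of c]] by blast
  qed
  have kerI: "a_kernel P B ?F = I"
  proof
    show "a_kernel P B ?F \<subseteq> I"
    proof
      fix p assume "p \<in> a_kernel P B ?F"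
      then have p: "p \<in> carrier P" "?F p = \<zero>\<^bsub>B\<^esub>" unfolding ker by blast+
      obtain c where c: "p \<ominus>\<^bsub>P\<^esub> (\<Oplus>\<^bsub>P\<^esub>i\<in>bI. c i \<odot>\<^bsub>P\<^esub> E i) \<in> I" using rep[OF p(1)] by blast
      let ?l = "\<Oplus>\<^bsub>P\<^esub>i\<in>bI. c i \<odot>\<^bsub>P\<^esub> E i"
      \<comment> \<open>The combination \<open>?l\<close> represents p modulo I and is therefore
        also mapped to zero; independence in B makes its coefficients vanish, which puts p itself
        into I.\<close>
      have "?F (p \<ominus>\<^bsub>P\<^esub> ?l) = \<zero>\<^bsub>B\<^esub>" using c \<open>I \<subseteq> _\<close> unfolding ker by blast
      moreover have "?F (p \<ominus>\<^bsub>P\<^esub> ?l) = ?F p \<ominus>\<^bsub>B\<^esub> ?F ?l"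
        by (rule linear_on_diff[OF PS.P.kalg_axioms B.kalg_axioms linear_on_F[OF X] p(1) P_lc_closed])
      ultimately have "\<zero>\<^bsub>B\<^esub> \<ominus>\<^bsub>B\<^esub> ?F ?l = \<zero>\<^bsub>B\<^esub>" unfolding p(2) by simp
      then have "?F ?l = \<zero>\<^bsub>B\<^esub>" using Fl(1)[OF P_lc_closed[of c]]
        by (simp add: a_minus_def)
      then have "(\<Oplus>\<^bsub>B\<^esub>i\<in>bI. c i \<odot>\<^bsub>B\<^esub> ?b i) = \<zero>\<^bsub>B\<^esub>" unfolding lc .
      then have "c i = 0" if "i \<in> bI" for i using BB.crd_lc[OF that, of c] by (simp only: BB.crd_zero)
      then have "?l = \<zero>\<^bsub>P\<^esub>"
        using E_closed by (intro PS.P.add.finprod_one_eqI) simp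
      then show "p \<in> I" using c p(1) by (simp add: a_minus_def)
    qed
  qed fact
  show "is_basis HK bI hE"
  proof (rule is_basisI[OF HK.kalg_axioms finite_bI])
    show "hE i \<in> carrier HK" if "i \<in> bI" for i
      unfolding hE_eq[OF that] by (rule hc_linear(1)[OF E_closed[OF that]])
    show "\<exists>c. X = (\<Oplus>\<^bsub>HK\<^esub>i\<in>bI. c i \<odot>\<^bsub>HK\<^esub> hE i)" if "X \<in> carrier HK" for X by (rule H_span[OF that])
    show "c i = 0" if "(\<Oplus>\<^bsub>HK\<^esub>i\<in>bI. c i \<odot>\<^bsub>HK\<^esub> hE i) = \<zero>\<^bsub>HK\<^esub>" "i \<in> bI" for c i
      using that(1) zero[OF _ refl that(2), of c] hc_eq_zero[OF P_lc_closed[of c]] unfolding hc_lc by blast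
  qed
  have surj: "?F ` carrier P = carrier B"
  proof
    show "?F ` carrier P \<subseteq> carrier B" using Fl(1) by blast
    show "carrier B \<subseteq> ?F ` carrier P"
    proof
      fix b assume b: "b \<in> carrier B"
      have "b = ?F (\<Oplus>\<^bsub>P\<^esub>i\<in>bI. BB.crd b i \<odot>\<^bsub>P\<^esub> E i)" unfolding lc BB.crd_expand[OF b] by (rule refl)
      then show "b \<in> ?F ` carrier P" using P_lc_closed by (rule image_eqI)
    qed
  qed
  \<comment> \<open>The map induced on cosets: the image of a coset under \<open>F\<close> is a
    singleton because I is contained in the kernel.\<close>
  define \<phi> where "\<phi> = (\<lambda>X. the_elem (?F ` X))"
  have iso: "\<phi> \<in> ring_iso (P Quot I) B" unfolding \<phi>_def using Fh.FactRing_iso_set[OF surj] unfolding kerI .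
  have val: "\<phi> (hc p) = ?F p" if "p \<in> carrier P" for p unfolding \<phi>_def using Fh.the_elem_simp[OF that] unfolding kerI .
  have "\<phi> \<in> ring_iso HK B"
    using iso unfolding ring_iso_def ring_hom_def H_eq quot_algebra_simps FactRing_def monoid.simps ring.simps partial_object.simps .
  moreover have "\<phi> (c \<odot>\<^bsub>HK\<^esub> Y) = c \<odot>\<^bsub>B\<^esub> \<phi> Y" if Y: "Y \<in> carrier HK" for c Y
  proof -
    obtain p where p: "p \<in> carrier P" "Y = hc p" using Y by (rule H_carrierE)
    show ?thesis unfolding p(2) hc_linear(3)[OF p(1), symmetric] val[OF p(1)] val[OF PS.P.smult_closed[OF p(1)]] by (rule Fl(3)[OF p(1)])
  qed
  ultimately have alg: "\<phi> \<in> alg_iso HK B" unfolding alg_iso_def by blast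
  have x: "\<forall>i\<in>{1..n}. \<phi> (hx i) = x i"
  proof
    fix i assume i: "i \<in> {1..n}"
    show "\<phi> (hx i) = x i" unfolding hx_eq val[OF PX.x_closed[OF i]] by (rule F_x[OF X i])
  qed
  have u: "\<forall>g\<in>G. \<phi> (hu g) = u g"
  proof
    fix g assume g: "g \<in> G"
    show "\<phi> (hu g) = u g" unfolding hu_eq val[OF PX.u_closed[OF g]] by (rule F_u[OF X g])
  qed
  show "\<exists>\<phi>\<in>alg_iso HK B. (\<forall>i\<in>{1..n}. \<phi> (hx i) = x i) \<and> (\<forall>g\<in>G. \<phi> (hu g) = u g)"
    by (rule bexI[OF _ alg]) (rule conjI[OF x u])
qed

section \<open>Homogeneous elements of \<open>\<Lambda> \<rtimes> G\<close>\<close>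

context qdata
begin

abbreviation "cn a \<equiv> tmonom A a 0"

lemma Deg_closed: "a \<in> Deg d \<Longrightarrow> a \<in> carrier A"
  by (simp add: Deg_iff)

lemma Deg_add: "a \<in> Deg d \<Longrightarrow> b \<in> Deg d \<Longrightarrow> a \<oplus>\<^bsub>A\<^esub> b \<in> Deg d"
proof -
  assume a: "a \<in> Deg d" and b: "b \<in> Deg d"
  note c = Deg_closed[OF a] Deg_closed[OF b]
  have "BA.crd a i \<noteq> 0 \<or> BA.crd b i \<noteq> 0" if "BA.crd (a \<oplus>\<^bsub>A\<^esub> b) i \<noteq> 0" for i
    using that unfolding BA.crd_add[OF c] by auto
  then show ?thesis using a b A.a_closed[OF c] unfolding Deg_iff by blast
qed

lemma Deg_smult: "a \<in> Deg d \<Longrightarrow> c \<odot>\<^bsub>A\<^esub> a \<in> Deg d"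
proof -
  assume a: "a \<in> Deg d"
  note c = Deg_closed[OF a]
  have "BA.crd a i \<noteq> 0" if "BA.crd (c \<odot>\<^bsub>A\<^esub> a) i \<noteq> 0" for i
    using that unfolding BA.crd_smult[OF c] by auto
  then show ?thesis using a A.smult_closed[OF c] unfolding Deg_iff by blast
qed

lemma Deg_zero: "\<zero>\<^bsub>A\<^esub> \<in> Deg d"
  by (simp add: Deg_iff)

lemma Deg_finsum: "(\<And>i. i \<in> X \<Longrightarrow> f i \<in> Deg d) \<Longrightarrow> finsum A f X \<in> Deg d"
  by (rule A.sub_finsum[OF Deg_zero Deg_add]) (blast intro: Deg_closed)+

lemma Deg_neg: "a \<in> Deg d \<Longrightarrow> d < 0 \<Longrightarrow> a = \<zero>\<^bsub>A\<^esub>"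
proof -
  assume a: "a \<in> Deg d" and d: "d < 0"
  have "BA.crd a i = 0" if "i \<in> bI" for i
  proof (rule ccontr)
    assume "BA.crd a i \<noteq> 0"
    then have "int (length (wd n (fst i))) = d" using a[unfolded Deg_iff] that by blast
    then show False using d by simp
  qed
  then show ?thesis using Deg_closed[OF a] by (intro BA.crd_eqI) simp_all
qed

lemma Deg_word:
  assumes "set w \<subseteq> {1..n}" "g \<in> G"
  shows "list_prod A (map yA w) \<otimes>\<^bsub>A\<^esub> uA g \<in> Deg (int (length w))"
proof -
  have w: "word w \<in> carrier T" using assms(1) by (rule word_closed)
  have zero: "\<zero>\<^bsub>Q\<^esub> = qc \<zero>\<^bsub>T\<^esub>" using linear_on_zero[OF T.kalg_axioms Q.kalg_axioms linear_on_qc] by simp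
  have "\<exists>x\<in>carrier T. (\<forall>z. x z \<noteq> 0 \<longrightarrow> int (length z) = int (length w)) \<and> QS.se (qc (word w)) g h = qc x" for h
  proof (cases "h = g")
    case True
    then show ?thesis using w by (intro bexI[of _ "word w"]) (auto simp: skew_elem_def word_def)
  next
    case False
    then have "QS.se (qc (word w)) g h = qc \<zero>\<^bsub>T\<^esub>" using zero by (simp add: skew_elem_def)
    moreover have "\<zero>\<^bsub>T\<^esub> z = 0" for z by (simp add: tensor_simps)
    ultimately show ?thesis by (intro bexI[OF _ T.zero_closed]) simp
  qed
  moreover have "QS.se (qc (word w)) g \<in> carrier A"
    unfolding A_eq by (rule QS.se_closed) (simp_all add: qc_linear w H_simps assms)
  ultimately show ?thesis unfolding yA_word_uA[OF assms] qext_skew_degree_def by blast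
qed

lemma Deg_yA: "i \<in> {1..n} \<Longrightarrow> yA i \<in> Deg 1"
  using Deg_word[of "[i]" id] by (simp add: uA_id del: atLeastAtMost_iff One_nat_def)

lemma Deg_uA: "g \<in> G \<Longrightarrow> uA g \<in> Deg 0"
  using Deg_word[of "[]" g] by simp

text \<open>Compatibility of the product with the grading in the case of a letter on the left, by
  which monomials grow in \<open>DX_e_BDeg\<close>.\<close>

lemma Deg_yA_mult:
  assumes i: "i \<in> {1..n}" and b: "b \<in> Deg d"
  shows "yA i \<otimes>\<^bsub>A\<^esub> b \<in> Deg (1 + d)"
proof -
  have bc: "b \<in> carrier A" using b by (rule Deg_closed)
  have "yA i \<otimes>\<^bsub>A\<^esub> b = yA i \<otimes>\<^bsub>A\<^esub> (\<Oplus>\<^bsub>A\<^esub>j\<in>bI. BA.crd b j \<odot>\<^bsub>A\<^esub> bA j)" by (simp only: BA.crd_expand[OF bc])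
  also have "\<dots> = (\<Oplus>\<^bsub>A\<^esub>j\<in>bI. yA i \<otimes>\<^bsub>A\<^esub> (BA.crd b j \<odot>\<^bsub>A\<^esub> bA j))"
    by (rule A.finsum_rdistr[OF finite_bI yA_closed[OF i]]) (intro Pi_I A.smult_closed BA.b_closed)
  also have "\<dots> \<in> Deg (1 + d)"
  proof (rule Deg_finsum)
    fix j assume j: "j \<in> bI"
    obtain \<alpha> g where jh: "j = (\<alpha>, g)" "g \<in> G" using j by auto
    have eq: "yA i \<otimes>\<^bsub>A\<^esub> (BA.crd b j \<odot>\<^bsub>A\<^esub> bA j) = BA.crd b j \<odot>\<^bsub>A\<^esub> (yA i \<otimes>\<^bsub>A\<^esub> bA j)"
      by (rule A.smult_mult_right[OF yA_closed[OF i] BA.b_closed[OF j]])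
    show "yA i \<otimes>\<^bsub>A\<^esub> (BA.crd b j \<odot>\<^bsub>A\<^esub> bA j) \<in> Deg (1 + d)"
    proof (cases "BA.crd b j = 0")
      case True
      then show ?thesis unfolding eq using A.m_closed[OF yA_closed[OF i] BA.b_closed[OF j]] by (simp add: Deg_zero)
    next
      case False
      then have d: "int (length (wd n \<alpha>)) = d" using b j unfolding Deg_iff jh(1) by auto
      have w: "set (i # wd n \<alpha>) \<subseteq> {1..n}" using i wd_sorted(3)[of n \<alpha>] by simp
      have "set (map yA (wd n \<alpha>)) \<subseteq> carrier A" using yA_closed wd_sorted(3)[of n \<alpha>] by auto
      then have "yA i \<otimes>\<^bsub>A\<^esub> bA j = list_prod A (map yA (i # wd n \<alpha>)) \<otimes>\<^bsub>A\<^esub> uA g"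
        unfolding jh(1) prod.case using yA_closed[OF i] uA_closed[OF jh(2)]
        by (simp add: A.m_assoc del: atLeastAtMost_iff One_nat_def)
      also have "\<dots> \<in> Deg (1 + d)" using Deg_word[OF w jh(2)] d by simp
      finally show ?thesis unfolding eq by (rule Deg_smult)
    qed
  qed
  finally show ?thesis .
qed

text \<open>Degree zero is the group algebra, since \<open>idx n {}\<close> is the only exponent
  vector with an empty word.\<close>

lemma Deg_zero_expand:
  assumes a: "a \<in> Deg 0"
  shows "a = (\<Oplus>\<^bsub>A\<^esub>g\<in>G. BA.crd a (idx n {}, g) \<odot>\<^bsub>A\<^esub> uA g)"
proof -
  have wd0: "wd n (idx n {}) = []" using set_wd_idx[of "{}" n] by simp
  have "a = (\<Oplus>\<^bsub>A\<^esub>i\<in>bI. BA.crd a i \<odot>\<^bsub>A\<^esub> bA i)" by (simp only: BA.crd_expand[OF Deg_closed[OF a]])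
  also have "\<dots> = (\<Oplus>\<^bsub>A\<^esub>i\<in>(\<lambda>g. (idx n {}, g)) ` G. BA.crd a i \<odot>\<^bsub>A\<^esub> bA i)"
  proof (rule A.finsum_mono_neutral[OF finite_bI, symmetric])
    show "(\<lambda>g. (idx n {}, g)) ` G \<subseteq> bI" by (auto simp: idx_expo)
    fix i assume i: "i \<in> bI - (\<lambda>g. (idx n {}, g)) ` G"
    obtain \<alpha> g where ih: "i = (\<alpha>, g)" "\<alpha> \<in> expo n" "g \<in> G" using i by auto
    have "wd n \<alpha> \<noteq> []"
    proof
      assume "wd n \<alpha> = []"
      then have "\<alpha> = idx n {}" using wd_inj[OF ih(2) idx_expo[of n "{}"]] wd0 by simp
      then show False using i ih by auto
    qed
    then have "BA.crd a i = 0" using a i ih by (auto simp: Deg_iff)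
    then show "BA.crd a i \<odot>\<^bsub>A\<^esub> bA i = \<zero>\<^bsub>A\<^esub>" using A.smult_zero_left[OF BA.b_closed] i by simp
  next
    fix i assume "i \<in> (\<lambda>g. (idx n {}, g)) ` G"
    then show "BA.crd a i \<odot>\<^bsub>A\<^esub> bA i \<in> carrier A" by (intro A.smult_closed BA.b_closed) (auto simp: idx_expo)
  qed
  also have "\<dots> = (\<Oplus>\<^bsub>A\<^esub>g\<in>G. BA.crd a (idx n {}, g) \<odot>\<^bsub>A\<^esub> bA (idx n {}, g))"
    by (rule A.finsum_reindex) (auto intro!: A.smult_closed A.m_closed simp: inj_on_def wd0)
  also have "\<dots> = (\<Oplus>\<^bsub>A\<^esub>g\<in>G. BA.crd a (idx n {}, g) \<odot>\<^bsub>A\<^esub> uA g)"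
    by (rule A.finsum_cong_all) (simp_all add: wd0)
  finally show ?thesis .
qed

end

section \<open>Graded deformations\<close>

locale qdefo = qdata n q scale v G for n and q :: "nat \<Rightarrow> nat \<Rightarrow> 'k::field" and scale :: "'k \<Rightarrow> 'v::ab_group_add \<Rightarrow> 'v" and v G +
  fixes \<mu>
  assumes graded: "is_graded_truncated_deformation scale v n G q \<mu>"
begin

lemma deformation: "is_deformation A \<mu>"
  and mu_deg: "i > 0 \<Longrightarrow> has_degree Deg (\<mu> i) (- 2 * int i)"
  and mu_square: "i > 0 \<Longrightarrow> j \<in> {1..n} \<Longrightarrow> \<mu> i (yA j) (yA j) = \<zero>\<^bsub>A\<^esub>"
  using graded unfolding is_graded_truncated_deformation_def Let_def by blast+

sublocale D: kbil A \<mu>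
  using deformation by unfold_locales (auto simp: is_deformation_def)

lemma mu0: "a \<in> carrier A \<Longrightarrow> b \<in> carrier A \<Longrightarrow> \<mu> 0 a b = a \<otimes>\<^bsub>A\<^esub> b"
  using deformation by (simp add: is_deformation_def)

lemma st_assoc:
  "f \<in> carrier PA.PA \<Longrightarrow> g \<in> carrier PA.PA \<Longrightarrow> h \<in> carrier PA.PA \<Longrightarrow> D.st (D.st f g) h = D.st f (D.st g h)"
  using deformation unfolding is_deformation_def Let_def D.B_simps by blast

lemma mu_Deg: "i > 0 \<Longrightarrow> a \<in> Deg p \<Longrightarrow> b \<in> Deg r \<Longrightarrow> \<mu> i a b \<in> Deg (p + r - 2 * int i)"
  using mu_deg[of i] unfolding has_degree_def by fastforce

lemma st_const: "a \<in> carrier A \<Longrightarrow> b \<in> carrier A \<Longrightarrow> D.st (cn a) (cn b) m = \<mu> m a b"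
  by (simp add: D.st_tmonom)

text \<open>The coefficient at t^m has degree p + r - 2 m, which is negative as soon as m is
  positive.\<close>

lemma st_const_low:
  assumes a: "a \<in> Deg p" and b: "b \<in> Deg r" and "p + r < 2"
  shows "D.st (cn a) (cn b) = cn (a \<otimes>\<^bsub>A\<^esub> b)"
proof
  fix m
  note c = Deg_closed[OF a] Deg_closed[OF b]
  have "\<mu> m a b = \<zero>\<^bsub>A\<^esub>" if "m > 0"
    using mu_Deg[OF that a b] that assms(3) by (intro Deg_neg) auto
  then show "D.st (cn a) (cn b) m = cn (a \<otimes>\<^bsub>A\<^esub> b) m"
    unfolding st_const[OF c] PA.tmonom_eq[OF A.m_closed[OF c]] using c by (simp add: mu0)
qed

lemma st_const_left:
  assumes a: "a \<in> carrier A" and f: "f \<in> carrier PA.PA"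
  shows "D.st (cn a) f m = (\<Oplus>\<^bsub>A\<^esub>i\<in>{..m}. \<mu> i a (f (m - i)))"
  unfolding star_def
proof (rule A.finsum_cong_all)
  fix i
  note fc = PA.PA_closed[OF f]
  have "(\<Oplus>\<^bsub>A\<^esub>j\<in>{..m - i}. \<mu> i (cn a j) (f (m - i - j))) = \<mu> i (cn a 0) (f (m - i - 0))"
    by (rule A.finsum_single) (use a fc in \<open>auto simp: PA.tmonom_eq\<close>)
  then show "(\<Oplus>\<^bsub>A\<^esub>j\<in>{..m - i}. \<mu> i (cn a j) (f (m - i - j))) = \<mu> i a (f (m - i))"
    using a by (simp add: PA.tmonom_eq)
  show "\<mu> i a (f (m - i)) \<in> carrier A" using a fc by simp
qed

lemma st_const_right:
  assumes a: "a \<in> carrier A" and f: "f \<in> carrier PA.PA"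
  shows "D.st f (cn a) m = (\<Oplus>\<^bsub>A\<^esub>i\<in>{..m}. \<mu> i (f (m - i)) a)"
  unfolding star_def
proof (rule A.finsum_cong_all)
  fix i assume i: "i \<in> {..m}"
  note fc = PA.PA_closed[OF f]
  have "(\<Oplus>\<^bsub>A\<^esub>j\<in>{..m - i}. \<mu> i (f j) (cn a (m - i - j))) = \<mu> i (f (m - i)) (cn a (m - i - (m - i)))"
    by (rule A.finsum_single) (use a fc in \<open>auto simp: PA.tmonom_eq\<close>)
  then show "(\<Oplus>\<^bsub>A\<^esub>j\<in>{..m - i}. \<mu> i (f j) (cn a (m - i - j))) = \<mu> i (f (m - i)) a"
    using a by (simp add: PA.tmonom_eq)
  show "\<mu> i (f (m - i)) a \<in> carrier A" using a fc by simp
qed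

text \<open>
  The unit of \<open>A\<close> is one for the deformed product: \<open>1 * 1 = 1\<close> for degree reasons, so
  multiplication by \<open>1\<close> is idempotent, and it is injective since it is the identity modulo \<open>t\<close>.
\<close>

lemma one_Deg: "\<one>\<^bsub>A\<^esub> \<in> Deg 0"
  using Deg_uA[OF G_id] by (simp add: uA_id)

lemma st_one_one: "D.st \<one>\<^bsub>PA.PA\<^esub> \<one>\<^bsub>PA.PA\<^esub> = \<one>\<^bsub>PA.PA\<^esub>"
  using st_const_low[OF one_Deg one_Deg] by (simp add: PA.tmonom_one)

lemma st_one_kernel:
  assumes d: "d \<in> carrier PA.PA"
    and z: "D.st \<one>\<^bsub>PA.PA\<^esub> d = \<zero>\<^bsub>PA.PA\<^esub> \<or> D.st d \<one>\<^bsub>PA.PA\<^esub> = \<zero>\<^bsub>PA.PA\<^esub>"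
  shows "d = \<zero>\<^bsub>PA.PA\<^esub>"
proof -
  note dc = PA.PA_closed[OF d]
  have "d m = \<zero>\<^bsub>A\<^esub>" for m
  proof (induction m rule: less_induct)
    case (less m)
    \<comment> \<open>Coefficients below \<open>m\<close> vanish by induction, so in both products
      only the term with \<open>\<mu> 0\<close> remains, the ordinary product with 1.\<close>
    have "D.st (cn \<one>\<^bsub>A\<^esub>) d m = \<mu> 0 \<one>\<^bsub>A\<^esub> (d (m - 0))"
      unfolding st_const_left[OF A.one_closed d]
      by (rule A.finsum_single) (use less dc in auto)
    moreover have "D.st d (cn \<one>\<^bsub>A\<^esub>) m = \<mu> 0 (d (m - 0)) \<one>\<^bsub>A\<^esub>"
      unfolding st_const_right[OF A.one_closed d]
      by (rule A.finsum_single) (use less dc in auto)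
    ultimately show ?case using z dc by (auto simp: PA.tmonom_one mu0 PA.PA_simps(3))
  qed
  then show ?thesis by (simp add: PA.PA_simps(3) fun_eq_iff)
qed

lemma st_one_left:
  assumes f: "f \<in> carrier PA.PA" shows "D.st \<one>\<^bsub>PA.PA\<^esub> f = f"
proof -
  let ?L = "D.st \<one>\<^bsub>PA.PA\<^esub>"
  have c: "?L f \<in> carrier PA.PA" "(- 1) \<odot>\<^bsub>PA.PA\<^esub> f \<in> carrier PA.PA" using f by simp_all
  let ?d = "?L f \<oplus>\<^bsub>PA.PA\<^esub> (- 1) \<odot>\<^bsub>PA.PA\<^esub> f"
  have "?L ?d = ?L (?L f) \<oplus>\<^bsub>PA.PA\<^esub> (- 1) \<odot>\<^bsub>PA.PA\<^esub> ?L f"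
    using D.st_r_distr[OF c, of "\<one>\<^bsub>PA.PA\<^esub>"] D.st_smult(2)[of "\<one>\<^bsub>PA.PA\<^esub>" f "- 1"] f by simp
  also have "?L (?L f) = ?L f" using st_assoc[of "\<one>\<^bsub>PA.PA\<^esub>" "\<one>\<^bsub>PA.PA\<^esub>" f] f by (simp add: st_one_one)
  also have "?L f \<oplus>\<^bsub>PA.PA\<^esub> (- 1) \<odot>\<^bsub>PA.PA\<^esub> ?L f = \<zero>\<^bsub>PA.PA\<^esub>"
    using c by (simp add: PA.P.minus_eq_smult[symmetric] PA.P.r_neg)
  finally have "?d = \<zero>\<^bsub>PA.PA\<^esub>" using c by (intro st_one_kernel) simp_all
  then show ?thesis using PA.P.eq_add_if_diff_zero[of "?L f" f "\<zero>\<^bsub>PA.PA\<^esub>"] c f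
    by (simp add: PA.P.diff_eq_smult)
qed

lemma st_one_right:
  assumes f: "f \<in> carrier PA.PA" shows "D.st f \<one>\<^bsub>PA.PA\<^esub> = f"
proof -
  let ?L = "\<lambda>f. D.st f \<one>\<^bsub>PA.PA\<^esub>"
  have c: "?L f \<in> carrier PA.PA" "(- 1) \<odot>\<^bsub>PA.PA\<^esub> f \<in> carrier PA.PA" using f by simp_all
  let ?d = "?L f \<oplus>\<^bsub>PA.PA\<^esub> (- 1) \<odot>\<^bsub>PA.PA\<^esub> f"
  have "?L ?d = ?L (?L f) \<oplus>\<^bsub>PA.PA\<^esub> (- 1) \<odot>\<^bsub>PA.PA\<^esub> ?L f"
    using D.st_l_distr[OF c, of "\<one>\<^bsub>PA.PA\<^esub>"] D.st_smult(1)[of f "\<one>\<^bsub>PA.PA\<^esub>" "- 1"] f by simp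
  also have "?L (?L f) = ?L f" using st_assoc[of f "\<one>\<^bsub>PA.PA\<^esub>" "\<one>\<^bsub>PA.PA\<^esub>"] f by (simp add: st_one_one)
  also have "?L f \<oplus>\<^bsub>PA.PA\<^esub> (- 1) \<odot>\<^bsub>PA.PA\<^esub> ?L f = \<zero>\<^bsub>PA.PA\<^esub>"
    using c by (simp add: PA.P.minus_eq_smult[symmetric] PA.P.r_neg)
  finally have "?d = \<zero>\<^bsub>PA.PA\<^esub>" using c by (intro st_one_kernel) simp_all
  then show ?thesis using PA.P.eq_add_if_diff_zero[of "?L f" f "\<zero>\<^bsub>PA.PA\<^esub>"] c f
    by (simp add: PA.P.diff_eq_smult)
qed

sublocale DB: kalg D.B
  by (rule D.kalg_B) (simp_all add: st_assoc st_one_left st_one_right)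

lemma B_lc:
  assumes "\<And>i. i \<in> X \<Longrightarrow> f i \<in> carrier A"
  shows "cn (\<Oplus>\<^bsub>A\<^esub>i\<in>X. c i \<odot>\<^bsub>A\<^esub> f i) = (\<Oplus>\<^bsub>D.B\<^esub>i\<in>X. [:c i:] \<odot>\<^bsub>D.B\<^esub> cn (f i))"
  using PA.tmonom_lc[OF assms] by (simp add: finsum_def D.B_simps)

text \<open>The relations of \<open>xalg\<close> involve at most one letter on each side, hence only
  products that are not deformed.\<close>

sublocale DX: xalg D.B n G rr "\<lambda>i. cn (yA i)" "\<lambda>g. cn (uA g)"
proof (intro xalg.intro DB.kalg_axioms xalg_axioms.intro)
  fix g i assume g: "g \<in> G" and i: "i \<in> {1..n}"
  have s: "(\<Oplus>\<^bsub>A\<^esub>j\<in>{1..n}. rr g i j \<odot>\<^bsub>A\<^esub> yA j) \<in> Deg 1"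
    by (intro Deg_finsum Deg_smult Deg_yA)
  have "cn (uA g) \<otimes>\<^bsub>D.B\<^esub> cn (yA i) = cn (uA g \<otimes>\<^bsub>A\<^esub> yA i)"
    unfolding D.B_simps by (rule st_const_low[OF Deg_uA[OF g] Deg_yA[OF i]]) simp
  also have "\<dots> = cn (\<Oplus>\<^bsub>A\<^esub>j\<in>{1..n}. rr g i j \<odot>\<^bsub>A\<^esub> yA j) \<otimes>\<^bsub>D.B\<^esub> cn (uA g)"
    unfolding uA_yA[OF g i] D.B_simps by (rule st_const_low[OF s Deg_uA[OF g], symmetric]) simp
  also have "cn (\<Oplus>\<^bsub>A\<^esub>j\<in>{1..n}. rr g i j \<odot>\<^bsub>A\<^esub> yA j) = (\<Oplus>\<^bsub>D.B\<^esub>j\<in>{1..n}. [:rr g i j:] \<odot>\<^bsub>D.B\<^esub> cn (yA j))"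
    by (rule B_lc) (rule yA_closed)
  finally show "cn (uA g) \<otimes>\<^bsub>D.B\<^esub> cn (yA i) = (\<Oplus>\<^bsub>D.B\<^esub>j\<in>{1..n}. [:rr g i j:] \<odot>\<^bsub>D.B\<^esub> cn (yA j)) \<otimes>\<^bsub>D.B\<^esub> cn (uA g)" .
next
  fix g h assume g: "g \<in> G" and h: "h \<in> G"
  show "cn (uA g) \<otimes>\<^bsub>D.B\<^esub> cn (uA h) = cn (uA (g \<circ> h))"
    unfolding D.B_simps uA_mult[OF g h, symmetric] by (rule st_const_low[OF Deg_uA[OF g] Deg_uA[OF h]]) simp
qed (simp_all only: G_id G_comp D.B_simps PA.tmonom_closed yA_closed uA_closed uA_id PA.tmonom_one)

text \<open>Homogeneous elements of \<open>A[t]\<close>, with \<open>t\<close> of degree 2.\<close>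

definition BDeg :: "int \<Rightarrow> (nat \<Rightarrow> ('v \<Rightarrow> 'v) \<Rightarrow> (nat list \<Rightarrow> 'k) set) set" where
  "BDeg d = {f \<in> carrier PA.PA. \<forall>m. f m \<in> Deg (d - 2 * int m)}"

text \<open>With t in degree 2 the deformed product is homogeneous, so a deformed monomial is the
  ordinary one plus terms with positive powers of t and correspondingly shorter words.\<close>

lemma DX_e_BDeg:
  assumes "set w \<subseteq> {1..n}" "g \<in> G"
  shows "DX.e w g \<in> BDeg (int (length w)) \<and> DX.e w g 0 = list_prod A (map yA w) \<otimes>\<^bsub>A\<^esub> uA g"
  using assms(1)
proof (induction w)
  case Nil
  have u: "uA g \<in> carrier A" using assms(2) by (rule uA_closed)
  have "cn (uA g) m \<in> Deg (0 - 2 * int m)" for m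
    unfolding PA.tmonom_eq[OF u] using Deg_uA[OF assms(2)] Deg_zero by simp
  moreover have "cn (uA g) 0 = uA g" unfolding PA.tmonom_eq[OF u] by simp
  ultimately show ?case using assms(2) PA.tmonom_closed[OF u] u by (simp add: DX.e_Nil BDeg_def)
next
  case (Cons i w)
  then have i: "i \<in> {1..n}" and w: "set w \<subseteq> {1..n}" by auto
  let ?X = "DX.e w g"
  have X: "?X \<in> carrier PA.PA" "\<And>m. ?X m \<in> Deg (int (length w) - 2 * int m)" "?X 0 = list_prod A (map yA w) \<otimes>\<^bsub>A\<^esub> uA g"
    using Cons.IH[OF w] by (simp_all add: BDeg_def)
  have e: "DX.e (i # w) g = D.st (cn (yA i)) ?X"
    unfolding DX.e_def DX.xw_simps D.B_simps(6)[symmetric]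
    using DX.x_closed[OF i] DX.xw_closed[OF w] DX.u_closed[OF assms(2)] by (simp only: DB.m_assoc)
  have yc: "yA i \<in> carrier A" using i by (rule yA_closed)
  have "D.st (cn (yA i)) ?X m \<in> Deg (int (length (i # w)) - 2 * int m)" for m
    unfolding st_const_left[OF yc X(1)]
  proof (rule Deg_finsum)
    fix j assume j: "j \<in> {..m}"
    \<comment> \<open>The letter has degree 1, the coefficient at m - j has the degree given by
      induction, and \<open>\<mu> j\<close> lowers by 2 j; the total does not depend on j. For j = 0
      the grading of A takes the place of the degree hypothesis.\<close>
    have d: "1 + (int (length w) - 2 * int (m - j)) - 2 * int j = int (length (i # w)) - 2 * int m" using j by auto
    show "\<mu> j (yA i) (?X (m - j)) \<in> Deg (int (length (i # w)) - 2 * int m)"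
    proof (cases "j = 0")
      case True
      then show ?thesis using Deg_yA_mult[OF i X(2)[of m]] yc Deg_closed[OF X(2)[of m]] by (simp add: mu0 algebra_simps)
    next
      case False
      then show ?thesis using mu_Deg[OF _ Deg_yA[OF i] X(2)[of "m - j"], of j] unfolding d by simp
    qed
  qed
  moreover have "D.st (cn (yA i)) ?X 0 = list_prod A (map yA (i # w)) \<otimes>\<^bsub>A\<^esub> uA g"
  proof -
    have "set (map yA w) \<subseteq> carrier A" using yA_closed w by auto
    moreover have "D.st (cn (yA i)) ?X 0 = yA i \<otimes>\<^bsub>A\<^esub> ?X 0"
      unfolding st_const_left[OF yc X(1)] using yc Deg_closed[OF X(2)[of 0]] by (simp add: mu0)
    ultimately show ?thesis using X(3) yc uA_closed[OF assms(2)] by (simp add: A.m_assoc)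
  qed
  ultimately show ?case unfolding e BDeg_def using yc X(1) by simp
qed

section \<open>The PBW basis of the deformed algebra\<close>

sublocale BP: fbasis D.B bI "\<lambda>i. cn (bA i)"
  by (intro fbasis.intro fbasis_axioms.intro DB.kalg_axioms finite_bI)
    (simp only: D.B_is_basis[symmetric], rule PA.is_basis_PA[OF finite_bI is_basis_A])

lemma BP_crd:
  assumes f: "f \<in> carrier PA.PA"
  shows "Polynomial.coeff (BP.crd f i) m = BA.crd (f m) i"
proof (cases "i \<in> bI")
  case True
  have "f = (\<Oplus>\<^bsub>D.B\<^esub>i\<in>bI. BP.crd f i \<odot>\<^bsub>D.B\<^esub> cn (bA i))"
    using BP.crd_expand[of f] f by (simp add: D.B_simps)
  also have "\<dots> = (\<Oplus>\<^bsub>PA.PA\<^esub>i\<in>bI. BP.crd f i \<odot>\<^bsub>PA.PA\<^esub> cn (bA i))"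
    by (simp add: finsum_def D.B_simps)
  finally have "f m = (\<Oplus>\<^bsub>PA.PA\<^esub>i\<in>bI. BP.crd f i \<odot>\<^bsub>PA.PA\<^esub> cn (bA i)) m" by (rule fun_cong)
  also have "\<dots> = (\<Oplus>\<^bsub>A\<^esub>i\<in>bI. Polynomial.coeff (BP.crd f i) m \<odot>\<^bsub>A\<^esub> bA i)"
    by (rule PA.PA_lc_apply) (rule BA.b_closed)
  finally have "f m = (\<Oplus>\<^bsub>A\<^esub>i\<in>bI. Polynomial.coeff (BP.crd f i) m \<odot>\<^bsub>A\<^esub> bA i)" .
  then show ?thesis using BA.crd_lc[OF True, of "\<lambda>i. Polynomial.coeff (BP.crd f i) m"] by simp
next
  case False
  then show ?thesis using f PA.PA_closed[OF f] by (simp add: BP.crd_outside BA.crd_outside D.B_simps)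
qed

text \<open>Triangularity with respect to the length of the word, measured against the constant
  basis of A[t].\<close>

lemma is_basis_DX: "is_basis D.B bI (\<lambda>(\<alpha>, g). DX.e (wd n \<alpha>) g)"
proof (rule BP.is_basis_triangular[where deg = "\<lambda>i. length (wd n (fst i))"])
  fix i assume i: "i \<in> bI"
  obtain \<alpha> g where ih: "i = (\<alpha>, g)" "g \<in> G" using i by auto
  let ?e = "case i of (\<alpha>, g) \<Rightarrow> DX.e (wd n \<alpha>) g"
  have e: "?e \<in> BDeg (int (length (wd n (fst i))))" "?e 0 = bA i"
    using DX_e_BDeg[OF wd_sorted(3) ih(2)] by (simp_all add: ih(1))
  then have ec: "?e \<in> carrier PA.PA" by (simp add: BDeg_def)
  then show "?e \<in> carrier D.B" by (simp add: D.B_simps)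
  \<comment> \<open>At t^m only monomials shorter by exactly 2 m letters occur, by
    homogeneity.\<close>
  have co: "Polynomial.coeff (BP.crd ?e j) m = 0 \<or> (int (length (wd n (fst j))) = int (length (wd n (fst i))) - 2 * int m)"
    if "j \<in> bI" for j m
    using e(1) that unfolding BP_crd[OF ec] BDeg_def Deg_iff by blast
  \<comment> \<open>Modulo t a deformed monomial is the ordinary monomial. Together with
    \<open>co\<close> this gives a diagonal of ones and other entries only at shorter words.\<close>
  have c0: "Polynomial.coeff (BP.crd ?e j) 0 = (if j = i then 1 else 0)" for j
    unfolding BP_crd[OF ec] e(2) by (rule BA.crd_basis[OF i])
  show "BP.crd ?e i = 1"
  proof (rule poly_eqI)
    fix m
    show "Polynomial.coeff (BP.crd ?e i) m = Polynomial.coeff 1 m"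
      using co[OF i, of m] c0[of i] by (cases "m = 0") auto
  qed
  show "j = i \<or> length (wd n (fst j)) < length (wd n (fst i))" if j: "j \<in> bI" "BP.crd ?e j \<noteq> 0" for j
  proof -
    obtain m where m: "Polynomial.coeff (BP.crd ?e j) m \<noteq> 0" using j(2) by (auto simp: poly_eq_iff)
    then show ?thesis using co[OF j(1), of m] c0[of j] by (cases "m = 0") (auto split: if_splits)
  qed
qed

section \<open>The bilinear function read off from a deformation\<close>

definition kc :: "nat \<Rightarrow> nat \<Rightarrow> ('v \<Rightarrow> 'v) \<Rightarrow> 'k" where
  "kc i j g = BA.crd (\<mu> 1 (yA j) (yA i) \<ominus>\<^bsub>A\<^esub> q i j \<odot>\<^bsub>A\<^esub> \<mu> 1 (yA i) (yA j)) (idx n {}, g)"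

text \<open>The relations fix the values on pairs of basis vectors; this is their bilinear extension
  to V, made zero outside G as elements of KG are encoded.\<close>

definition kap :: "'v \<Rightarrow> 'v \<Rightarrow> ('v \<Rightarrow> 'v) \<Rightarrow> 'k" where
  "kap a b g = (if g \<in> G then \<Sum>i\<in>{1..n}. \<Sum>j\<in>{1..n}. rp a i * rp b j * kc i j g else 0)"

lemma kap_v:
  assumes "i \<in> {1..n}" "j \<in> {1..n}" "g \<in> G"
  shows "kap (v i) (v j) g = kc i j g"
proof -
  have "(\<Sum>i'\<in>{1..n}. \<Sum>j'\<in>{1..n}. rp (v i) i' * rp (v j) j' * kc i' j' g) =
    (\<Sum>i'\<in>{1..n}. \<Sum>j'\<in>{1..n}. if j' = j then (if i' = i then kc i j g else 0) else 0)"
    by (intro sum.cong refl) (auto simp: rp_basis assms simp del: atLeastAtMost_iff One_nat_def)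
  also have "\<dots> = kc i j g" using assms by (simp add: sum.delta)
  finally show ?thesis using assms(3) by (simp add: kap_def)
qed

lemma bilinear_kap: "bilinear_to_group_algebra scale G kap"
proof -
  have vsk: "vector_space ((*) :: 'k \<Rightarrow> 'k \<Rightarrow> 'k)" by unfold_locales (simp_all add: algebra_simps)
  have "Vector_Spaces.linear scale (*) (\<lambda>x. kap x y g)" for y g
    unfolding Vector_Spaces.linear_iff
    by (simp add: vs vsk kap_def rp_add rp_scale algebra_simps sum.distrib sum_distrib_left)
  moreover have "Vector_Spaces.linear scale (*) (\<lambda>y. kap x y g)" for x g
    unfolding Vector_Spaces.linear_iff
    by (simp add: vs vsk kap_def rp_add rp_scale algebra_simps sum.distrib sum_distrib_left)
  ultimately show ?thesis unfolding bilinear_to_group_algebra_def by (simp add: kap_def)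
qed

text \<open>Compared coefficient by coefficient: at t^0 it is the relation of the quantum exterior
  algebra, at t^1 the definition of \<open>kc\<close>, and beyond that everything vanishes by
  degree. The case i = j is included because the ideal has generators for it.\<close>

lemma DB_swap:
  assumes i: "i \<in> {1..n}" and j: "j \<in> {1..n}"
  shows "cn (yA j) \<otimes>\<^bsub>D.B\<^esub> cn (yA i) = [:q i j:] \<odot>\<^bsub>D.B\<^esub> (cn (yA i) \<otimes>\<^bsub>D.B\<^esub> cn (yA j)) \<oplus>\<^bsub>D.B\<^esub>
    [:0, 1:] \<odot>\<^bsub>D.B\<^esub> (\<Oplus>\<^bsub>D.B\<^esub>g\<in>G. [:kap (v i) (v j) g:] \<odot>\<^bsub>D.B\<^esub> cn (uA g))"
proof -
  note y = yA_closed[OF i] yA_closed[OF j]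
  let ?d = "\<mu> 1 (yA j) (yA i) \<ominus>\<^bsub>A\<^esub> q i j \<odot>\<^bsub>A\<^esub> \<mu> 1 (yA i) (yA j)"
  \<comment> \<open>Two letters have degree 2 and \<open>\<mu> 1\<close> lowers it by 2, so these
    values lie in the group algebra.\<close>
  have m1: "\<mu> 1 (yA j) (yA i) \<in> Deg 0" "\<mu> 1 (yA i) (yA j) \<in> Deg 0"
    using mu_Deg[of 1 _ 1 _ 1] Deg_yA[OF i] Deg_yA[OF j] by fastforce+
  have "?d \<in> Deg 0"
    unfolding A.diff_eq_smult[OF Deg_closed[OF m1(1)] A.smult_closed[OF Deg_closed[OF m1(2)]]]
    by (intro Deg_add Deg_smult m1)
  note dexp = Deg_zero_expand[OF this]
  have dc: "?d \<in> carrier A" using \<open>?d \<in> Deg 0\<close> by (rule Deg_closed)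
  have "(\<Oplus>\<^bsub>D.B\<^esub>g\<in>G. [:kap (v i) (v j) g:] \<odot>\<^bsub>D.B\<^esub> cn (uA g)) = cn (\<Oplus>\<^bsub>A\<^esub>g\<in>G. kap (v i) (v j) g \<odot>\<^bsub>A\<^esub> uA g)"
    by (rule B_lc[symmetric]) (rule uA_closed)
  also have "(\<Oplus>\<^bsub>A\<^esub>g\<in>G. kap (v i) (v j) g \<odot>\<^bsub>A\<^esub> uA g) = (\<Oplus>\<^bsub>A\<^esub>g\<in>G. BA.crd ?d (idx n {}, g) \<odot>\<^bsub>A\<^esub> uA g)"
    by (rule A.finsum_cong_all) (simp_all only: kap_v[OF i j] kc_def A.smult_closed uA_closed)
  also have "\<dots> = ?d" by (rule dexp[symmetric])
  finally have k: "(\<Oplus>\<^bsub>D.B\<^esub>g\<in>G. [:kap (v i) (v j) g:] \<odot>\<^bsub>D.B\<^esub> cn (uA g)) = cn ?d" .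
  have t: "[:0, 1:] \<odot>\<^bsub>PA.PA\<^esub> cn ?d = tmonom A ?d 1"
    using PA.smult_monom_tmonom[OF dc, of 1 1 0] dc by (simp add: monom_altdef)
  note c = PA.tmonom_closed[OF y(1), of 0] PA.tmonom_closed[OF y(2), of 0]
  have "D.st (cn (yA j)) (cn (yA i)) = [:q i j:] \<odot>\<^bsub>PA.PA\<^esub> D.st (cn (yA i)) (cn (yA j)) \<oplus>\<^bsub>PA.PA\<^esub> tmonom A ?d 1"
  proof
    fix m
    have "([:q i j:] \<odot>\<^bsub>PA.PA\<^esub> D.st (cn (yA i)) (cn (yA j)) \<oplus>\<^bsub>PA.PA\<^esub> tmonom A ?d 1) m =
      q i j \<odot>\<^bsub>A\<^esub> \<mu> m (yA i) (yA j) \<oplus>\<^bsub>A\<^esub> (if m = 1 then ?d else \<zero>\<^bsub>A\<^esub>)"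
      using fun_cong[OF PA.PA_add[OF PA.P.smult_closed[OF D.st_closed[OF c], of "[:q i j:]"] PA.tmonom_closed[OF dc, of 1]], of m]
      unfolding PA.const_smult[OF D.st_closed[OF c]] st_const[OF y] PA.tmonom_eq[OF dc] .
    also have "\<dots> = \<mu> m (yA j) (yA i)"
    proof (cases "m = 1")
      case True
      have "q i j \<odot>\<^bsub>A\<^esub> \<mu> 1 (yA i) (yA j) \<oplus>\<^bsub>A\<^esub> ?d = \<mu> 1 (yA j) (yA i)"
        using Deg_closed[OF m1(1)] A.smult_closed[OF Deg_closed[OF m1(2)]] by (simp only: a_minus_def A.a_lcomm A.r_neg A.a_inv_closed A.r_zero A.minus_closed A.a_closed)
      then show ?thesis using True by simp
    next
      case False
      then consider "m = 0" | "m \<ge> 2" by linarith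
      then have "q i j \<odot>\<^bsub>A\<^esub> \<mu> m (yA i) (yA j) = \<mu> m (yA j) (yA i)"
      proof cases
        case 1
        \<comment> \<open>For i = j both sides are zero, the squares of the letters being zero in
          A.\<close>
        then show ?thesis using y yA_swap[OF i j] yA_square[OF i] by (cases "i = j") (simp_all add: mu0)
      next
        case 2
        \<comment> \<open>From m = 2 on the degree 2 - 2 m is negative.\<close>
        have "\<mu> m (yA i) (yA j) = \<zero>\<^bsub>A\<^esub>" "\<mu> m (yA j) (yA i) = \<zero>\<^bsub>A\<^esub>"
          using mu_Deg[OF _ Deg_yA[OF i] Deg_yA[OF j], of m] mu_Deg[OF _ Deg_yA[OF j] Deg_yA[OF i], of m] 2
          by (auto intro!: Deg_neg[of _ "1 + 1 - 2 * int m"])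
        then show ?thesis by simp
      qed
      then show ?thesis using False y by simp
    qed
    finally show "D.st (cn (yA j)) (cn (yA i)) m = ([:q i j:] \<odot>\<^bsub>PA.PA\<^esub> D.st (cn (yA i)) (cn (yA j)) \<oplus>\<^bsub>PA.PA\<^esub> tmonom A ?d 1) m"
      using y by (simp only: st_const)
  qed
  then show ?thesis unfolding k unfolding D.B_simps(4-6) t .
qed

lemma DB_square:
  assumes i: "i \<in> {1..n}" shows "cn (yA i) \<otimes>\<^bsub>D.B\<^esub> cn (yA i) = \<zero>\<^bsub>D.B\<^esub>"
  unfolding D.B_simps PA.PA_simps(3)
proof
  fix m
  have "\<mu> m (yA i) (yA i) = \<zero>\<^bsub>A\<^esub>"
    using mu_square[OF _ i, of m] yA_square[OF i] yA_closed[OF i] by (cases "m = 0") (simp_all add: mu0)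
  then show "D.st (cn (yA i)) (cn (yA i)) m = \<zero>\<^bsub>A\<^esub>" using yA_closed[OF i] by (simp only: st_const)
qed

theorem deformation_is_qdh:
  "\<exists>\<kappa>. bilinear_to_group_algebra scale G \<kappa> \<and> is_truncated_qdh scale v n G q \<kappa> \<and>
    qdh_deformation_iso scale v n G q \<kappa> \<mu> \<noteq> {}"
proof -
  interpret K: qkappa n q scale v G kap
    by (intro qkappa.intro qkappa_axioms.intro qdata_axioms) (simp add: kap_def)
  note iso = K.pbw_iso[OF DX.xalg_axioms DB_swap DB_square is_basis_DX]
  have "is_truncated_qdh scale v n G q kap" unfolding K.is_truncated_qdh_iff by (rule iso(1))
  moreover obtain \<phi> where "\<phi> \<in> alg_iso K.HK D.B"
    "\<forall>i\<in>{1..n}. \<phi> (K.hx i) = cn (yA i)" "\<forall>g\<in>G. \<phi> (K.hu g) = cn (uA g)"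
    using iso(2) by blast
  then have "\<phi> \<in> qdh_deformation_iso scale v n G q kap \<mu>"
    by (simp add: qdh_deformation_iso_def Let_def)
  ultimately show ?thesis using bilinear_kap by blast
qed

end

section \<open>Setting t = 0\<close>

lemma (in kpoly) PA_diff:
  assumes f: "f \<in> carrier PA" and g: "g \<in> carrier PA"
  shows "(f \<ominus>\<^bsub>PA\<^esub> g) m = f m \<ominus> g m"
proof -
  have 1: "(- 1 :: 'k poly) = [:- 1:]" by (simp add: one_pCons)
  have "f \<ominus>\<^bsub>PA\<^esub> g = f \<oplus>\<^bsub>PA\<^esub> [:- 1:] \<odot>\<^bsub>PA\<^esub> g" using P.diff_eq_smult[OF f g] unfolding 1 .
  then have "(f \<ominus>\<^bsub>PA\<^esub> g) m = f m \<oplus> (- 1) \<odot> g m"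
    using PA_add[OF f P.smult_closed[OF g, of "[:- 1:]"]] const_smult[OF g, of "- 1" m] by simp
  then show ?thesis using diff_eq_smult[OF PA_closed[OF f] PA_closed[OF g]] by simp
qed

lemma (in kpoly) PA_smult_0: "f \<in> carrier PA \<Longrightarrow> (p \<odot>\<^bsub>PA\<^esub> f) 0 = Polynomial.coeff p 0 \<odot> f 0"
  by (simp add: PA_smult PA_closed)

lemma (in kpoly) PA_mult_0: "f \<in> carrier PA \<Longrightarrow> g \<in> carrier PA \<Longrightarrow> (f \<otimes>\<^bsub>PA\<^esub> g) 0 = f 0 \<otimes> g 0"
  by (simp add: PA_mult PA_closed)

context qdata
begin

lemma PB: "fbasis PA.PA bI (\<lambda>i. cn (bA i))"
  by (intro fbasis.intro fbasis_axioms.intro PA.P.kalg_axioms finite_bI PA.is_basis_PA is_basis_A)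

text \<open>The undeformed A[t] is one more target for \<open>F\<close>; taking the constant
  coefficient afterwards gives the reduction at t = 0.\<close>

lemma AX: "xalg PA.PA n G rr (\<lambda>i. cn (yA i)) (\<lambda>g. cn (uA g))"
  by (rule PA.xalg_PA) (simp_all only: G_id G_comp yA_closed uA_closed uA_mult uA_id uA_yA)

lemma AX_e:
  assumes w: "set w \<subseteq> {1..n}" and g: "g \<in> G"
  shows "xalg.e PA.PA (\<lambda>i. cn (yA i)) (\<lambda>g. cn (uA g)) w g = cn (list_prod A (map yA w) \<otimes>\<^bsub>A\<^esub> uA g)"
proof -
  interpret X: xalg PA.PA n G rr "\<lambda>i. cn (yA i)" "\<lambda>g. cn (uA g)" by (rule AX)
  have l: "list_prod A (map yA w) \<in> carrier A" if "set w \<subseteq> {1..n}" for w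
    using that yA_closed by (intro A.list_prod_closed) auto
  have "X.xw w = cn (list_prod A (map yA w))"
    using w
  proof (induction w)
    case Nil
    then show ?case by (simp add: X.xw_simps PA.tmonom_one)
  next
    case (Cons i w)
    then have i: "i \<in> {1..n}" and w: "set w \<subseteq> {1..n}" by auto
    show ?case unfolding X.xw_simps Cons.IH[OF w] PA.tmonom_mult[OF yA_closed[OF i] l[OF w]] by simp
  qed
  then show ?thesis unfolding X.e_def using PA.tmonom_mult[OF l[OF w] uA_closed[OF g]] by simp
qed

text \<open>The map \<open>T(V) \<rtimes> G[t] \<rightarrow> \<Lambda> \<rtimes> G\<close> with \<open>t \<mapsto> 0\<close>.\<close>

definition ev :: "(nat \<Rightarrow> ('v \<Rightarrow> 'v) \<Rightarrow> nat list \<Rightarrow> 'k) \<Rightarrow> ('v \<Rightarrow> 'v) \<Rightarrow> (nat list \<Rightarrow> 'k) set" where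
  "ev p = F PA.PA (\<lambda>i. cn (yA i)) (\<lambda>g. cn (uA g)) p 0"

lemma ev_closed: "p \<in> carrier P \<Longrightarrow> ev p \<in> carrier A"
  unfolding ev_def by (rule PA.PA_closed[OF F_closed[OF AX]])

lemma ev_mult: "p \<in> carrier P \<Longrightarrow> r \<in> carrier P \<Longrightarrow> ev (p \<otimes>\<^bsub>P\<^esub> r) = ev p \<otimes>\<^bsub>A\<^esub> ev r"
  unfolding ev_def by (simp only: F_mult[OF AX] PA.PA_mult_0 F_closed[OF AX])

lemma ev_add: "p \<in> carrier P \<Longrightarrow> r \<in> carrier P \<Longrightarrow> ev (p \<oplus>\<^bsub>P\<^esub> r) = ev p \<oplus>\<^bsub>A\<^esub> ev r"
  unfolding ev_def by (simp only: F_add[OF AX] PA.PA_add F_closed[OF AX])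

lemma ev_diff: "p \<in> carrier P \<Longrightarrow> r \<in> carrier P \<Longrightarrow> ev (p \<ominus>\<^bsub>P\<^esub> r) = ev p \<ominus>\<^bsub>A\<^esub> ev r"
  unfolding ev_def
  by (simp only: linear_on_diff[OF PS.P.kalg_axioms PA.P.kalg_axioms linear_on_F[OF AX]] PA.PA_diff F_closed[OF AX])

lemma ev_smult: "p \<in> carrier P \<Longrightarrow> ev (c \<odot>\<^bsub>P\<^esub> p) = Polynomial.coeff c 0 \<odot>\<^bsub>A\<^esub> ev p"
  unfolding ev_def by (simp only: F_smult[OF AX] PA.PA_smult_0 F_closed[OF AX])

lemma ev_x: "i \<in> {1..n} \<Longrightarrow> ev (xP i) = yA i"
  unfolding ev_def F_x[OF AX] PA.tmonom_eq[OF yA_closed] by simp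

lemma ev_one: "ev \<one>\<^bsub>P\<^esub> = \<one>\<^bsub>A\<^esub>"
  unfolding ev_def F_one[OF AX] by (simp add: PA.PA_simps)

lemma ev_e: "set w \<subseteq> {1..n} \<Longrightarrow> g \<in> G \<Longrightarrow> ev (PX.e w g) = list_prod A (map yA w) \<otimes>\<^bsub>A\<^esub> uA g"
proof -
  assume w: "set w \<subseteq> {1..n}" and g: "g \<in> G"
  have c: "list_prod A (map yA w) \<otimes>\<^bsub>A\<^esub> uA g \<in> carrier A"
    by (rule Deg_closed[OF Deg_word[OF w g]])
  show ?thesis unfolding ev_def F_e[OF AX w g] AX_e[OF w g] PA.tmonom_eq[OF c] by simp
qed

lemma ev_ideal: "ideal {p \<in> carrier P. ev p = \<zero>\<^bsub>A\<^esub>} P"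
proof -
  have "ev \<in> ring_hom P A"
    by (rule ring_hom_memI) (simp_all only: ev_closed ev_mult ev_add ev_one)
  then interpret ev: ring_hom_ring P A ev
    by (intro ring_hom_ringI2 PS.P.ring_axioms A.ring_axioms)
  show ?thesis using ev.kernel_is_ideal unfolding a_kernel_def' .
qed

section \<open>Homogeneous elements of T(V) x G [t]\<close>

lemma homog_smult: "z \<in> homog k \<Longrightarrow> [:c:] \<odot>\<^bsub>P\<^esub> z \<in> homog k"
  and homog_add: "z \<in> homog k \<Longrightarrow> y \<in> homog k \<Longrightarrow> z \<oplus>\<^bsub>P\<^esub> y \<in> homog k"
  and homog_zero: "\<zero>\<^bsub>P\<^esub> \<in> homog k"
  using ksub_homog[of k] unfolding ksub_def by blast+

lemma homog_closed: "z \<in> homog k \<Longrightarrow> z \<in> carrier P"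
  unfolding homog_def by blast

lemma homog_diff: "z \<in> homog k \<Longrightarrow> y \<in> homog k \<Longrightarrow> z \<ominus>\<^bsub>P\<^esub> y \<in> homog k"
proof -
  assume z: "z \<in> homog k" and y: "y \<in> homog k"
  have 1: "(- 1 :: 'k poly) = [:- 1:]" by (simp add: one_pCons)
  show ?thesis unfolding PS.P.diff_eq_smult[OF homog_closed[OF z] homog_closed[OF y]] 1
    by (intro homog_add homog_smult z y)
qed

lemma homog_t: "z \<in> homog 0 \<Longrightarrow> [:0, 1:] \<odot>\<^bsub>P\<^esub> z \<in> homog 2"
proof -
  assume z: "z \<in> homog 0"
  have zc: "z \<in> carrier P" by (rule homog_closed[OF z])
  \<comment> \<open>Multiplication by t raises the exponent by one and so accounts for two units of
    degree.\<close>
  have "hp d 0 (p * [:0, 1:]) = hp d 2 p * [:0, 1:]" for d and p :: "'k poly"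
  proof (rule poly_eqI)
    fix m
    show "Polynomial.coeff (hp d 0 (p * [:0, 1:])) m = Polynomial.coeff (hp d 2 p * [:0, 1:]) m"
      by (cases m) (simp_all add: hp_coeff)
  qed
  then have "comp d ((p * [:0, 1:]) \<odot>\<^bsub>P\<^esub> z) = (hp d 2 p * [:0, 1:]) \<odot>\<^bsub>P\<^esub> z" for d p
    using z by (simp only: homog_def mem_Collect_eq)
  then show ?thesis unfolding homog_def
    by (intro CollectI conjI allI PS.P.smult_closed zc) (simp only: PS.P.smult_assoc[OF zc, symmetric])
qed

lemma homog_x_x: "i \<in> {1..n} \<Longrightarrow> j \<in> {1..n} \<Longrightarrow> xP i \<otimes>\<^bsub>P\<^esub> xP j \<in> homog 2"
  using homog_e_e[of "[i]" "[j]" id id] G_id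
  by (simp add: PX.e_single del: atLeastAtMost_iff One_nat_def) (simp add: numeral_2_eq_2)

lemma homog_u: "g \<in> G \<Longrightarrow> uP g \<in> homog 0"
  using homog_e[of "[]" g] by (simp add: PX.e_Nil)

text \<open>To be used as an induction over a homogeneous component: with \<open>N\<close> the set
  of elements having a linear property, only PBW monomials of length \<open>d\<close> need
  checking.\<close>

lemma Deg_sub:
  assumes N: "\<zero>\<^bsub>A\<^esub> \<in> N" "\<And>x y. x \<in> N \<Longrightarrow> y \<in> N \<Longrightarrow> x \<oplus>\<^bsub>A\<^esub> y \<in> N" "\<And>c x. x \<in> N \<Longrightarrow> c \<odot>\<^bsub>A\<^esub> x \<in> N" "N \<subseteq> carrier A"
    and b: "\<And>i. i \<in> bI \<Longrightarrow> int (length (wd n (fst i))) = d \<Longrightarrow> bA i \<in> N"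
    and a: "a \<in> Deg d"
  shows "a \<in> N"
proof -
  have "(\<Oplus>\<^bsub>A\<^esub>i\<in>bI. BA.crd a i \<odot>\<^bsub>A\<^esub> bA i) \<in> N"
  proof (rule A.sub_finsum[OF N(1,2,4)])
    fix i assume i: "i \<in> bI"
    show "BA.crd a i \<odot>\<^bsub>A\<^esub> bA i \<in> N"
    proof (cases "BA.crd a i = 0")
      case True
      show ?thesis unfolding True A.smult_zero_left[OF BA.b_closed[OF i]] by (rule N(1))
    next
      case False
      then have "int (length (wd n (fst i))) = d" using a[unfolded Deg_iff] i by blast
      then show ?thesis by (intro N(3) b i)
    qed
  qed
  then show ?thesis unfolding BA.crd_expand[OF Deg_closed[OF a]] .
qed

lemma bA_Nil: "g \<in> G \<Longrightarrow> bA (idx n {}, g) = uA g"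
  and bA_single: "i \<in> {1..n} \<Longrightarrow> bA (idx n {i}, id) = yA i"
proof -
  have "wd n (idx n {}) = []" using wd_idx[of "[]" n] by simp
  then show "bA (idx n {}, g) = uA g" if "g \<in> G" using uA_closed[OF that] by simp
  show "bA (idx n {i}, id) = yA i" if "i \<in> {1..n}"
    using wd_idx[of "[i]" n] yA_closed[OF that] that by (simp add: uA_id del: atLeastAtMost_iff One_nat_def)
qed

end

section \<open>The deformation given by a PBW basis\<close>

context qkappa
begin

text \<open>Every term of a generator has degree 2: it contains either two letters, or a group
  element and one factor t.\<close>

lemma gens_homog: "z \<in> gens \<Longrightarrow> z \<in> homog 2"
proof -
  assume "z \<in> gens"
  then consider i j where "i \<in> {1..n}" "j \<in> {1..n}" "z = gen i j" | i where "i \<in> {1..n}" "z = xP i \<otimes>\<^bsub>P\<^esub> xP i"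
    unfolding gens_def by blast
  then show ?thesis
  proof cases
    case 1
    have "(\<Oplus>\<^bsub>P\<^esub>g\<in>G. [:k0 i j g:] \<odot>\<^bsub>P\<^esub> uP g) \<in> homog 0"
      by (rule PS.P.sub_finsum[OF homog_zero homog_add]) (blast intro: homog_closed homog_smult homog_u)+
    then show ?thesis unfolding 1(3) gen_def by (intro homog_diff homog_smult homog_x_x homog_t 1)
  next
    case 2
    then show ?thesis using homog_x_x[OF 2(1) 2(1)] by simp
  qed
qed

text \<open>A component of a generator is the generator itself or zero, so the criterion for
  homogeneous ideals applies.\<close>

lemma comp_I: "z \<in> I \<Longrightarrow> comp d z \<in> I"
  unfolding I_eq
proof (rule homogeneous_ideal[OF gens_closed])
  fix z d assume z: "z \<in> gens"
  have zc: "z \<in> carrier P" using z gens_closed by blast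
  have "comp d (1 \<odot>\<^bsub>P\<^esub> z) = hp d 2 1 \<odot>\<^bsub>P\<^esub> z" using gens_homog[OF z] unfolding homog_def by blast
  then have "comp d z = hp d 2 1 \<odot>\<^bsub>P\<^esub> z" unfolding PS.P.smult_one[OF zc] .
  also have "\<dots> \<in> I" by (rule PS.P.ideal_smult[OF ideal_I gens_I[OF z]])
  finally show "comp d z \<in> Idl\<^bsub>P\<^esub> gens" unfolding I_eq .
qed

text \<open>At t = 0 the term with the bilinear function disappears and the generators become the
  relations of the quantum exterior algebra.\<close>

lemma I_ev: "z \<in> I \<Longrightarrow> ev z = \<zero>\<^bsub>A\<^esub>"
proof -
  have "ev z = \<zero>\<^bsub>A\<^esub>" if z: "z \<in> gens" for z
  proof -
    consider i j where "i \<in> {1..n}" "j \<in> {1..n}" "z = gen i j" | i where "i \<in> {1..n}" "z = xP i \<otimes>\<^bsub>P\<^esub> xP i"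
      using z unfolding gens_def by blast
    then show ?thesis
    proof cases
      case 1
      note c = PX.x_closed[OF 1(1)] PX.x_closed[OF 1(2)]
      note y = yA_closed[OF 1(1)] yA_closed[OF 1(2)]
      have "ev z = (yA j \<otimes>\<^bsub>A\<^esub> yA i \<ominus>\<^bsub>A\<^esub> q i j \<odot>\<^bsub>A\<^esub> (yA i \<otimes>\<^bsub>A\<^esub> yA j)) \<ominus>\<^bsub>A\<^esub> 0 \<odot>\<^bsub>A\<^esub> ev (\<Oplus>\<^bsub>P\<^esub>g\<in>G. [:k0 i j g:] \<odot>\<^bsub>P\<^esub> uP g)"
        unfolding 1(3) gen_def
        by (simp only: ev_diff ev_smult ev_mult PS.P.minus_closed PS.P.smult_closed PS.P.m_closed c k_sum_closed ev_x 1(1,2)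
          coeff_pCons_0)
      also have "\<dots> = yA j \<otimes>\<^bsub>A\<^esub> yA i \<ominus>\<^bsub>A\<^esub> q i j \<odot>\<^bsub>A\<^esub> (yA i \<otimes>\<^bsub>A\<^esub> yA j)"
        using y by (simp add: A.smult_zero_left[OF ev_closed[OF k_sum_closed]] a_minus_def)
      also have "\<dots> = \<zero>\<^bsub>A\<^esub>"
      \<comment> \<open>For i = j there is no commutation relation to use; the generator reduces to
        a multiple of a square of a letter.\<close>
      proof (cases "i = j")
        case True
        show ?thesis unfolding True yA_square[OF 1(2)] by (simp add: a_minus_def)
      next
        case False
        have "q i j \<odot>\<^bsub>A\<^esub> (yA i \<otimes>\<^bsub>A\<^esub> yA j) \<in> carrier A" by (intro A.smult_closed A.m_closed y)
        then show ?thesis unfolding yA_swap[OF 1(1,2) False] by (simp only: a_minus_def A.r_neg)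
      qed
      finally show ?thesis .
    next
      case 2
      note c = PX.x_closed[OF 2(1)]
      show ?thesis unfolding 2(2) ev_mult[OF c c] ev_x[OF 2(1)] by (rule yA_square[OF 2(1)])
    qed
  qed
  then have "gens \<subseteq> {p \<in> carrier P. ev p = \<zero>\<^bsub>A\<^esub>}" using gens_closed by blast
  then have "I \<subseteq> {p \<in> carrier P. ev p = \<zero>\<^bsub>A\<^esub>}"
    unfolding I_eq by (rule PS.P.genideal_minimal[OF ev_ideal])
  then show "z \<in> I \<Longrightarrow> ev z = \<zero>\<^bsub>A\<^esub>" by blast
qed

end

section \<open>Transport of the product along the PBW basis\<close>

locale qpbw = qkappa n q scale v G \<kappa> for n and q :: "nat \<Rightarrow> nat \<Rightarrow> 'k::field" and scale :: "'k \<Rightarrow> 'v::ab_group_add \<Rightarrow> 'v" and v G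
    and \<kappa> :: "'v \<Rightarrow> 'v \<Rightarrow> ('v \<Rightarrow> 'v) \<Rightarrow> 'k" +
  assumes pbw: "is_basis HK bI hE"
begin

sublocale HB: fbasis HK bI hE
  by (intro fbasis.intro fbasis_axioms.intro HK.kalg_axioms finite_bI pbw)

sublocale PB: fbasis PA.PA bI "\<lambda>i. cn (bA i)" by (rule PB)

sublocale C: basis_change HK bI hE PA.PA "\<lambda>i. cn (bA i)"
  by (intro basis_change.intro HB.fbasis_axioms PB)

sublocale R: basis_change PA.PA bI "\<lambda>i. cn (bA i)" HK hE
  by (intro basis_change.intro HB.fbasis_axioms PB)

abbreviation "\<phi> \<equiv> C.change"
abbreviation "\<psi> \<equiv> R.change"

lemmas \<phi>_linear = linear_onD[OF C.linear_on_change]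
lemmas \<psi>_linear = linear_onD[OF R.linear_on_change]

lemma \<phi>_\<psi>: "f \<in> carrier PA.PA \<Longrightarrow> \<phi> (\<psi> f) = f"
  by (rule C.change_eqI) (simp_all only: R.change_closed R.crd_change)

lemma \<psi>_\<phi>: "X \<in> carrier HK \<Longrightarrow> \<psi> (\<phi> X) = X"
  by (rule R.change_eqI) (simp_all only: C.change_closed C.crd_change)

lemma \<phi>_apply:
  assumes X: "X \<in> carrier HK"
  shows "\<phi> X m = (\<Oplus>\<^bsub>A\<^esub>i\<in>bI. Polynomial.coeff (HB.crd X i) m \<odot>\<^bsub>A\<^esub> bA i)"
  unfolding C.change_def by (rule PA.PA_lc_apply) (rule BA.b_closed)

lemma \<phi>_crd:
  assumes X: "X \<in> carrier HK" and l: "l \<in> bI"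
  shows "BA.crd (\<phi> X m) l = Polynomial.coeff (HB.crd X l) m"
  unfolding \<phi>_apply[OF X] by (rule BA.crd_lc[OF l])

lemma hc_rep:
  assumes p: "p \<in> carrier P"
  shows "p \<ominus>\<^bsub>P\<^esub> (\<Oplus>\<^bsub>P\<^esub>i\<in>bI. HB.crd (hc p) i \<odot>\<^bsub>P\<^esub> E i) \<in> I"
proof -
  have "hc p = hc (\<Oplus>\<^bsub>P\<^esub>i\<in>bI. HB.crd (hc p) i \<odot>\<^bsub>P\<^esub> E i)"
    unfolding hc_lc by (rule HB.crd_expand[OF hc_linear(1)[OF p], symmetric])
  then show ?thesis using PS.P.coset_eq_iff[OF ideal_I p P_lc_closed[of "HB.crd (hc p)"]] by blast
qed

lemma ev_lc: "ev (\<Oplus>\<^bsub>P\<^esub>i\<in>bI. c i \<odot>\<^bsub>P\<^esub> E i) = (\<Oplus>\<^bsub>A\<^esub>i\<in>bI. Polynomial.coeff (c i) 0 \<odot>\<^bsub>A\<^esub> bA i)"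
proof -
  have "ev (\<Oplus>\<^bsub>P\<^esub>i\<in>bI. c i \<odot>\<^bsub>P\<^esub> E i) = (\<Oplus>\<^bsub>A\<^esub>i\<in>bI. ev (c i \<odot>\<^bsub>P\<^esub> E i))"
  proof (rule additive_finsum[where h = ev, OF PS.P.is_abelian_group A.is_abelian_group])
    show "ev \<in> carrier P \<rightarrow> carrier A" by (rule funcsetI) (rule ev_closed)
  qed (intro ev_add PS.P.smult_closed E_closed; assumption)+
  also have "\<dots> = (\<Oplus>\<^bsub>A\<^esub>i\<in>bI. Polynomial.coeff (c i) 0 \<odot>\<^bsub>A\<^esub> bA i)"
  proof (rule A.finsum_cong_all)
    fix i assume i: "i \<in> bI"
    obtain \<alpha> g where ih: "i = (\<alpha>, g)" "g \<in> G" using i by auto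
    show "ev (c i \<odot>\<^bsub>P\<^esub> E i) = Polynomial.coeff (c i) 0 \<odot>\<^bsub>A\<^esub> bA i"
      unfolding ev_smult[OF E_closed[OF i]] unfolding ih(1) prod.case ev_e[OF wd_sorted(3) ih(2)] by (rule refl)
    show "Polynomial.coeff (c i) 0 \<odot>\<^bsub>A\<^esub> bA i \<in> carrier A" by (intro A.smult_closed BA.b_closed i)
  qed
  finally show ?thesis .
qed

text \<open>An element and its PBW combination differ by a member of I, which evaluation at t = 0
  kills. Hence matching the bases and then setting t = 0 agrees with evaluating any
  representative.\<close>

lemma \<phi>_hc_0:
  assumes p: "p \<in> carrier P"
  shows "\<phi> (hc p) 0 = ev p"
proof -
  let ?l = "\<Oplus>\<^bsub>P\<^esub>i\<in>bI. HB.crd (hc p) i \<odot>\<^bsub>P\<^esub> E i"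
  have "ev p \<ominus>\<^bsub>A\<^esub> ev ?l = \<zero>\<^bsub>A\<^esub>"
    using I_ev[OF hc_rep[OF p]] unfolding ev_diff[OF p P_lc_closed] .
  then have "ev p \<ominus>\<^bsub>A\<^esub> ev ?l \<ominus>\<^bsub>A\<^esub> \<zero>\<^bsub>A\<^esub> = \<zero>\<^bsub>A\<^esub>" by (simp add: a_minus_def)
  then have "ev p = ev ?l"
    using A.eq_add_if_diff_zero[OF ev_closed[OF p] ev_closed[OF P_lc_closed] A.zero_closed]
      A.r_zero[OF ev_closed[OF P_lc_closed]] by (simp only:)
  then show ?thesis unfolding \<phi>_apply[OF hc_linear(1)[OF p]] ev_lc by (rule sym)
qed

definition pm :: "(nat \<Rightarrow> ('v \<Rightarrow> 'v) \<Rightarrow> (nat list \<Rightarrow> 'k) set) \<Rightarrow> (nat \<Rightarrow> ('v \<Rightarrow> 'v) \<Rightarrow> (nat list \<Rightarrow> 'k) set) \<Rightarrow>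
    nat \<Rightarrow> ('v \<Rightarrow> 'v) \<Rightarrow> (nat list \<Rightarrow> 'k) set" where
  "pm f g = \<phi> (\<psi> f \<otimes>\<^bsub>HK\<^esub> \<psi> g)"

lemma pm_closed: "pm f g \<in> carrier PA.PA"
  unfolding pm_def by (rule C.change_closed)

lemma pm_add:
  assumes "f \<in> carrier PA.PA" "f' \<in> carrier PA.PA"
  shows "pm (f \<oplus>\<^bsub>PA.PA\<^esub> f') g = pm f g \<oplus>\<^bsub>PA.PA\<^esub> pm f' g"
    and "pm g (f \<oplus>\<^bsub>PA.PA\<^esub> f') = pm g f \<oplus>\<^bsub>PA.PA\<^esub> pm g f'"
  unfolding pm_def
  by (simp_all only: \<psi>_linear assms HK.l_distr HK.r_distr R.change_closed \<phi>_linear HK.m_closed)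

lemma pm_smult:
  assumes "f \<in> carrier PA.PA"
  shows "pm (c \<odot>\<^bsub>PA.PA\<^esub> f) g = c \<odot>\<^bsub>PA.PA\<^esub> pm f g"
    and "pm g (c \<odot>\<^bsub>PA.PA\<^esub> f) = c \<odot>\<^bsub>PA.PA\<^esub> pm g f"
  unfolding pm_def
  by (simp_all only: \<psi>_linear assms HK.smult_mult_left HK.smult_mult_right R.change_closed \<phi>_linear HK.m_closed)

lemma pm_zero: "pm \<zero>\<^bsub>PA.PA\<^esub> g = \<zero>\<^bsub>PA.PA\<^esub>" "pm g \<zero>\<^bsub>PA.PA\<^esub> = \<zero>\<^bsub>PA.PA\<^esub>"
  using pm_smult[OF PA.P.zero_closed, where c = 0 and g = g] PA.P.smult_zero_left[OF PA.P.zero_closed] PA.P.smult_zero_left[OF pm_closed] by simp_all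

lemma pm_assoc: "pm (pm f g) h = pm f (pm g h)"
  unfolding pm_def by (simp only: \<psi>_\<phi> HK.m_closed HK.m_assoc R.change_closed)

text \<open>Only products of constants are recorded, coefficient by coefficient;
  \<open>st_eq_pm\<close> shows that nothing is lost.\<close>

definition \<mu> :: "nat \<Rightarrow> (('v \<Rightarrow> 'v) \<Rightarrow> (nat list \<Rightarrow> 'k) set) \<Rightarrow> (('v \<Rightarrow> 'v) \<Rightarrow> (nat list \<Rightarrow> 'k) set) \<Rightarrow>
    ('v \<Rightarrow> 'v) \<Rightarrow> (nat list \<Rightarrow> 'k) set" where
  "\<mu> i a b = pm (cn a) (cn b) i"

lemma bilinear_\<mu>: "bilinear_op A (\<mu> i)"
  unfolding bilinear_op_def \<mu>_def
  by (intro ballI conjI allI PA.PA_closed pm_closed)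
    (simp_all only: PA.tmonom_linear PA.tmonom_closed pm_add pm_smult PA.PA_add[OF pm_closed pm_closed] PA.const_smult[OF pm_closed])

sublocale D: kbil A \<mu>
proof (intro kbil.intro kbil_axioms.intro PA.kpoly_axioms bilinear_\<mu>)
  fix a b
  obtain m where "\<forall>i>m. pm (cn a) (cn b) i = \<zero>\<^bsub>A\<^esub>" using PA.PA_bound[OF pm_closed] by blast
  then have "{i. \<mu> i a b \<noteq> \<zero>\<^bsub>A\<^esub>} \<subseteq> {..m}" unfolding \<mu>_def by (auto simp: not_less[symmetric])
  then show "finite {i. \<mu> i a b \<noteq> \<zero>\<^bsub>A\<^esub>}" by (rule finite_subset) simp
qed

text \<open>Both products are K[t]-bilinear and agree on constants by the definition of
  \<open>\<mu>\<close>. Associativity of the deformation is thereby inherited from the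
  quotient.\<close>

lemma st_eq_pm:
  assumes f: "f \<in> carrier PA.PA" and g: "g \<in> carrier PA.PA"
  shows "D.st f g = pm f g"
  using f
proof (induction f rule: PA.PA_induct)
  case zero
  show ?case by (simp only: D.st_zero[OF g] pm_zero)
next
  case (add f h)
  then show ?case by (simp only: D.st_l_distr g pm_add)
next
  case (monom a j)
  note ac = PA.tmonom_closed[OF monom]
  show ?case using g
  proof (induction g rule: PA.PA_induct)
    case zero
    show ?case by (simp only: D.st_zero[OF ac] pm_zero)
  next
    case (add f h)
    then show ?case by (simp only: D.st_r_distr ac pm_add)
  next
    case (monom b k)
    note bc = PA.tmonom_closed[OF monom]
    have t: "tmonom A a j = Polynomial.monom 1 j \<odot>\<^bsub>PA.PA\<^esub> cn a" "tmonom A b k = Polynomial.monom 1 k \<odot>\<^bsub>PA.PA\<^esub> cn b"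
      using PA.smult_monom_tmonom[OF \<open>a \<in> carrier A\<close>, of 1 j 0] PA.smult_monom_tmonom[OF monom, of 1 k 0] \<open>a \<in> carrier A\<close> monom by simp_all
    have "D.st (cn a) (cn b) = pm (cn a) (cn b)"
      unfolding D.st_tmonom[OF \<open>a \<in> carrier A\<close> monom] by (simp add: \<mu>_def)
    then show ?case
      unfolding t by (simp only: D.st_smult PA.P.smult_closed ac bc pm_smult)
  qed
qed

text \<open>Lift both factors to T(V) x G [t]: evaluation at t = 0 is multiplicative there, and it
  computes the constant coefficient.\<close>

lemma \<mu>_0:
  assumes a: "a \<in> carrier A" and b: "b \<in> carrier A"
  shows "\<mu> 0 a b = a \<otimes>\<^bsub>A\<^esub> b"
proof -
  obtain p where p: "p \<in> carrier P" "\<psi> (cn a) = hc p" by (rule H_carrierE[OF R.change_closed])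
  obtain r where r: "r \<in> carrier P" "\<psi> (cn b) = hc r" by (rule H_carrierE[OF R.change_closed])
  have ev: "ev p = a" "ev r = b"
    unfolding \<phi>_hc_0[OF p(1), symmetric] \<phi>_hc_0[OF r(1), symmetric] p(2)[symmetric] r(2)[symmetric]
      \<phi>_\<psi>[OF PA.tmonom_closed[OF a]] \<phi>_\<psi>[OF PA.tmonom_closed[OF b]]
    unfolding PA.tmonom_eq[OF a] PA.tmonom_eq[OF b] by simp_all
  show ?thesis
    unfolding \<mu>_def pm_def p(2) r(2) hc_mult[OF p(1) r(1), symmetric] \<phi>_hc_0[OF PS.P.m_closed[OF p(1) r(1)]]
      ev_mult[OF p(1) r(1)] ev by (rule refl)
qed

lemma deformation: "is_deformation A \<mu>"
  unfolding is_deformation_def Let_def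
proof (intro conjI allI ballI bilinear_\<mu> \<mu>_0 D.fin)
  fix f g h assume "f \<in> carrier D.B" "g \<in> carrier D.B" "h \<in> carrier D.B"
  then show "(f \<otimes>\<^bsub>D.B\<^esub> g) \<otimes>\<^bsub>D.B\<^esub> h = f \<otimes>\<^bsub>D.B\<^esub> (g \<otimes>\<^bsub>D.B\<^esub> h)"
    unfolding D.B_simps by (simp only: st_eq_pm pm_closed pm_assoc)
qed

lemma \<psi>_bA: "i \<in> bI \<Longrightarrow> \<psi> (cn (bA i)) = hE i" and \<phi>_hE: "i \<in> bI \<Longrightarrow> \<phi> (hE i) = cn (bA i)"
  by (rule R.change_basis, assumption) (rule C.change_basis)

text \<open>The degree condition in coordinates. A product of two monomials has a homogeneous
  representative, and since I is homogeneous, the component of that degree of its PBW expansion is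
  again an expansion; uniqueness of coordinates then leaves no other terms.\<close>

lemma crd_hE_hE:
  assumes i: "i \<in> bI" and j: "j \<in> bI" and l: "l \<in> bI"
    and nz: "Polynomial.coeff (HB.crd (hE i \<otimes>\<^bsub>HK\<^esub> hE j) l) k \<noteq> 0"
  shows "2 * k + length (wd n (fst l)) = length (wd n (fst i)) + length (wd n (fst j))"
proof -
  define d where "d = length (wd n (fst i)) + length (wd n (fst j))"
  define p where "p = E i \<otimes>\<^bsub>P\<^esub> E j"
  have p: "p \<in> homog d"
    unfolding p_def d_def using homog_e_e[OF wd_sorted(3) wd_sorted(3)] i j by (cases i; cases j) simp
  have pc: "p \<in> carrier P" using p by (rule homog_closed)
  have hp: "hE i \<otimes>\<^bsub>HK\<^esub> hE j = hc p"
    unfolding hE_eq[OF i] hE_eq[OF j] p_def by (rule hc_mult[OF E_closed[OF i] E_closed[OF j], symmetric])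
  define c where "c = HB.crd (hc p)"
  let ?l = "\<lambda>c. \<Oplus>\<^bsub>P\<^esub>i\<in>bI. c i \<odot>\<^bsub>P\<^esub> E i"
  let ?c = "\<lambda>i. hp d (length (wd n (fst i))) (c i)"
  have compl: "comp d (?l c) = ?l ?c"
  proof -
    have "comp d (?l c) = (\<Oplus>\<^bsub>P\<^esub>i\<in>bI. comp d (c i \<odot>\<^bsub>P\<^esub> E i))"
    proof (rule additive_finsum[where h = "comp d", OF PS.P.is_abelian_group PS.P.is_abelian_group])
      show "comp d \<in> carrier P \<rightarrow> carrier P" by (rule funcsetI) (rule comp_closed)
    qed (intro comp_add comp_closed PS.P.smult_closed E_closed; assumption)+
    also have "\<dots> = ?l ?c"
    proof (rule PS.P.finsum_cong_all)
      fix i assume i: "i \<in> bI"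
      obtain \<alpha> g where ih: "i = (\<alpha>, g)" "g \<in> G" using i by auto
      show "comp d (c i \<odot>\<^bsub>P\<^esub> E i) = ?c i \<odot>\<^bsub>P\<^esub> E i"
        unfolding ih(1) prod.case fst_conv by (rule comp_elem[OF wd_sorted(3) ih(2)])
      show "?c i \<odot>\<^bsub>P\<^esub> E i \<in> carrier P" by (intro PS.P.smult_closed E_closed i)
    qed
    finally show ?thesis .
  qed
  have compp: "comp d p = p"
  proof -
    have "comp d (1 \<odot>\<^bsub>P\<^esub> p) = hp d d 1 \<odot>\<^bsub>P\<^esub> p" using p unfolding homog_def by blast
    moreover have "hp d d 1 = 1" by (rule poly_eqI) (simp add: hp_coeff)
    ultimately show ?thesis unfolding PS.P.smult_one[OF pc] by (simp only: PS.P.smult_one[OF pc])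
  qed
  \<comment> \<open>Taking the component of degree d of a member of I stays in I; it fixes p and
    filters the coefficients of the expansion by \<open>hp\<close>.\<close>
  have "p \<ominus>\<^bsub>P\<^esub> ?l c \<in> I" unfolding c_def by (rule hc_rep[OF pc])
  then have "comp d (p \<ominus>\<^bsub>P\<^esub> ?l c) \<in> I" by (rule comp_I)
  also have "comp d (p \<ominus>\<^bsub>P\<^esub> ?l c) = p \<ominus>\<^bsub>P\<^esub> ?l ?c"
  proof -
    \<comment> \<open>The scalar -1 is written as a monomial in t of exponent 0, since components
      are computed for monomial scalars and then keep their index.\<close>
    have 1: "(- 1 :: 'k poly) = Polynomial.monom (- 1) 0" by (simp add: one_pCons monom_0)
    have "comp d (p \<oplus>\<^bsub>P\<^esub> (- 1) \<odot>\<^bsub>P\<^esub> ?l c) = comp d p \<oplus>\<^bsub>P\<^esub> comp d ((- 1) \<odot>\<^bsub>P\<^esub> ?l c)"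
      by (intro comp_add comp_closed pc PS.P.smult_closed P_lc_closed)
    also have "comp d ((- 1) \<odot>\<^bsub>P\<^esub> ?l c) = (- 1) \<odot>\<^bsub>P\<^esub> comp d (?l c)"
      unfolding 1 comp_monom[OF P_lc_closed] by simp
    finally show ?thesis
      unfolding compl compp PS.P.diff_eq_smult[OF pc P_lc_closed] .
  qed
  finally have "hc p = hc (?l ?c)" using PS.P.coset_eq_iff[OF ideal_I pc P_lc_closed[of ?c]] by blast
  then have "hc p = (\<Oplus>\<^bsub>HK\<^esub>i\<in>bI. ?c i \<odot>\<^bsub>HK\<^esub> hE i)" unfolding hc_lc .
  \<comment> \<open>Coordinates are unique, so filtering by degree has not changed them.\<close>
  then have "HB.crd (hc p) l = ?c l" using HB.crd_lc[OF l, of ?c] by (simp only:)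
  then have "Polynomial.coeff (?c l) k \<noteq> 0" using nz unfolding hp by simp
  then show ?thesis unfolding hp_coeff d_def by (simp split: if_splits)
qed


lemma \<mu>_bA_Deg:
  assumes i: "i \<in> bI" and j: "j \<in> bI"
  shows "\<mu> k (bA i) (bA j) \<in> Deg (int (length (wd n (fst i))) + int (length (wd n (fst j))) - 2 * int k)"
proof -
  have X: "hE i \<otimes>\<^bsub>HK\<^esub> hE j \<in> carrier HK" by (intro HK.m_closed HB.b_closed i j)
  have mu: "\<mu> k (bA i) (bA j) = \<phi> (hE i \<otimes>\<^bsub>HK\<^esub> hE j) k"
    unfolding \<mu>_def pm_def \<psi>_bA[OF i] \<psi>_bA[OF j] by (rule refl)
  show ?thesis unfolding Deg_iff mu
  proof (intro conjI ballI impI)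
    show "\<phi> (hE i \<otimes>\<^bsub>HK\<^esub> hE j) k \<in> carrier A" by (rule PA.PA_closed[OF C.change_closed])
    fix l assume l: "l \<in> bI" and "BA.crd (\<phi> (hE i \<otimes>\<^bsub>HK\<^esub> hE j) k) l \<noteq> 0"
    then have "2 * k + length (wd n (fst l)) = length (wd n (fst i)) + length (wd n (fst j))"
      unfolding \<phi>_crd[OF X l] by (intro crd_hE_hE i j)
    then show "int (length (wd n (fst l))) = int (length (wd n (fst i))) + int (length (wd n (fst j))) - 2 * int k" by linarith
  qed
qed

text \<open>Bilinearity carries the statement from pairs of PBW monomials to homogeneous elements,
  one argument at a time by \<open>Deg_sub\<close>.\<close>

lemma \<mu>_Deg:
  assumes a: "a \<in> Deg p" and b: "b \<in> Deg r"
  shows "\<mu> k a b \<in> Deg (p + r - 2 * int k)"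
proof -
  have bc: "b \<in> carrier A" by (rule Deg_closed[OF b])
  let ?N = "{a \<in> carrier A. \<mu> k a b \<in> Deg (p + r - 2 * int k)}"
  have "a \<in> ?N"
  proof (rule Deg_sub[OF _ _ _ _ _ a])
    fix i assume i: "i \<in> bI" and p: "int (length (wd n (fst i))) = p"
    note ic = BA.b_closed[OF i]
    let ?M = "{b \<in> carrier A. \<mu> k (bA i) b \<in> Deg (p + r - 2 * int k)}"
    have "b \<in> ?M"
    proof (rule Deg_sub[OF _ _ _ _ _ b])
      fix j assume j: "j \<in> bI" and r: "int (length (wd n (fst j))) = r"
      show "bA j \<in> ?M" using \<mu>_bA_Deg[OF i j, of k] BA.b_closed[OF j] unfolding p r by blast
    qed (auto simp only: mem_Collect_eq A.zero_closed A.a_closed A.smult_closed D.mu_zero[OF ic] D.mu_add_right[OF ic]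
        D.mu_smult_right[OF ic] Deg_zero Deg_add Deg_smult)
    then show "bA i \<in> ?N" using ic by blast
  qed (auto simp only: mem_Collect_eq A.zero_closed A.a_closed A.smult_closed D.mu_zero[OF bc] D.mu_add_left[OF _ _ bc]
      D.mu_smult_left[OF _ bc] Deg_zero Deg_add Deg_smult)
  then show ?thesis by blast
qed

text \<open>Letters and group elements are themselves PBW monomials, so matching the bases already
  matches the generators.\<close>

lemma \<phi>_hx: "i \<in> {1..n} \<Longrightarrow> \<phi> (hx i) = cn (yA i)" and \<phi>_hu: "g \<in> G \<Longrightarrow> \<phi> (hu g) = cn (uA g)"
  and \<psi>_yA: "i \<in> {1..n} \<Longrightarrow> \<psi> (cn (yA i)) = hx i"
proof -
  have i: "(idx n {i}, id) \<in> bI" for i using idx_expo G_id by simp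
  have g: "(idx n {}, g) \<in> bI" if "g \<in> G" for g using idx_expo that by simp
  have hi: "hE (idx n {i}, id) = hx i" if "i \<in> {1..n}" for i
    using wd_idx[of "[i]" n] that HX.e_single[OF that] by (simp del: atLeastAtMost_iff One_nat_def)
  have hg: "hE (idx n {}, g) = hu g" if "g \<in> G" for g
    using wd_idx[of "[]" n] HX.e_Nil[OF that] by simp
  show "\<phi> (hx i) = cn (yA i)" if "i \<in> {1..n}"
    using \<phi>_hE[OF i, of i] unfolding hi[OF that] bA_single[OF that] .
  show "\<psi> (cn (yA i)) = hx i" if "i \<in> {1..n}"
    using \<psi>_bA[OF i, of i] unfolding hi[OF that] bA_single[OF that] .
  show "\<phi> (hu g) = cn (uA g)" if "g \<in> G"
    using \<phi>_hE[OF g[OF that]] unfolding hg[OF that] bA_Nil[OF that] .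
qed

text \<open>The square of a letter is a generator of the ideal without a term in t, so it vanishes
  at every power of t.\<close>

lemma \<mu>_yA_yA:
  assumes j: "j \<in> {1..n}" shows "\<mu> k (yA j) (yA j) = \<zero>\<^bsub>A\<^esub>"
proof -
  have "\<phi> \<zero>\<^bsub>HK\<^esub> = \<zero>\<^bsub>PA.PA\<^esub>" by (rule linear_on_zero[OF HK.kalg_axioms PA.P.kalg_axioms C.linear_on_change])
  then show ?thesis unfolding \<mu>_def pm_def \<psi>_yA[OF j] H_square[OF j] PA.PA_simps(3) by simp
qed

theorem qdh_is_deformation:
  "is_graded_truncated_deformation scale v n G q \<mu>" "\<phi> \<in> qdh_deformation_iso scale v n G q \<kappa> \<mu>"
proof -
  have "has_degree Deg (\<mu> i) (- 2 * int i)" for i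
    unfolding has_degree_def using \<mu>_Deg by (simp add: algebra_simps)
  then show "is_graded_truncated_deformation scale v n G q \<mu>"
    unfolding is_graded_truncated_deformation_def Let_def using deformation \<mu>_yA_yA by blast
  have mult: "\<phi> (X \<otimes>\<^bsub>HK\<^esub> Y) = D.st (\<phi> X) (\<phi> Y)" if "X \<in> carrier HK" "Y \<in> carrier HK" for X Y
    using that by (simp only: st_eq_pm C.change_closed pm_def \<psi>_\<phi>)
  have one: "\<phi> \<one>\<^bsub>HK\<^esub> = \<one>\<^bsub>PA.PA\<^esub>"
    using \<phi>_hu[OF G_id] unfolding HX.u_id uA_id PA.tmonom_one .
  have "\<phi> \<in> ring_iso HK D.B"
  proof (rule ring_iso_memI)
    show "\<phi> X \<in> carrier D.B" if "X \<in> carrier HK" for X unfolding D.B_simps by (rule C.change_closed)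
    show "\<phi> (X \<otimes>\<^bsub>HK\<^esub> Y) = \<phi> X \<otimes>\<^bsub>D.B\<^esub> \<phi> Y" if "X \<in> carrier HK" "Y \<in> carrier HK" for X Y
      unfolding D.B_simps by (rule mult[OF that])
    show "\<phi> (X \<oplus>\<^bsub>HK\<^esub> Y) = \<phi> X \<oplus>\<^bsub>D.B\<^esub> \<phi> Y" if "X \<in> carrier HK" "Y \<in> carrier HK" for X Y
      unfolding D.B_simps by (rule \<phi>_linear(2)[OF that])
    show "\<phi> \<one>\<^bsub>HK\<^esub> = \<one>\<^bsub>D.B\<^esub>" unfolding D.B_simps by (rule one)
    show "bij_betw \<phi> (carrier HK) (carrier D.B)" unfolding D.B_simps by (rule C.bij_change)
  qed
  then have "\<phi> \<in> alg_iso HK D.B" unfolding alg_iso_def D.B_simps using \<phi>_linear(3) by blast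
  then show "\<phi> \<in> qdh_deformation_iso scale v n G q \<kappa> \<mu>"
    unfolding qdh_deformation_iso_def Let_def using \<phi>_hx \<phi>_hu by blast
qed

end

text \<open>\<open>q_inverse\<close> makes the two relations for a pair of letters say the same, and
  \<open>G_acts\<close> makes the action of G on the quantum exterior algebra well defined. Since
  both algebras carry the generators v_i and g, identifying them means an isomorphism that preserves
  these.\<close>

theorem theorem3p2:
  fixes scale :: "'k::field \<Rightarrow> 'v::ab_group_add \<Rightarrow> 'v"
    and v :: "nat \<Rightarrow> 'v" and n :: nat
    and G :: "('v \<Rightarrow> 'v) set"
    and q :: "nat \<Rightarrow> nat \<Rightarrow> 'k"
  assumes "CHAR('k) \<noteq> 2"
    and "vector_space scale"
    and "inj_on v {1..n}"
    and "\<not> module.dependent scale (v ` {1..n})"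
    and "module.span scale (v ` {1..n}) = UNIV"
    and "subgroup G (GL scale)" and "finite G"
    and "\<not> CHAR('k) dvd card G"
    and "\<And>i j. i \<in> {1..n} \<Longrightarrow> j \<in> {1..n} \<Longrightarrow> q i j \<noteq> 0"
    and q_inverse: "\<And>i j. i \<in> {1..n} \<Longrightarrow> j \<in> {1..n} \<Longrightarrow> i \<noteq> j \<Longrightarrow> q j i = inverse (q i j)"
    and G_acts: "\<And>g. g \<in> G \<Longrightarrow> tensor_action scale v n g ` qext_ideal n q \<subseteq> qext_ideal n q"
  shows "(\<forall>\<kappa>. bilinear_to_group_algebra scale G \<kappa> \<and> is_truncated_qdh scale v n G q \<kappa> \<longrightarrow>
            (\<exists>\<mu>. is_graded_truncated_deformation scale v n G q \<mu> \<and>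
                 qdh_deformation_iso scale v n G q \<kappa> \<mu> \<noteq> {})) \<and>
         (\<forall>\<mu>. is_graded_truncated_deformation scale v n G q \<mu> \<longrightarrow>
            (\<exists>\<kappa>. bilinear_to_group_algebra scale G \<kappa> \<and> is_truncated_qdh scale v n G q \<kappa> \<and>
                 qdh_deformation_iso scale v n G q \<kappa> \<mu> \<noteq> {}))"
proof -
  interpret qdata n q scale v G
    by (intro qdata.intro qext.intro qdata_axioms.intro assms)
  show ?thesis
  proof (intro conjI allI impI)
    fix \<kappa> assume \<kappa>: "bilinear_to_group_algebra scale G \<kappa> \<and> is_truncated_qdh scale v n G q \<kappa>"
    interpret K: qkappa n q scale v G \<kappa>
      by (intro qkappa.intro qkappa_axioms.intro qdata_axioms) (use \<kappa> in \<open>simp add: bilinear_to_group_algebra_def\<close>)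
    interpret K: qpbw n q scale v G \<kappa>
      by (intro qpbw.intro qpbw_axioms.intro K.qkappa_axioms) (use \<kappa> in \<open>simp only: K.is_truncated_qdh_iff\<close>)
    show "\<exists>\<mu>. is_graded_truncated_deformation scale v n G q \<mu> \<and> qdh_deformation_iso scale v n G q \<kappa> \<mu> \<noteq> {}"
      using K.qdh_is_deformation by blast
  next
    fix \<mu> assume "is_graded_truncated_deformation scale v n G q \<mu>"
    then interpret D: qdefo n q scale v G \<mu>
      by (intro qdefo.intro qdefo_axioms.intro qdata_axioms)
    show "\<exists>\<kappa>. bilinear_to_group_algebra scale G \<kappa> \<and> is_truncated_qdh scale v n G q \<kappa> \<and>
        qdh_deformation_iso scale v n G q \<kappa> \<mu> \<noteq> {}"
      by (rule D.deformation_is_qdh)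
  qed
qed

end
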